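(* Let $\mathcal H$ be a finite-dimensional Hilbert space with pairwise commuting Hermitian charges $\hat L_0=H,\hat L_1,\dots,\hat L_{q-1}$. Two states $\rho,\sigma$ on $\mathcal H$ satisfy $S(\rho)=S(\sigma)$ and ${\operatorname{Tr}}(\hat L_k\rho)={\operatorname{Tr}}(\hat L_k\sigma)$ for all $k=0,\dots,q-1$ if and only if there exist, for each $n$, an ancillary Hilbert space $\mathcal K_n$ with $\log\dim\mathcal K_n=o(n)$, Hermitian charges $\hat L_{k}'$ on $\mathcal K_n$ ($k=0,\dots,q-1$) with $\|\hat L_k'\|_\infty=o(n)$, states $\omega_n,\omega_n'$ on $\mathcal K_n$, and a unitary $U_n$ on $\mathcal H^{\otimes n}\otimes\mathcal K_n$ with $[U_n,\hat L_k^{(n)}+\hat L_k']=0$ for all $k$, such that $$\lim_{n\to\infty}\big\|U_n(\rho^{\otimes n}\otimes\omega_n')U_n^\dagger-\sigma^{\otimes n}\otimes\omega_n\big\|_1=0.$$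
   Context: $S$ is the von Neumann entropy. The $n$-copy charges are $\hat L_k^{(n)}=\sum_{i=1}^n\mathbb{I}^{\otimes(i-1)}\otimes\hat L_k\otimes\mathbb{I}^{\otimes(n-i)}$ on $\mathcal H^{\otimes n}$, and in $\hat L_k^{(n)}+\hat L_k'$ each term is understood tensored with the identity on the other factor. $\|X\|_1={\operatorname{Tr}}\sqrt{X^\dagger X}$ and $\|X\|_\infty$ is the operator norm. *)

theory Defs
  imports "Jordan_Normal_Form.Jordan_Normal_Form" "HOL-Library.Landau_Symbols"
begin

text \<open>Finite-dimensional Hilbert spaces are modelled as C^d; operators as complex d x d matrices.\<close>

definition adj :: "complex mat \<Rightarrow> complex mat" where
  "adj A = mat (dim_col A) (dim_row A) (\<lambda>(i,j). cnj (A $$ (j,i)))"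

definition hermitian :: "complex mat \<Rightarrow> bool" where
  "hermitian A \<longleftrightarrow> A \<in> carrier_mat (dim_row A) (dim_row A) \<and> adj A = A"

definition vinner :: "complex vec \<Rightarrow> complex vec \<Rightarrow> complex" where
  "vinner u v = (\<Sum>i<dim_vec u. cnj (u $ i) * v $ i)"

definition positive_mat :: "complex mat \<Rightarrow> bool" where
  "positive_mat A \<longleftrightarrow> hermitian A \<and>
     (\<forall>v \<in> carrier_vec (dim_row A). 0 \<le> Re (vinner v (A *\<^sub>v v)))"

definition mtrace :: "complex mat \<Rightarrow> complex" where
  "mtrace A = (\<Sum>i<dim_row A. A $$ (i,i))"

definition density_mat :: "nat \<Rightarrow> complex mat \<Rightarrow> bool" where
  "density_mat d \<rho> \<longleftrightarrow> \<rho> \<in> carrier_mat d d \<and> positive_mat \<rho> \<and> mtrace \<rho> = 1"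

definition unitary_mat :: "nat \<Rightarrow> complex mat \<Rightarrow> bool" where
  "unitary_mat m U \<longleftrightarrow> U \<in> carrier_mat m m \<and> adj U * U = 1\<^sub>m m"

definition mat_sqrt :: "complex mat \<Rightarrow> complex mat" where
  "mat_sqrt A = (THE S. S \<in> carrier_mat (dim_row A) (dim_row A) \<and> positive_mat S \<and> S * S = A)"

definition trace_norm :: "complex mat \<Rightarrow> real" where
  "trace_norm X = Re (mtrace (mat_sqrt (adj X * X)))"

definition vnorm :: "complex vec \<Rightarrow> real" where
  "vnorm v = sqrt (\<Sum>i<dim_vec v. (cmod (v $ i))\<^sup>2)"

definition op_norm :: "complex mat \<Rightarrow> real" where
  "op_norm X = Sup {vnorm (X *\<^sub>v v) | v. v \<in> carrier_vec (dim_col X) \<and> vnorm v = 1}"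

definition eigvals_mset :: "complex mat \<Rightarrow> complex multiset" where
  "eigvals_mset A = proots (char_poly A)"

definition vn_entropy :: "complex mat \<Rightarrow> real" where
  "vn_entropy \<rho> = - (\<Sum>e\<in>#eigvals_mset \<rho>. (let x = Re e in if x \<le> 0 then 0 else x * ln x))"

definition kron :: "complex mat \<Rightarrow> complex mat \<Rightarrow> complex mat" where
  "kron A B = mat (dim_row A * dim_row B) (dim_col A * dim_col B)
     (\<lambda>(i,j). A $$ (i div dim_row B, j div dim_col B) * B $$ (i mod dim_row B, j mod dim_col B))"

primrec tpow :: "complex mat \<Rightarrow> nat \<Rightarrow> complex mat" where
  "tpow A 0 = 1\<^sub>m 1"
| "tpow A (Suc n) = kron (tpow A n) A"

definition copy_charge :: "nat \<Rightarrow> complex mat \<Rightarrow> nat \<Rightarrow> complex mat" where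
  "copy_charge d L n =
     foldr (\<lambda>i acc. kron (kron (1\<^sub>m (d ^ i)) L) (1\<^sub>m (d ^ (n - 1 - i))) + acc)
       [0..<n] (0\<^sub>m (d ^ n) (d ^ n))"

end

theory Submission
  imports Defs "HOL-Analysis.L2_Norm" "HOL-Real_Asymp.Real_Asymp" "HOL-Library.Function_Algebras"
begin

text \<open>Necessity: a conserved total charge changes its expectation only by the trace-norm error times
  its norm \<open>O(n)\<close>, and the ancilla contributes \<open>o(n)\<close>; for the entropy, compare the rank of the typical
  subspace of one side with the largest typical eigenvalue of the other side.

  Sufficiency: in a joint eigenbasis of the charges, both \<open>n\<close>-copy states are concentrated on the window of
  basis vectors whose charges deviate from the common mean by at most \<open>\<delta> = n^(2/3)\<close>, and their
  truncations have almost all their weight on eigenvalues within a factor \<open>exp (O(\<delta>))\<close> of \<open>exp (- n S)\<close>. An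
  embezzling ancilla with spectrum proportional to \<open>1 / l\<close>, \<open>l \<le> exp (n^(5/6))\<close>, makes the two spectra
  approximately equal, so some unitary \<open>V\<close> on the window almost converts one state into the other. The
  charges moved by \<open>V\<close> are absorbed by a reference frame, in a uniform superposition over an iterated
  sumset of the possible charge differences; such sumsets grow polynomially, so one of them is almost
  invariant under these differences.\<close>

subsection \<open>Linear algebra over finite index sets\<close>

text \<open>Neither state need commute with the charges. Cutting to a charge window therefore
  destroys the eigenvectors of a state, and the truncated operator has to be diagonalized afresh;
  what survives is a bound on the size and number of its large eigenvalues, which is all that
  embezzling asks for.

  The charge values may be incommensurable real numbers, so the frame cannot live on a lattice. Its
  labels are sums of charge differences that actually occur; each is described by \<open>d\<close>
  integer counts, and this keeps the dimension polynomial in n.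

  The scales must fit together: the window has to be wider than sqrt n to capture the states, yet so
  narrow that about n^(1/6) steps of its width stay below n; the logarithm of the number of
  embezzling levels must dominate the spectral spread \<delta> and still be o(n).

  Trace norms are handled by duality: errors are bounded for every contraction
  (\<open>contr\<close>) as test operator. Test operators can be pulled back along isometries, so
  estimates on the system carry over to system, ancilla and frame together.\<close>

definition ip :: "'a set \<Rightarrow> ('a \<Rightarrow> complex) \<Rightarrow> ('a \<Rightarrow> complex) \<Rightarrow> complex" where
  "ip A u v = (\<Sum>a\<in>A. cnj (u a) * v a)"

definition nrm :: "'a set \<Rightarrow> ('a \<Rightarrow> complex) \<Rightarrow> real" where
  "nrm A v = L2_set (\<lambda>a. cmod (v a)) A"

definition ap :: "'a set \<Rightarrow> ('a \<Rightarrow> 'a \<Rightarrow> complex) \<Rightarrow> ('a \<Rightarrow> complex) \<Rightarrow> 'a \<Rightarrow> complex" where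
  "ap A X v = (\<lambda>a. if a \<in> A then (\<Sum>b\<in>A. X a b * v b) else 0)"

definition bil :: "'a set \<Rightarrow> ('a \<Rightarrow> 'a \<Rightarrow> complex) \<Rightarrow> ('a \<Rightarrow> complex) \<Rightarrow> ('a \<Rightarrow> complex) \<Rightarrow> complex" where
  "bil A X w v = ip A w (ap A X v)"

text \<open>Completeness is built in beside orthonormality, so that expansions and Parseval hold for
  an arbitrary index set \<open>I\<close> without a dimension count.\<close>

definition onb :: "'i set \<Rightarrow> 'a set \<Rightarrow> ('i \<Rightarrow> 'a \<Rightarrow> complex) \<Rightarrow> bool" where
  "onb I A y \<longleftrightarrow> (\<forall>k\<in>I. \<forall>l\<in>I. ip A (y k) (y l) = of_bool (k = l)) \<and>
     (\<forall>a\<in>A. \<forall>b\<in>A. (\<Sum>k\<in>I. y k a * cnj (y k b)) = of_bool (a = b))"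

text \<open>Fewer equations than unknowns: making row \<open>m\<close> of a square system zero
  forces its determinant to vanish, and a kernel vector solves the first \<open>m\<close> equations
  whatever stands in the later rows.\<close>

lemma homogeneous_solution:
  fixes c :: "nat \<Rightarrow> nat \<Rightarrow> complex"
  assumes "m < n"
  shows "\<exists>x. (\<exists>j<n. x j \<noteq> 0) \<and> (\<forall>i<m. (\<Sum>j<n. c i j * x j) = 0)"
proof -
  define C where "C = mat\<^sub>r n n (\<lambda>i. if i = m then 0\<^sub>v n else vec n (c i))"
  have C: "C \<in> carrier_mat n n" by (simp add: C_def)
  have "det C = 0" unfolding C_def by (rule det_row_0[OF assms]) auto
  then obtain v where v: "v \<in> carrier_vec n" "v \<noteq> 0\<^sub>v n" "C *\<^sub>v v = 0\<^sub>v n"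
    using det_0_iff_vec_prod_zero[OF C] by auto
  have "\<exists>j<n. v $ j \<noteq> 0" using v(1,2) by (metis carrier_vecD eq_vecI index_zero_vec(1) index_zero_vec(2))
  moreover have "(\<Sum>j<n. c i j * v $ j) = 0" if "i < m" for i
  proof -
    have "(C *\<^sub>v v) $ i = 0" using v that assms by simp
    moreover have "(C *\<^sub>v v) $ i = (\<Sum>j<n. c i j * v $ j)"
      using that assms v(1) by (simp add: C_def scalar_prod_def atLeast0LessThan)
    ultimately show ?thesis by simp
  qed
  ultimately show ?thesis by blast
qed

text \<open>The vector p(T) v, by Horner's scheme. Working with functions instead of matrices lets
  \<open>T\<close> act on a subspace that is given only by a predicate.\<close>

definition opoly :: "(('a \<Rightarrow> complex) \<Rightarrow> ('a \<Rightarrow> complex)) \<Rightarrow> ('a \<Rightarrow> complex) \<Rightarrow> complex poly \<Rightarrow> 'a \<Rightarrow> complex" where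
  "opoly T v p = fold_coeffs (\<lambda>a w x. a * v x + T w x) p (\<lambda>_. 0)"

locale linear_op =
  fixes T :: "('a \<Rightarrow> complex) \<Rightarrow> ('a \<Rightarrow> complex)"
  assumes lin: "T (\<lambda>a. x * u a + w a) = (\<lambda>a. x * T u a + T w a)"
begin

lemma zero: "T (\<lambda>_. 0) = (\<lambda>_. 0)"
proof
  fix a
  have "T (\<lambda>a. 1 * 0 + 0) a = 1 * T (\<lambda>_. 0) a + T (\<lambda>_. 0) a"
    by (subst lin) simp
  then show "T (\<lambda>_. 0) a = 0" by simp
qed

lemma add: "T (\<lambda>a. u a + w a) = (\<lambda>a. T u a + T w a)"
  using lin[of 1 u w] by simp

lemma scale: "T (\<lambda>a. x * u a) = (\<lambda>a. x * T u a)"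
  using lin[of x u "\<lambda>_. 0"] by (simp add: zero)

lemma opoly_0: "opoly T v 0 = (\<lambda>_. 0)"
  by (simp add: opoly_def)

lemma opoly_pCons: "opoly T v (pCons a p) = (\<lambda>x. a * v x + T (opoly T v p) x)"
proof (cases "p = 0 \<and> a = 0")
  case True
  then show ?thesis by (simp add: opoly_def zero)
next
  case False
  then show ?thesis by (cases "p = 0") (simp_all add: opoly_def zero)
qed

lemma opoly_smult: "opoly T v (Polynomial.smult c p) = (\<lambda>x. c * opoly T v p x)"
proof (induction p)
  case (pCons a p)
  then show ?case
    by (simp only: smult_pCons opoly_pCons pCons.IH scale) (simp add: algebra_simps)
qed (simp add: opoly_0)

lemma opoly_add: "opoly T v (p + r) = (\<lambda>x. opoly T v p x + opoly T v r x)"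
proof (induction p arbitrary: r)
  case 0
  then show ?case by (simp add: opoly_0)
next
  case (pCons a p)
  obtain b s where r: "r = pCons b s" by (cases r)
  show ?case
    unfolding r by (simp only: add_pCons opoly_pCons pCons.IH add) (simp add: algebra_simps)
qed

lemma opoly_monom: "opoly T v (Polynomial.monom c i) = (\<lambda>x. c * (T ^^ i) v x)"
  by (induction i) (simp_all add: monom_0 monom_Suc opoly_pCons opoly_0 zero scale)

lemma opoly_sum_monom:
  "opoly T v (\<Sum>i<n. Polynomial.monom (c i) i) = (\<lambda>x. \<Sum>i<n. c i * (T ^^ i) v x)"
  by (induction n) (simp_all add: opoly_0 opoly_add opoly_monom add.commute)

text \<open>The \<open>card A + 1\<close> iterates of \<open>v\<close> are linearly dependent, so
  some nonzero polynomial annihilates \<open>v\<close>. If r has least degree among these and r = (X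
  - e) g, then g(T) v is nonzero by minimality and T multiplies it by e. It stays in
  \<open>E\<close> as a combination of iterates of \<open>v\<close>.\<close>

lemma eigenvector_in_subspace:
  assumes E_lin: "\<And>x u w. E u \<Longrightarrow> E w \<Longrightarrow> E (\<lambda>a. x * u a + w a)"
    and E_T: "\<And>u. E u \<Longrightarrow> E (T u)"
    and supp: "\<And>u a. E u \<Longrightarrow> a \<notin> A \<Longrightarrow> u a = 0"
    and fin: "finite A" and v: "E v" "v \<noteq> (\<lambda>_. 0)"
  shows "\<exists>w e. E w \<and> w \<noteq> (\<lambda>_. 0) \<and> T w = (\<lambda>a. e * w a)"
proof -
  have E0: "E (\<lambda>_. 0)" using E_lin[OF v(1) v(1), of "-1"] by simp
  have Ep: "E (opoly T v p)" for p
  proof (induction p)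
    case 0
    then show ?case by (simp add: opoly_0 E0)
  next
    case (pCons a p)
    then show ?case using E_lin[OF v(1) E_T] by (simp add: opoly_pCons)
  qed
  obtain f where f: "bij_betw f {..<card A} A"
    using ex_bij_betw_nat_finite[OF fin] by (auto simp: atLeast0LessThan)
  obtain c where c: "\<exists>j<Suc (card A). c j \<noteq> 0"
      "\<And>i. i < card A \<Longrightarrow> (\<Sum>j<Suc (card A). (T ^^ j) v (f i) * c j) = 0"
    using homogeneous_solution[of "card A" "Suc (card A)" "\<lambda>i j. (T ^^ j) v (f i)"] by auto
  define p where "p = (\<Sum>i<Suc (card A). Polynomial.monom (c i) i)"
  have "coeff p j = c j" if "j < Suc (card A)" for j
    using that by (simp add: p_def coeff_sum del: sum.lessThan_Suc)
  then have "p \<noteq> 0" using c(1) by (metis coeff_0)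
  have ET: "E ((T ^^ i) v)" for i by (induction i) (simp_all add: v E_T)
  have p0: "opoly T v p = (\<lambda>_. 0)"
  proof
    fix a
    have *: "opoly T v p a = (\<Sum>j<Suc (card A). c j * (T ^^ j) v a)"
      unfolding p_def opoly_sum_monom ..
    show "opoly T v p a = 0"
    proof (cases "a \<in> A")
      case True
      then obtain i where "i < card A" "a = f i" using f by (auto simp: bij_betw_def)
      then show ?thesis using c(2)[of i] * by (simp add: mult.commute)
    next
      case False
      then show ?thesis using supp[OF Ep] by simp
    qed
  qed
  define P where "P = (\<lambda>p. p \<noteq> 0 \<and> opoly T v p = (\<lambda>_. 0))"
  obtain r where r: "P r" and rmin: "\<And>s. P s \<Longrightarrow> degree r \<le> degree s"
    using ex_has_least_nat[of P p degree] \<open>p \<noteq> 0\<close> p0 by (auto simp: P_def)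
  have "degree r \<noteq> 0"
  proof
    assume "degree r = 0"
    then obtain a where "r = [:a:]" by (rule degree_eq_zeroE)
    then have "a \<noteq> 0" "(\<lambda>x. a * v x) = (\<lambda>_. 0)" using r by (auto simp: P_def opoly_pCons opoly_0 zero)
    then have "v = (\<lambda>_. 0)" by (auto simp: fun_eq_iff)
    then show False using v by simp
  qed
  then have "\<not> constant (poly r)" by (simp add: constant_degree)
  then obtain e where "poly r e = 0" using fundamental_theorem_of_algebra by blast
  then obtain g where g: "r = [:-e, 1:] * g" using poly_eq_0_iff_dvd by (metis dvdE)
  then have "g \<noteq> 0" using r by (auto simp: P_def)
  have "degree r = Suc (degree g)" using g \<open>g \<noteq> 0\<close> by (simp add: degree_mult_eq del: mult_pCons_left)
  then have ng: "opoly T v g \<noteq> (\<lambda>_. 0)" using rmin[of g] \<open>g \<noteq> 0\<close> by (auto simp: P_def)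
  have "r = Polynomial.smult (-e) g + pCons 0 g" using g by simp
  then have "opoly T v r = (\<lambda>x. - e * opoly T v g x + T (opoly T v g) x)"
    by (simp only: opoly_add opoly_smult opoly_pCons) simp
  then have "T (opoly T v g) = (\<lambda>a. e * opoly T v g a)" using r by (auto simp: P_def fun_eq_iff)
  then show ?thesis using Ep ng by blast
qed

end

text \<open>Induction on \<open>q\<close>: the joint eigenspace \<open>E'\<close> of the first
  \<open>q\<close> operators inside \<open>E\<close> is invariant under the next operator by
  commutation, so it contains an eigenvector of that operator.\<close>

lemma common_eigenvector_in_subspace:
  fixes T :: "nat \<Rightarrow> ('a \<Rightarrow> complex) \<Rightarrow> ('a \<Rightarrow> complex)"
  assumes lin: "\<And>k. k < q \<Longrightarrow> linear_op (T k)"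
    and E_lin: "\<And>x u w. E u \<Longrightarrow> E w \<Longrightarrow> E (\<lambda>a. x * u a + w a)"
    and E_T: "\<And>k u. k < q \<Longrightarrow> E u \<Longrightarrow> E (T k u)"
    and comm: "\<And>k l u. k < q \<Longrightarrow> l < q \<Longrightarrow> E u \<Longrightarrow> T k (T l u) = T l (T k u)"
    and supp: "\<And>u a. E u \<Longrightarrow> a \<notin> A \<Longrightarrow> u a = 0"
    and fin: "finite A" and v: "E v" "v \<noteq> (\<lambda>_. 0)"
  shows "\<exists>w e. E w \<and> w \<noteq> (\<lambda>_. 0) \<and> (\<forall>k<q. T k w = (\<lambda>a. e k * w a))"
  using assms(1,3,4)
proof (induction q)
  case 0
  then show ?case using v by blast
next
  case (Suc q)
  have "\<exists>w e. E w \<and> w \<noteq> (\<lambda>_. 0) \<and> (\<forall>k<q. T k w = (\<lambda>a. e k * w a))"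
    using Suc.prems by (intro Suc.IH) auto
  then obtain w e where w: "E w" "w \<noteq> (\<lambda>_. 0)" "\<And>k. k < q \<Longrightarrow> T k w = (\<lambda>a. e k * w a)"
    by blast
  interpret linear_op "T q" using Suc.prems(1) by simp
  define E' where "E' = (\<lambda>u. E u \<and> (\<forall>k<q. T k u = (\<lambda>a. e k * u a)))"
  have "\<exists>w f. E' w \<and> w \<noteq> (\<lambda>_. 0) \<and> T q w = (\<lambda>a. f * w a)"
  proof (rule eigenvector_in_subspace[where A = A and v = w])
    fix x u w assume *: "E' u" "E' w"
    have "T k (\<lambda>a. x * u a + w a) = (\<lambda>a. e k * (x * u a + w a))" if "k < q" for k
    proof -
      interpret k: linear_op "T k" using Suc.prems(1) that by simp
      show ?thesis using * that by (subst k.lin) (auto simp: E'_def algebra_simps)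
    qed
    then show "E' (\<lambda>a. x * u a + w a)" using * E_lin by (auto simp: E'_def)
  next
    fix u assume *: "E' u"
    have "T k (T q u) = (\<lambda>a. e k * T q u a)" if "k < q" for k
    proof -
      have "T k (T q u) = T q (T k u)" using Suc.prems(3)[of k q u] that * by (auto simp: E'_def)
      also have "T k u = (\<lambda>a. e k * u a)" using * that by (auto simp: E'_def)
      finally show ?thesis by (simp add: scale)
    qed
    then show "E' (T q u)" using * Suc.prems(2) by (auto simp: E'_def)
  qed (use w supp fin in \<open>auto simp: E'_def\<close>)
  then obtain w' f where w': "E' w'" "w' \<noteq> (\<lambda>_. 0)" "T q w' = (\<lambda>a. f * w' a)" by blast
  have "\<forall>k<Suc q. T k w' = (\<lambda>a. (e(q := f)) k * w' a)"
    using w' by (auto simp: E'_def less_Suc_eq)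
  moreover have "E w'" using w' by (simp add: E'_def)
  ultimately show ?case using w'(2) by blast
qed

section \<open>Hermitian forms and joint eigenbases\<close>

lemma linear_op_ap: "linear_op (ap A X)"
  by unfold_locales (auto simp: ap_def fun_eq_iff sum.distrib sum_distrib_left algebra_simps)

lemma ip_cnj: "cnj (ip A u v) = ip A v u"
  by (simp add: ip_def mult.commute)

lemma ip_self: "ip A v v = of_real ((nrm A v)\<^sup>2)"
proof -
  have "(nrm A v)\<^sup>2 = (\<Sum>a\<in>A. (cmod (v a))\<^sup>2)"
    by (simp add: nrm_def L2_set_def sum_nonneg)
  moreover have "ip A v v = of_real (\<Sum>a\<in>A. (cmod (v a))\<^sup>2)"
    unfolding ip_def of_real_sum
    by (intro sum.cong refl) (metis complex_norm_square mult.commute)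
  ultimately show ?thesis by simp
qed

lemma nrm_sq: "(nrm A v)\<^sup>2 = (\<Sum>a\<in>A. (cmod (v a))\<^sup>2)"
  by (simp add: nrm_def L2_set_def sum_nonneg)

lemma nrm_nonneg [simp]: "0 \<le> nrm A v"
  by (simp add: nrm_def)

lemma ip_add_right: "ip A u (\<lambda>a. v a + w a) = ip A u v + ip A u w"
  by (simp add: ip_def sum.distrib algebra_simps)

lemma ip_scale_right: "ip A u (\<lambda>a. x * v a) = x * ip A u v"
  by (simp add: ip_def sum_distrib_left algebra_simps)

lemma ip_scale_left: "ip A (\<lambda>a. x * u a) v = cnj x * ip A u v"
  by (simp add: ip_def sum_distrib_left algebra_simps)

lemma ip_sum_right: "ip A u (\<lambda>a. \<Sum>i\<in>I. f i a) = (\<Sum>i\<in>I. ip A u (f i))"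
  by (simp add: ip_def sum_distrib_left sum.swap[of _ I A])

lemma ip_sum_left: "ip A (\<lambda>a. \<Sum>i\<in>I. f i a) u = (\<Sum>i\<in>I. ip A (f i) u)"
  by (simp add: ip_def sum_distrib_right sum.swap[of _ I A])

lemma ip_cong:
  "(\<And>a. a \<in> A \<Longrightarrow> u a = u' a) \<Longrightarrow> (\<And>a. a \<in> A \<Longrightarrow> v a = v' a) \<Longrightarrow> ip A u v = ip A u' v'"
  by (simp add: ip_def)

definition herm_on :: "'a set \<Rightarrow> ('a \<Rightarrow> 'a \<Rightarrow> complex) \<Rightarrow> bool" where
  "herm_on A X \<longleftrightarrow> (\<forall>a\<in>A. \<forall>b\<in>A. X a b = cnj (X b a))"

lemma ip_ap_herm:
  assumes "herm_on A X"
  shows "ip A u (ap A X v) = ip A (ap A X u) v"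
proof -
  have "ip A u (ap A X v) = (\<Sum>a\<in>A. \<Sum>b\<in>A. cnj (u a) * X a b * v b)"
    by (simp add: ip_def ap_def sum_distrib_left mult.assoc)
  also have "\<dots> = (\<Sum>b\<in>A. \<Sum>a\<in>A. cnj (u a) * X a b * v b)" by (rule sum.swap)
  also have "\<dots> = ip A (ap A X u) v"
    unfolding ip_def ap_def
  proof (intro sum.cong refl)
    fix b assume b: "b \<in> A"
    have "cnj (X b a) = X a b" if "a \<in> A" for a
      using assms b that unfolding herm_on_def by metis
    then show "(\<Sum>a\<in>A. cnj (u a) * X a b * v b) = cnj (if b \<in> A then \<Sum>c\<in>A. X b c * u c else 0) * v b"
      using b by (simp add: sum_distrib_left mult_ac)
  qed
  finally show ?thesis .
qed

lemma ap_ap: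
  assumes "a \<in> A"
  shows "ap A X (ap A Y v) a = (\<Sum>c\<in>A. (\<Sum>b\<in>A. X a b * Y b c) * v c)"
proof -
  have "ap A X (ap A Y v) a = (\<Sum>b\<in>A. \<Sum>c\<in>A. X a b * Y b c * v c)"
    using assms by (simp add: ap_def sum_distrib_left mult.assoc)
  also have "\<dots> = (\<Sum>c\<in>A. \<Sum>b\<in>A. X a b * Y b c * v c)" by (rule sum.swap)
  finally show ?thesis by (simp add: sum_distrib_right)
qed

lemma nrm_eq_0: "finite A \<Longrightarrow> nrm A v = 0 \<longleftrightarrow> (\<forall>a\<in>A. v a = 0)"
  by (simp add: nrm_def L2_set_eq_0_iff)

text \<open>Deflation: the vectors orthogonal to those already found form a subspace
  \<open>E\<close>, invariant because the operators are Hermitian and nonzero because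
  \<open>m < card A\<close>. A common eigenvector in it is normalized and appended.\<close>

lemma orthonormal_eigenvectors:
  assumes fin: "finite A" and herm: "\<And>k. k < q \<Longrightarrow> herm_on A (X k)"
    and comm: "\<And>k l a b. k < q \<Longrightarrow> l < q \<Longrightarrow> a \<in> A \<Longrightarrow> b \<in> A \<Longrightarrow>
        (\<Sum>c\<in>A. X k a c * X l c b) = (\<Sum>c\<in>A. X l a c * X k c b)"
  shows "m \<le> card A \<Longrightarrow> \<exists>y (ev :: nat \<Rightarrow> nat \<Rightarrow> real). (\<forall>i<m. \<forall>j<m. ip A (y i) (y j) = of_bool (i = j)) \<and>
      (\<forall>i<m. \<forall>k<q. ap A (X k) (y i) = (\<lambda>a. of_real (ev k i) * y i a))"
proof (induction m)
  case 0
  then show ?case by simp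
next
  case (Suc m)
  obtain y and ev :: "nat \<Rightarrow> nat \<Rightarrow> real" where
    yev: "(\<forall>i<m. \<forall>j<m. ip A (y i) (y j) = of_bool (i = j)) \<and>
      (\<forall>i<m. \<forall>k<q. ap A (X k) (y i) = (\<lambda>a. of_real (ev k i) * y i a))"
    using Suc.IH[OF Suc_leD[OF Suc.prems]] by blast
  have y: "ip A (y i) (y j) = of_bool (i = j)" if "i < m" "j < m" for i j
    using yev that by blast
  have ev: "ap A (X k) (y i) = (\<lambda>a. of_real (ev k i) * y i a)" if "i < m" "k < q" for i k
    using yev that by blast
  define E where "E = (\<lambda>v. (\<forall>a. a \<notin> A \<longrightarrow> v a = 0) \<and> (\<forall>j<m. ip A (y j) v = 0))"
  obtain f where f: "bij_betw f {..<card A} A"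
    using ex_bij_betw_nat_finite[OF fin] by (auto simp: atLeast0LessThan)
  obtain x where x: "\<exists>j<card A. x j \<noteq> 0" "\<And>i. i < m \<Longrightarrow> (\<Sum>j<card A. cnj (y i (f j)) * x j) = 0"
    using homogeneous_solution[of m "card A" "\<lambda>i j. cnj (y i (f j))"] Suc.prems by auto
  define g where "g = the_inv_into {..<card A} f"
  have gf: "g (f j) = j" if "j < card A" for j
    using f that by (simp add: g_def bij_betw_def the_inv_into_f_f)
  define v where "v = (\<lambda>a. if a \<in> A then x (g a) else 0)"
  have "v \<noteq> (\<lambda>_. 0)"
  proof -
    obtain j where j: "j < card A" "x j \<noteq> 0" using x(1) by blast
    then have "f j \<in> A" using f by (auto simp: bij_betw_def)
    then have "v (f j) = x j" using j gf by (simp add: v_def)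
    then show ?thesis using j by metis
  qed
  have "ip A (y i) v = (\<Sum>j<card A. cnj (y i (f j)) * x j)" for i
  proof -
    have "ip A (y i) v = (\<Sum>j<card A. cnj (y i (f j)) * v (f j))"
      unfolding ip_def by (rule sum.reindex_bij_betw[OF f, symmetric])
    also have "\<dots> = (\<Sum>j<card A. cnj (y i (f j)) * x j)"
      using f gf by (intro sum.cong refl) (auto simp: v_def bij_betw_def)
    finally show ?thesis .
  qed
  then have Ev: "E v" using x(2) by (simp add: E_def v_def)
  have "\<exists>w e. E w \<and> w \<noteq> (\<lambda>_. 0) \<and> (\<forall>k<q. ap A (X k) w = (\<lambda>a. e k * w a))"
  proof (rule common_eigenvector_in_subspace[where A = A and v = v])
    fix k u assume *: "k < q" "E u"
    have "ip A (y j) (ap A (X k) u) = 0" if "j < m" for j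
    proof -
      have "ip A (y j) (ap A (X k) u) = ip A (\<lambda>a. of_real (ev k j) * y j a) u"
        using ip_ap_herm[OF herm[OF \<open>k < q\<close>]] ev that * by simp
      then show ?thesis using * that by (simp add: ip_scale_left E_def)
    qed
    then show "E (ap A (X k) u)" by (auto simp: E_def ap_def)
  next
    fix k l u assume *: "k < q" "l < q" "E u"
    show "ap A (X k) (ap A (X l) u) = ap A (X l) (ap A (X k) u)"
    proof
      fix a
      show "ap A (X k) (ap A (X l) u) a = ap A (X l) (ap A (X k) u) a"
      proof (cases "a \<in> A")
        case True
        then show ?thesis using comm[OF *(1,2) True] by (simp add: ap_ap)
      next
        case False
        then show ?thesis by (simp add: ap_def)
      qed
    qed
  qed (use fin Ev \<open>v \<noteq> _\<close> in \<open>auto simp: linear_op_ap E_def ip_add_right ip_scale_right\<close>)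
  then obtain w e where w: "E w" "w \<noteq> (\<lambda>_. 0)" "\<And>k. k < q \<Longrightarrow> ap A (X k) w = (\<lambda>a. e k * w a)"
    by blast
  have nw: "nrm A w \<noteq> 0"
    using w(1,2) nrm_eq_0[OF fin, of w] by (auto simp: E_def fun_eq_iff)
  define z where "z = (\<lambda>a. of_real (1 / nrm A w) * w a)"
  have zz: "ip A z z = 1"
    unfolding z_def ip_scale_left ip_scale_right ip_self using nw
    by (simp add: power2_eq_square)
  have ez: "ap A (X k) z = (\<lambda>a. e k * z a)" if "k < q" for k
  proof -
    interpret linear_op "ap A (X k)" by (rule linear_op_ap)
    show ?thesis unfolding z_def by (subst scale) (simp add: w that mult.left_commute)
  qed
  \<comment> \<open>Moving the Hermitian operator across the inner product at the unit eigenvector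
    \<open>z\<close> gives e = cnj e; this is what allows the eigenvalues \<open>ev\<close> to be
    real.\<close>
  have ereal: "of_real (Re (e k)) = e k" if "k < q" for k
  proof -
    have "e k = ip A z (ap A (X k) z)" using ez that by (simp add: ip_scale_right zz)
    also have "\<dots> = ip A (ap A (X k) z) z" by (rule ip_ap_herm[OF herm[OF that]])
    also have "\<dots> = cnj (e k)" using ez that by (simp add: ip_scale_left zz)
    finally show ?thesis by (metis Reals_cnj_iff complex_is_Real_iff of_real_Re)
  qed
  have yz: "ip A (y j) z = 0" if "j < m" for j
    using w(1) that unfolding z_def ip_scale_right by (simp add: E_def)
  then have zy: "ip A z (y j) = 0" if "j < m" for j
    using that by (metis ip_cnj complex_cnj_zero)
  show ?case
  proof (intro exI conjI allI impI)
    fix i j assume "i < Suc m" "j < Suc m"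
    then show "ip A ((y(m := z)) i) ((y(m := z)) j) = of_bool (i = j)"
      using y yz zy zz by (auto simp: less_Suc_eq)
  next
    fix i k assume "i < Suc m" "k < q"
    then show "ap A (X k) ((y(m := z)) i) = (\<lambda>a. of_real ((if i = m then Re (e k) else ev k i)) * (y(m := z)) i a)"
      using ev ez ereal by (auto simp: less_Suc_eq)
  qed
qed

text \<open>With the vectors as columns, orthonormality says that the adjoint is a left inverse; for
  a square matrix it is then also a right inverse, which is completeness.\<close>

lemma orthonormal_complete:
  assumes fin: "finite A"
    and y: "\<And>i j. i < card A \<Longrightarrow> j < card A \<Longrightarrow> ip A (y i) (y j) = of_bool (i = j)"
  shows "onb {..<card A} A y"
proof -
  let ?n = "card A"
  obtain f where f: "bij_betw f {..<?n} A"
    using ex_bij_betw_nat_finite[OF fin] by (auto simp: atLeast0LessThan)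
  define Y where "Y = mat ?n ?n (\<lambda>(a,j). y j (f a))"
  define Z where "Z = mat ?n ?n (\<lambda>(j,a). cnj (y j (f a)))"
  have c: "Y \<in> carrier_mat ?n ?n" "Z \<in> carrier_mat ?n ?n" by (auto simp: Y_def Z_def)
  have "Z * Y = 1\<^sub>m ?n"
  proof (rule eq_matI)
    fix i j assume ij: "i < dim_row (1\<^sub>m ?n)" "j < dim_col (1\<^sub>m ?n)"
    have "(Z * Y) $$ (i,j) = (\<Sum>a<?n. cnj (y i (f a)) * y j (f a))"
      using ij by (simp add: Y_def Z_def scalar_prod_def atLeast0LessThan)
    also have "\<dots> = ip A (y i) (y j)"
      unfolding ip_def by (rule sum.reindex_bij_betw[OF f])
    finally show "(Z * Y) $$ (i,j) = 1\<^sub>m ?n $$ (i,j)" using y ij by simp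
  qed (auto simp: Y_def Z_def)
  then have YZ: "Y * Z = 1\<^sub>m ?n" using mat_mult_left_right_inverse c by blast
  have "(\<Sum>k<?n. y k a * cnj (y k b)) = of_bool (a = b)" if "a \<in> A" "b \<in> A" for a b
  proof -
    have "a \<in> f ` {..<?n}" "b \<in> f ` {..<?n}" using f that by (simp_all add: bij_betw_def)
    then obtain i j where ij: "i < ?n" "j < ?n" "a = f i" "b = f j" by blast
    have "(Y * Z) $$ (i,j) = (\<Sum>k<?n. y k a * cnj (y k b))"
      using ij by (simp add: Y_def Z_def scalar_prod_def atLeast0LessThan)
    moreover have "a = b \<longleftrightarrow> i = j" using ij f by (auto simp: bij_betw_def inj_on_def)
    ultimately show ?thesis using YZ ij(1,2) by (cases "i = j") (simp_all)
  qed
  then show ?thesis using y by (simp add: onb_def)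
qed

lemma onb_expand:
  assumes "onb I A y" "finite A" "a \<in> A"
  shows "v a = (\<Sum>k\<in>I. ip A (y k) v * y k a)"
proof -
  have "(\<Sum>k\<in>I. ip A (y k) v * y k a) = (\<Sum>b\<in>A. (\<Sum>k\<in>I. y k a * cnj (y k b)) * v b)"
    by (simp add: ip_def sum_distrib_left sum_distrib_right sum.swap[of _ I A] mult_ac)
  also have "\<dots> = (\<Sum>b\<in>A. of_bool (a = b) * v b)"
    using assms by (intro sum.cong refl) (simp add: onb_def)
  also have "\<dots> = v a" using assms by simp
  finally show ?thesis by simp
qed

lemma onb_parseval:
  assumes "onb I A y" "finite A"
  shows "(\<Sum>k\<in>I. cnj (ip A (y k) u) * ip A (y k) v) = ip A u v"
proof -
  have "ip A u v = (\<Sum>a\<in>A. cnj (u a) * (\<Sum>k\<in>I. ip A (y k) v * y k a))"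
    unfolding ip_def[of A u v] using onb_expand[OF assms, of _ v] by (intro sum.cong refl) simp
  also have "\<dots> = (\<Sum>k\<in>I. ip A u (y k) * ip A (y k) v)"
    unfolding ip_def[of A u] by (simp add: sum_distrib_left sum_distrib_right sum.swap[of _ I A] mult_ac)
  finally show ?thesis by (simp add: ip_cnj)
qed

lemma onb_parseval_nrm:
  assumes "onb I A y" "finite A"
  shows "(\<Sum>k\<in>I. (cmod (ip A (y k) v))\<^sup>2) = (nrm A v)\<^sup>2"
proof -
  have "complex_of_real (\<Sum>k\<in>I. (cmod (ip A (y k) v))\<^sup>2) = (\<Sum>k\<in>I. cnj (ip A (y k) v) * ip A (y k) v)"
    unfolding of_real_sum by (intro sum.cong refl) (metis complex_norm_square mult.commute)
  also have "\<dots> = of_real ((nrm A v)\<^sup>2)" by (simp only: onb_parseval[OF assms] ip_self)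
  finally show ?thesis using of_real_eq_iff by blast
qed

text \<open>The index set is an arbitrary finite set because the compression to a window is
  diagonalized on the window itself; with \<open>q = Suc 0\<close> this is the spectral theorem for
  a single operator.\<close>

theorem simultaneous_diagonalization:
  assumes fin: "finite A" and herm: "\<And>k. k < q \<Longrightarrow> herm_on A (X k)"
    and comm: "\<And>k l a b. k < q \<Longrightarrow> l < q \<Longrightarrow> a \<in> A \<Longrightarrow> b \<in> A \<Longrightarrow>
        (\<Sum>c\<in>A. X k a c * X l c b) = (\<Sum>c\<in>A. X l a c * X k c b)"
  obtains y and ev :: "nat \<Rightarrow> nat \<Rightarrow> real" where "onb {..<card A} A y"
    "\<And>k a b. k < q \<Longrightarrow> a \<in> A \<Longrightarrow> b \<in> A \<Longrightarrow>
       X k a b = (\<Sum>i<card A. of_real (ev k i) * y i a * cnj (y i b))"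
proof -
  have "\<exists>y (ev :: nat \<Rightarrow> nat \<Rightarrow> real). (\<forall>i<card A. \<forall>j<card A. ip A (y i) (y j) = of_bool (i = j)) \<and>
      (\<forall>i<card A. \<forall>k<q. ap A (X k) (y i) = (\<lambda>a. of_real (ev k i) * y i a))"
    by (rule orthonormal_eigenvectors[OF fin herm comm order.refl])
  then obtain y and ev :: "nat \<Rightarrow> nat \<Rightarrow> real" where
    yev: "(\<forall>i<card A. \<forall>j<card A. ip A (y i) (y j) = of_bool (i = j)) \<and>
      (\<forall>i<card A. \<forall>k<q. ap A (X k) (y i) = (\<lambda>a. of_real (ev k i) * y i a))"
    by (elim exE)
  have y: "ip A (y i) (y j) = of_bool (i = j)" if "i < card A" "j < card A" for i j
    using yev that by blast
  have ev: "ap A (X k) (y i) = (\<lambda>a. of_real (ev k i) * y i a)" if "i < card A" "k < q" for i k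
    using yev that by blast
  have o: "onb {..<card A} A y" by (rule orthonormal_complete[OF fin y])
  have "X k a b = (\<Sum>i<card A. of_real (ev k i) * y i a * cnj (y i b))"
    if "k < q" "a \<in> A" "b \<in> A" for k a b
  proof -
    have "X k a b = (\<Sum>c\<in>A. X k a c * of_bool (c = b))" using that fin by simp
    also have "\<dots> = (\<Sum>c\<in>A. X k a c * (\<Sum>i<card A. y i c * cnj (y i b)))"
      using o that by (intro sum.cong refl) (simp add: onb_def)
    also have "\<dots> = (\<Sum>c\<in>A. \<Sum>i<card A. X k a c * y i c * cnj (y i b))"
      by (simp add: sum_distrib_left mult.assoc)
    also have "\<dots> = (\<Sum>i<card A. \<Sum>c\<in>A. X k a c * y i c * cnj (y i b))"
      by (rule sum.swap)
    also have "\<dots> = (\<Sum>i<card A. (\<Sum>c\<in>A. X k a c * y i c) * cnj (y i b))"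
      by (simp add: sum_distrib_right)
    also have "\<dots> = (\<Sum>i<card A. ap A (X k) (y i) a * cnj (y i b))"
      using that by (simp add: ap_def)
    also have "\<dots> = (\<Sum>i<card A. of_real (ev k i) * y i a * cnj (y i b))"
      using ev that by (intro sum.cong refl) simp
    finally show ?thesis .
  qed
  then show thesis using that o by blast
qed

subsection \<open>Spectral decompositions and the trace norm\<close>

abbreviation ent :: "complex mat \<Rightarrow> nat \<Rightarrow> nat \<Rightarrow> complex" where
  "ent M \<equiv> \<lambda>a b. M $$ (a, b)"

text \<open>The trace of X M, the pairing of a test operator with a state.\<close>

definition trp :: "'a set \<Rightarrow> ('a \<Rightarrow> 'a \<Rightarrow> complex) \<Rightarrow> ('a \<Rightarrow> 'a \<Rightarrow> complex) \<Rightarrow> complex" where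
  "trp A X M = (\<Sum>a\<in>A. \<Sum>b\<in>A. X a b * M b a)"

text \<open>Operator norm at most one, expressed by the sesquilinear form: in this form it passes
  directly to compressions along isometries and to relabelled bases.\<close>

definition contr :: "'a set \<Rightarrow> ('a \<Rightarrow> 'a \<Rightarrow> complex) \<Rightarrow> bool" where
  "contr A X \<longleftrightarrow> (\<forall>w v. cmod (bil A X w v) \<le> nrm A w * nrm A v)"

lemma nrm_cong: "(\<And>a. a \<in> A \<Longrightarrow> u a = v a) \<Longrightarrow> nrm A u = nrm A v"
  by (simp add: nrm_def cong: L2_set_cong)

lemma bil_explicit: "bil A X w v = (\<Sum>a\<in>A. \<Sum>b\<in>A. cnj (w a) * X a b * v b)"
  by (simp add: bil_def ip_def ap_def sum_distrib_left mult.assoc)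

lemma bil_cong:
  "(\<And>a. a \<in> A \<Longrightarrow> w a = w' a) \<Longrightarrow> (\<And>a. a \<in> A \<Longrightarrow> v a = v' a) \<Longrightarrow> bil A X w v = bil A X w' v'"
  by (simp add: bil_explicit)

lemma cauchy_schwarz: "cmod (ip A u v) \<le> nrm A u * nrm A v"
proof -
  have "cmod (ip A u v) \<le> (\<Sum>a\<in>A. \<bar>cmod (u a)\<bar> * \<bar>cmod (v a)\<bar>)"
    unfolding ip_def by (rule order_trans[OF norm_sum]) (simp add: norm_mult)
  also have "\<dots> \<le> nrm A u * nrm A v" unfolding nrm_def by (rule L2_set_mult_ineq)
  finally show ?thesis .
qed

lemma nrm_add_le: "nrm A (\<lambda>a. u a + v a) \<le> nrm A u + nrm A v"
proof -
  have "nrm A (\<lambda>a. u a + v a) \<le> L2_set (\<lambda>a. cmod (u a) + cmod (v a)) A"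
    unfolding nrm_def by (rule L2_set_mono) (auto simp: norm_triangle_ineq)
  also have "\<dots> \<le> nrm A u + nrm A v" unfolding nrm_def by (rule L2_set_triangle_ineq)
  finally show ?thesis .
qed

lemma nrm_scale: "nrm A (\<lambda>a. x * v a) = cmod x * nrm A v"
  by (simp add: nrm_def norm_mult L2_set_right_distrib)

lemma nrm_diff_le: "nrm A (\<lambda>a. u a - v a) \<le> nrm A u + nrm A v"
  using nrm_add_le[of A u "\<lambda>a. - v a"] by (simp add: nrm_def)

lemma bil_diff_right: "bil A X w (\<lambda>a. u a - v a) = bil A X w u - bil A X w v"
  by (simp add: bil_explicit sum_subtractf algebra_simps)

lemma bil_diff_left: "bil A X (\<lambda>a. u a - v a) w = bil A X u w - bil A X v w"
  by (simp add: bil_explicit sum_subtractf algebra_simps)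

text \<open>Turns a distance between vectors into an error of expectation values: the difference
  splits into two terms, each linear in \<open>u - v\<close>.\<close>

lemma contr_diff:
  assumes "contr A X"
  shows "cmod (bil A X u u - bil A X v v) \<le> nrm A (\<lambda>a. u a - v a) * (nrm A u + nrm A v)"
proof -
  let ?d = "\<lambda>a. u a - v a"
  have "bil A X u u - bil A X v v = bil A X ?d u + bil A X v ?d"
    by (simp add: bil_diff_right bil_diff_left)
  also have "cmod \<dots> \<le> nrm A ?d * nrm A u + nrm A v * nrm A ?d"
    using assms by (intro order_trans[OF norm_triangle_ineq] add_mono) (auto simp: contr_def)
  finally show ?thesis by (simp add: algebra_simps)
qed

text \<open>The vectors need be neither orthogonal nor normalized, so this covers spectral
  decompositions, their images under unitaries and vectors cut to a window alike.\<close>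

lemma trp_ensemble:
  "trp A X (\<lambda>a b. \<Sum>i\<in>I. w i * v i a * cnj (v i b)) = (\<Sum>i\<in>I. w i * bil A X (v i) (v i))"
proof -
  have "trp A X (\<lambda>a b. \<Sum>i\<in>I. w i * v i a * cnj (v i b))
      = (\<Sum>a\<in>A. \<Sum>b\<in>A. \<Sum>i\<in>I. X a b * (w i * v i b * cnj (v i a)))"
    by (simp add: trp_def sum_distrib_left)
  also have "\<dots> = (\<Sum>a\<in>A. \<Sum>i\<in>I. \<Sum>b\<in>A. X a b * (w i * v i b * cnj (v i a)))"
    by (intro sum.cong refl sum.swap)
  also have "\<dots> = (\<Sum>i\<in>I. \<Sum>a\<in>A. \<Sum>b\<in>A. X a b * (w i * v i b * cnj (v i a)))"
    by (rule sum.swap)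
  also have "\<dots> = (\<Sum>i\<in>I. w i * bil A X (v i) (v i))"
    by (simp add: bil_explicit sum_distrib_left mult_ac)
  finally show ?thesis .
qed

lemma trp_cong: "(\<And>a b. a \<in> A \<Longrightarrow> b \<in> A \<Longrightarrow> M a b = M' a b) \<Longrightarrow> trp A X M = trp A X M'"
  by (simp add: trp_def)

lemma trp_diff: "trp A X (\<lambda>a b. M a b - M' a b) = trp A X M - trp A X M'"
  by (simp add: trp_def sum_subtractf algebra_simps)

definition diagonalizes :: "nat \<Rightarrow> complex mat \<Rightarrow> (nat \<Rightarrow> nat \<Rightarrow> complex) \<Rightarrow> (nat \<Rightarrow> real) \<Rightarrow> bool" where
  "diagonalizes n M y e \<longleftrightarrow> M \<in> carrier_mat n n \<and> onb {..<n} {..<n} y \<and>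
     (\<forall>a<n. \<forall>b<n. M $$ (a,b) = (\<Sum>i<n. of_real (e i) * y i a * cnj (y i b)))"

section \<open>Hermitian matrices and their spectral decompositions\<close>

lemma dim_adj [simp]: "dim_row (adj A) = dim_col A" "dim_col (adj A) = dim_row A"
  by (auto simp: adj_def)

lemma adj_carrier [simp]: "A \<in> carrier_mat n m \<Longrightarrow> adj A \<in> carrier_mat m n"
  by (auto simp: adj_def)

lemma adj_index: "i < dim_col A \<Longrightarrow> j < dim_row A \<Longrightarrow> adj A $$ (i,j) = cnj (A $$ (j,i))"
  by (simp add: adj_def)

lemma mult_index_sum:
  "A \<in> carrier_mat n m \<Longrightarrow> B \<in> carrier_mat m l \<Longrightarrow> i < n \<Longrightarrow> j < l \<Longrightarrow>
    (A * B) $$ (i,j) = (\<Sum>k<m. A $$ (i,k) * B $$ (k,j))"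
  by (simp add: scalar_prod_def atLeast0LessThan)

lemma hermitian_herm_on:
  assumes "M \<in> carrier_mat n n"
  shows "hermitian M \<longleftrightarrow> herm_on {..<n} (ent M)"
proof
  assume h: "hermitian M"
  have "M $$ (a,b) = cnj (M $$ (b,a))" if "a < n" "b < n" for a b
  proof -
    have "M $$ (a,b) = adj M $$ (a,b)" using h by (simp add: hermitian_def)
    then show ?thesis using adj_index[of a M b] that assms by simp
  qed
  then show "herm_on {..<n} (ent M)" unfolding herm_on_def by blast
next
  assume h: "herm_on {..<n} (ent M)"
  have "adj M = M"
  proof (rule eq_matI)
    fix i j assume "i < dim_row M" "j < dim_col M"
    then show "adj M $$ (i,j) = M $$ (i,j)"
      using h assms adj_index[of i M j] unfolding herm_on_def by (metis carrier_matD lessThan_iff)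
  qed (use assms in auto)
  then show "hermitian M" using assms by (simp add: hermitian_def)
qed

lemma hermitian_diagonalizes:
  assumes "M \<in> carrier_mat n n" "hermitian M"
  obtains y e where "diagonalizes n M y e"
proof -
  obtain y ev where "onb {..<card {..<n}} {..<n} y" and
    ev: "\<And>k a b. k < Suc 0 \<Longrightarrow> a \<in> {..<n} \<Longrightarrow> b \<in> {..<n} \<Longrightarrow>
       ent M a b = (\<Sum>i<card {..<n}. of_real (ev k i :: real) * y i a * cnj (y i b))"
    by (rule simultaneous_diagonalization[of "{..<n}" "Suc 0" "\<lambda>_. ent M"])
      (use assms hermitian_herm_on in auto)
  then have "diagonalizes n M y (ev 0)"
    using assms ev[of 0] by (simp add: diagonalizes_def)
  then show thesis by (rule that)
qed

lemma diagonalizes_ap: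
  assumes "diagonalizes n M y e" "i < n"
  shows "ap {..<n} (ent M) (y i) a = (if a < n then of_real (e i) * y i a else 0)"
proof (cases "a < n")
  case True
  have "ap {..<n} (ent M) (y i) a = (\<Sum>b<n. \<Sum>j<n. of_real (e j) * y j a * (cnj (y j b) * y i b))"
    using True assms by (simp add: ap_def diagonalizes_def sum_distrib_right mult.assoc)
  also have "\<dots> = (\<Sum>j<n. of_real (e j) * y j a * ip {..<n} (y j) (y i))"
    by (subst sum.swap) (simp add: ip_def sum_distrib_left)
  also have "\<dots> = (\<Sum>j<n. of_real (e j) * y j a * of_bool (j = i))"
    using assms by (intro sum.cong refl) (simp add: diagonalizes_def onb_def)
  finally show ?thesis using assms True by simp
qed (simp add: ap_def)

lemma diagonalizes_bil:
  assumes "diagonalizes n M y e"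
  shows "bil {..<n} (ent M) v v = of_real (\<Sum>i<n. e i * (cmod (ip {..<n} (y i) v))\<^sup>2)"
proof -
  let ?A = "{..<n}"
  have "bil ?A (ent M) v v = trp ?A (ent M) (\<lambda>a b. \<Sum>i\<in>{0::nat}. 1 * v a * cnj (v b))"
    by (subst trp_ensemble) simp
  also have "\<dots> = trp ?A (\<lambda>a b. v a * cnj (v b)) (ent M)"
    unfolding trp_def by (subst sum.swap) (simp add: mult_ac)
  also have "\<dots> = trp ?A (\<lambda>a b. v a * cnj (v b)) (\<lambda>a b. \<Sum>i<n. of_real (e i) * y i a * cnj (y i b))"
    by (rule trp_cong) (use assms in \<open>auto simp: diagonalizes_def\<close>)
  also have "\<dots> = (\<Sum>i<n. of_real (e i) * bil ?A (\<lambda>a b. v a * cnj (v b)) (y i) (y i))"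
    by (rule trp_ensemble)
  also have "\<dots> = (\<Sum>i<n. of_real (e i) * (ip ?A (y i) v * cnj (ip ?A (y i) v)))"
    by (simp add: bil_explicit ip_def sum_product mult_ac)
  also have "\<dots> = of_real (\<Sum>i<n. e i * (cmod (ip ?A (y i) v))\<^sup>2)"
    unfolding of_real_sum of_real_mult complex_norm_square ..
  finally show ?thesis .
qed

lemma onb_nrm: "onb I A y \<Longrightarrow> i \<in> I \<Longrightarrow> nrm A (y i) = 1"
proof -
  assume "onb I A y" "i \<in> I"
  then have "complex_of_real ((nrm A (y i))\<^sup>2) = 1" unfolding ip_self[symmetric] by (simp add: onb_def)
  then have "(nrm A (y i))\<^sup>2 = 1" using of_real_eq_1_iff by blast
  then show ?thesis using nrm_nonneg[of A "y i"] by (simp add: power2_eq_1_iff)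
qed

lemma diagonalizes_trace:
  assumes "diagonalizes n M y e"
  shows "mtrace M = of_real (\<Sum>i<n. e i)"
proof -
  have "mtrace M = (\<Sum>a<n. \<Sum>i<n. of_real (e i) * (cnj (y i a) * y i a))"
    using assms by (auto simp: mtrace_def diagonalizes_def mult_ac intro!: sum.cong)
  also have "\<dots> = (\<Sum>i<n. of_real (e i) * ip {..<n} (y i) (y i))"
    by (subst sum.swap) (simp add: ip_def sum_distrib_left)
  also have "\<dots> = (\<Sum>i<n. of_real (e i))"
    using assms by (intro sum.cong refl) (simp add: diagonalizes_def onb_def)
  finally show ?thesis by simp
qed

lemma diagonalizes_ev:
  assumes "diagonalizes n M y e" "i < n"
  shows "bil {..<n} (ent M) (y i) (y i) = of_real (e i)"
proof -
  have "bil {..<n} (ent M) (y i) (y i) = ip {..<n} (y i) (\<lambda>a. of_real (e i) * y i a)"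
    unfolding bil_def by (rule ip_cong) (use diagonalizes_ap[OF assms] in auto)
  also have "\<dots> = of_real (e i) * ip {..<n} (y i) (y i)" by (rule ip_scale_right)
  finally show ?thesis using assms by (simp add: diagonalizes_def onb_def)
qed

lemma vinner_bil:
  assumes "M \<in> carrier_mat n n" "v \<in> carrier_vec n"
  shows "vinner v (M *\<^sub>v v) = bil {..<n} (ent M) (\<lambda>a. v $ a) (\<lambda>a. v $ a)"
  using assms
  by (auto simp: vinner_def bil_explicit scalar_prod_def atLeast0LessThan sum_distrib_left mult_ac intro!: sum.cong)

lemma positive_mat_bil:
  assumes "M \<in> carrier_mat n n"
  shows "positive_mat M \<longleftrightarrow> hermitian M \<and> (\<forall>v. 0 \<le> Re (bil {..<n} (ent M) v v))"
proof -
  have "(\<forall>v \<in> carrier_vec n. 0 \<le> Re (vinner v (M *\<^sub>v v))) \<longleftrightarrow> (\<forall>v. 0 \<le> Re (bil {..<n} (ent M) v v))"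
  proof (intro iffI allI ballI)
    fix v assume *: "\<forall>v \<in> carrier_vec n. 0 \<le> Re (vinner v (M *\<^sub>v v))"
    have "bil {..<n} (ent M) v v = vinner (vec n v) (M *\<^sub>v vec n v)"
      by (subst vinner_bil[OF assms]) (auto intro!: bil_cong)
    then show "0 \<le> Re (bil {..<n} (ent M) v v)" using * by simp
  next
    fix v :: "complex vec"
    assume "\<forall>v. 0 \<le> Re (bil {..<n} (ent M) v v)" "v \<in> carrier_vec n"
    then show "0 \<le> Re (vinner v (M *\<^sub>v v))" by (simp add: vinner_bil[OF assms])
  qed
  then show ?thesis using assms by (auto simp: positive_mat_def)
qed

lemma positive_diagonalizes:
  assumes "diagonalizes n M y e"
  shows "positive_mat M \<longleftrightarrow> (\<forall>i<n. 0 \<le> e i)"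
proof
  have M: "M \<in> carrier_mat n n" using assms by (simp add: diagonalizes_def)
  {
    assume "positive_mat M"
    then show "\<forall>i<n. 0 \<le> e i"
      using diagonalizes_ev[OF assms] by (metis Re_complex_of_real positive_mat_bil[OF M])
  next
    assume *: "\<forall>i<n. 0 \<le> e i"
    have "herm_on {..<n} (ent M)"
      using assms by (auto simp: herm_on_def diagonalizes_def mult_ac)
    then have "hermitian M" using hermitian_herm_on[OF M] by simp
    moreover have "0 \<le> Re (bil {..<n} (ent M) v v)" for v
      unfolding diagonalizes_bil[OF assms] using * by (auto intro!: sum_nonneg)
    ultimately show "positive_mat M" by (simp add: positive_mat_bil[OF M])
  }
qed

lemma diagonalizes_hermitian:
  assumes "diagonalizes n M y e"
  shows "hermitian M"
proof -
  have "herm_on {..<n} (ent M)"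
    using assms by (auto simp: herm_on_def diagonalizes_def mult_ac)
  moreover have "M \<in> carrier_mat n n" using assms by (simp add: diagonalizes_def)
  ultimately show ?thesis using hermitian_herm_on by blast
qed

text \<open>Expanding \<open>z j\<close> in the basis \<open>y\<close>, only vectors
  \<open>y i\<close> with nonzero overlap appear, and on those S acts by the same number
  \<open>t j\<close>; hence S and T agree on the basis \<open>z\<close>. No matching of degenerate
  eigenvectors is required.\<close>

lemma diagonalizes_unique:
  assumes S: "diagonalizes n S y s" and T: "diagonalizes n T z t"
    and eq: "\<And>i j. i < n \<Longrightarrow> j < n \<Longrightarrow> ip {..<n} (y i) (z j) \<noteq> 0 \<Longrightarrow> s i = t j"
  shows "S = T"
proof (rule eq_matI)
  let ?A = "{..<n}"
  have Sz: "ap ?A (ent S) (z j) a = of_real (t j) * z j a" if "a < n" "j < n" for a j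
  proof -
    have "ap ?A (ent S) (z j) a = (\<Sum>b<n. \<Sum>i<n. of_real (s i) * y i a * (cnj (y i b) * z j b))"
      using S that by (simp add: ap_def diagonalizes_def sum_distrib_right mult.assoc)
    also have "\<dots> = (\<Sum>i<n. of_real (s i) * y i a * ip ?A (y i) (z j))"
      by (subst sum.swap) (simp add: ip_def sum_distrib_left)
    also have "\<dots> = (\<Sum>i<n. of_real (t j) * (ip ?A (y i) (z j) * y i a))"
    proof (intro sum.cong refl)
      fix i assume "i \<in> ?A"
      then show "of_real (s i) * y i a * ip ?A (y i) (z j) = of_real (t j) * (ip ?A (y i) (z j) * y i a)"
        using eq[of i j] that by (cases "ip ?A (y i) (z j) = 0") auto
    qed
    also have "\<dots> = of_real (t j) * z j a"
      using onb_expand[of ?A ?A y a "z j"] S that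
      by (simp add: diagonalizes_def sum_distrib_left)
    finally show ?thesis .
  qed
  fix a b assume "a < dim_row T" "b < dim_col T"
  then have ab: "a < n" "b < n" using T by (auto simp: diagonalizes_def)
  have z: "onb ?A ?A z" using T by (simp add: diagonalizes_def)
  have "S $$ (a,b) = (\<Sum>c<n. S $$ (a,c) * of_bool (c = b))" using ab by simp
  also have "\<dots> = (\<Sum>c<n. S $$ (a,c) * (\<Sum>j<n. z j c * cnj (z j b)))"
    using z ab by (intro sum.cong refl) (simp add: onb_def)
  also have "\<dots> = (\<Sum>c<n. \<Sum>j<n. S $$ (a,c) * z j c * cnj (z j b))"
    by (simp add: sum_distrib_left mult.assoc)
  also have "\<dots> = (\<Sum>j<n. \<Sum>c<n. S $$ (a,c) * z j c * cnj (z j b))" by (rule sum.swap)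
  also have "\<dots> = (\<Sum>j<n. ap ?A (ent S) (z j) a * cnj (z j b))"
    using ab by (simp add: ap_def sum_distrib_right)
  also have "\<dots> = T $$ (a,b)" using Sz ab T by (simp add: diagonalizes_def)
  finally show "S $$ (a,b) = T $$ (a,b)" .
qed (use S T in \<open>auto simp: diagonalizes_def\<close>)

lemma ap_square:
  assumes S: "diagonalizes n S y s" and i: "i < n"
  shows "ap {..<n} (ent (S * S)) (y i) a = (if a < n then of_real ((s i)\<^sup>2) * y i a else 0)"
proof (cases "a < n")
  case True
  let ?A = "{..<n}"
  have c: "S \<in> carrier_mat n n" using S by (simp add: diagonalizes_def)
  have "ap ?A (ent (S * S)) (y i) a = (\<Sum>c<n. (\<Sum>b<n. S $$ (a,b) * S $$ (b,c)) * y i c)"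
    using True c by (simp add: ap_def mult_index_sum[OF c c] del: index_mult_mat)
  also have "\<dots> = ap ?A (ent S) (ap ?A (ent S) (y i)) a"
    using True by (simp add: ap_ap)
  also have "ap ?A (ent S) (ap ?A (ent S) (y i)) a = ap ?A (ent S) (\<lambda>a. of_real (s i) * y i a) a"
    using True by (simp add: ap_def[of ?A "ent S" "ap ?A (ent S) (y i)"] ap_def[of ?A "ent S" "\<lambda>a. of_real (s i) * y i a"]
        diagonalizes_ap[OF S i])
  also have "\<dots> = of_real (s i) * ap ?A (ent S) (y i) a"
    using True by (simp add: ap_def sum_distrib_left mult_ac)
  finally show ?thesis using True by (simp add: diagonalizes_ap[OF S i] power2_eq_square)
qed (simp add: ap_def)

text \<open>\<open>mat_sqrt\<close> is a definite description, so uniqueness has to be proved.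
  Moving \<open>S * S = T * T\<close> across an inner product of eigenvectors with nonzero overlap
  gives (s i)^2 = (t j)^2, hence s i = t j by positivity.\<close>

lemma positive_sqrt_unique:
  assumes S: "S \<in> carrier_mat n n" "positive_mat S" and T: "T \<in> carrier_mat n n" "positive_mat T"
    and eq: "S * S = T * T"
  shows "S = T"
proof -
  let ?A = "{..<n}"
  have h: "hermitian S" "hermitian T" using S T by (auto simp: positive_mat_def)
  obtain y s where ys: "diagonalizes n S y s" using hermitian_diagonalizes[OF S(1) h(1)] .
  obtain z t where zt: "diagonalizes n T z t" using hermitian_diagonalizes[OF T(1) h(2)] .
  have s0: "0 \<le> s i" if "i < n" for i using positive_diagonalizes[OF ys] S that by simp
  have t0: "0 \<le> t i" if "i < n" for i using positive_diagonalizes[OF zt] T that by simp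
  show ?thesis
  proof (rule diagonalizes_unique[OF ys zt])
    fix i j assume ij: "i < n" "j < n" and nz: "ip ?A (y i) (z j) \<noteq> 0"
    have SS: "S * S \<in> carrier_mat n n" using S by simp
    have "herm_on ?A (ent (S * S))"
    proof -
      have "cnj (S $$ (b, a)) = S $$ (a, b)" if "a < n" "b < n" for a b
        using h(1) hermitian_herm_on[OF S(1)] that unfolding herm_on_def by (metis lessThan_iff)
      then show ?thesis
        unfolding herm_on_def
        by (auto simp: mult_index_sum[OF S(1) S(1)] mult.commute simp del: index_mult_mat intro!: sum.cong)
    qed
    then have "ip ?A (y i) (ap ?A (ent (S * S)) (z j)) = ip ?A (ap ?A (ent (S * S)) (y i)) (z j)"
      by (rule ip_ap_herm)
    moreover have "ip ?A (ap ?A (ent (S * S)) (y i)) (z j) = of_real ((s i)\<^sup>2) * ip ?A (y i) (z j)"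
    proof -
      have "ip ?A (ap ?A (ent (S * S)) (y i)) (z j) = ip ?A (\<lambda>a. of_real ((s i)\<^sup>2) * y i a) (z j)"
        by (rule ip_cong) (auto simp: ap_square[OF ys ij(1)])
      then show ?thesis by (simp add: ip_scale_left)
    qed
    moreover have "ip ?A (y i) (ap ?A (ent (T * T)) (z j)) = of_real ((t j)\<^sup>2) * ip ?A (y i) (z j)"
    proof -
      have "ip ?A (y i) (ap ?A (ent (T * T)) (z j)) = ip ?A (y i) (\<lambda>a. of_real ((t j)\<^sup>2) * z j a)"
        by (rule ip_cong) (auto simp: ap_square[OF zt ij(2)])
      then show ?thesis by (simp add: ip_scale_right)
    qed
    ultimately have "complex_of_real ((s i)\<^sup>2) = of_real ((t j)\<^sup>2)" using nz eq by simp
    then have "(s i)\<^sup>2 = (t j)\<^sup>2" using of_real_eq_iff by blast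
    then show "s i = t j" using s0 t0 ij by simp
  qed
qed

definition spectral_mat :: "nat \<Rightarrow> (nat \<Rightarrow> nat \<Rightarrow> complex) \<Rightarrow> (nat \<Rightarrow> real) \<Rightarrow> complex mat" where
  "spectral_mat n y e = mat n n (\<lambda>(a,b). \<Sum>i<n. of_real (e i) * y i a * cnj (y i b))"

lemma spectral_mat_diagonalizes:
  "onb {..<n} {..<n} y \<Longrightarrow> diagonalizes n (spectral_mat n y e) y e"
  by (simp add: diagonalizes_def spectral_mat_def)

lemma spectral_mat_eq: "diagonalizes n M y e \<Longrightarrow> M = spectral_mat n y e"
  by (rule eq_matI) (auto simp: diagonalizes_def spectral_mat_def)

lemma spectral_mat_mult:
  assumes y: "onb {..<n} {..<n} y"
  shows "spectral_mat n y e * spectral_mat n y f = spectral_mat n y (\<lambda>i. e i * f i)"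
proof (rule eq_matI)
  fix a b assume "a < dim_row (spectral_mat n y (\<lambda>i. e i * f i))" "b < dim_col (spectral_mat n y (\<lambda>i. e i * f i))"
  then have ab: "a < n" "b < n" by (auto simp: spectral_mat_def)
  let ?E = "spectral_mat n y e" and ?F = "spectral_mat n y f"
  have c: "?E \<in> carrier_mat n n" "?F \<in> carrier_mat n n" by (auto simp: spectral_mat_def)
  have "(?E * ?F) $$ (a,b) = (\<Sum>c<n. ?E $$ (a,c) * ?F $$ (c,b))"
    by (rule mult_index_sum[OF c ab])
  also have "\<dots> = (\<Sum>c<n. \<Sum>i<n. ?E $$ (a,c) * y i c * (of_real (f i) * cnj (y i b)))"
    using ab by (simp add: spectral_mat_def[of n y f] sum_distrib_left mult_ac)
  also have "\<dots> = (\<Sum>i<n. \<Sum>c<n. ?E $$ (a,c) * y i c * (of_real (f i) * cnj (y i b)))"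
    by (rule sum.swap)
  also have "\<dots> = (\<Sum>i<n. ap {..<n} (ent ?E) (y i) a * (of_real (f i) * cnj (y i b)))"
    using ab by (simp add: ap_def sum_distrib_right)
  also have "\<dots> = (\<Sum>i<n. of_real (e i * f i) * y i a * cnj (y i b))"
    using diagonalizes_ap[OF spectral_mat_diagonalizes[OF y]] ab by (simp add: mult_ac)
  finally show "(?E * ?F) $$ (a,b) = spectral_mat n y (\<lambda>i. e i * f i) $$ (a,b)"
    using ab by (simp add: spectral_mat_def)
qed (auto simp: spectral_mat_def)

lemma trace_norm_diagonalizes:
  assumes M: "diagonalizes n M y e"
  shows "trace_norm M = (\<Sum>i<n. \<bar>e i\<bar>)"
proof -
  have y: "onb {..<n} {..<n} y" using M by (simp add: diagonalizes_def)
  let ?S = "spectral_mat n y (\<lambda>i. \<bar>e i\<bar>)"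
  have "adj M = M" using diagonalizes_hermitian[OF M] by (simp add: hermitian_def)
  then have MM: "adj M * M = spectral_mat n y (\<lambda>i. e i * e i)"
    using spectral_mat_mult[OF y] spectral_mat_eq[OF M] by simp
  have S: "diagonalizes n ?S y (\<lambda>i. \<bar>e i\<bar>)" by (rule spectral_mat_diagonalizes[OF y])
  have Sc: "?S \<in> carrier_mat n n" by (simp add: spectral_mat_def)
  have Sp: "positive_mat ?S" using positive_diagonalizes[OF S] by simp
  have SS: "?S * ?S = adj M * M" unfolding MM spectral_mat_mult[OF y] by (simp add: abs_mult_self_eq)
  have "mat_sqrt (adj M * M) = ?S"
    unfolding mat_sqrt_def
  proof (rule the_equality)
    have "dim_row (adj M * M) = n" unfolding MM by (simp add: spectral_mat_def)
    then show "?S \<in> carrier_mat (dim_row (adj M * M)) (dim_row (adj M * M)) \<and> positive_mat ?S \<and> ?S * ?S = adj M * M"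
      using Sc Sp SS by simp
    fix T assume "T \<in> carrier_mat (dim_row (adj M * M)) (dim_row (adj M * M)) \<and> positive_mat T \<and> T * T = adj M * M"
    then show "T = ?S" using positive_sqrt_unique[of T n ?S] Sc Sp SS \<open>dim_row (adj M * M) = n\<close> by simp
  qed
  then show ?thesis by (simp add: trace_norm_def diagonalizes_trace[OF S])
qed

lemma trp_diagonalizes:
  assumes "diagonalizes n M y e"
  shows "trp {..<n} X (ent M) = (\<Sum>i<n. of_real (e i) * bil {..<n} X (y i) (y i))"
proof -
  have "trp {..<n} X (ent M) = trp {..<n} X (\<lambda>a b. \<Sum>i<n. of_real (e i) * y i a * cnj (y i b))"
    by (rule trp_cong) (use assms in \<open>auto simp: diagonalizes_def\<close>)
  then show ?thesis by (simp only: trp_ensemble)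
qed

text \<open>One half of the duality between trace norm and operator norm. A bound on the quadratic
  form of X is enough, since the trace is evaluated in the eigenbasis of the Hermitian M.\<close>

lemma trace_norm_lower:
  assumes "M \<in> carrier_mat n n" "hermitian M"
    and X: "\<And>v. nrm {..<n} v = 1 \<Longrightarrow> cmod (bil {..<n} X v v) \<le> c"
  shows "cmod (trp {..<n} X (ent M)) \<le> c * trace_norm M"
proof -
  obtain y e where d: "diagonalizes n M y e" using hermitian_diagonalizes[OF assms(1,2)] .
  have "cmod (trp {..<n} X (ent M)) \<le> (\<Sum>i<n. \<bar>e i\<bar> * cmod (bil {..<n} X (y i) (y i)))"
    unfolding trp_diagonalizes[OF d] by (rule order_trans[OF norm_sum]) (simp add: norm_mult)
  also have "\<dots> \<le> (\<Sum>i<n. \<bar>e i\<bar> * c)"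
    using d by (intro sum_mono mult_left_mono X) (auto simp: diagonalizes_def onb_nrm)
  finally show ?thesis by (simp add: trace_norm_diagonalizes[OF d] sum_distrib_left mult.commute)
qed

text \<open>The other half of the duality: the sign of M, built on its eigenbasis, is a contraction
  whose pairing with M is the trace norm.\<close>

lemma trace_norm_upper:
  assumes "M \<in> carrier_mat n n" "hermitian M"
    and X: "\<And>X. contr {..<n} X \<Longrightarrow> cmod (trp {..<n} X (ent M)) \<le> \<epsilon>"
  shows "trace_norm M \<le> \<epsilon>"
proof -
  let ?A = "{..<n}"
  obtain y e where d: "diagonalizes n M y e" using hermitian_diagonalizes[OF assms(1,2)] .
  have y: "onb ?A ?A y" using d by (simp add: diagonalizes_def)
  define X where "X = ent (spectral_mat n y (\<lambda>i. sgn (e i)))"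
  have dX: "diagonalizes n (spectral_mat n y (\<lambda>i. sgn (e i))) y (\<lambda>i. sgn (e i))"
    by (rule spectral_mat_diagonalizes[OF y])
  have "contr ?A X"
    unfolding contr_def
  proof (intro allI)
    fix w v
    have "bil ?A X w v = (\<Sum>a<n. \<Sum>b<n. \<Sum>i<n. of_real (sgn (e i)) * (cnj (w a) * y i a) * (cnj (y i b) * v b))"
      by (simp add: bil_explicit X_def spectral_mat_def sum_distrib_left sum_distrib_right mult_ac)
    also have "\<dots> = (\<Sum>a<n. \<Sum>i<n. \<Sum>b<n. of_real (sgn (e i)) * (cnj (w a) * y i a) * (cnj (y i b) * v b))"
      by (intro sum.cong refl sum.swap)
    also have "\<dots> = (\<Sum>i<n. \<Sum>a<n. \<Sum>b<n. of_real (sgn (e i)) * (cnj (w a) * y i a) * (cnj (y i b) * v b))"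
      by (rule sum.swap)
    also have "\<dots> = (\<Sum>i<n. of_real (sgn (e i)) * ip ?A w (y i) * ip ?A (y i) v)"
      by (simp add: ip_def sum_product sum_distrib_left sum_distrib_right mult_ac)
    finally have "cmod (bil ?A X w v) \<le> (\<Sum>i<n. cmod (of_real (sgn (e i)) * ip ?A w (y i) * ip ?A (y i) v))"
      by (simp add: norm_sum)
    also have "\<dots> \<le> (\<Sum>i<n. \<bar>cmod (ip ?A (y i) w)\<bar> * \<bar>cmod (ip ?A (y i) v)\<bar>)"
    proof (intro sum_mono)
      fix i
      have "cmod (ip ?A w (y i)) = cmod (ip ?A (y i) w)" by (metis ip_cnj complex_mod_cnj)
      then show "cmod (of_real (sgn (e i)) * ip ?A w (y i) * ip ?A (y i) v)
          \<le> \<bar>cmod (ip ?A (y i) w)\<bar> * \<bar>cmod (ip ?A (y i) v)\<bar>"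
        by (simp add: norm_mult sgn_if)
    qed
    also have "\<dots> \<le> L2_set (\<lambda>i. cmod (ip ?A (y i) w)) ?A * L2_set (\<lambda>i. cmod (ip ?A (y i) v)) ?A"
      by (rule L2_set_mult_ineq)
    also have "\<dots> = nrm ?A w * nrm ?A v"
      unfolding L2_set_def onb_parseval_nrm[OF y finite_lessThan] by simp
    finally show "cmod (bil ?A X w v) \<le> nrm ?A w * nrm ?A v" .
  qed
  moreover have "trp ?A X (ent M) = of_real (\<Sum>i<n. \<bar>e i\<bar>)"
  proof -
    have "e i * sgn (e i) = \<bar>e i\<bar>" for i by (simp add: sgn_if)
    then show ?thesis
      unfolding trp_diagonalizes[OF d] of_real_sum
      by (intro sum.cong refl) (simp add: X_def diagonalizes_ev[OF dX] del: of_real_mult flip: of_real_mult)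
  qed
  ultimately have "cmod (of_real (\<Sum>i<n. \<bar>e i\<bar>)) \<le> \<epsilon>" using X by metis
  then show ?thesis unfolding trace_norm_diagonalizes[OF d] by (simp only: norm_of_real)
qed

text \<open>Entropy is defined through the roots of the characteristic polynomial; similarity to the
  diagonal matrix of the \<open>e i\<close> identifies them with multiplicity.\<close>

lemma eigvals_mset_diagonalizes:
  assumes d: "diagonalizes n M y e"
  shows "eigvals_mset M = image_mset (\<lambda>i. of_real (e i)) (mset_set {..<n})"
proof -
  define P where "P = mat n n (\<lambda>(a,i). y i a)"
  define Q where "Q = mat n n (\<lambda>(i,a). cnj (y i a))"
  define E where "E = mat n n (\<lambda>(i,j). if i = j then complex_of_real (e i) else 0)"
  have c: "P \<in> carrier_mat n n" "Q \<in> carrier_mat n n" "E \<in> carrier_mat n n" "M \<in> carrier_mat n n"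
    using d by (auto simp: P_def Q_def E_def diagonalizes_def)
  have y: "onb {..<n} {..<n} y" using d by (simp add: diagonalizes_def)
  have QP: "Q * P = 1\<^sub>m n"
  proof (rule eq_matI)
    fix i j assume ij: "i < dim_row (1\<^sub>m n)" "j < dim_col (1\<^sub>m n)"
    then have "(Q * P) $$ (i,j) = ip {..<n} (y i) (y j)"
      using mult_index_sum[OF c(2,1), of i j] by (simp add: P_def Q_def ip_def)
    then show "(Q * P) $$ (i,j) = 1\<^sub>m n $$ (i,j)" using ij y by (simp add: onb_def)
  qed (use c in auto)
  then have PQ: "P * Q = 1\<^sub>m n" using mat_mult_left_right_inverse c by blast
  have "M = P * E * Q"
  proof (rule eq_matI)
    fix a b assume "a < dim_row (P * E * Q)" "b < dim_col (P * E * Q)"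
    then have ab: "a < n" "b < n" using c by auto
    have "(P * E) $$ (a,i) = of_real (e i) * y i a" if "i < n" for i
    proof -
      have "(P * E) $$ (a,i) = (\<Sum>j<n. y j a * (if j = i then complex_of_real (e j) else 0))"
        using mult_index_sum[OF c(1,3) ab(1) that] that ab by (simp add: P_def E_def)
      also have "\<dots> = (\<Sum>j<n. if j = i then y j a * complex_of_real (e j) else 0)"
        by (intro sum.cong) auto
      finally show ?thesis using that by simp
    qed
    moreover have "(P * E * Q) $$ (a,b) = (\<Sum>i<n. (P * E) $$ (a,i) * Q $$ (i,b))"
      by (rule mult_index_sum) (use c ab in auto)
    ultimately have "(P * E * Q) $$ (a,b) = (\<Sum>i<n. of_real (e i) * y i a * cnj (y i b))"
      using ab by (simp add: Q_def)
    then show "M $$ (a,b) = (P * E * Q) $$ (a,b)" using d ab by (simp add: diagonalizes_def)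
  qed (use c in auto)
  then have "similar_mat M E" using PQ QP c
    unfolding similar_mat_def similar_mat_wit_def Let_def by (intro exI[of _ P] exI[of _ Q]) auto
  then have "char_poly M = char_poly E" by (rule char_poly_similar)
  also have "\<dots> = (\<Prod>a\<leftarrow>diag_mat E. [:- a, 1:])"
    by (rule char_poly_upper_triangular[OF c(3)]) (auto simp: E_def upper_triangular_def)
  also have "diag_mat E = map (\<lambda>i. of_real (e i)) [0..<n]"
    by (simp add: diag_mat_def E_def)
  finally have cp: "char_poly M = (\<Prod>p\<leftarrow>map (\<lambda>i. [:- complex_of_real (e i), 1:]) [0..<n]. p)"
    by (simp add: comp_def)
  have "eigvals_mset M = (\<Sum>p\<leftarrow>map (\<lambda>i. [:- complex_of_real (e i), 1:]) [0..<n]. proots p)"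
    unfolding eigvals_mset_def cp by (rule proots_prod_list) auto
  also have "\<dots> = (\<Sum>i\<leftarrow>[0..<n]. {#complex_of_real (e i)#})"
    by (simp add: comp_def)
  also have "\<dots> = image_mset (\<lambda>i. of_real (e i)) (mset_set {..<n})"
    by (induction n) (auto simp: lessThan_Suc)
  finally show ?thesis .
qed

lemma vn_entropy_diagonalizes:
  assumes d: "diagonalizes n M y e" and "\<And>i. i < n \<Longrightarrow> 0 \<le> e i"
  shows "vn_entropy M = (\<Sum>i<n. e i * (- ln (e i)))"
proof -
  have "vn_entropy M = - (\<Sum>i<n. let x = e i in if x \<le> 0 then 0 else x * ln x)"
    unfolding vn_entropy_def eigvals_mset_diagonalizes[OF d]
    by (simp add: image_mset.compositionality comp_def sum_unfold_sum_mset)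
  also have "\<dots> = - (\<Sum>i<n. e i * ln (e i))"
    using assms(2) by (intro arg_cong[where f = uminus] sum.cong refl) (auto simp: Let_def intro: antisym)
  finally show ?thesis by (simp add: sum_negf)
qed

lemma density_diagonalizes:
  assumes "density_mat n \<rho>"
  obtains y p where "diagonalizes n \<rho> y p" "\<And>i. i < n \<Longrightarrow> 0 \<le> p i" "(\<Sum>i<n. p i) = 1"
proof -
  have c: "\<rho> \<in> carrier_mat n n" "positive_mat \<rho>" "hermitian \<rho>" "mtrace \<rho> = 1"
    using assms by (auto simp: density_mat_def positive_mat_def)
  obtain y p where d: "diagonalizes n \<rho> y p" using hermitian_diagonalizes[OF c(1,3)] .
  have "complex_of_real (\<Sum>i<n. p i) = 1" using c diagonalizes_trace[OF d] by simp
  then have "(\<Sum>i<n. p i) = 1" using of_real_eq_1_iff by blast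
  then show thesis using that[OF d] positive_diagonalizes[OF d] c by simp
qed

lemma diagonalizes_density:
  assumes "diagonalizes n \<rho> y p" "\<And>i. i < n \<Longrightarrow> 0 \<le> p i" "(\<Sum>i<n. p i) = 1"
  shows "density_mat n \<rho>"
  using assms positive_diagonalizes[OF assms(1)] diagonalizes_trace[OF assms(1)]
  by (simp add: density_mat_def diagonalizes_def)

lemma density_dim_pos: "density_mat n \<rho> \<Longrightarrow> 0 < n"
  by (rule ccontr) (auto simp: density_mat_def mtrace_def)

section \<open>The operator norm as a bound on quadratic forms\<close>

lemma vnorm_nrm: "v \<in> carrier_vec n \<Longrightarrow> vnorm v = nrm {..<n} (\<lambda>a. v $ a)"
  by (auto simp: vnorm_def nrm_def L2_set_def)

lemma vnorm_mult:
  assumes "X \<in> carrier_mat n n" "v \<in> carrier_vec n"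
  shows "vnorm (X *\<^sub>v v) = nrm {..<n} (ap {..<n} (ent X) (\<lambda>a. v $ a))"
proof -
  have "vnorm (X *\<^sub>v v) = nrm {..<n} (\<lambda>a. (X *\<^sub>v v) $ a)" using assms by (intro vnorm_nrm) auto
  also have "\<dots> = nrm {..<n} (ap {..<n} (ent X) (\<lambda>a. v $ a))"
    using assms by (intro nrm_cong) (auto simp: ap_def scalar_prod_def atLeast0LessThan)
  finally show ?thesis .
qed

lemma bil_op_norm:
  assumes X: "X \<in> carrier_mat n n"
  shows "cmod (bil {..<n} (ent X) v v) \<le> op_norm X * (nrm {..<n} v)\<^sup>2"
proof -
  let ?A = "{..<n}"
  define S where "S = {vnorm (X *\<^sub>v v) | v. v \<in> carrier_vec (dim_col X) \<and> vnorm v = 1}"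
  \<comment> \<open>A crude bound by the sum of all entries. It only serves to show that the set is
    bounded above, without which its supremum says nothing.\<close>
  define C where "C = (\<Sum>a<n. \<Sum>b<n. cmod (X $$ (a,b)))"
  have "vnorm (X *\<^sub>v v) \<le> C" if v: "v \<in> carrier_vec n" "vnorm v = 1" for v
  proof -
    have le1: "cmod (v $ b) \<le> 1" if "b < n" for b
    proof -
      have "cmod (v $ b) \<le> nrm ?A (\<lambda>a. v $ a)"
        unfolding nrm_def using that by (intro member_le_L2_set) auto
      then show ?thesis using v vnorm_nrm[OF v(1)] by simp
    qed
    have "vnorm (X *\<^sub>v v) \<le> (\<Sum>a<n. cmod (ap ?A (ent X) (\<lambda>a. v $ a) a))"
      unfolding vnorm_mult[OF X v(1)] nrm_def by (rule L2_set_le_sum) simp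
    also have "\<dots> \<le> C"
      unfolding C_def
    proof (intro sum_mono)
      fix a assume a: "a \<in> ?A"
      have "cmod (ap ?A (ent X) (\<lambda>a. v $ a) a) \<le> (\<Sum>b<n. cmod (X $$ (a,b) * v $ b))"
        using a by (simp add: ap_def norm_sum)
      also have "\<dots> \<le> (\<Sum>b<n. cmod (X $$ (a,b)))"
        using le1 by (intro sum_mono) (auto simp: norm_mult intro!: mult_left_le)
      finally show "cmod (ap ?A (ent X) (\<lambda>a. v $ a) a) \<le> (\<Sum>b<n. cmod (X $$ (a,b)))" .
    qed
    finally show ?thesis .
  qed
  then have bdd: "bdd_above S" unfolding S_def bdd_above_def using X by (intro exI[of _ C]) auto
  show ?thesis
  proof (cases "nrm ?A v = 0")
    case True
    have "cmod (bil ?A (ent X) v v) \<le> nrm ?A v * nrm ?A (ap ?A (ent X) v)"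
      unfolding bil_def by (rule cauchy_schwarz)
    then show ?thesis using True by simp
  next
    case False
    define w where "w = vec n (\<lambda>a. of_real (1 / nrm ?A v) * v a)"
    have wc: "w \<in> carrier_vec n" by (simp add: w_def)
    have nw: "nrm ?A (\<lambda>a. w $ a) = nrm ?A (\<lambda>a. of_real (1 / nrm ?A v) * v a)"
      by (rule nrm_cong) (simp add: w_def)
    have "vnorm w = 1" unfolding vnorm_nrm[OF wc] nw nrm_scale norm_of_real using False by simp
    then have "vnorm (X *\<^sub>v w) \<in> S" using X wc by (auto simp: S_def)
    then have "vnorm (X *\<^sub>v w) \<le> op_norm X" unfolding op_norm_def S_def[symmetric] by (rule cSup_upper[OF _ bdd])
    moreover have "vnorm (X *\<^sub>v w) = nrm ?A (\<lambda>a. of_real (1 / nrm ?A v) * ap ?A (ent X) v a)"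
      unfolding vnorm_mult[OF X wc]
      by (rule nrm_cong) (simp add: ap_def w_def sum_distrib_left sum_divide_distrib)
    ultimately have "nrm ?A (ap ?A (ent X) v) / nrm ?A v \<le> op_norm X"
      by (simp only: nrm_scale norm_of_real) (simp add: False)
    then have *: "nrm ?A (ap ?A (ent X) v) \<le> op_norm X * nrm ?A v"
      using False nrm_nonneg[of ?A v] by (simp add: field_simps)
    have "cmod (bil ?A (ent X) v v) \<le> nrm ?A v * nrm ?A (ap ?A (ent X) v)"
      unfolding bil_def by (rule cauchy_schwarz)
    also have "\<dots> \<le> nrm ?A v * (op_norm X * nrm ?A v)"
      using * by (intro mult_left_mono) auto
    finally show ?thesis by (simp add: power2_eq_square mult_ac)
  qed
qed

lemma op_norm_diag:
  assumes "0 < n" "\<And>i. i < n \<Longrightarrow> \<bar>f i\<bar> \<le> c"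
  shows "\<bar>op_norm (mat n n (\<lambda>(i,j). if i = j then complex_of_real (f i) else 0))\<bar> \<le> c"
proof -
  let ?A = "{..<n}"
  define X where "X = mat n n (\<lambda>(i,j). if i = j then complex_of_real (f i) else 0)"
  have X: "X \<in> carrier_mat n n" by (simp add: X_def)
  define S where "S = {vnorm (X *\<^sub>v v) | v. v \<in> carrier_vec (dim_col X) \<and> vnorm v = 1}"
  have c0: "0 \<le> c" using assms by force
  have le: "vnorm (X *\<^sub>v v) \<le> c" if v: "v \<in> carrier_vec n" "vnorm v = 1" for v
  proof -
    have "vnorm (X *\<^sub>v v) = nrm ?A (\<lambda>a. of_real (f a) * v $ a)"
      unfolding vnorm_mult[OF X v(1)]
    proof (rule nrm_cong)
      fix a assume a: "a \<in> ?A"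
      then have "ap ?A (ent X) (\<lambda>a. v $ a) a = (\<Sum>b<n. (if a = b then of_real (f a) else 0) * v $ b)"
        by (simp add: ap_def X_def)
      also have "\<dots> = (\<Sum>b<n. if a = b then of_real (f a) * v $ b else 0)"
        by (intro sum.cong) auto
      finally show "ap ?A (ent X) (\<lambda>a. v $ a) a = of_real (f a) * v $ a" using a by simp
    qed
    also have "\<dots> \<le> L2_set (\<lambda>a. c * cmod (v $ a)) ?A"
      unfolding nrm_def using assms(2) by (intro L2_set_mono) (auto simp: norm_mult intro!: mult_right_mono)
    also have "\<dots> = c * nrm ?A (\<lambda>a. v $ a)" using c0 by (simp add: nrm_def L2_set_right_distrib)
    also have "\<dots> = c" using v vnorm_nrm[OF v(1)] by simp
    finally show ?thesis .
  qed
  \<comment> \<open>A unit basis vector makes the set under the supremum nonempty; this is where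
    \<open>0 < n\<close> enters.\<close>
  define w where "w = vec n (\<lambda>a. if a = 0 then 1 else 0 :: complex)"
  have "vnorm w = 1"
  proof -
    have "(\<Sum>i<n. (cmod (w $ i))\<^sup>2) = (\<Sum>i<n. if i = 0 then 1 else 0)"
      by (intro sum.cong) (auto simp: w_def)
    then show ?thesis using assms(1) by (simp add: vnorm_def w_def)
  qed
  then have inS: "vnorm (X *\<^sub>v w) \<in> S" using X by (auto simp: S_def w_def)
  have leS: "s \<le> c" if "s \<in> S" for s using that le X by (auto simp: S_def)
  have "op_norm X \<le> c" unfolding op_norm_def S_def[symmetric] using inS leS by (intro cSup_least) auto
  moreover have "0 \<le> vnorm (X *\<^sub>v w)" by (simp add: vnorm_def sum_nonneg)
  moreover have "vnorm (X *\<^sub>v w) \<le> op_norm X"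
    unfolding op_norm_def S_def[symmetric] by (rule cSup_upper[OF inS]) (use leS in \<open>auto simp: bdd_above_def\<close>)
  ultimately show ?thesis by (simp add: X_def)
qed

section \<open>Arithmetic of product indices\<close>

lemma sum_mult_index:
  fixes g :: "nat \<Rightarrow> 'a::comm_monoid_add"
  shows "(\<Sum>a<m * n. g a) = (\<Sum>i<m. \<Sum>j<n. g (i * n + j))"
proof (induction m)
  case (Suc m)
  have *: "{..<Suc m * n} = {..<m * n} \<union> {m * n..<m * n + n}" by auto
  have "(\<Sum>a<Suc m * n. g a) = (\<Sum>a<m * n. g a) + (\<Sum>a\<in>{m * n..<m * n + n}. g a)"
    unfolding * by (rule sum.union_disjoint) auto
  also have "(\<Sum>a\<in>{m * n..<m * n + n}. g a) = (\<Sum>j<n. g (m * n + j))"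
    using sum.shift_bounds_nat_ivl[of g 0 "m * n" n] by (simp add: atLeast0LessThan add.commute)
  finally show ?case using Suc by simp
qed simp

lemma index_less: "i < m \<Longrightarrow> j < n \<Longrightarrow> i * n + j < m * (n::nat)"
  using mult_le_mono1[of "Suc i" m n] by simp

lemma index_div: "a < m * n \<Longrightarrow> a div n < (m::nat)"
  by (simp add: less_mult_imp_div_less)

lemma index_mod: "a < m * n \<Longrightarrow> a mod n < (n::nat)"
  by (cases n) auto

lemma div_mod_eq_iff: "a div n = b div n \<and> a mod n = b mod n \<longleftrightarrow> a = (b::nat)"
  by (metis div_mult_mod_eq)

subsection \<open>Kronecker products\<close>

lemma kron_dim [simp]: "dim_row (kron A B) = dim_row A * dim_row B"
  "dim_col (kron A B) = dim_col A * dim_col B"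
  by (auto simp: kron_def)

lemma kron_carrier [simp]:
  "A \<in> carrier_mat m n \<Longrightarrow> B \<in> carrier_mat k l \<Longrightarrow> kron A B \<in> carrier_mat (m * k) (n * l)"
  by (auto simp: kron_def)

lemma kron_index:
  assumes "A \<in> carrier_mat m n" "B \<in> carrier_mat k l" "i < m * k" "j < n * l"
  shows "kron A B $$ (i,j) = A $$ (i div k, j div l) * B $$ (i mod k, j mod l)"
  using assms by (simp add: kron_def)

lemma kron_mult:
  assumes "A \<in> carrier_mat m n" "B \<in> carrier_mat k l" "C \<in> carrier_mat n r" "D \<in> carrier_mat l s"
  shows "kron A B * kron C D = kron (A * C) (B * D)"
proof (rule eq_matI)
  fix i j assume "i < dim_row (kron (A * C) (B * D))" "j < dim_col (kron (A * C) (B * D))"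
  then have ij: "i < m * k" "j < r * s" using assms by auto
  have AB: "kron A B \<in> carrier_mat (m * k) (n * l)" and CD: "kron C D \<in> carrier_mat (n * l) (r * s)"
    and AC: "A * C \<in> carrier_mat m r" and BD: "B * D \<in> carrier_mat k s"
    using assms by auto
  have "(kron A B * kron C D) $$ (i,j) = (\<Sum>a<n * l. kron A B $$ (i,a) * kron C D $$ (a,j))"
    by (rule mult_index_sum[OF AB CD ij])
  also have "\<dots> = (\<Sum>a<n * l. (A $$ (i div k, a div l) * B $$ (i mod k, a mod l)) *
        (C $$ (a div l, j div s) * D $$ (a mod l, j mod s)))"
    using kron_index[OF assms(1,2) ij(1)] kron_index[OF assms(3,4) _ ij(2)] by simp
  also have "\<dots> = (\<Sum>p<n. \<Sum>q<l. (A $$ (i div k, p) * C $$ (p, j div s)) * (B $$ (i mod k, q) * D $$ (q, j mod s)))"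
    unfolding sum_mult_index by (intro sum.cong refl) (simp add: mult_ac)
  also have "\<dots> = (A * C) $$ (i div k, j div s) * (B * D) $$ (i mod k, j mod s)"
    using mult_index_sum[OF assms(1,3) index_div[OF ij(1)] index_div[OF ij(2)]]
      mult_index_sum[OF assms(2,4) index_mod[OF ij(1)] index_mod[OF ij(2)]]
    by (simp add: sum_product)
  also have "\<dots> = kron (A * C) (B * D) $$ (i,j)"
    by (rule kron_index[OF AC BD ij, symmetric])
  finally show "(kron A B * kron C D) $$ (i,j) = kron (A * C) (B * D) $$ (i,j)" .
qed (use assms in auto)

lemma kron_assoc: "kron (kron A B) C = kron A (kron B C)"
proof (rule eq_matI)
  fix i j assume ij: "i < dim_row (kron A (kron B C))" "j < dim_col (kron A (kron B C))"
  let ?k = "dim_row B" and ?l = "dim_col B" and ?r = "dim_row C" and ?s = "dim_col C"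
  have "i < (dim_row A * ?k) * ?r" "j < (dim_col A * ?l) * ?s"
    using ij by (auto simp: mult.assoc)
  moreover have "i div ?r < dim_row A * ?k" "j div ?s < dim_col A * ?l"
    using calculation index_div by blast+
  moreover have "i mod (?k * ?r) < ?k * ?r" "j mod (?l * ?s) < ?l * ?s"
    using ij index_mod by auto
  moreover have "i div r div k = i div (k * r)" "i div r mod k = i mod (k * r) div r"
    "i mod r = i mod (k * r) mod r" for i k r :: nat
    by (cases "r = 0", simp, simp add: div_mult2_eq mod_mult2_eq mult.commute[of k])+
  ultimately show "kron (kron A B) C $$ (i,j) = kron A (kron B C) $$ (i,j)"
    using ij by (simp add: kron_def)
qed (auto simp: mult.assoc)

lemma kron_one: "kron (1\<^sub>m m) (1\<^sub>m n) = 1\<^sub>m (m * n)"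
proof (rule eq_matI)
  fix i j assume "i < dim_row (1\<^sub>m (m * n))" "j < dim_col (1\<^sub>m (m * n))"
  then have ij: "i < m * n" "j < m * n" by auto
  then have "kron (1\<^sub>m m) (1\<^sub>m n) $$ (i,j) = of_bool (i div n = j div n) * of_bool (i mod n = j mod n)"
    using kron_index[OF one_carrier_mat one_carrier_mat ij] index_div[of i m n] index_div[of j m n]
      index_mod[of i m n] index_mod[of j m n] by simp
  also have "\<dots> = 1\<^sub>m (m * n) $$ (i,j)" using div_mod_eq_iff[of i n j] ij by auto
  finally show "kron (1\<^sub>m m) (1\<^sub>m n) $$ (i,j) = 1\<^sub>m (m * n) $$ (i,j)" .
qed auto

lemma kron_one_right: "kron A (1\<^sub>m 1) = A"
  by (rule eq_matI) (auto simp: kron_def)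

lemma adj_kron: "adj (kron A B) = kron (adj A) (adj B)"
  by (rule eq_matI) (auto simp: kron_def adj_def index_div index_mod)

lemma adj_mult:
  assumes "A \<in> carrier_mat n m" "B \<in> carrier_mat m l"
  shows "adj (A * B) = adj B * adj A"
proof (rule eq_matI)
  fix i j assume "i < dim_row (adj B * adj A)" "j < dim_col (adj B * adj A)"
  then have ij: "i < l" "j < n" using assms by auto
  have "adj (A * B) $$ (i,j) = cnj (\<Sum>k<m. A $$ (j,k) * B $$ (k,i))"
    using assms ij mult_index_sum[OF assms ij(2,1)] by (subst adj_index) auto
  also have "\<dots> = (\<Sum>k<m. adj B $$ (i,k) * adj A $$ (k,j))"
    using assms ij by (simp add: adj_def mult.commute)
  also have "\<dots> = (adj B * adj A) $$ (i,j)"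
    using assms ij by (intro mult_index_sum[symmetric]) auto
  finally show "adj (A * B) $$ (i,j) = (adj B * adj A) $$ (i,j)" .
qed (use assms in auto)

lemma adj_adj [simp]: "adj (adj A) = A"
  by (rule eq_matI) (auto simp: adj_def)

lemma adj_one [simp]: "adj (1\<^sub>m n) = 1\<^sub>m n"
  by (rule eq_matI) (auto simp: adj_def)

lemma adj_minus: "A \<in> carrier_mat n m \<Longrightarrow> B \<in> carrier_mat n m \<Longrightarrow> adj (A - B) = adj A - adj B"
  by (rule eq_matI) (auto simp: adj_def)

section \<open>Unitary matrices, traces and bases of tensor products\<close>

lemma unitary_right:
  assumes "unitary_mat m U"
  shows "U * adj U = 1\<^sub>m m"
  using assms mat_mult_left_right_inverse[of "adj U" m U] by (simp add: unitary_mat_def)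

lemma unitary_adj: "unitary_mat m U \<Longrightarrow> unitary_mat m (adj U)"
  using unitary_right by (simp add: unitary_mat_def)

lemma unitary_mult:
  assumes "unitary_mat m U" "unitary_mat m V"
  shows "unitary_mat m (U * V)"
proof -
  have c: "U \<in> carrier_mat m m" "V \<in> carrier_mat m m" "adj U \<in> carrier_mat m m" "adj V \<in> carrier_mat m m"
    using assms by (auto simp: unitary_mat_def)
  have "adj (U * V) * (U * V) = adj V * ((adj U * U) * V)"
    unfolding adj_mult[OF c(1,2)] using c by (simp add: assoc_mult_mat[of _ m m _ m _ m])
  also have "\<dots> = 1\<^sub>m m" using assms c by (simp add: unitary_mat_def)
  finally show ?thesis using c by (simp add: unitary_mat_def)
qed

lemma unitary_kron:
  assumes "unitary_mat m U" "unitary_mat n V"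
  shows "unitary_mat (m * n) (kron U V)"
proof -
  have c: "U \<in> carrier_mat m m" "V \<in> carrier_mat n n" "adj U \<in> carrier_mat m m" "adj V \<in> carrier_mat n n"
    using assms by (auto simp: unitary_mat_def)
  show ?thesis
    using assms c kron_mult[OF c(3,4,1,2)] by (simp add: unitary_mat_def adj_kron kron_one)
qed

lemma unitary_one: "unitary_mat n (1\<^sub>m n)"
  by (simp add: unitary_mat_def)

lemma mtrace_kron:
  assumes "A \<in> carrier_mat m m" "B \<in> carrier_mat n n"
  shows "mtrace (kron A B) = mtrace A * mtrace B"
proof -
  have "mtrace (kron A B) = (\<Sum>a<m * n. A $$ (a div n, a div n) * B $$ (a mod n, a mod n))"
    using assms by (simp add: mtrace_def kron_index[OF assms])
  also have "\<dots> = (\<Sum>i<m. \<Sum>j<n. A $$ (i,i) * B $$ (j,j))"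
    unfolding sum_mult_index by (intro sum.cong refl) simp
  finally show ?thesis using assms by (simp add: mtrace_def sum_product)
qed

lemma mtrace_add: "A \<in> carrier_mat n n \<Longrightarrow> B \<in> carrier_mat n n \<Longrightarrow> mtrace (A + B) = mtrace A + mtrace B"
  by (simp add: mtrace_def sum.distrib)

lemma mtrace_mult_trp:
  assumes "X \<in> carrier_mat n n" "M \<in> carrier_mat n n"
  shows "mtrace (X * M) = trp {..<n} (ent X) (ent M)"
  using assms mult_index_sum[OF assms] by (simp add: mtrace_def trp_def del: index_mult_mat(1))

lemma mtrace_comm:
  assumes "A \<in> carrier_mat n m" "B \<in> carrier_mat m n"
  shows "mtrace (A * B) = mtrace (B * A)"
proof -
  have "mtrace (A * B) = (\<Sum>i<n. \<Sum>k<m. A $$ (i,k) * B $$ (k,i))"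
    using assms mult_index_sum[OF assms] by (simp add: mtrace_def del: index_mult_mat(1))
  also have "\<dots> = (\<Sum>k<m. \<Sum>i<n. B $$ (k,i) * A $$ (i,k))"
    by (subst sum.swap) (simp add: mult.commute)
  also have "\<dots> = mtrace (B * A)"
    using assms mult_index_sum[OF assms(2,1)] by (simp add: mtrace_def del: index_mult_mat(1))
  finally show ?thesis .
qed

lemma onb_kron:
  fixes m n :: nat
  assumes y: "onb {..<m} {..<m} y" and z: "onb {..<n} {..<n} z"
  shows "onb {..<m * n} {..<m * n} (\<lambda>i a. y (i div n) (a div n) * z (i mod n) (a mod n))"
    (is "onb _ _ ?w")
  unfolding onb_def
proof (intro conjI ballI)
  fix k l assume "k \<in> {..<m * n}" "l \<in> {..<m * n}"
  then have kl: "k < m * n" "l < m * n" by auto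
  have "ip {..<m * n} (?w k) (?w l) = (\<Sum>a<m * n. cnj (?w k a) * ?w l a)"
    by (simp add: ip_def)
  also have "\<dots> = (\<Sum>i<m. \<Sum>j<n. (cnj (y (k div n) i) * y (l div n) i) *
      (cnj (z (k mod n) j) * z (l mod n) j))"
    by (subst sum_mult_index, intro sum.cong refl) (simp add: mult_ac)
  also have "\<dots> = ip {..<m} (y (k div n)) (y (l div n)) * ip {..<n} (z (k mod n)) (z (l mod n))"
    by (simp add: ip_def sum_product)
  also have "\<dots> = of_bool (k = l)"
    using y z index_div[OF kl(1)] index_div[OF kl(2)] index_mod[OF kl(1)] index_mod[OF kl(2)]
      div_mod_eq_iff[of k n l] by (auto simp: onb_def)
  finally show "ip {..<m * n} (?w k) (?w l) = of_bool (k = l)" .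
next
  fix a b assume "a \<in> {..<m * n}" "b \<in> {..<m * n}"
  then have ab: "a < m * n" "b < m * n" by auto
  have "(\<Sum>k<m * n. ?w k a * cnj (?w k b)) = (\<Sum>i<m. \<Sum>j<n. (y i (a div n) * cnj (y i (b div n))) *
      (z j (a mod n) * cnj (z j (b mod n))))"
    unfolding sum_mult_index by (intro sum.cong refl) (simp add: mult_ac)
  also have "\<dots> = (\<Sum>i<m. y i (a div n) * cnj (y i (b div n))) * (\<Sum>j<n. z j (a mod n) * cnj (z j (b mod n)))"
    by (simp add: sum_product)
  also have "\<dots> = of_bool (a = b)"
    using y z index_div[OF ab(1)] index_div[OF ab(2)] index_mod[OF ab(1)] index_mod[OF ab(2)]
      div_mod_eq_iff[of a n b] by (auto simp: onb_def)
  finally show "(\<Sum>k<m * n. ?w k a * cnj (?w k b)) = of_bool (a = b)" .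
qed

lemma diagonalizes_kron:
  assumes A: "diagonalizes m A y e" and B: "diagonalizes n B z f"
  shows "diagonalizes (m * n) (kron A B) (\<lambda>i a. y (i div n) (a div n) * z (i mod n) (a mod n))
    (\<lambda>i. e (i div n) * f (i mod n))"
  unfolding diagonalizes_def
proof (intro conjI allI impI)
  have c: "A \<in> carrier_mat m m" "B \<in> carrier_mat n n" using A B by (auto simp: diagonalizes_def)
  then show "kron A B \<in> carrier_mat (m * n) (m * n)" by simp
  show "onb {..<m * n} {..<m * n} (\<lambda>i a. y (i div n) (a div n) * z (i mod n) (a mod n))"
    using A B by (intro onb_kron) (auto simp: diagonalizes_def)
  fix a b assume ab: "a < m * n" "b < m * n"
  have "kron A B $$ (a,b) = A $$ (a div n, b div n) * B $$ (a mod n, b mod n)"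
    by (rule kron_index[OF c ab])
  also have "\<dots> = (\<Sum>i<m. of_real (e i) * y i (a div n) * cnj (y i (b div n))) *
      (\<Sum>j<n. of_real (f j) * z j (a mod n) * cnj (z j (b mod n)))"
    using A B index_div[OF ab(1)] index_div[OF ab(2)] index_mod[OF ab(1)] index_mod[OF ab(2)]
    by (simp add: diagonalizes_def)
  also have "\<dots> = (\<Sum>i<m. \<Sum>j<n. (of_real (e i) * y i (a div n) * cnj (y i (b div n))) *
      (of_real (f j) * z j (a mod n) * cnj (z j (b mod n))))"
    by (rule sum_product)
  also have "\<dots> = (\<Sum>k<m * n. of_real (e (k div n) * f (k mod n)) * (y (k div n) (a div n) * z (k mod n) (a mod n)) *
       cnj (y (k div n) (b div n) * z (k mod n) (b mod n)))"
    unfolding sum_mult_index by (intro sum.cong refl) (simp add: mult_ac)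
  finally show "kron A B $$ (a,b) = (\<Sum>k<m * n. of_real (e (k div n) * f (k mod n)) *
      (y (k div n) (a div n) * z (k mod n) (a mod n)) *
       cnj (y (k div n) (b div n) * z (k mod n) (b mod n)))" .
qed

subsection \<open>Tensor powers\<close>

text \<open>An index below \<open>d ^ n\<close> is read as \<open>n\<close> digits in base
  \<open>d\<close>, the last copy being the lowest digit, as in
  \<open>kron (tpow A n) A\<close>.\<close>

primrec tvec :: "nat \<Rightarrow> (nat \<Rightarrow> nat \<Rightarrow> complex) \<Rightarrow> nat \<Rightarrow> nat \<Rightarrow> nat \<Rightarrow> complex" where
  "tvec d y 0 i a = 1"
| "tvec d y (Suc n) i a = tvec d y n (i div d) (a div d) * y (i mod d) (a mod d)"

text \<open>The weight of a digit string for independent digits of law \<open>p\<close>: the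
  eigenvalues of a tensor power form a classical product distribution, on which \<open>tsum\<close>
  is a sum of independent variables.\<close>

primrec tprod :: "nat \<Rightarrow> (nat \<Rightarrow> real) \<Rightarrow> nat \<Rightarrow> nat \<Rightarrow> real" where
  "tprod d p 0 i = 1"
| "tprod d p (Suc n) i = tprod d p n (i div d) * p (i mod d)"

primrec tsum :: "nat \<Rightarrow> (nat \<Rightarrow> real) \<Rightarrow> nat \<Rightarrow> nat \<Rightarrow> real" where
  "tsum d f 0 i = 0"
| "tsum d f (Suc n) i = tsum d f n (i div d) + f (i mod d)"

lemma tpow_carrier [simp]: "A \<in> carrier_mat d d \<Longrightarrow> tpow A n \<in> carrier_mat (d ^ n) (d ^ n)"
proof (induction n)
  case (Suc n)
  then show ?case using kron_carrier[of "tpow A n" "d ^ n" "d ^ n" A d d] by (simp add: mult.commute)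
qed simp

lemma diagonalizes_tpow:
  assumes "diagonalizes d A y e"
  shows "diagonalizes (d ^ n) (tpow A n) (tvec d y n) (tprod d e n)"
proof (induction n)
  case 0
  show ?case by (simp add: diagonalizes_def onb_def ip_def lessThan_Suc)
next
  case (Suc n)
  have "tvec d y (Suc n) = (\<lambda>i a. tvec d y n (i div d) (a div d) * y (i mod d) (a mod d))"
    "tprod d e (Suc n) = (\<lambda>i. tprod d e n (i div d) * e (i mod d))"
    by (simp_all add: fun_eq_iff)
  then show ?case using diagonalizes_kron[OF Suc assms] by (simp add: mult.commute)
qed

lemma tpow_mult:
  assumes "A \<in> carrier_mat d d" "B \<in> carrier_mat d d"
  shows "tpow (A * B) n = tpow A n * tpow B n"
proof (induction n)
  case (Suc n)
  have "tpow (A * B) (Suc n) = kron (tpow A n * tpow B n) (A * B)" using Suc by simp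
  also have "\<dots> = kron (tpow A n) A * kron (tpow B n) B"
    by (rule kron_mult[OF tpow_carrier[OF assms(1)] assms(1) tpow_carrier[OF assms(2)] assms(2), symmetric])
  finally show ?case by simp
qed simp

lemma tpow_adj: "tpow (adj A) n = adj (tpow A n)"
  by (induction n) (simp_all add: adj_kron)

lemma tpow_unitary: "unitary_mat d U \<Longrightarrow> unitary_mat (d ^ n) (tpow U n)"
proof (induction n)
  case (Suc n)
  then show ?case using unitary_kron[of "d ^ n" "tpow U n" d U] by (simp add: mult.commute)
qed (simp add: unitary_one)

lemma tprod_nonneg: "(\<And>i. i < d \<Longrightarrow> 0 \<le> p i) \<Longrightarrow> i < d ^ n \<Longrightarrow> 0 \<le> tprod d p n i"
proof (induction n arbitrary: i)
  case (Suc n)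
  then have "i < d ^ n * d" by (simp add: mult.commute)
  then show ?case using Suc index_div[of i "d ^ n" d] index_mod[of i "d ^ n" d] by simp
qed simp

lemma sum_power_Suc:
  fixes g :: "nat \<Rightarrow> 'a::comm_monoid_add"
  shows "(\<Sum>a<d ^ Suc n. g a) = (\<Sum>i<d ^ n. \<Sum>j<d. g (i * d + j))"
  using sum_mult_index[of g "d ^ n" d] by (simp add: mult.commute)

lemma tprod_sum: "(\<Sum>i<d. p i) = 1 \<Longrightarrow> (\<Sum>i<d ^ n. tprod d p n i) = 1"
proof (induction n)
  case (Suc n)
  have "(\<Sum>i<d ^ Suc n. tprod d p (Suc n) i) = (\<Sum>i<d ^ n. \<Sum>j<d. tprod d p n i * p j)"
    unfolding sum_power_Suc by (intro sum.cong refl) simp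
  also have "\<dots> = (\<Sum>i<d ^ n. tprod d p n i) * (\<Sum>j<d. p j)" by (simp add: sum_product)
  finally show ?case using Suc by simp
qed (simp add: lessThan_Suc)

text \<open>Both moments are proved in one induction: adding a digit creates a cross term in the
  second moment, which the vanishing first moment removes.\<close>

lemma tprod_variance:
  fixes p f :: "nat \<Rightarrow> real"
  assumes p: "(\<Sum>i<d. p i) = 1" and \<mu>: "\<mu> = (\<Sum>i<d. p i * f i)"
  defines "V \<equiv> \<Sum>i<d. p i * (f i - \<mu>)\<^sup>2"
  shows "(\<Sum>i<d ^ n. tprod d p n i * (tsum d f n i - real n * \<mu>)) = 0 \<and>
    (\<Sum>i<d ^ n. tprod d p n i * (tsum d f n i - real n * \<mu>)\<^sup>2) = real n * V"
proof (induction n)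
  case (Suc n)
  let ?P = "tprod d p n" and ?S = "\<lambda>i. tsum d f n i - real n * \<mu>" and ?g = "\<lambda>j. f j - \<mu>"
  have g0: "(\<Sum>j<d. p j * ?g j) = 0"
  proof -
    have "(\<Sum>j<d. p j * ?g j) = (\<Sum>j<d. p j * f j) - (\<Sum>j<d. p j) * \<mu>"
      by (simp add: right_diff_distrib sum_subtractf sum_distrib_right)
    then show ?thesis using p \<mu> by simp
  qed
  have P1: "(\<Sum>i<d ^ n. ?P i) = 1" by (rule tprod_sum[OF p])
  have S0: "(\<Sum>i<d ^ n. ?P i * ?S i) = 0" and S2: "(\<Sum>i<d ^ n. ?P i * (?S i)\<^sup>2) = real n * V"
    using Suc by auto
  have "(\<Sum>i<d ^ Suc n. tprod d p (Suc n) i * (tsum d f (Suc n) i - real (Suc n) * \<mu>))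
      = (\<Sum>i<d ^ n. \<Sum>j<d. (?P i * ?S i) * p j + ?P i * (p j * ?g j))"
    unfolding sum_power_Suc by (intro sum.cong refl) (simp add: algebra_simps)
  also have "\<dots> = (\<Sum>i<d ^ n. ?P i * ?S i) * (\<Sum>j<d. p j) + (\<Sum>i<d ^ n. ?P i) * (\<Sum>j<d. p j * ?g j)"
    by (simp add: sum.distrib sum_product)
  finally have 1: "(\<Sum>i<d ^ Suc n. tprod d p (Suc n) i * (tsum d f (Suc n) i - real (Suc n) * \<mu>)) = 0"
    using S0 g0 by simp
  have "(\<Sum>i<d ^ Suc n. tprod d p (Suc n) i * (tsum d f (Suc n) i - real (Suc n) * \<mu>)\<^sup>2)
      = (\<Sum>i<d ^ n. \<Sum>j<d. (?P i * (?S i)\<^sup>2) * p j + (?P i * ?S i) * (2 * (p j * ?g j)) + ?P i * (p j * (?g j)\<^sup>2))"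
    unfolding sum_power_Suc by (intro sum.cong refl) (simp add: algebra_simps power2_eq_square)
  also have "\<dots> = (\<Sum>i<d ^ n. ?P i * (?S i)\<^sup>2) * (\<Sum>j<d. p j)
      + (\<Sum>i<d ^ n. ?P i * ?S i) * (\<Sum>j<d. 2 * (p j * ?g j)) + (\<Sum>i<d ^ n. ?P i) * (\<Sum>j<d. p j * (?g j)\<^sup>2)"
    by (simp add: sum.distrib sum_product)
  finally have 2: "(\<Sum>i<d ^ Suc n. tprod d p (Suc n) i * (tsum d f (Suc n) i - real (Suc n) * \<mu>)\<^sup>2)
      = real (Suc n) * V"
    using S0 S2 P1 p by (simp add: V_def algebra_simps)
  show ?case using 1 2 by simp
qed (simp add: lessThan_Suc)

lemma tprod_chebyshev:
  fixes p f :: "nat \<Rightarrow> real"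
  assumes p: "\<And>i. i < d \<Longrightarrow> 0 \<le> p i" "(\<Sum>i<d. p i) = 1" and \<mu>: "(\<Sum>i<d. p i * f i) = \<mu>"
    and \<delta>: "0 < \<delta>"
  shows "(\<Sum>i\<in>{i\<in>{..<d ^ n}. \<delta> < \<bar>tsum d f n i - real n * \<mu>\<bar>}. tprod d p n i)
    \<le> real n * (\<Sum>i<d. p i * (f i - \<mu>)\<^sup>2) / \<delta>\<^sup>2"
proof -
  let ?S = "{i\<in>{..<d ^ n}. \<delta> < \<bar>tsum d f n i - real n * \<mu>\<bar>}"
  have P: "0 \<le> tprod d p n i" if "i < d ^ n" for i by (rule tprod_nonneg[OF _ that]) (rule p(1))
  have "(\<Sum>i\<in>?S. tprod d p n i) * \<delta>\<^sup>2 \<le> (\<Sum>i\<in>?S. tprod d p n i * (tsum d f n i - real n * \<mu>)\<^sup>2)"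
    unfolding sum_distrib_right
    using P \<delta> by (intro sum_mono mult_left_mono) (auto simp: abs_le_square_iff[symmetric])
  also have "\<dots> \<le> (\<Sum>i<d ^ n. tprod d p n i * (tsum d f n i - real n * \<mu>)\<^sup>2)"
    using P by (intro sum_mono2) auto
  also have "\<dots> = real n * (\<Sum>i<d. p i * (f i - \<mu>)\<^sup>2)"
    using tprod_variance[OF p(2) \<mu>[symmetric]] by simp
  finally show ?thesis using \<delta> by (simp add: field_simps)
qed

text \<open>Positivity of the product excludes digits of weight zero; there \<open>ln 0 = 0\<close>
  would make the right-hand side wrong.\<close>

lemma tprod_pos_digit: 
  "0 < tprod d p n i \<Longrightarrow> (\<And>i. i < d \<Longrightarrow> 0 \<le> p i) \<Longrightarrow> i < d ^ n \<Longrightarrow> tprod d p n i = exp (- tsum d (\<lambda>i. - ln (p i)) n i)"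
proof (induction n arbitrary: i)
  case (Suc n)
  then have i: "i < d ^ n * d" by (simp add: mult.commute)
  have "0 \<le> tprod d p n (i div d)" "0 \<le> p (i mod d)"
    using tprod_nonneg[of d p "i div d" n] Suc.prems index_div[OF i] index_mod[OF i] by auto
  then have "0 < tprod d p n (i div d)" "0 < p (i mod d)"
    using Suc.prems(1) by (auto simp: zero_less_mult_iff)
  then show ?case using Suc.IH[of "i div d"] Suc.prems(2) index_div[OF i] by (simp add: exp_add exp_diff exp_minus field_simps)
qed simp

subsection \<open>Charges of several copies\<close>

lemma foldr_add_mat:
  assumes "\<And>i. i \<in> set xs \<Longrightarrow> F i \<in> carrier_mat m n"
  shows "foldr (\<lambda>i acc. F i + acc) xs (0\<^sub>m m n) \<in> carrier_mat m n \<and>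
    (\<forall>a<m. \<forall>b<n. foldr (\<lambda>i acc. F i + acc) xs (0\<^sub>m m n) $$ (a,b) = (\<Sum>i\<leftarrow>xs. F i $$ (a,b)))"
  using assms by (induction xs) auto

lemma copy_charge_term_carrier:
  assumes "L \<in> carrier_mat d d" "i < n"
  shows "kron (kron (1\<^sub>m (d ^ i)) L) (1\<^sub>m (d ^ (n - 1 - i))) \<in> carrier_mat (d ^ n) (d ^ n)"
proof -
  have "n = i + 1 + (n - 1 - i)" using assms by simp
  then have "d ^ i * d * d ^ (n - 1 - i) = d ^ n" by (metis power_add power_one_right)
  then show ?thesis
    using kron_carrier[OF kron_carrier[OF one_carrier_mat assms(1)] one_carrier_mat] by metis
qed

lemma copy_charge_entry:
  assumes "L \<in> carrier_mat d d"
  shows "copy_charge d L n \<in> carrier_mat (d ^ n) (d ^ n)"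
    and "a < d ^ n \<Longrightarrow> b < d ^ n \<Longrightarrow> copy_charge d L n $$ (a,b) =
      (\<Sum>i<n. kron (kron (1\<^sub>m (d ^ i)) L) (1\<^sub>m (d ^ (n - 1 - i))) $$ (a,b))"
proof -
  have *: "i \<in> set [0..<n] \<Longrightarrow> kron (kron (1\<^sub>m (d ^ i)) L) (1\<^sub>m (d ^ (n - 1 - i))) \<in> carrier_mat (d ^ n) (d ^ n)" for i
    using copy_charge_term_carrier[OF assms] by simp
  note F = foldr_add_mat[of "[0..<n]" "\<lambda>i. kron (kron (1\<^sub>m (d ^ i)) L) (1\<^sub>m (d ^ (n - 1 - i)))", OF *]
  show "copy_charge d L n \<in> carrier_mat (d ^ n) (d ^ n)" using F by (simp add: copy_charge_def)
  show "copy_charge d L n $$ (a,b) = (\<Sum>i<n. kron (kron (1\<^sub>m (d ^ i)) L) (1\<^sub>m (d ^ (n - 1 - i))) $$ (a,b))"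
    if "a < d ^ n" "b < d ^ n"
    using F that unfolding copy_charge_def by (simp add: interv_sum_list_conv_sum_set_nat atLeast0LessThan)
qed

lemma copy_charge_0: "L \<in> carrier_mat d d \<Longrightarrow> copy_charge d L 0 = 0\<^sub>m 1 1"
  by (simp add: copy_charge_def)

text \<open>Associativity turns the sum over sites into a recursion on the number of copies. Norm
  bounds, expectations, the diagonal form and the change of basis are all obtained by induction
  along it.\<close>

lemma copy_charge_Suc:
  assumes L: "L \<in> carrier_mat d d"
  shows "copy_charge d L (Suc n) = kron (copy_charge d L n) (1\<^sub>m d) + kron (1\<^sub>m (d ^ n)) L"
proof (rule eq_matI)
  let ?C = "copy_charge d L n"
  have C: "?C \<in> carrier_mat (d ^ n) (d ^ n)" by (rule copy_charge_entry(1)[OF L])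
  have c1: "kron ?C (1\<^sub>m d) \<in> carrier_mat (d ^ n * d) (d ^ n * d)" using C by simp
  have c2: "kron (1\<^sub>m (d ^ n)) L \<in> carrier_mat (d ^ n * d) (d ^ n * d)" using L by simp
  fix a b assume "a < dim_row (kron ?C (1\<^sub>m d) + kron (1\<^sub>m (d ^ n)) L)" "b < dim_col (kron ?C (1\<^sub>m d) + kron (1\<^sub>m (d ^ n)) L)"
  then have ab: "a < d ^ n * d" "b < d ^ n * d" using L by auto
  define F where "F = (\<lambda>n i. kron (kron (1\<^sub>m (d ^ i)) L) (1\<^sub>m (d ^ (n - 1 - i))))"
  have F: "F (Suc n) i $$ (a,b) = F n i $$ (a div d, b div d) * 1\<^sub>m d $$ (a mod d, b mod d)" if "i < n" for i
  proof -
    have "Suc n - 1 - i = Suc (n - 1 - i)" using that by simp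
    then have "F (Suc n) i = kron (F n i) (1\<^sub>m d)"
      unfolding F_def by (simp add: kron_assoc kron_one mult.commute)
    moreover have "F n i \<in> carrier_mat (d ^ n) (d ^ n)"
      unfolding F_def by (rule copy_charge_term_carrier[OF L that])
    ultimately show ?thesis using kron_index[OF _ one_carrier_mat ab] by metis
  qed
  have "copy_charge d L (Suc n) $$ (a,b) = (\<Sum>i<Suc n. F (Suc n) i $$ (a,b))"
    unfolding F_def using ab by (intro copy_charge_entry(2)[OF L]) (auto simp: mult.commute)
  also have "\<dots> = (\<Sum>i<n. F n i $$ (a div d, b div d)) * 1\<^sub>m d $$ (a mod d, b mod d) + F (Suc n) n $$ (a,b)"
    using F by (simp add: sum_distrib_right)
  also have "(\<Sum>i<n. F n i $$ (a div d, b div d)) = ?C $$ (a div d, b div d)"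
    unfolding F_def using copy_charge_entry(2)[OF L index_div[OF ab(1)] index_div[OF ab(2)]] by simp
  also have "?C $$ (a div d, b div d) * 1\<^sub>m d $$ (a mod d, b mod d) = kron ?C (1\<^sub>m d) $$ (a,b)"
    by (rule kron_index[OF C one_carrier_mat ab, symmetric])
  also have "F (Suc n) n = kron (1\<^sub>m (d ^ n)) L" by (simp add: F_def kron_one_right[simplified])
  also have "kron ?C (1\<^sub>m d) $$ (a,b) + kron (1\<^sub>m (d ^ n)) L $$ (a,b) = (kron ?C (1\<^sub>m d) + kron (1\<^sub>m (d ^ n)) L) $$ (a,b)"
    using ab L by (subst index_add_mat(1)) auto
  finally show "copy_charge d L (Suc n) $$ (a,b) = (kron ?C (1\<^sub>m d) + kron (1\<^sub>m (d ^ n)) L) $$ (a,b)" .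
qed (use L copy_charge_entry(1)[OF L, of "Suc n"] in auto)

text \<open>A bound on the numerical radius. It suffices when pairing with Hermitian operators, and
  it adds up directly over sums and tensor factors, which a supremum over unit vectors does
  not.\<close>

definition qbound :: "nat \<Rightarrow> complex mat \<Rightarrow> real \<Rightarrow> bool" where
  "qbound n X c \<longleftrightarrow> (\<forall>v. cmod (bil {..<n} (ent X) v v) \<le> c * (nrm {..<n} v)\<^sup>2)"

lemma nrm_sq_mult_index:
  fixes m n :: nat
  shows "(nrm {..<m * n} v)\<^sup>2 = (\<Sum>i<m. \<Sum>j<n. (cmod (v (i * n + j)))\<^sup>2)"
  by (simp add: nrm_sq sum_mult_index)

lemma bil_kron_one_right:
  assumes A: "A \<in> carrier_mat m m"
  shows "bil {..<m * n} (ent (kron A (1\<^sub>m n))) v v =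
    (\<Sum>j<n. bil {..<m} (ent A) (\<lambda>i. v (i * n + j)) (\<lambda>i. v (i * n + j)))"
proof -
  have "bil {..<m * n} (ent (kron A (1\<^sub>m n))) v v =
      (\<Sum>a<m * n. \<Sum>b<m * n. cnj (v a) * (A $$ (a div n, b div n) * 1\<^sub>m n $$ (a mod n, b mod n)) * v b)"
    unfolding bil_explicit by (intro sum.cong refl) (simp add: kron_index[OF A one_carrier_mat] del: index_one_mat)
  also have "\<dots> = (\<Sum>i<m. \<Sum>j<n. \<Sum>i'<m. \<Sum>j'<n. cnj (v (i * n + j)) *
      (A $$ (i, i') * of_bool (j = j')) * v (i' * n + j'))"
    unfolding sum_mult_index by (intro sum.cong refl) auto
  also have "\<dots> = (\<Sum>i<m. \<Sum>j<n. \<Sum>i'<m. cnj (v (i * n + j)) * A $$ (i, i') * v (i' * n + j))"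
  proof (intro sum.cong refl)
    fix i j i' assume "j \<in> {..<n}"
    have "(\<Sum>j'<n. cnj (v (i * n + j)) * (A $$ (i, i') * of_bool (j = j')) * v (i' * n + j'))
        = (\<Sum>j'<n. if j = j' then cnj (v (i * n + j)) * A $$ (i, i') * v (i' * n + j') else 0)"
      by (intro sum.cong) auto
    then show "(\<Sum>j'<n. cnj (v (i * n + j)) * (A $$ (i, i') * of_bool (j = j')) * v (i' * n + j'))
        = cnj (v (i * n + j)) * A $$ (i, i') * v (i' * n + j)"
      using \<open>j \<in> {..<n}\<close> by simp
  qed
  also have "\<dots> = (\<Sum>j<n. bil {..<m} (ent A) (\<lambda>i. v (i * n + j)) (\<lambda>i. v (i * n + j)))"
    unfolding bil_explicit by (rule sum.swap)
  finally show ?thesis .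
qed

lemma bil_kron_one_left:
  assumes B: "B \<in> carrier_mat n n"
  shows "bil {..<m * n} (ent (kron (1\<^sub>m m) B)) v v =
    (\<Sum>i<m. bil {..<n} (ent B) (\<lambda>j. v (i * n + j)) (\<lambda>j. v (i * n + j)))"
proof -
  have "bil {..<m * n} (ent (kron (1\<^sub>m m) B)) v v =
      (\<Sum>a<m * n. \<Sum>b<m * n. cnj (v a) * (1\<^sub>m m $$ (a div n, b div n) * B $$ (a mod n, b mod n)) * v b)"
    unfolding bil_explicit by (intro sum.cong refl) (simp add: kron_index[OF one_carrier_mat B] del: index_one_mat)
  also have "\<dots> = (\<Sum>i<m. \<Sum>j<n. \<Sum>i'<m. \<Sum>j'<n. cnj (v (i * n + j)) *
      (of_bool (i = i') * B $$ (j, j')) * v (i' * n + j'))"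
    unfolding sum_mult_index by (intro sum.cong refl) auto
  also have "\<dots> = (\<Sum>i<m. \<Sum>j<n. \<Sum>j'<n. cnj (v (i * n + j)) * B $$ (j, j') * v (i * n + j'))"
  proof (rule sum.cong[OF refl], rule sum.cong[OF refl])
    fix i j assume "i \<in> {..<m}"
    have "(\<Sum>i'<m. \<Sum>j'<n. cnj (v (i * n + j)) * (of_bool (i = i') * B $$ (j, j')) * v (i' * n + j'))
        = (\<Sum>i'<m. if i = i' then \<Sum>j'<n. cnj (v (i * n + j)) * B $$ (j, j') * v (i' * n + j') else 0)"
      by (intro sum.cong) auto
    then show "(\<Sum>i'<m. \<Sum>j'<n. cnj (v (i * n + j)) * (of_bool (i = i') * B $$ (j, j')) * v (i' * n + j'))
        = (\<Sum>j'<n. cnj (v (i * n + j)) * B $$ (j, j') * v (i * n + j'))"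
      using \<open>i \<in> {..<m}\<close> by simp
  qed
  finally show ?thesis by (simp only: bil_explicit)
qed

text \<open>The form splits over the slices of \<open>v\<close> along the second factor, and so does
  the square of the norm.\<close>

lemma qbound_kron_one_right:
  assumes A: "A \<in> carrier_mat m m" and c: "qbound m A c"
  shows "qbound (m * n) (kron A (1\<^sub>m n)) c"
  unfolding qbound_def
proof
  fix v
  have "cmod (bil {..<m * n} (ent (kron A (1\<^sub>m n))) v v)
      \<le> (\<Sum>j<n. c * (nrm {..<m} (\<lambda>i. v (i * n + j)))\<^sup>2)"
    unfolding bil_kron_one_right[OF A] using c
    by (intro order_trans[OF norm_sum] sum_mono) (simp add: qbound_def)
  also have "\<dots> = c * (nrm {..<m * n} v)\<^sup>2"
    unfolding nrm_sq_mult_index sum_distrib_left by (simp only: nrm_sq sum_distrib_left) (rule sum.swap)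
  finally show "cmod (bil {..<m * n} (ent (kron A (1\<^sub>m n))) v v) \<le> c * (nrm {..<m * n} v)\<^sup>2" .
qed

lemma qbound_kron_one_left:
  assumes B: "B \<in> carrier_mat n n" and c: "qbound n B c"
  shows "qbound (m * n) (kron (1\<^sub>m m) B) c"
  unfolding qbound_def
proof
  fix v
  have "cmod (bil {..<m * n} (ent (kron (1\<^sub>m m) B)) v v)
      \<le> (\<Sum>i<m. c * (nrm {..<n} (\<lambda>j. v (i * n + j)))\<^sup>2)"
    unfolding bil_kron_one_left[OF B] using c
    by (intro order_trans[OF norm_sum] sum_mono) (simp add: qbound_def)
  also have "\<dots> = c * (nrm {..<m * n} v)\<^sup>2"
    unfolding nrm_sq_mult_index sum_distrib_left by (simp only: nrm_sq sum_distrib_left)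
  finally show "cmod (bil {..<m * n} (ent (kron (1\<^sub>m m) B)) v v) \<le> c * (nrm {..<m * n} v)\<^sup>2" .
qed

lemma qbound_add:
  assumes "A \<in> carrier_mat n n" "B \<in> carrier_mat n n" "qbound n A a" "qbound n B b"
  shows "qbound n (A + B) (a + b)"
  unfolding qbound_def
proof
  fix v
  have "bil {..<n} (ent (A + B)) v v = bil {..<n} (ent A) v v + bil {..<n} (ent B) v v"
    using assms by (simp add: bil_explicit algebra_simps sum.distrib)
  then have "cmod (bil {..<n} (ent (A + B)) v v) \<le> cmod (bil {..<n} (ent A) v v) + cmod (bil {..<n} (ent B) v v)"
    by (simp add: norm_triangle_ineq)
  also have "\<dots> \<le> a * (nrm {..<n} v)\<^sup>2 + b * (nrm {..<n} v)\<^sup>2"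
    using assms by (intro add_mono) (auto simp: qbound_def)
  finally show "cmod (bil {..<n} (ent (A + B)) v v) \<le> (a + b) * (nrm {..<n} v)\<^sup>2"
    by (simp add: algebra_simps)
qed

lemma qbound_copy_charge:
  assumes L: "L \<in> carrier_mat d d" and c: "qbound d L c"
  shows "qbound (d ^ n) (copy_charge d L n) (real n * c)"
proof (induction n)
  case 0
  show ?case using L by (simp add: copy_charge_0 qbound_def bil_explicit)
next
  case (Suc n)
  have C: "copy_charge d L n \<in> carrier_mat (d ^ n) (d ^ n)" by (rule copy_charge_entry(1)[OF L])
  have "qbound (d ^ n * d) (kron (copy_charge d L n) (1\<^sub>m d) + kron (1\<^sub>m (d ^ n)) L) (real n * c + c)"
    using C L by (intro qbound_add qbound_kron_one_right qbound_kron_one_left Suc c) auto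
  then show ?case unfolding copy_charge_Suc[OF L] by (simp add: algebra_simps)
qed

lemma trp_qbound:
  assumes "X \<in> carrier_mat n n" "qbound n X c" "M \<in> carrier_mat n n" "hermitian M"
  shows "cmod (mtrace (X * M)) \<le> c * trace_norm M"
  unfolding mtrace_mult_trp[OF assms(1,3)]
proof (rule trace_norm_lower[OF assms(3,4)])
  fix v assume "nrm {..<n} v = 1"
  then show "cmod (bil {..<n} (ent X) v v) \<le> c"
    using assms(2) unfolding qbound_def by (metis mult.right_neutral one_power2)
qed

lemma density_trace_norm: "density_mat n \<rho> \<Longrightarrow> trace_norm \<rho> = 1"
  using density_diagonalizes[of n \<rho>] trace_norm_diagonalizes by (metis (no_types, lifting) abs_of_nonneg lessThan_iff sum.cong)

lemma density_kron:
  assumes "density_mat m \<rho>" "density_mat n \<omega>"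
  shows "density_mat (m * n) (kron \<rho> \<omega>)"
proof -
  obtain y p where p: "diagonalizes m \<rho> y p" "\<And>i. i < m \<Longrightarrow> 0 \<le> p i" "(\<Sum>i<m. p i) = 1"
    using density_diagonalizes[OF assms(1)] by blast
  obtain z q where q: "diagonalizes n \<omega> z q" "\<And>i. i < n \<Longrightarrow> 0 \<le> q i" "(\<Sum>i<n. q i) = 1"
    using density_diagonalizes[OF assms(2)] by blast
  have "(\<Sum>a<m * n. p (a div n) * q (a mod n)) = (\<Sum>i<m. p i) * (\<Sum>j<n. q j)"
    unfolding sum_mult_index sum_product by (intro sum.cong refl) simp
  then show ?thesis
    using p q index_div index_mod
    by (intro diagonalizes_density[OF diagonalizes_kron[OF p(1) q(1)]]) auto
qed

lemma density_tpow:
  assumes "density_mat d \<rho>"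
  shows "density_mat (d ^ n) (tpow \<rho> n)"
proof -
  obtain y p where p: "diagonalizes d \<rho> y p" "\<And>i. i < d \<Longrightarrow> 0 \<le> p i" "(\<Sum>i<d. p i) = 1"
    using density_diagonalizes[OF assms(1)] by blast
  show ?thesis
    by (rule diagonalizes_density[OF diagonalizes_tpow[OF p(1)]]) (use p tprod_sum tprod_nonneg in auto)
qed

section \<open>Expectations of the total charge and their conservation\<close>

lemma mtrace_copy_charge:
  assumes L: "L \<in> carrier_mat d d" and \<rho>: "density_mat d \<rho>"
  shows "mtrace (copy_charge d L n * tpow \<rho> n) = of_nat n * mtrace (L * \<rho>)"
proof (induction n)
  case 0
  show ?case using L by (simp add: copy_charge_0 mtrace_def)
next
  case (Suc n)
  let ?C = "copy_charge d L n" and ?R = "tpow \<rho> n"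
  have C: "?C \<in> carrier_mat (d ^ n) (d ^ n)" by (rule copy_charge_entry(1)[OF L])
  have r: "\<rho> \<in> carrier_mat d d" and R: "?R \<in> carrier_mat (d ^ n) (d ^ n)" and t: "mtrace \<rho> = 1" "mtrace ?R = 1"
    using \<rho> density_tpow[OF \<rho>, of n] by (auto simp: density_mat_def)
  have "copy_charge d L (Suc n) * tpow \<rho> (Suc n) = kron ?C (1\<^sub>m d) * kron ?R \<rho> + kron (1\<^sub>m (d ^ n)) L * kron ?R \<rho>"
    unfolding copy_charge_Suc[OF L] tpow.simps
    by (rule add_mult_distrib_mat[of _ "d ^ n * d" "d ^ n * d" _ _ "d ^ n * d"]) (use C L r R in auto)
  also have "\<dots> = kron (?C * ?R) \<rho> + kron ?R (L * \<rho>)"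
    using kron_mult[OF C one_carrier_mat R r] kron_mult[OF one_carrier_mat L R r] r R by simp
  finally have "mtrace (copy_charge d L (Suc n) * tpow \<rho> (Suc n)) = mtrace (kron (?C * ?R) \<rho>) + mtrace (kron ?R (L * \<rho>))"
    using C L r R by (simp add: mtrace_add[of _ "d ^ n * d"])
  also have "\<dots> = mtrace (?C * ?R) * mtrace \<rho> + mtrace ?R * mtrace (L * \<rho>)"
    using C L r R by (simp add: mtrace_kron[of _ "d ^ n" _ d])
  finally show ?case using Suc t by (simp add: algebra_simps)
qed

lemma mtrace_total_charge:
  assumes L: "L \<in> carrier_mat d d" and L': "L' \<in> carrier_mat D D" and \<rho>: "density_mat d \<rho>" and \<omega>: "density_mat D \<omega>"
  shows "mtrace ((kron (copy_charge d L n) (1\<^sub>m D) + kron (1\<^sub>m (d ^ n)) L') * kron (tpow \<rho> n) \<omega>)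
    = of_nat n * mtrace (L * \<rho>) + mtrace (L' * \<omega>)"
proof -
  let ?C = "copy_charge d L n" and ?R = "tpow \<rho> n"
  have C: "?C \<in> carrier_mat (d ^ n) (d ^ n)" by (rule copy_charge_entry(1)[OF L])
  have w: "\<omega> \<in> carrier_mat D D" and R: "?R \<in> carrier_mat (d ^ n) (d ^ n)" and t: "mtrace \<omega> = 1" "mtrace ?R = 1"
    using \<omega> density_tpow[OF \<rho>, of n] by (auto simp: density_mat_def)
  have "(kron ?C (1\<^sub>m D) + kron (1\<^sub>m (d ^ n)) L') * kron ?R \<omega> = kron ?C (1\<^sub>m D) * kron ?R \<omega> + kron (1\<^sub>m (d ^ n)) L' * kron ?R \<omega>"
    by (rule add_mult_distrib_mat[of _ "d ^ n * D" "d ^ n * D" _ _ "d ^ n * D"]) (use C L' w R in auto)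
  also have "\<dots> = kron (?C * ?R) \<omega> + kron ?R (L' * \<omega>)"
    using kron_mult[OF C one_carrier_mat R w] kron_mult[OF one_carrier_mat L' R w] w R by simp
  finally have "mtrace ((kron ?C (1\<^sub>m D) + kron (1\<^sub>m (d ^ n)) L') * kron ?R \<omega>)
      = mtrace (kron (?C * ?R) \<omega>) + mtrace (kron ?R (L' * \<omega>))"
    using C L' w R by (simp add: mtrace_add[of _ "d ^ n * D"])
  also have "\<dots> = mtrace (?C * ?R) * mtrace \<omega> + mtrace ?R * mtrace (L' * \<omega>)"
    using C L' w R by (simp add: mtrace_kron[of _ "d ^ n" _ D])
  finally show ?thesis using t by (simp add: mtrace_copy_charge[OF L \<rho>])
qed

lemma hermitian_conj:
  assumes "A \<in> carrier_mat m m" "hermitian A" "U \<in> carrier_mat m m"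
  shows "hermitian (U * A * adj U)"
proof -
  have a: "adj A = A" using assms by (simp add: hermitian_def)
  have "adj (U * A * adj U) = adj (adj U) * (adj A * adj U)"
    using assms by (simp add: adj_mult[of "U * A" m m "adj U" m] adj_mult[of U m m A m])
  also have "\<dots> = U * A * adj U" using assms a by (simp add: assoc_mult_mat[of U m m A m "adj U" m])
  finally have "adj (U * A * adj U) = U * A * adj U" .
  moreover have "U * A * adj U \<in> carrier_mat m m" using assms by auto
  ultimately show ?thesis unfolding hermitian_def by (metis carrier_matD(1))
qed

lemma hermitian_minus:
  assumes "A \<in> carrier_mat m m" "B \<in> carrier_mat m m" "hermitian A" "hermitian B"
  shows "hermitian (A - B)"
  using assms adj_minus[OF assms(1,2)] by (auto simp: hermitian_def minus_carrier_mat)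

lemma density_hermitian: "density_mat n \<rho> \<Longrightarrow> \<rho> \<in> carrier_mat n n \<and> hermitian \<rho>"
  by (auto simp: density_mat_def positive_mat_def)

text \<open>T passes through U, and cyclicity of the trace then cancels U against its
  adjoint.\<close>

lemma mtrace_conj_commuting:
  assumes T: "T \<in> carrier_mat m m" and A: "A \<in> carrier_mat m m" and U: "unitary_mat m U" and c: "U * T = T * U"
  shows "mtrace (T * (U * A * adj U)) = mtrace (T * A)"
proof -
  have Uc: "U \<in> carrier_mat m m" "adj U \<in> carrier_mat m m" using U by (auto simp: unitary_mat_def)
  have "T * (U * A * adj U) = (U * T) * (A * adj U)"
    using T A Uc c by (simp add: assoc_mult_mat[of _ m m _ m _ m])
  also have "\<dots> = U * (T * A * adj U)" using T A Uc by (simp add: assoc_mult_mat[of _ m m _ m _ m])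
  finally have "mtrace (T * (U * A * adj U)) = mtrace (U * (T * A * adj U))" by simp
  also have "\<dots> = mtrace (T * A * adj U * U)" using T A Uc by (intro mtrace_comm) auto
  also have "T * A * adj U * U = T * A * (adj U * U)" using T A Uc by (intro assoc_mult_mat[of _ m m _ m _ m]) auto
  finally show ?thesis using U T A by (simp add: unitary_mat_def)
qed

lemma mtrace_minus: "A \<in> carrier_mat n n \<Longrightarrow> B \<in> carrier_mat n n \<Longrightarrow> mtrace (A - B) = mtrace A - mtrace B"
  by (simp add: mtrace_def sum_subtractf)

text \<open>The total charge T commutes with U, so its expectation in the error operator
  \<open>M\<close> is exactly the charge difference of the two sides: n times that of one copy plus
  that of the ancilla. This expectation is at most the bound on T times the trace norm of
  \<open>M\<close>, and the ancilla part is at most twice \<open>op_norm L'\<close>.\<close>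

lemma charge_difference_bound:
  fixes n :: nat
  assumes L: "L \<in> carrier_mat d d" and L': "L' \<in> carrier_mat D D"
    and \<rho>: "density_mat d \<rho>" and \<sigma>: "density_mat d \<sigma>" and \<omega>: "density_mat D \<omega>" and \<omega>': "density_mat D \<omega>'"
    and U: "unitary_mat (d ^ n * D) U"
    and comm: "U * (kron (copy_charge d L n) (1\<^sub>m D) + kron (1\<^sub>m (d ^ n)) L') =
      (kron (copy_charge d L n) (1\<^sub>m D) + kron (1\<^sub>m (d ^ n)) L') * U"
  shows "real n * cmod (mtrace (L * \<rho>) - mtrace (L * \<sigma>)) \<le> 2 * op_norm L' +
    (real n * op_norm L + op_norm L') * trace_norm (U * kron (tpow \<rho> n) \<omega>' * adj U - kron (tpow \<sigma> n) \<omega>)"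
proof -
  let ?m = "d ^ n * D"
  define T where "T = kron (copy_charge d L n) (1\<^sub>m D) + kron (1\<^sub>m (d ^ n)) L'"
  define A where "A = kron (tpow \<rho> n) \<omega>'"
  define B where "B = kron (tpow \<sigma> n) \<omega>"
  define M where "M = U * A * adj U - B"
  have C: "copy_charge d L n \<in> carrier_mat (d ^ n) (d ^ n)" by (rule copy_charge_entry(1)[OF L])
  have T: "T \<in> carrier_mat ?m ?m" using C L' by (simp add: T_def)
  have A: "A \<in> carrier_mat ?m ?m" "hermitian A" and B: "B \<in> carrier_mat ?m ?m" "hermitian B"
    unfolding A_def B_def using density_hermitian[OF density_kron[OF density_tpow]] \<rho> \<sigma> \<omega> \<omega>' by auto
  have Uc: "U \<in> carrier_mat ?m ?m" using U by (simp add: unitary_mat_def)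
  have UA: "U * A * adj U \<in> carrier_mat ?m ?m" using Uc A by auto
  have M: "M \<in> carrier_mat ?m ?m" "hermitian M"
    unfolding M_def using hermitian_minus[OF UA B(1) hermitian_conj[OF A Uc] B(2)] UA B by auto
  have qL: "qbound d L (op_norm L)" using bil_op_norm[OF L] by (simp add: qbound_def)
  have qL': "qbound D L' (op_norm L')" using bil_op_norm[OF L'] by (simp add: qbound_def)
  have qT: "qbound ?m T (real n * op_norm L + op_norm L')"
    unfolding T_def using C L'
    by (intro qbound_add qbound_kron_one_right qbound_kron_one_left qbound_copy_charge[OF L qL] qL') auto
  have "mtrace (T * M) = mtrace (T * (U * A * adj U)) - mtrace (T * B)"
    unfolding M_def mult_minus_distrib_mat[OF T UA B(1)] using T UA B by (intro mtrace_minus) auto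
  also have "\<dots> = mtrace (T * A) - mtrace (T * B)"
    using mtrace_conj_commuting[OF T A(1) U] comm by (simp add: T_def)
  also have "\<dots> = of_nat n * (mtrace (L * \<rho>) - mtrace (L * \<sigma>)) + (mtrace (L' * \<omega>') - mtrace (L' * \<omega>))"
    unfolding T_def A_def B_def using mtrace_total_charge[OF L L' \<rho> \<omega>'] mtrace_total_charge[OF L L' \<sigma> \<omega>]
    by (simp add: algebra_simps)
  finally have "of_nat n * (mtrace (L * \<rho>) - mtrace (L * \<sigma>)) = mtrace (T * M) + mtrace (L' * \<omega>) - mtrace (L' * \<omega>')"
    by simp
  then have "cmod (of_nat n * (mtrace (L * \<rho>) - mtrace (L * \<sigma>))) \<le> cmod (mtrace (T * M)) + cmod (mtrace (L' * \<omega>)) + cmod (mtrace (L' * \<omega>'))"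
    by (simp only:) (meson norm_triangle_ineq norm_triangle_ineq4 add_mono_thms_linordered_semiring(3) order_trans)
  moreover have "cmod (mtrace (L' * \<omega>)) \<le> op_norm L'" "cmod (mtrace (L' * \<omega>')) \<le> op_norm L'"
    using trp_qbound[OF L' qL'] density_hermitian density_trace_norm \<omega> \<omega>' by (metis mult.right_neutral)+
  moreover have "cmod (mtrace (T * M)) \<le> (real n * op_norm L + op_norm L') * trace_norm M"
    by (rule trp_qbound[OF T qT M])
  ultimately show ?thesis by (simp add: norm_mult M_def A_def B_def)
qed

subsection \<open>Typical eigenvalues\<close>

text \<open>Positivity is a separate clause: with \<open>ln 0 = 0\<close> a string containing a
  digit of weight zero could otherwise pass the test on the sum.\<close>

definition typical :: "nat \<Rightarrow> (nat \<Rightarrow> real) \<Rightarrow> real \<Rightarrow> real \<Rightarrow> nat \<Rightarrow> nat set" where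
  "typical d p s \<delta> n = {i\<in>{..<d ^ n}. 0 < tprod d p n i \<and> \<bar>tsum d (\<lambda>i. - ln (p i)) n i - real n * s\<bar> \<le> \<delta>}"

text \<open>The variance of -ln p when \<open>s\<close> is the entropy, hence the constant in
  Chebyshev's inequality for the logarithms of the eigenvalues.\<close>

definition logvar :: "nat \<Rightarrow> (nat \<Rightarrow> real) \<Rightarrow> real \<Rightarrow> real" where
  "logvar d p s = (\<Sum>i<d. p i * (- ln (p i) - s)\<^sup>2)"

locale spectrum =
  fixes d :: nat and p :: "nat \<Rightarrow> real" and s :: real
  assumes p_nonneg: "i < d \<Longrightarrow> 0 \<le> p i" and p_sum: "(\<Sum>i<d. p i) = 1"
    and s: "(\<Sum>i<d. p i * (- ln (p i))) = s"
begin

lemma typical_subset: "typical d p s \<delta> n \<subseteq> {..<d ^ n}"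
  by (auto simp: typical_def)

lemma typical_bounds:
  assumes "i \<in> typical d p s \<delta> n"
  shows "exp (- (real n * s) - \<delta>) \<le> tprod d p n i" "tprod d p n i \<le> exp (- (real n * s) + \<delta>)"
  using assms tprod_pos_digit[of d p n i] p_nonneg by (auto simp: typical_def abs_le_iff)

text \<open>Each typical string weighs at least exp (- n s - \<delta>), and the total weight is
  one.\<close>

lemma typical_card: "real (card (typical d p s \<delta> n)) \<le> exp (real n * s + \<delta>)"
proof -
  let ?T = "typical d p s \<delta> n"
  have "real (card ?T) * exp (- (real n * s) - \<delta>) \<le> (\<Sum>i\<in>?T. tprod d p n i)"
    using sum_bounded_below[of ?T "exp (- (real n * s) - \<delta>)" "tprod d p n"] typical_bounds by simp
  also have "\<dots> \<le> (\<Sum>i<d ^ n. tprod d p n i)"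
    using typical_subset tprod_nonneg[OF p_nonneg] by (intro sum_mono2) auto
  also have "\<dots> = 1" by (rule tprod_sum[OF p_sum])
  finally show ?thesis by (simp add: exp_diff exp_minus exp_add field_simps)
qed

lemma atypical_mass:
  assumes "0 < \<delta>"
  shows "(\<Sum>i\<in>{..<d ^ n} - typical d p s \<delta> n. tprod d p n i) \<le> real n * logvar d p s / \<delta>\<^sup>2"
proof -
  let ?S = "{i\<in>{..<d ^ n}. \<delta> < \<bar>tsum d (\<lambda>i. - ln (p i)) n i - real n * s\<bar>}"
  have nn: "0 \<le> tprod d p n i" if "i < d ^ n" for i by (rule tprod_nonneg[OF _ that]) (rule p_nonneg)
  have "(\<Sum>i\<in>{..<d ^ n} - typical d p s \<delta> n. tprod d p n i) \<le> (\<Sum>i\<in>?S. tprod d p n i)"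
  proof -
    \<comment> \<open>Strings of weight zero drop out of the sum; an atypical string of positive
      weight deviates by more than \<delta>.\<close>
    have "(\<Sum>i\<in>{..<d ^ n} - typical d p s \<delta> n. tprod d p n i) = (\<Sum>i\<in>?S \<inter> ({..<d ^ n} - typical d p s \<delta> n). tprod d p n i)"
      by (rule sum.mono_neutral_right) (use nn in \<open>force simp: typical_def\<close>)+
    also have "\<dots> \<le> (\<Sum>i\<in>?S. tprod d p n i)" using nn by (intro sum_mono2) auto
    finally show ?thesis .
  qed
  also have "\<dots> \<le> real n * logvar d p s / \<delta>\<^sup>2"
    unfolding logvar_def by (rule tprod_chebyshev) (use p_nonneg p_sum s assms in auto)
  finally show ?thesis .
qed

lemma typical_mass:
  assumes "0 < \<delta>"
  shows "1 - real n * logvar d p s / \<delta>\<^sup>2 \<le> (\<Sum>i\<in>typical d p s \<delta> n. tprod d p n i)"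
proof -
  have "(\<Sum>i<d ^ n. tprod d p n i) = (\<Sum>i\<in>{..<d ^ n} - typical d p s \<delta> n. tprod d p n i) + (\<Sum>i\<in>typical d p s \<delta> n. tprod d p n i)"
    by (rule sum.subset_diff) (use typical_subset in auto)
  then show ?thesis using atypical_mass[OF assms, of n] tprod_sum[OF p_sum, of n] by linarith
qed

end

section \<open>Unitary conjugation and comparison of spectra\<close>

lemma onb_unitary:
  assumes U: "unitary_mat m U" and y: "onb {..<m} {..<m} y"
  shows "onb {..<m} {..<m} (\<lambda>i. ap {..<m} (ent U) (y i))"
proof -
  have Uc: "U \<in> carrier_mat m m" "adj U \<in> carrier_mat m m" using U by (auto simp: unitary_mat_def)
  have UU: "(\<Sum>a<m. cnj (U $$ (a,b)) * U $$ (a,c)) = of_bool (b = c)" if "b < m" "c < m" for b c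
  proof -
    have "(adj U * U) $$ (b,c) = (\<Sum>a<m. adj U $$ (b,a) * U $$ (a,c))"
      by (rule mult_index_sum[OF Uc(2,1) that])
    also have "\<dots> = (\<Sum>a<m. cnj (U $$ (a,b)) * U $$ (a,c))"
      using Uc that by (intro sum.cong refl) (auto simp: adj_index)
    finally show ?thesis using U that by (cases "b = c") (simp_all add: unitary_mat_def)
  qed
  have iso: "ip {..<m} (ap {..<m} (ent U) u) (ap {..<m} (ent U) v) = ip {..<m} u v" for u v
  proof -
    have "ip {..<m} (ap {..<m} (ent U) u) (ap {..<m} (ent U) v)
        = (\<Sum>a<m. \<Sum>b<m. \<Sum>c<m. cnj (u b) * (cnj (U $$ (a,b)) * U $$ (a,c)) * v c)"
      unfolding ip_def
    proof (intro sum.cong refl)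
      fix a assume "a \<in> {..<m}"
      then have "cnj (ap {..<m} (ent U) u a) * ap {..<m} (ent U) v a
          = (\<Sum>b<m. cnj (U $$ (a,b) * u b)) * (\<Sum>c<m. U $$ (a,c) * v c)"
        by (simp add: ap_def)
      also have "\<dots> = (\<Sum>b<m. \<Sum>c<m. cnj (U $$ (a,b) * u b) * (U $$ (a,c) * v c))"
        by (rule sum_product)
      finally show "cnj (ap {..<m} (ent U) u a) * ap {..<m} (ent U) v a
          = (\<Sum>b<m. \<Sum>c<m. cnj (u b) * (cnj (U $$ (a,b)) * U $$ (a,c)) * v c)"
        by (simp add: mult_ac)
    qed
    also have "\<dots> = (\<Sum>b<m. \<Sum>a<m. \<Sum>c<m. cnj (u b) * (cnj (U $$ (a,b)) * U $$ (a,c)) * v c)"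
      by (rule sum.swap)
    also have "\<dots> = (\<Sum>b<m. \<Sum>c<m. \<Sum>a<m. cnj (u b) * (cnj (U $$ (a,b)) * U $$ (a,c)) * v c)"
      by (intro sum.cong refl sum.swap)
    also have "\<dots> = (\<Sum>b<m. \<Sum>c<m. cnj (u b) * of_bool (b = c) * v c)"
      using UU by (intro sum.cong refl) (simp flip: sum_distrib_left sum_distrib_right)
    also have "\<dots> = (\<Sum>b<m. \<Sum>c<m. if b = c then cnj (u b) * v c else 0)"
      by (intro sum.cong refl) auto
    finally show ?thesis by (simp add: ip_def)
  qed
  have "onb {..<card {..<m}} {..<m} (\<lambda>i. ap {..<m} (ent U) (y i))"
    by (rule orthonormal_complete) (use y iso in \<open>auto simp: onb_def\<close>)
  then show ?thesis by simp
qed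

lemma conj_entry:
  assumes "U \<in> carrier_mat m m" "A \<in> carrier_mat m m" "a < m" "b < m"
  shows "(U * A * adj U) $$ (a,b) = (\<Sum>c<m. \<Sum>e<m. U $$ (a,c) * A $$ (c,e) * cnj (U $$ (b,e)))"
proof -
  have UA: "U * A \<in> carrier_mat m m" and aU: "adj U \<in> carrier_mat m m" using assms by auto
  have "(U * A * adj U) $$ (a,b) = (\<Sum>e<m. (\<Sum>c<m. U $$ (a,c) * A $$ (c,e)) * cnj (U $$ (b,e)))"
    using mult_index_sum[OF UA aU assms(3,4)] mult_index_sum[OF assms(1,2,3)] assms
    by (simp add: adj_index del: index_mult_mat)
  also have "\<dots> = (\<Sum>e<m. \<Sum>c<m. U $$ (a,c) * A $$ (c,e) * cnj (U $$ (b,e)))"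
    by (simp add: sum_distrib_right)
  also have "\<dots> = (\<Sum>c<m. \<Sum>e<m. U $$ (a,c) * A $$ (c,e) * cnj (U $$ (b,e)))" by (rule sum.swap)
  finally show ?thesis .
qed

lemma conj_ensemble:
  assumes U: "U \<in> carrier_mat m m" and A: "A \<in> carrier_mat m m" and ab: "a < m" "b < m"
    and e: "\<And>a b. a < m \<Longrightarrow> b < m \<Longrightarrow> A $$ (a,b) = (\<Sum>i\<in>I. w i * v i a * cnj (v i b))"
  shows "(U * A * adj U) $$ (a,b) = (\<Sum>i\<in>I. w i * ap {..<m} (ent U) (v i) a * cnj (ap {..<m} (ent U) (v i) b))"
proof -
  have "(U * A * adj U) $$ (a,b) = (\<Sum>c<m. \<Sum>e<m. \<Sum>i\<in>I. w i * (U $$ (a,c) * v i c) * cnj (U $$ (b,e) * v i e))"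
    unfolding conj_entry[OF U A ab] using e
    by (intro sum.cong refl) (simp add: sum_distrib_left sum_distrib_right mult_ac)
  also have "\<dots> = (\<Sum>c<m. \<Sum>i\<in>I. \<Sum>e<m. w i * (U $$ (a,c) * v i c) * cnj (U $$ (b,e) * v i e))"
    by (intro sum.cong refl sum.swap)
  also have "\<dots> = (\<Sum>i\<in>I. \<Sum>c<m. \<Sum>e<m. w i * (U $$ (a,c) * v i c) * cnj (U $$ (b,e) * v i e))"
    by (rule sum.swap)
  also have "\<dots> = (\<Sum>i\<in>I. w i * ap {..<m} (ent U) (v i) a * cnj (ap {..<m} (ent U) (v i) b))"
  proof (intro sum.cong refl)
    fix i
    have "w i * ap {..<m} (ent U) (v i) a * cnj (ap {..<m} (ent U) (v i) b)
        = w i * ((\<Sum>c<m. U $$ (a,c) * v i c) * (\<Sum>e<m. cnj (U $$ (b,e) * v i e)))"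
      using ab by (simp add: ap_def)
    also have "\<dots> = (\<Sum>c<m. \<Sum>e<m. w i * ((U $$ (a,c) * v i c) * cnj (U $$ (b,e) * v i e)))"
      by (subst sum_product) (simp only: sum_distrib_left)
    finally show "(\<Sum>c<m. \<Sum>e<m. w i * (U $$ (a,c) * v i c) * cnj (U $$ (b,e) * v i e))
        = w i * ap {..<m} (ent U) (v i) a * cnj (ap {..<m} (ent U) (v i) b)"
      by (simp only: mult.assoc)
  qed
  finally show ?thesis .
qed

lemma diagonalizes_conj:
  assumes U: "unitary_mat m U" and A: "diagonalizes m A y e"
  shows "diagonalizes m (U * A * adj U) (\<lambda>i. ap {..<m} (ent U) (y i)) e"
proof -
  have c: "U \<in> carrier_mat m m" "A \<in> carrier_mat m m" using U A by (auto simp: unitary_mat_def diagonalizes_def)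
  have "U * A * adj U \<in> carrier_mat m m" using c by auto
  moreover have "(U * A * adj U) $$ (a,b) = (\<Sum>i<m. of_real (e i) * ap {..<m} (ent U) (y i) a * cnj (ap {..<m} (ent U) (y i) b))"
    if "a < m" "b < m" for a b
    by (rule conj_ensemble[OF c that]) (use A in \<open>auto simp: diagonalizes_def\<close>)
  ultimately show ?thesis using onb_unitary[OF U] A by (auto simp: diagonalizes_def)
qed

lemma trace_norm_minus_commute:
  assumes A: "A \<in> carrier_mat m m" "hermitian A" and B: "B \<in> carrier_mat m m" "hermitian B"
  shows "trace_norm (A - B) = trace_norm (B - A)"
proof -
  have "A - B \<in> carrier_mat m m" using A B by auto
  then obtain y e where d: "diagonalizes m (A - B) y e"
    using hermitian_diagonalizes hermitian_minus[OF A(1) B(1) A(2) B(2)] by blast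
  have "(B - A) $$ (a,b) = (\<Sum>i<m. of_real (- e i) * y i a * cnj (y i b))" if "a < m" "b < m" for a b
  proof -
    have "(B - A) $$ (a,b) = - ((A - B) $$ (a,b))" using that A B by simp
    also have "(A - B) $$ (a,b) = (\<Sum>i<m. of_real (e i) * y i a * cnj (y i b))"
      using d that by (simp add: diagonalizes_def)
    finally show ?thesis by (simp add: sum_negf)
  qed
  moreover have "onb {..<m} {..<m} y" using d by (simp add: diagonalizes_def)
  moreover have "B - A \<in> carrier_mat m m" using A B by auto
  ultimately have "diagonalizes m (B - A) y (\<lambda>i. - e i)" unfolding diagonalizes_def by blast
  then show ?thesis using trace_norm_diagonalizes[OF d] by (simp add: trace_norm_diagonalizes)
qed

text \<open>The error is tested with the spectral projection \<open>P\<close> of A onto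
  \<open>G\<close>. Its expectation in A is the sum over \<open>G\<close>; in B it is at most
  \<kappa> times the rank of \<open>P\<close> from the eigenvectors in \<open>H\<close>, plus the
  full mass outside \<open>H\<close>.\<close>

lemma spectral_overlap:
  assumes A: "diagonalizes m A y e" and B: "diagonalizes m B z f"
    and f: "\<And>j. j < m \<Longrightarrow> 0 \<le> f j" and G: "G \<subseteq> {..<m}" and H: "\<And>j. j \<in> H \<Longrightarrow> j < m \<Longrightarrow> f j \<le> \<kappa>" and \<kappa>: "0 \<le> \<kappa>"
  shows "(\<Sum>i\<in>G. e i) \<le> trace_norm (A - B) + real (card G) * \<kappa> + (\<Sum>j\<in>{..<m} - H. f j)"
proof -
  let ?A = "{..<m}"
  have c: "A \<in> carrier_mat m m" "B \<in> carrier_mat m m" and y: "onb ?A ?A y" and z: "onb ?A ?A z"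
    using A B by (auto simp: diagonalizes_def)
  define P where "P = spectral_mat m y (\<lambda>i. of_bool (i \<in> G))"
  have dP: "diagonalizes m P y (\<lambda>i. of_bool (i \<in> G))" unfolding P_def by (rule spectral_mat_diagonalizes[OF y])
  have bP: "bil ?A (ent P) v v = of_real (\<Sum>i\<in>G. (cmod (ip ?A (y i) v))\<^sup>2)" for v
  proof -
    have "(\<Sum>i<m. of_bool (i \<in> G) * (cmod (ip ?A (y i) v))\<^sup>2) = (\<Sum>i\<in>G. of_bool (i \<in> G) * (cmod (ip ?A (y i) v))\<^sup>2)"
      using G by (intro sum.mono_neutral_right) auto
    then show ?thesis unfolding diagonalizes_bil[OF dP] by simp
  qed
  have finG: "finite G" using G finite_subset by blast
  have le1: "(\<Sum>i\<in>G. (cmod (ip ?A (y i) v))\<^sup>2) \<le> (nrm ?A v)\<^sup>2" for v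
    unfolding onb_parseval_nrm[OF y finite_lessThan, symmetric] using G by (intro sum_mono2) auto
  have M: "A - B \<in> carrier_mat m m" "hermitian (A - B)"
    using c hermitian_minus[OF c diagonalizes_hermitian[OF A] diagonalizes_hermitian[OF B]] by auto
  have "cmod (trp ?A (ent P) (ent (A - B))) \<le> 1 * trace_norm (A - B)"
  proof (rule trace_norm_lower[OF M])
    fix v assume "nrm ?A v = 1"
    then have "(\<Sum>i\<in>G. (cmod (ip ?A (y i) v))\<^sup>2) \<le> 1" using le1[of v] by simp
    then show "cmod (bil ?A (ent P) v v) \<le> 1"
      unfolding bP norm_of_real by (simp add: sum_nonneg)
  qed
  moreover have "trp ?A (ent P) (ent (A - B)) = trp ?A (ent P) (ent A) - trp ?A (ent P) (ent B)"
    unfolding trp_diff[symmetric] by (rule trp_cong) (use c in auto)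
  moreover have "trp ?A (ent P) (ent A) = of_real (\<Sum>i\<in>G. e i)"
  proof -
    have "trp ?A (ent P) (ent A) = of_real (\<Sum>i<m. e i * of_bool (i \<in> G))"
      unfolding trp_diagonalizes[OF A] of_real_sum by (intro sum.cong refl) (simp add: diagonalizes_ev[OF dP])
    also have "(\<Sum>i<m. e i * of_bool (i \<in> G)) = (\<Sum>i\<in>G. e i * of_bool (i \<in> G))"
      using G by (intro sum.mono_neutral_right) auto
    finally show ?thesis by simp
  qed
  moreover have "trp ?A (ent P) (ent B) = of_real (\<Sum>j<m. f j * (\<Sum>i\<in>G. (cmod (ip ?A (y i) (z j)))\<^sup>2))"
    unfolding trp_diagonalizes[OF B] bP by simp
  ultimately have "cmod (of_real ((\<Sum>i\<in>G. e i) - (\<Sum>j<m. f j * (\<Sum>i\<in>G. (cmod (ip ?A (y i) (z j)))\<^sup>2)))) \<le> trace_norm (A - B)"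
    by simp
  then have "(\<Sum>i\<in>G. e i) - (\<Sum>j<m. f j * (\<Sum>i\<in>G. (cmod (ip ?A (y i) (z j)))\<^sup>2)) \<le> trace_norm (A - B)"
    unfolding norm_of_real by linarith
  moreover have "(\<Sum>j<m. f j * (\<Sum>i\<in>G. (cmod (ip ?A (y i) (z j)))\<^sup>2)) \<le> real (card G) * \<kappa> + (\<Sum>j\<in>?A - H. f j)"
  proof -
    let ?g = "\<lambda>j. \<Sum>i\<in>G. (cmod (ip ?A (y i) (z j)))\<^sup>2"
    have "(\<Sum>j<m. f j * ?g j) = (\<Sum>j\<in>?A - H. f j * ?g j) + (\<Sum>j\<in>?A \<inter> H. f j * ?g j)"
      by (subst sum.subset_diff[of "?A \<inter> H"]) (auto simp: Diff_Int2 Diff_Int)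
    also have "(\<Sum>j\<in>?A - H. f j * ?g j) \<le> (\<Sum>j\<in>?A - H. f j * 1)"
    proof (intro sum_mono mult_left_mono)
      fix j assume "j \<in> ?A - H"
      then have "nrm ?A (z j) = 1" using onb_nrm[OF z] by auto
      then show "?g j \<le> 1" using le1[of "z j"] by simp
      show "0 \<le> f j" using f \<open>j \<in> ?A - H\<close> by auto
    qed
    also have "(\<Sum>j\<in>?A \<inter> H. f j * ?g j) \<le> (\<Sum>j\<in>?A \<inter> H. \<kappa> * ?g j)"
      using H by (intro sum_mono mult_right_mono) (auto intro: sum_nonneg)
    also have "\<dots> \<le> (\<Sum>j<m. \<kappa> * ?g j)" using \<kappa> by (intro sum_mono2) (auto intro!: mult_nonneg_nonneg sum_nonneg)
    also have "\<dots> = \<kappa> * (\<Sum>i\<in>G. \<Sum>j<m. (cmod (ip ?A (y i) (z j)))\<^sup>2)"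
      unfolding sum_distrib_left[symmetric] by (subst sum.swap) simp
    \<comment> \<open>Parseval in the basis \<open>z\<close>: every \<open>y i\<close> has total
      overlap one, so what remains is the rank of \<open>P\<close>.\<close>
    also have "(\<Sum>i\<in>G. \<Sum>j<m. (cmod (ip ?A (y i) (z j)))\<^sup>2) = (\<Sum>i\<in>G. 1)"
    proof (intro sum.cong refl)
      fix i assume "i \<in> G"
      have "cmod (ip ?A (y i) (z j)) = cmod (ip ?A (z j) (y i))" for j by (metis ip_cnj complex_mod_cnj)
      then have "(\<Sum>j<m. (cmod (ip ?A (y i) (z j)))\<^sup>2) = (nrm ?A (y i))\<^sup>2"
        using onb_parseval_nrm[OF z finite_lessThan, of "y i"] by simp
      also have "\<dots> = 1" using onb_nrm[OF y] \<open>i \<in> G\<close> G by auto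
      finally show "(\<Sum>j<m. (cmod (ip ?A (y i) (z j)))\<^sup>2) = 1" .
    qed
    finally show ?thesis by (simp add: mult.commute)
  qed
  ultimately show ?thesis by linarith
qed

lemma sum_div_set:
  fixes g :: "nat \<Rightarrow> 'a::comm_monoid_add"
  assumes "T \<subseteq> {..<m}"
  shows "(\<Sum>a\<in>{a\<in>{..<m * n}. a div n \<in> T}. g a) = (\<Sum>i\<in>T. \<Sum>j<n. g (i * n + j))"
proof -
  have "(\<Sum>a\<in>{a\<in>{..<m * n}. a div n \<in> T}. g a) = (\<Sum>a<m * n. if a div n \<in> T then g a else 0)"
    by (rule sum.inter_filter) simp
  also have "\<dots> = (\<Sum>i<m. \<Sum>j<n. if i \<in> T then g (i * n + j) else 0)"
    unfolding sum_mult_index by (intro sum.cong refl) simp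
  also have "\<dots> = (\<Sum>i<m. if i \<in> T then \<Sum>j<n. g (i * n + j) else 0)"
    by (intro sum.cong refl) auto
  also have "\<dots> = (\<Sum>i\<in>{i\<in>{..<m}. i \<in> T}. \<Sum>j<n. g (i * n + j))"
    by (rule sum.inter_filter[symmetric]) simp
  also have "{i\<in>{..<m}. i \<in> T} = T" using assms by auto
  finally show ?thesis .
qed

lemma density_spectrum:
  assumes "density_mat d \<rho>"
  obtains y p where "diagonalizes d \<rho> y p" "spectrum d p (vn_entropy \<rho>)"
proof -
  obtain y p where p: "diagonalizes d \<rho> y p" "\<And>i. i < d \<Longrightarrow> 0 \<le> p i" "(\<Sum>i<d. p i) = 1"
    using density_diagonalizes[OF assms] by blast
  have "spectrum d p (vn_entropy \<rho>)"
    by unfold_locales (use p vn_entropy_diagonalizes[OF p(1,2)] in auto)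
  then show thesis using that p by blast
qed

text \<open>Instead of Fannes' inequality, compare ranks: the typical subspace of the first state has
  about \<open>exp (n s)\<close> dimensions, on which the second state can only put the mass
  \<open>exp (n s) * exp (- n t)\<close>; the ancilla contributes the factor \<open>D\<close>.\<close>

lemma typical_overlap:
  assumes p: "spectrum d p s" and q: "spectrum d q t"
    and A: "diagonalizes (d ^ n * D) A y (\<lambda>a. tprod d p n (a div D) * e (a mod D))"
    and B: "diagonalizes (d ^ n * D) B z (\<lambda>a. tprod d q n (a div D) * f (a mod D))"
    and e: "(\<Sum>j<D. e j) = 1" and f: "\<And>j. j < D \<Longrightarrow> 0 \<le> f j" "(\<Sum>j<D. f j) = 1" and \<delta>: "0 < \<delta>"
  shows "1 - real n * logvar d p s / \<delta>\<^sup>2 \<le>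
    trace_norm (A - B) + real D * exp (real n * (s - t) + 2 * \<delta>) + real n * logvar d q t / \<delta>\<^sup>2"
proof -
  interpret p: spectrum d p s by (rule p)
  interpret q: spectrum d q t by (rule q)
  let ?T = "typical d p s \<delta> n" and ?S = "typical d q t \<delta> n"
  define G where "G = {a\<in>{..<d ^ n * D}. a div D \<in> ?T}"
  define H where "H = {a\<in>{..<d ^ n * D}. a div D \<in> ?S}"
  let ?\<kappa> = "exp (- (real n * t) + \<delta>)"
  have q0: "0 \<le> tprod d q n i" if "i < d ^ n" for i by (rule tprod_nonneg[OF _ that]) (rule q.p_nonneg)
  have "(\<Sum>a\<in>G. tprod d p n (a div D) * e (a mod D)) \<le> trace_norm (A - B) + real (card G) * ?\<kappa>
      + (\<Sum>a\<in>{..<d ^ n * D} - H. tprod d q n (a div D) * f (a mod D))"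
  proof (rule spectral_overlap[OF A B])
    fix a assume a: "a < d ^ n * D"
    show "0 \<le> tprod d q n (a div D) * f (a mod D)"
      using q0 f(1) index_div[OF a] index_mod[OF a] by simp
    assume "a \<in> H"
    \<comment> \<open>Ancilla eigenvalues are at most one, so tensoring with the ancilla cannot
      raise an eigenvalue above the typical bound of the second state.\<close>
    have "f (a mod D) \<le> (\<Sum>j<D. f j)"
      using f(1) index_mod[OF a] by (intro member_le_sum) auto
    then have "tprod d q n (a div D) * f (a mod D) \<le> tprod d q n (a div D) * 1"
      using q0 index_div[OF a] f(2) by (intro mult_left_mono) auto
    also have "\<dots> \<le> ?\<kappa>" using q.typical_bounds(2) \<open>a \<in> H\<close> by (simp add: H_def)
    finally show "tprod d q n (a div D) * f (a mod D) \<le> ?\<kappa>" .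
  qed (auto simp: G_def)
  moreover have "(\<Sum>a\<in>G. tprod d p n (a div D) * e (a mod D)) = (\<Sum>i\<in>?T. tprod d p n i)"
    unfolding G_def sum_div_set[OF p.typical_subset]
    using e by (intro sum.cong refl) (simp flip: sum_distrib_left)
  moreover have "(\<Sum>a\<in>{..<d ^ n * D} - H. tprod d q n (a div D) * f (a mod D)) = (\<Sum>i\<in>{..<d ^ n} - ?S. tprod d q n i)"
  proof -
    have "{..<d ^ n * D} - H = {a\<in>{..<d ^ n * D}. a div D \<in> {..<d ^ n} - ?S}"
      using index_div by (auto simp: H_def)
    then have "(\<Sum>a\<in>{..<d ^ n * D} - H. tprod d q n (a div D) * f (a mod D))
        = (\<Sum>i\<in>{..<d ^ n} - ?S. \<Sum>j<D. tprod d q n ((i * D + j) div D) * f ((i * D + j) mod D))"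
      by (simp only: sum_div_set[of "{..<d ^ n} - ?S" "d ^ n", OF Diff_subset])
    also have "\<dots> = (\<Sum>i\<in>{..<d ^ n} - ?S. tprod d q n i)"
      using f(2) by (intro sum.cong refl) (simp flip: sum_distrib_left)
    finally show ?thesis .
  qed
  moreover have "real (card G) * ?\<kappa> \<le> real D * exp (real n * (s - t) + 2 * \<delta>)"
  proof -
    have "real (card G) = (\<Sum>a\<in>G. 1)" by simp
    also have "\<dots> = real (card ?T) * real D"
      unfolding G_def sum_div_set[OF p.typical_subset] by simp
    finally have "real (card G) * ?\<kappa> \<le> (exp (real n * s + \<delta>) * real D) * ?\<kappa>"
      using p.typical_card[of \<delta> n] by (intro mult_right_mono) (auto intro: mult_right_mono)
    also have "\<dots> = real D * (exp (real n * s + \<delta>) * ?\<kappa>)" by simp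
    also have "exp (real n * s + \<delta>) * ?\<kappa> = exp (real n * (s - t) + 2 * \<delta>)"
      by (simp add: algebra_simps flip: exp_add)
    finally show ?thesis .
  qed
  ultimately show ?thesis using p.typical_mass[OF \<delta>, of n] q.atypical_mass[OF \<delta>, of n] by linarith
qed

section \<open>The limit in the necessity direction\<close>

lemma entropy_le_limit:
  assumes D: "(\<lambda>n. ln (real (D n))) \<in> o[at_top](\<lambda>n. real n)" "\<And>n. 0 < D n"
    and tn: "tn \<longlonglongrightarrow> 0"
    and le: "\<And>n \<delta>. 0 < \<delta> \<Longrightarrow> 1 - real n * V / \<delta>\<^sup>2 \<le> tn n + real (D n) * exp (real n * (s - t) + 2 * \<delta>) + real n * W / \<delta>\<^sup>2"
  shows "t \<le> s"
proof (rule ccontr)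
  assume "\<not> t \<le> s"
  define g where "g = t - s"
  have g: "0 < g" using \<open>\<not> t \<le> s\<close> by (simp add: g_def)
  \<comment> \<open>The bound is used with width \<delta> = \<eta> n. Then 2 \<delta> = g n / 4, and
    eventually ln (D n) is at most g n / 4, so the rank term is at most exp (- g n / 2), while the
    two variance terms are of order 1 / n.\<close>
  define \<eta> where "\<eta> = g / 8"
  have \<eta>: "0 < \<eta>" using g by (simp add: \<eta>_def)
  have ev: "eventually (\<lambda>n. norm (ln (real (D n))) \<le> (g / 4) * norm (real n)) at_top"
    using g by (intro landau_o.smallD[OF D(1)]) simp
  have "eventually (\<lambda>n. 1 \<le> tn n + exp (- (g / 2) * real n) + (V + W) / \<eta>\<^sup>2 * (1 / real n)) at_top"
    using ev eventually_gt_at_top[of 0]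
  proof eventually_elim
    case (elim n)
    have "real n * V / (\<eta> * real n)\<^sup>2 = V / \<eta>\<^sup>2 * (1 / real n)" "real n * W / (\<eta> * real n)\<^sup>2 = W / \<eta>\<^sup>2 * (1 / real n)"
      using elim by (auto simp: power2_eq_square field_simps)
    moreover have "real (D n) * exp (real n * (s - t) + 2 * (\<eta> * real n)) \<le> exp (- (g / 2) * real n)"
    proof -
      have "real (D n) = exp (ln (real (D n)))" using D(2) by simp
      also have "\<dots> \<le> exp (g / 4 * real n)" using elim by simp
      finally have "real (D n) * exp (real n * (s - t) + 2 * (\<eta> * real n))
          \<le> exp (g / 4 * real n) * exp (real n * (s - t) + 2 * (\<eta> * real n))"
        by (rule mult_right_mono) simp
      also have "\<dots> = exp (g / 4 * real n + (real n * (s - t) + 2 * (\<eta> * real n)))"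
        by (rule exp_add[symmetric])
      also have "g / 4 * real n + (real n * (s - t) + 2 * (\<eta> * real n)) = - (g / 2) * real n"
        by (simp add: g_def \<eta>_def field_simps)
      finally show ?thesis .
    qed
    moreover have "1 - real n * V / (\<eta> * real n)\<^sup>2 \<le>
        tn n + real (D n) * exp (real n * (s - t) + 2 * (\<eta> * real n)) + real n * W / (\<eta> * real n)\<^sup>2"
      using le[of "\<eta> * real n" n] \<eta> elim by simp
    ultimately show ?case by (simp add: add_divide_distrib)
  qed
  moreover have "(\<lambda>n. tn n + exp (- (g / 2) * real n) + (V + W) / \<eta>\<^sup>2 * (1 / real n)) \<longlonglongrightarrow> 0 + 0 + (V + W) / \<eta>\<^sup>2 * 0"
  proof (intro tendsto_add tendsto_mult tendsto_const tn lim_1_over_n)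
    show "(\<lambda>n. exp (- (g / 2) * real n)) \<longlonglongrightarrow> 0" using g by real_asymp
  qed
  ultimately have "1 \<le> 0 + 0 + (V + W) / \<eta>\<^sup>2 * 0"
    by (intro tendsto_lowerbound) auto
  then show False by simp
qed

theorem necessity:
  fixes d q :: nat and L :: "nat \<Rightarrow> complex mat" and \<rho> \<sigma> :: "complex mat"
  assumes L: "\<forall>k<q. L k \<in> carrier_mat d d \<and> hermitian (L k)"
    and \<rho>: "density_mat d \<rho>" and \<sigma>: "density_mat d \<sigma>"
    and D: "(\<lambda>n. ln (real (D n))) \<in> o[at_top](\<lambda>n. real n)"
    and L': "\<forall>n. \<forall>k<q. L' n k \<in> carrier_mat (D n) (D n) \<and> hermitian (L' n k)"
    and oL': "\<forall>k<q. (\<lambda>n. op_norm (L' n k)) \<in> o[at_top](\<lambda>n. real n)"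
    and \<omega>: "\<forall>n. density_mat (D n) (\<omega> n) \<and> density_mat (D n) (\<omega>' n)"
    and U: "\<forall>n. unitary_mat (d ^ n * D n) (U n)"
    and comm: "\<forall>n. \<forall>k<q.
          U n * (kron (copy_charge d (L k) n) (1\<^sub>m (D n)) + kron (1\<^sub>m (d ^ n)) (L' n k))
          = (kron (copy_charge d (L k) n) (1\<^sub>m (D n)) + kron (1\<^sub>m (d ^ n)) (L' n k)) * U n"
    and lim: "(\<lambda>n. trace_norm (U n * kron (tpow \<rho> n) (\<omega>' n) * adj (U n) - kron (tpow \<sigma> n) (\<omega> n))) \<longlonglongrightarrow> 0"
  shows "vn_entropy \<rho> = vn_entropy \<sigma> \<and> (\<forall>k<q. mtrace (L k * \<rho>) = mtrace (L k * \<sigma>))"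
proof (intro conjI allI impI)
  define tn where "tn = (\<lambda>n. trace_norm (U n * kron (tpow \<rho> n) (\<omega>' n) * adj (U n) - kron (tpow \<sigma> n) (\<omega> n)))"
  have tn: "tn \<longlonglongrightarrow> 0" using lim by (simp add: tn_def)
  have Dpos: "0 < D n" for n using \<omega> density_dim_pos by blast
  obtain y p where p: "diagonalizes d \<rho> y p" "spectrum d p (vn_entropy \<rho>)" using density_spectrum[OF \<rho>] .
  obtain z r where r: "diagonalizes d \<sigma> z r" "spectrum d r (vn_entropy \<sigma>)" using density_spectrum[OF \<sigma>] .
  \<comment> \<open>Both inequalities refer to the same trace distance: the second exchanges the
    roles of the two states, by symmetry of the trace norm of a difference.\<close>
  have ov: "1 - real n * logvar d p (vn_entropy \<rho>) / \<delta>\<^sup>2 \<le> tn n +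
        real (D n) * exp (real n * (vn_entropy \<rho> - vn_entropy \<sigma>) + 2 * \<delta>) + real n * logvar d r (vn_entropy \<sigma>) / \<delta>\<^sup>2"
      "1 - real n * logvar d r (vn_entropy \<sigma>) / \<delta>\<^sup>2 \<le> tn n +
        real (D n) * exp (real n * (vn_entropy \<sigma> - vn_entropy \<rho>) + 2 * \<delta>) + real n * logvar d p (vn_entropy \<rho>) / \<delta>\<^sup>2"
    if \<delta>: "0 < \<delta>" for n \<delta>
  proof -
    obtain u e where e: "diagonalizes (D n) (\<omega>' n) u e" "\<And>i. i < D n \<Longrightarrow> 0 \<le> e i" "(\<Sum>i<D n. e i) = 1"
      using density_diagonalizes \<omega> by metis
    obtain v f where f: "diagonalizes (D n) (\<omega> n) v f" "\<And>i. i < D n \<Longrightarrow> 0 \<le> f i" "(\<Sum>i<D n. f i) = 1"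
      using density_diagonalizes \<omega> by metis
    have un: "unitary_mat (d ^ n * D n) (U n)" using U by blast
    note A = diagonalizes_conj[OF un diagonalizes_kron[OF diagonalizes_tpow[OF p(1)] e(1)]]
    note B = diagonalizes_kron[OF diagonalizes_tpow[OF r(1)] f(1), of n]
    have cA: "U n * kron (tpow \<rho> n) (\<omega>' n) * adj (U n) \<in> carrier_mat (d ^ n * D n) (d ^ n * D n)"
      and cB: "kron (tpow \<sigma> n) (\<omega> n) \<in> carrier_mat (d ^ n * D n) (d ^ n * D n)"
      using A B by (auto simp only: diagonalizes_def)
    have c: "trace_norm (kron (tpow \<sigma> n) (\<omega> n) - U n * kron (tpow \<rho> n) (\<omega>' n) * adj (U n)) = tn n"
      unfolding tn_def
      by (rule trace_norm_minus_commute[OF cB diagonalizes_hermitian[OF B] cA diagonalizes_hermitian[OF A]])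
    show "1 - real n * logvar d p (vn_entropy \<rho>) / \<delta>\<^sup>2 \<le> tn n +
        real (D n) * exp (real n * (vn_entropy \<rho> - vn_entropy \<sigma>) + 2 * \<delta>) + real n * logvar d r (vn_entropy \<sigma>) / \<delta>\<^sup>2"
      unfolding tn_def by (rule typical_overlap[OF p(2) r(2) A B e(3) f(2,3) \<delta>])
    show "1 - real n * logvar d r (vn_entropy \<sigma>) / \<delta>\<^sup>2 \<le> tn n +
        real (D n) * exp (real n * (vn_entropy \<sigma> - vn_entropy \<rho>) + 2 * \<delta>) + real n * logvar d p (vn_entropy \<rho>) / \<delta>\<^sup>2"
      unfolding c[symmetric] by (rule typical_overlap[OF r(2) p(2) B A f(3) e(2,3) \<delta>])
  qed
  show "vn_entropy \<rho> = vn_entropy \<sigma>"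
    using entropy_le_limit[OF D Dpos tn ov(1)] entropy_le_limit[OF D Dpos tn ov(2)] by (rule antisym[rotated])
  fix k assume k: "k < q"
  define c where "c = cmod (mtrace (L k * \<rho>) - mtrace (L k * \<sigma>))"
  define op where "op = (\<lambda>n. op_norm (L' n k))"
  \<comment> \<open>After division by n the ancilla charge enters only as a term tending to 0, and
    the charge of the copies only as the constant \<open>op_norm (L k)\<close> times the
    error.\<close>
  have "c \<le> 2 * (op n / real n) + (op_norm (L k) + op n / real n) * tn n" if "0 < n" for n
  proof -
    have "real n * c \<le> 2 * op n + (real n * op_norm (L k) + op n) * tn n"
      unfolding c_def op_def tn_def
      by (rule charge_difference_bound) (use L L' \<rho> \<sigma> \<omega> U comm k in auto)
    also have "\<dots> = real n * (2 * (op n / real n) + (op_norm (L k) + op n / real n) * tn n)"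
      using that by (simp add: field_simps)
    finally show ?thesis using that by (simp add: mult_le_cancel_left)
  qed
  then have "eventually (\<lambda>n. c \<le> 2 * (op n / real n) + (op_norm (L k) + op n / real n) * tn n) at_top"
    using eventually_gt_at_top[of 0] by (rule eventually_mono[rotated])
  moreover have "(\<lambda>n. 2 * (op n / real n) + (op_norm (L k) + op n / real n) * tn n) \<longlonglongrightarrow> 2 * 0 + (op_norm (L k) + 0) * 0"
    using oL' k by (intro tendsto_intros tn smalloD_tendsto) (auto simp: op_def)
  ultimately have "c \<le> 2 * 0 + (op_norm (L k) + 0) * 0" by (intro tendsto_lowerbound) auto
  then show "mtrace (L k * \<rho>) = mtrace (L k * \<sigma>)" by (simp add: c_def)
qed

subsection \<open>Flattening spectra with a harmonic ancilla\<close>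

definition harmon :: "nat \<Rightarrow> real" where
  "harmon n = (\<Sum>l<n. 1 / (real l + 1))"

text \<open>A partial matching leaves complements of equal size, so it extends to a permutation; a
  full permutation is what a unitary between two eigenbases requires.\<close>

lemma bij_betw_extend:
  assumes "finite S" "P \<subseteq> S" "P' \<subseteq> S" "bij_betw p P P'"
  obtains \<pi> where "bij_betw \<pi> S S" "\<And>x. x \<in> P \<Longrightarrow> \<pi> x = p x"
proof -
  have fin: "finite P" "finite P'" using assms finite_subset by auto
  have "card P = card P'" by (rule bij_betw_same_card[OF assms(4)])
  then have "card (S - P) = card (S - P')" using assms fin by (simp add: card_Diff_subset)
  then obtain r where r: "bij_betw r (S - P) (S - P')"
    using finite_same_card_bij assms(1) by (metis finite_Diff)
  have "bij_betw (\<lambda>x. if x \<in> P then p x else r x) (P \<union> (S - P)) (P' \<union> (S - P'))"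
    by (rule bij_betw_disjoint_Un) (use assms r in auto)
  then show thesis using assms(2,3) that[of "\<lambda>x. if x \<in> P then p x else r x"] by (simp add: Un_absorb1)
qed

lemma harmon_pos: "0 < n \<Longrightarrow> 0 < harmon n"
  unfolding harmon_def by (intro sum_pos) auto

text \<open>Each eigenvalue \<open>\<beta> k\<close> is cut into \<open>f k\<close> cells of size \<open>u\<close>. Tensoring with the weights
  \<open>1 / (l + 1)\<close>, the entry \<open>(k, f k * j + c)\<close> is at least \<open>u / (j + 1)\<close> for every cell \<open>c\<close>,
  independently of \<open>k\<close>; so cells of the two spectra can be matched arbitrarily.\<close>

lemma flatten:
  fixes \<beta> \<beta>' :: "'a \<Rightarrow> real" and u \<epsilon> :: real and m J :: nat
  assumes fin: "finite A" and u: "0 < u" and m: "0 < m" and J: "0 < J"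
    and \<beta>: "\<And>k. k \<in> A \<Longrightarrow> 0 \<le> \<beta> k" "(\<Sum>k\<in>A. \<beta> k) \<le> 1" "\<And>k. k \<in> A \<Longrightarrow> nat \<lfloor>\<beta> k / u\<rfloor> \<le> m"
      "1 - \<epsilon> \<le> u * (\<Sum>k\<in>A. real (nat \<lfloor>\<beta> k / u\<rfloor>))"
    and \<beta>': "\<And>k. k \<in> A \<Longrightarrow> 0 \<le> \<beta>' k" "(\<Sum>k\<in>A. \<beta>' k) \<le> 1" "\<And>k. k \<in> A \<Longrightarrow> nat \<lfloor>\<beta>' k / u\<rfloor> \<le> m"
      "1 - \<epsilon> \<le> u * (\<Sum>k\<in>A. real (nat \<lfloor>\<beta>' k / u\<rfloor>))"
  defines "N \<equiv> m * J"
  obtains \<pi> where "bij_betw \<pi> (A \<times> {..<N}) (A \<times> {..<N})"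
    "(\<Sum>x\<in>A \<times> {..<N}. \<bar>\<beta> (fst x) / ((real (snd x) + 1) * harmon N) - \<beta>' (fst (\<pi> x)) / ((real (snd (\<pi> x)) + 1) * harmon N)\<bar>)
      \<le> 2 - 2 * (1 - \<epsilon>) * (harmon J / harmon N)"
proof -
  have N: "0 < N" using m J by (simp add: N_def)
  have hN: "0 < harmon N" by (rule harmon_pos[OF N])
  have hJ: "0 < harmon J" by (rule harmon_pos[OF J])
  let ?S = "A \<times> {..<N}"
  define f where "f = (\<lambda>(b :: 'a \<Rightarrow> real) k. nat \<lfloor>b k / u\<rfloor>)"
  define w where "w = (\<lambda>b (x :: 'a \<times> nat). b (fst x) / ((real (snd x) + 1) * harmon N))"
  define C where "C = (\<lambda>b. SIGMA k:A. {..<f b k})"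
  define \<Phi> where "\<Phi> = (\<lambda>b (x :: ('a \<times> nat) \<times> nat). (fst (fst x), f b (fst (fst x)) * snd x + snd (fst x)))"
  have finC: "finite (C b)" for b using fin by (simp add: C_def)
  have cardC: "card (C b) = (\<Sum>k\<in>A. f b k)" for b using fin by (simp add: C_def)
  have inj: "inj_on (\<Phi> b) (C b \<times> {..<J})" for b
  proof (rule inj_onI)
    fix x y assume xy: "x \<in> C b \<times> {..<J}" "y \<in> C b \<times> {..<J}" "\<Phi> b x = \<Phi> b y"
    obtain k c j where x: "x = ((k, c), j)" by (metis prod.collapse)
    obtain k' c' j' where y: "y = ((k', c'), j')" by (metis prod.collapse)
    have "k = k'" using xy(3) by (simp add: \<Phi>_def x y)
    have cc: "c < f b k" "c' < f b k" using xy \<open>k = k'\<close> by (auto simp: C_def x y)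
    have eq: "f b k * j + c = f b k * j' + c'" using xy(3) \<open>k = k'\<close> by (simp add: \<Phi>_def x y)
    have "(f b k * j + c) div f b k = j" "(f b k * j' + c') div f b k = j'"
      "(f b k * j + c) mod f b k = c" "(f b k * j' + c') mod f b k = c'"
      using cc by auto
    then show "x = y" using eq \<open>k = k'\<close> by (simp add: x y)
  qed
  have range: "\<Phi> b ` (C b \<times> {..<J}) \<subseteq> ?S" if "\<And>k. k \<in> A \<Longrightarrow> f b k \<le> m" for b
  proof
    fix z assume "z \<in> \<Phi> b ` (C b \<times> {..<J})"
    then obtain k c j where z: "z = (k, f b k * j + c)" "k \<in> A" "c < f b k" "j < J"
      by (auto simp: \<Phi>_def C_def)
    \<comment> \<open>This fixes the number \<open>m * J\<close> of ancilla levels: at most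
      \<open>m\<close> cells per eigenvalue, each occurring once for every j below
      \<open>J\<close>.\<close>
    have "f b k * j + c < f b k * J" using index_less[OF z(4,3)] by (simp add: mult.commute)
    also have "\<dots> \<le> N" using that[OF z(2)] by (simp add: N_def)
    finally show "z \<in> ?S" using z by simp
  qed
  have low: "u / ((real j + 1) * harmon N) \<le> w b (\<Phi> b ((k, c), j))"
    if "(k, c) \<in> C b" "\<And>k. k \<in> A \<Longrightarrow> 0 \<le> b k" for b k c j
  proof -
    have k: "k \<in> A" "c < f b k" using that by (auto simp: C_def)
    have "real (f b k) \<le> b k / u" using that(2)[OF k(1)] u by (simp add: f_def)
    then have 1: "u * real (f b k) \<le> b k" using u by (simp add: field_simps)
    \<comment> \<open>Since c + 1 is at most f, the cells of round j all lie in the first f (j + 1)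
      ancilla levels.\<close>
    have "real (f b k * j + c) + 1 \<le> real (f b k) * (real j + 1)"
      using k(2) by (simp add: algebra_simps flip: of_nat_mult of_nat_add)
    then have 2: "real (f b k * j + c) + 1 \<le> real (f b k) * (real j + 1)" .
    have "u / ((real j + 1) * harmon N) = u * real (f b k) / (real (f b k) * (real j + 1) * harmon N)"
      using k(2) by simp
    also have "\<dots> \<le> u * real (f b k) / ((real (f b k * j + c) + 1) * harmon N)"
      using 2 u hN k(2) by (intro divide_left_mono mult_right_mono mult_pos_pos) (auto intro: add_nonneg_pos)
    also have "\<dots> \<le> b k / ((real (f b k * j + c) + 1) * harmon N)"
      using 1 hN by (intro divide_right_mono) auto
    finally show ?thesis by (simp add: w_def \<Phi>_def)
  qed
  \<comment> \<open>Only the smaller number of cells can be matched. Each side has cells of total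
    mass at least 1 - \<epsilon>, hence so has the matched part.\<close>
  define M where "M = min (card (C \<beta>)) (card (C \<beta>'))"
  obtain C0 where C0: "C0 \<subseteq> C \<beta>" "card C0 = M" "finite C0"
    using obtain_subset_with_card_n[of M "C \<beta>"] by (auto simp: M_def)
  obtain C0' where C0': "C0' \<subseteq> C \<beta>'" "card C0' = M" "finite C0'"
    using obtain_subset_with_card_n[of M "C \<beta>'"] by (auto simp: M_def)
  obtain g where g: "bij_betw g C0 C0'" using finite_same_card_bij C0 C0' by metis
  define P where "P = \<Phi> \<beta> ` (C0 \<times> {..<J})"
  define P' where "P' = \<Phi> \<beta>' ` (C0' \<times> {..<J})"
  have injP: "inj_on (\<Phi> \<beta>) (C0 \<times> {..<J})" "inj_on (\<Phi> \<beta>') (C0' \<times> {..<J})"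
    by (rule inj_on_subset[OF inj Sigma_mono[OF C0(1) order.refl]], rule inj_on_subset[OF inj Sigma_mono[OF C0'(1) order.refl]])
  have b1: "bij_betw (\<Phi> \<beta>) (C0 \<times> {..<J}) P" and b2: "bij_betw (\<Phi> \<beta>') (C0' \<times> {..<J}) P'"
    using injP by (auto simp: P_def P'_def bij_betw_def)
  have b3: "bij_betw (map_prod g id) (C0 \<times> {..<J}) (C0' \<times> {..<J})"
    using g by (intro bij_betw_map_prod) auto
  \<comment> \<open>A matched cell keeps its round j, so both of the matched entries obey the same
    lower bound \<open>low\<close>.\<close>
  define p where "p = \<Phi> \<beta>' \<circ> map_prod g id \<circ> the_inv_into (C0 \<times> {..<J}) (\<Phi> \<beta>)"
  have "bij_betw p P P'"
    unfolding p_def by (rule bij_betw_trans[OF bij_betw_the_inv_into[OF b1] bij_betw_trans[OF b3 b2]])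
  moreover have "P \<subseteq> ?S" using range[of \<beta>] C0(1) \<beta>(3) unfolding P_def f_def by blast
  moreover have "P' \<subseteq> ?S" using range[of \<beta>'] C0'(1) \<beta>'(3) unfolding P'_def f_def by blast
  ultimately obtain \<pi> where \<pi>: "bij_betw \<pi> ?S ?S" "\<And>x. x \<in> P \<Longrightarrow> \<pi> x = p x"
    using bij_betw_extend[of ?S P P' p] fin by auto
  have PS: "P \<subseteq> ?S" by fact
  have w0: "0 \<le> w \<beta> x" "0 \<le> w \<beta>' x" if "x \<in> ?S" for x
    using that \<beta>(1) \<beta>'(1) hN by (auto simp: w_def)
  have \<pi>S: "\<pi> x \<in> ?S" if "x \<in> ?S" for x using \<pi>(1) that by (auto simp: bij_betw_def)
  have wsum: "(\<Sum>x\<in>?S. w b x) = (\<Sum>k\<in>A. b k)" for b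
  proof -
    have "(\<Sum>x\<in>?S. w b x) = (\<Sum>k\<in>A. \<Sum>l<N. b k * (1 / (real l + 1)) / harmon N)"
      by (simp add: w_def sum.cartesian_product case_prod_unfold)
    also have "\<dots> = (\<Sum>k\<in>A. b k * harmon N / harmon N)"
      by (intro sum.cong refl) (simp add: harmon_def sum_distrib_left sum_divide_distrib)
    finally show ?thesis using hN by simp
  qed
  have "(1 - \<epsilon>) * (harmon J / harmon N) \<le> (u * real M) * (harmon J / harmon N)"
  proof (rule mult_right_mono)
    have "real (card (C \<beta>)) = (\<Sum>k\<in>A. real (nat \<lfloor>\<beta> k / u\<rfloor>))" "real (card (C \<beta>')) = (\<Sum>k\<in>A. real (nat \<lfloor>\<beta>' k / u\<rfloor>))"
      unfolding cardC f_def by simp_all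
    then show "1 - \<epsilon> \<le> u * real M" using \<beta>(4) \<beta>'(4) by (auto simp: M_def min_def)
    show "0 \<le> harmon J / harmon N" using hJ hN by simp
  qed
  also have "\<dots> = (\<Sum>x\<in>C0 \<times> {..<J}. u / ((real (snd x) + 1) * harmon N))"
  proof -
    have "(\<Sum>x\<in>C0 \<times> {..<J}. u / ((real (snd x) + 1) * harmon N)) = (\<Sum>x\<in>C0. \<Sum>j<J. u / harmon N * (1 / (real j + 1)))"
      by (subst sum.cartesian_product) (auto intro!: sum.cong)
    also have "\<dots> = real M * (u / harmon N * harmon J)"
      using C0 by (simp add: harmon_def sum_distrib_left)
    finally show ?thesis by simp
  qed
  also have "\<dots> \<le> (\<Sum>x\<in>C0 \<times> {..<J}. min (w \<beta> (\<Phi> \<beta> x)) (w \<beta>' (\<pi> (\<Phi> \<beta> x))))"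
  proof (intro sum_mono)
    fix x assume x: "x \<in> C0 \<times> {..<J}"
    obtain c j where xc: "x = (c, j)" by (cases x)
    have inP: "\<Phi> \<beta> x \<in> P" using x by (auto simp: P_def)
    have "\<pi> (\<Phi> \<beta> x) = \<Phi> \<beta>' (g c, j)"
      unfolding \<pi>(2)[OF inP] p_def using the_inv_into_f_f[OF injP(1) x] by (simp add: xc)
    moreover have "c \<in> C \<beta>" "g c \<in> C \<beta>'" using x g C0 C0' by (auto simp: xc bij_betw_def)
    moreover obtain k e where "c = (k, e)" by (cases c)
    moreover obtain k' e' where "g c = (k', e')" by (cases "g c")
    ultimately show "u / ((real (snd x) + 1) * harmon N) \<le> min (w \<beta> (\<Phi> \<beta> x)) (w \<beta>' (\<pi> (\<Phi> \<beta> x)))"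
      using low[of k e \<beta> j] low[of k' e' \<beta>' j] \<beta>(1) \<beta>'(1) by (simp add: xc)
  qed
  also have "\<dots> = (\<Sum>x\<in>P. min (w \<beta> x) (w \<beta>' (\<pi> x)))"
    by (rule sum.reindex_bij_betw[OF b1])
  also have "\<dots> \<le> (\<Sum>x\<in>?S. min (w \<beta> x) (w \<beta>' (\<pi> x)))"
    using fin PS w0 \<pi>S by (intro sum_mono2) auto
  finally have min: "(1 - \<epsilon>) * (harmon J / harmon N) \<le> (\<Sum>x\<in>?S. min (w \<beta> x) (w \<beta>' (\<pi> x)))" .
  \<comment> \<open>Since |a - b| = a + b - 2 min a b, the lower bound on the common mass becomes an
    upper bound on the distance.\<close>
  have "(\<Sum>x\<in>?S. \<bar>w \<beta> x - w \<beta>' (\<pi> x)\<bar>) = (\<Sum>x\<in>?S. w \<beta> x + w \<beta>' (\<pi> x) - 2 * min (w \<beta> x) (w \<beta>' (\<pi> x)))"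
    by (intro sum.cong refl) (auto simp: min_def)
  also have "\<dots> = (\<Sum>x\<in>?S. w \<beta> x) + (\<Sum>x\<in>?S. w \<beta>' (\<pi> x)) - 2 * (\<Sum>x\<in>?S. min (w \<beta> x) (w \<beta>' (\<pi> x)))"
    by (simp add: sum_subtractf sum.distrib sum_distrib_left)
  also have "(\<Sum>x\<in>?S. w \<beta>' (\<pi> x)) = (\<Sum>x\<in>?S. w \<beta>' x)" by (rule sum.reindex_bij_betw[OF \<pi>(1)])
  finally have "(\<Sum>x\<in>?S. \<bar>w \<beta> x - w \<beta>' (\<pi> x)\<bar>) \<le> 2 - 2 * ((1 - \<epsilon>) * (harmon J / harmon N))"
    using wsum \<beta>(2) \<beta>'(2) min by simp
  then show thesis using that[OF \<pi>(1)] by (simp only: w_def mult.assoc)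
qed

subsection \<open>Iterated sumsets\<close>

primrec sumset :: "'g::ab_group_add set \<Rightarrow> nat \<Rightarrow> 'g set" where
  "sumset \<Delta> 0 = {0}"
| "sumset \<Delta> (Suc r) = (\<lambda>(a, b). a + b) ` (sumset \<Delta> r \<times> \<Delta>)"

lemma finite_sumset: "finite \<Delta> \<Longrightarrow> finite (sumset \<Delta> r)"
  by (induction r) auto

lemma sumset_mono: "0 \<in> \<Delta> \<Longrightarrow> sumset \<Delta> r \<subseteq> sumset \<Delta> (Suc r)"
  by (auto intro!: image_eqI[where x = "(_, 0)"])

lemma zero_in_sumset: "0 \<in> \<Delta> \<Longrightarrow> 0 \<in> sumset \<Delta> r"
  by (induction r) (auto intro!: image_eqI[where x = "(0, 0)"])

text \<open>The logarithms of the cardinalities start at 0 and telescope over \<open>R\<close>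
  steps, so one step grows by at most the average; 1 + x \<le> exp x turns this into a
  ratio.\<close>

lemma slow_growth:
  assumes fin: "finite \<Delta>" and 0: "0 \<in> \<Delta>" and R: "0 < R"
  obtains r where "r < R"
    "1 - ln (real (card (sumset \<Delta> R))) / real R \<le> real (card (sumset \<Delta> r)) / real (card (sumset \<Delta> (Suc r)))"
proof -
  let ?c = "\<lambda>r. real (card (sumset \<Delta> r))"
  have pos: "0 < ?c r" for r
    using zero_in_sumset[OF 0, of r] finite_sumset[OF fin, of r] by (auto simp: card_gt_0_iff)
  have "\<exists>r<R. ln (?c (Suc r)) - ln (?c r) \<le> ln (?c R) / real R"
  proof (rule ccontr)
    assume "\<not> ?thesis"
    then have "(\<Sum>r<R. ln (?c R) / real R) < (\<Sum>r<R. ln (?c (Suc r)) - ln (?c r))"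
      using R by (intro sum_strict_mono) (auto simp: not_le)
    also have "\<dots> = ln (?c R) - ln (?c 0)" by (rule sum_lessThan_telescope)
    finally show False using R by simp
  qed
  then obtain r where r: "r < R" "ln (?c (Suc r)) - ln (?c r) \<le> ln (?c R) / real R" by blast
  have "1 - ln (?c R) / real R \<le> 1 + (ln (?c r) - ln (?c (Suc r)))" using r by simp
  also have "\<dots> \<le> exp (ln (?c r) - ln (?c (Suc r)))" by (rule exp_ge_add_one_self)
  also have "\<dots> = ?c r / ?c (Suc r)" unfolding exp_diff using pos[of r] pos[of "Suc r"] by (simp only: exp_ln)
  finally show thesis using that r by blast
qed

text \<open>\<open>z t\<close> counts the copies in basis state t. The same counts serve every
  \<open>f\<close>, hence all charges at once.\<close>

lemma tsum_digit_counts: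
  assumes "i < d ^ n"
  shows "\<exists>z :: nat \<Rightarrow> int. (\<forall>t. 0 \<le> z t \<and> z t \<le> int n) \<and> (\<forall>f. tsum d f n i = (\<Sum>t<d. of_int (z t) * f t))"
  using assms
proof (induction n arbitrary: i)
  case 0
  then show ?case by (intro exI[of _ "\<lambda>_. 0"]) simp
next
  case (Suc n)
  then have i: "i < d ^ n * d" by (simp add: mult.commute)
  obtain z :: "nat \<Rightarrow> int" where z: "\<forall>t. 0 \<le> z t \<and> z t \<le> int n"
      "\<forall>f. tsum d f n (i div d) = (\<Sum>t<d. of_int (z t) * f t)"
    using Suc.IH[OF index_div[OF i]] by blast
  have m: "i mod d < d" by (rule index_mod[OF i])
  let ?z = "\<lambda>t. z t + of_bool (t = i mod d)"
  have "tsum d f (Suc n) i = (\<Sum>t<d. of_int (?z t) * f t)" for f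
  proof -
    have "(\<Sum>t<d. of_int (?z t) * f t) = (\<Sum>t<d. of_int (z t) * f t) + (\<Sum>t<d. if t = i mod d then f t else 0)"
      unfolding sum.distrib[symmetric] by (intro sum.cong refl) (auto simp: algebra_simps)
    then show ?thesis using z(2) m by simp
  qed
  moreover have "\<forall>t. 0 \<le> ?z t \<and> ?z t \<le> int (Suc n)"
  proof
    fix t show "0 \<le> ?z t \<and> ?z t \<le> int (Suc n)" using z(1)[rule_format, of t] by auto
  qed
  ultimately show ?case by (intro exI[of _ ?z]) blast
qed

text \<open>Every element of the sumset is the image, under one fixed linear map, of an integer
  vector in a box of side 2 r n + 1 in dimension d. The count is polynomial in r and n however the
  eigenvalues \<open>lam\<close> are related arithmetically.\<close>

lemma card_sumset_charges:
  fixes lam :: "nat \<Rightarrow> nat \<Rightarrow> real"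
  assumes "\<And>x. x \<in> \<Delta> \<Longrightarrow> \<exists>z :: nat \<Rightarrow> int. (\<forall>t. \<bar>z t\<bar> \<le> int n) \<and> x = (\<lambda>k. \<Sum>t<d. of_int (z t) * lam k t)"
  shows "real (card (sumset \<Delta> r)) \<le> (2 * real r * real n + 1) ^ d"
proof -
  have ex: "\<exists>z :: nat \<Rightarrow> int. (\<forall>t. \<bar>z t\<bar> \<le> int (r * n)) \<and> x = (\<lambda>k. \<Sum>t<d. of_int (z t) * lam k t)"
    if "x \<in> sumset \<Delta> r" for x
    using that
  proof (induction r arbitrary: x)
    case 0
    then show ?case by (intro exI[of _ "\<lambda>_. 0"]) (auto simp: fun_eq_iff)
  next
    case (Suc r)
    then obtain a b where ab: "x = a + b" "a \<in> sumset \<Delta> r" "b \<in> \<Delta>" by auto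
    obtain z :: "nat \<Rightarrow> int" where z: "\<forall>t. \<bar>z t\<bar> \<le> int (r * n)" "a = (\<lambda>k. \<Sum>t<d. of_int (z t) * lam k t)"
      using Suc.IH[OF ab(2)] by blast
    obtain z' :: "nat \<Rightarrow> int" where z': "\<forall>t. \<bar>z' t\<bar> \<le> int n" "b = (\<lambda>k. \<Sum>t<d. of_int (z' t) * lam k t)"
      using assms[OF ab(3)] by blast
    have "\<bar>z t + z' t\<bar> \<le> int (Suc r * n)" for t
      using z(1)[rule_format, of t] z'(1)[rule_format, of t] by simp
    moreover have "x = (\<lambda>k. \<Sum>t<d. of_int (z t + z' t) * lam k t)"
      unfolding ab(1) z(2) z'(2) by (simp add: fun_eq_iff sum.distrib algebra_simps)
    ultimately show ?case by (intro exI[of _ "\<lambda>t. z t + z' t"]) auto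
  qed
  let ?Z = "PiE {..<d} (\<lambda>_. {- int (r * n)..int (r * n)})"
  have "sumset \<Delta> r \<subseteq> (\<lambda>z k. \<Sum>t<d. of_int (z t) * lam k t) ` ?Z"
  proof
    fix x assume "x \<in> sumset \<Delta> r"
    then obtain z :: "nat \<Rightarrow> int" where z: "\<forall>t. \<bar>z t\<bar> \<le> int (r * n)" "x = (\<lambda>k. \<Sum>t<d. of_int (z t) * lam k t)"
      using ex by blast
    have "restrict z {..<d} \<in> ?Z" using z(1) by (auto simp: abs_le_iff minus_le_iff)
    moreover have "x = (\<lambda>k. \<Sum>t<d. of_int (restrict z {..<d} t) * lam k t)" unfolding z(2) by simp
    ultimately show "x \<in> (\<lambda>z k. \<Sum>t<d. of_int (z t) * lam k t) ` ?Z" by blast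
  qed
  then have "card (sumset \<Delta> r) \<le> card ?Z"
    by (intro surj_card_le finite_PiE) auto
  also have "\<dots> = nat (2 * int (r * n) + 1) ^ d"
    by (simp add: card_PiE algebra_simps)
  finally have "real (card (sumset \<Delta> r)) \<le> real (nat (2 * int (r * n) + 1)) ^ d"
    by (metis of_nat_le_iff of_nat_power)
  also have "real (nat (2 * int (r * n) + 1)) = 2 * real r * real n + 1" by simp
  finally show ?thesis .
qed

lemma sumset_bound:
  fixes \<Delta> :: "(nat \<Rightarrow> real) set"
  assumes "\<And>x. x \<in> \<Delta> \<Longrightarrow> \<bar>x k\<bar> \<le> c"
  shows "x \<in> sumset \<Delta> r \<Longrightarrow> \<bar>x k\<bar> \<le> real r * c"
proof (induction r arbitrary: x)
  case (Suc r)
  then obtain a b where ab: "x = a + b" "a \<in> sumset \<Delta> r" "b \<in> \<Delta>" by auto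
  have "\<bar>x k\<bar> \<le> \<bar>a k\<bar> + \<bar>b k\<bar>" by (simp add: ab)
  also have "\<dots> \<le> real r * c + c" using Suc.IH[OF ab(2)] assms[OF ab(3)] by simp
  finally show ?case by (simp add: algebra_simps)
qed auto

subsection \<open>Restricting an ensemble to a window of basis vectors\<close>

lemma bil_bound_contr: "contr A X \<Longrightarrow> cmod (bil A X v v) \<le> (nrm A v)\<^sup>2"
  by (simp add: contr_def power2_eq_square)

lemma bil_ensemble:
  assumes "\<And>a b. a \<in> A \<Longrightarrow> b \<in> A \<Longrightarrow> B a b = (\<Sum>i\<in>I. w i * v i a * cnj (v i b))"
  shows "bil A B x x' = (\<Sum>i\<in>I. w i * (cnj (ip A (v i) x) * ip A (v i) x'))"
proof -
  have "bil A B x x' = (\<Sum>a\<in>A. \<Sum>b\<in>A. \<Sum>i\<in>I. w i * (cnj (x a) * v i a) * (cnj (v i b) * x' b))"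
    unfolding bil_explicit using assms
    by (intro sum.cong refl) (simp add: sum_distrib_left sum_distrib_right mult_ac)
  also have "\<dots> = (\<Sum>a\<in>A. \<Sum>i\<in>I. \<Sum>b\<in>A. w i * (cnj (x a) * v i a) * (cnj (v i b) * x' b))"
    by (intro sum.cong refl sum.swap)
  also have "\<dots> = (\<Sum>i\<in>I. \<Sum>a\<in>A. \<Sum>b\<in>A. w i * (cnj (x a) * v i a) * (cnj (v i b) * x' b))"
    by (rule sum.swap)
  also have "\<dots> = (\<Sum>i\<in>I. w i * (cnj (ip A (v i) x) * ip A (v i) x'))"
    by (simp add: ip_def sum_product sum_distrib_left mult_ac)
  finally show ?thesis .
qed

lemma onb_eigenvalue:
  assumes "onb I A y" "finite I" "k \<in> I"
    and B: "\<And>a b. a \<in> A \<Longrightarrow> b \<in> A \<Longrightarrow> B a b = (\<Sum>i\<in>I. w i * y i a * cnj (y i b))"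
  shows "bil A B (y k) (y l) = w k * ip A (y k) (y l)"
proof -
  have "bil A B (y k) (y l) = (\<Sum>i\<in>I. w i * (cnj (ip A (y i) (y k)) * ip A (y i) (y l)))"
    by (rule bil_ensemble[OF B])
  also have "\<dots> = (\<Sum>i\<in>I. if i = k then w i * ip A (y i) (y l) else 0)"
    using assms(1,3) by (intro sum.cong refl) (auto simp: onb_def)
  finally show ?thesis using assms by simp
qed

text \<open>An operator of rank \<open>r\<close> has at most \<open>r\<close> nonzero eigenvalues; this is the quantitative
  form for a positive sum of \<open>card T\<close> rank-one operators.\<close>

lemma truncated_eigenvalue_sum:
  fixes \<beta> :: "'i \<Rightarrow> real" and \<gamma> :: "'t \<Rightarrow> 'i \<Rightarrow> complex"
  assumes fin: "finite T" "finite K" and u: "0 < u" and \<beta>: "\<And>j. j \<in> K \<Longrightarrow> 0 \<le> \<beta> j"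
    and diag: "\<And>j l. j \<in> K \<Longrightarrow> l \<in> K \<Longrightarrow> (\<Sum>t\<in>T. cnj (\<gamma> t j) * \<gamma> t l) = of_real (\<beta> j) * of_bool (j = l)"
  shows "(\<Sum>j\<in>K. min (\<beta> j) u) \<le> real (card T) * u"
proof -
  \<comment> \<open>Let \<Gamma> be the matrix with entries \<open>\<gamma> t j\<close>; its columns
    are orthogonal with squared lengths \<beta>. Weighting them by \<theta> gives the operator
    \<Gamma> \<theta> \<Gamma>^* with nonzero eigenvalues min (\<beta> j) u. Its trace is the sum in
    question, and also the sum of the \<open>card T\<close> diagonal entries \<open>S t\<close>,
    each of which is at most u.\<close>
  define \<theta> where "\<theta> = (\<lambda>j. if \<beta> j \<le> u then 1 else u / \<beta> j)"
  have \<theta>: "0 \<le> \<theta> j" "\<theta> j * \<beta> j = min (\<beta> j) u" "\<theta> j * \<beta> j \<le> u" if "j \<in> K" for j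
    using \<beta>[OF that] u by (auto simp: \<theta>_def min_def)
  define S where "S = (\<lambda>t. \<Sum>j\<in>K. \<theta> j * (cmod (\<gamma> t j))\<^sup>2)"
  have S0: "0 \<le> S t" for t unfolding S_def using \<theta>(1) by (intro sum_nonneg) auto
  have sq: "(\<Sum>t\<in>T. (cmod (\<gamma> t j))\<^sup>2) = \<beta> j" if "j \<in> K" for j
  proof -
    have "complex_of_real (\<Sum>t\<in>T. (cmod (\<gamma> t j))\<^sup>2) = (\<Sum>t\<in>T. cnj (\<gamma> t j) * \<gamma> t j)"
      unfolding of_real_sum by (intro sum.cong refl) (metis complex_norm_square mult.commute)
    also have "\<dots> = of_real (\<beta> j)" using diag[OF that that] by simp
    finally show ?thesis using of_real_eq_iff by blast
  qed
  have "S t \<le> u" if t: "t \<in> T" for t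
  proof -
    define g where "g = (\<lambda>t'. \<Sum>j\<in>K. of_real (\<theta> j) * (cnj (\<gamma> t' j) * \<gamma> t j))"
    have "complex_of_real (S t) = g t"
      unfolding S_def g_def of_real_sum of_real_mult
      by (intro sum.cong refl) (metis complex_norm_square mult.commute)
    then have "(S t)\<^sup>2 = (cmod (g t))\<^sup>2" using S0[of t] by (metis norm_of_real power2_abs)
    \<comment> \<open>\<open>g\<close> is a row of that operator and \<open>S t\<close> its diagonal
      entry. As no eigenvalue exceeds u, the squared length of the row is at most u times the
      diagonal entry.\<close>
    also have "\<dots> \<le> (\<Sum>t'\<in>T. (cmod (g t'))\<^sup>2)" using t fin by (intro member_le_sum) auto
    also have "\<dots> = (\<Sum>j\<in>K. (\<theta> j)\<^sup>2 * \<beta> j * (cmod (\<gamma> t j))\<^sup>2)"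
    proof -
      have "complex_of_real (\<Sum>t'\<in>T. (cmod (g t'))\<^sup>2) = (\<Sum>t'\<in>T. g t' * cnj (g t'))"
        unfolding of_real_sum by (intro sum.cong refl) (rule complex_norm_square)
      also have "\<dots> = (\<Sum>t'\<in>T. \<Sum>j\<in>K. \<Sum>l\<in>K. of_real (\<theta> j) * \<gamma> t j * (of_real (\<theta> l) * cnj (\<gamma> t l)) * (cnj (\<gamma> t' j) * \<gamma> t' l))"
      proof (intro sum.cong refl)
        fix t'
        have "cnj (g t') = (\<Sum>l\<in>K. of_real (\<theta> l) * (\<gamma> t' l * cnj (\<gamma> t l)))" by (simp add: g_def)
        then show "g t' * cnj (g t') = (\<Sum>j\<in>K. \<Sum>l\<in>K. of_real (\<theta> j) * \<gamma> t j * (of_real (\<theta> l) * cnj (\<gamma> t l)) * (cnj (\<gamma> t' j) * \<gamma> t' l))"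
          unfolding g_def by (simp only: sum_product) (simp add: mult_ac)
      qed
      also have "\<dots> = (\<Sum>j\<in>K. \<Sum>t'\<in>T. \<Sum>l\<in>K. of_real (\<theta> j) * \<gamma> t j * (of_real (\<theta> l) * cnj (\<gamma> t l)) * (cnj (\<gamma> t' j) * \<gamma> t' l))"
        by (rule sum.swap)
      also have "\<dots> = (\<Sum>j\<in>K. \<Sum>l\<in>K. \<Sum>t'\<in>T. of_real (\<theta> j) * \<gamma> t j * (of_real (\<theta> l) * cnj (\<gamma> t l)) * (cnj (\<gamma> t' j) * \<gamma> t' l))"
        by (intro sum.cong refl sum.swap)
      also have "\<dots> = (\<Sum>j\<in>K. \<Sum>l\<in>K. of_real (\<theta> j) * \<gamma> t j * (of_real (\<theta> l) * cnj (\<gamma> t l)) * (of_real (\<beta> j) * of_bool (j = l)))"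
        using diag by (intro sum.cong refl) (simp flip: sum_distrib_left)
      also have "\<dots> = (\<Sum>j\<in>K. \<Sum>l\<in>K. if j = l then of_real (\<theta> j) * \<gamma> t j * (of_real (\<theta> l) * cnj (\<gamma> t l)) * of_real (\<beta> j) else 0)"
        by (intro sum.cong refl) auto
      also have "\<dots> = (\<Sum>j\<in>K. of_real ((\<theta> j)\<^sup>2 * \<beta> j) * (\<gamma> t j * cnj (\<gamma> t j)))"
        using fin by (simp add: power2_eq_square mult_ac)
      also have "\<dots> = complex_of_real (\<Sum>j\<in>K. (\<theta> j)\<^sup>2 * \<beta> j * (cmod (\<gamma> t j))\<^sup>2)"
        unfolding of_real_sum of_real_mult complex_norm_square ..
      finally show ?thesis using of_real_eq_iff by blast
    qed
    also have "\<dots> \<le> (\<Sum>j\<in>K. u * (\<theta> j * (cmod (\<gamma> t j))\<^sup>2))"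
    proof (intro sum_mono)
      fix j assume j: "j \<in> K"
      have "(\<theta> j * \<beta> j) * (\<theta> j * (cmod (\<gamma> t j))\<^sup>2) \<le> u * (\<theta> j * (cmod (\<gamma> t j))\<^sup>2)"
        using \<theta>[OF j] by (intro mult_right_mono) auto
      then show "(\<theta> j)\<^sup>2 * \<beta> j * (cmod (\<gamma> t j))\<^sup>2 \<le> u * (\<theta> j * (cmod (\<gamma> t j))\<^sup>2)"
        by (simp add: power2_eq_square mult_ac)
    qed
    also have "\<dots> = u * S t" by (simp add: S_def sum_distrib_left)
    finally have "S t * S t \<le> u * S t" by (simp add: power2_eq_square)
    then show "S t \<le> u" using S0[of t] u by (cases "S t = 0") auto
  qed
  then have "(\<Sum>t\<in>T. S t) \<le> real (card T) * u" using sum_bounded_above[of T S u] by simp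
  moreover have "(\<Sum>t\<in>T. S t) = (\<Sum>j\<in>K. min (\<beta> j) u)"
  proof -
    have "(\<Sum>t\<in>T. S t) = (\<Sum>j\<in>K. \<theta> j * (\<Sum>t\<in>T. (cmod (\<gamma> t j))\<^sup>2))"
      unfolding S_def by (subst sum.swap) (simp add: sum_distrib_left)
    also have "\<dots> = (\<Sum>j\<in>K. min (\<beta> j) u)" using sq \<theta>(2) by (intro sum.cong refl) simp
    finally show ?thesis .
  qed
  ultimately show ?thesis by simp
qed

text \<open>Serves both as the projection onto the window and as the extension by zero of a vector
  that lives on \<open>W\<close> only.\<close>

definition wcut :: "'a set \<Rightarrow> ('a \<Rightarrow> complex) \<Rightarrow> 'a \<Rightarrow> complex" where
  "wcut W v = (\<lambda>a. if a \<in> W then v a else 0)"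

lemma nrm_cut_sq: "finite I \<Longrightarrow> W \<subseteq> I \<Longrightarrow> (nrm I (wcut W v))\<^sup>2 = (\<Sum>a\<in>W. (cmod (v a))\<^sup>2)"
  unfolding nrm_sq by (rule sum.mono_neutral_cong_right) (auto simp: wcut_def)

lemma nrm_cut: "finite I \<Longrightarrow> W \<subseteq> I \<Longrightarrow> nrm I (wcut W v) = nrm W v"
  by (rule power2_eq_imp_eq) (simp_all add: nrm_cut_sq, simp add: nrm_sq)

lemma ip_cut: "finite I \<Longrightarrow> W \<subseteq> I \<Longrightarrow> ip I v (wcut W x) = ip W v x"
  unfolding ip_def by (rule sum.mono_neutral_cong_right) (auto simp: wcut_def)

lemma nrm_minus_cut_sq:
  assumes "finite I" "W \<subseteq> I"
  shows "(nrm I (\<lambda>a. v a - wcut W v a))\<^sup>2 = (\<Sum>a\<in>I - W. (cmod (v a))\<^sup>2)"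
  unfolding nrm_sq using assms by (intro sum.mono_neutral_cong_right) (auto simp: wcut_def)

lemma nrm_cut_le: "finite I \<Longrightarrow> W \<subseteq> I \<Longrightarrow> nrm I (wcut W v) \<le> nrm I v"
  by (rule power2_le_imp_le) (auto simp: nrm_sq wcut_def intro!: sum_mono)

text \<open>Dropping the eigenvectors outside \<open>T\<close> costs \<epsilon>2, projecting the
  others onto \<open>W\<close> costs 2 sqrt \<epsilon>1. The projected vectors are in general no
  longer orthogonal, so the compressed operator \<open>B\<close> is diagonalized again on
  \<open>W\<close>. Compression cannot raise an eigenvalue above \<open>pmax\<close>, and
  \<open>B\<close> is a sum of \<open>card T\<close> rank-one terms, which bounds the mass of
  \<beta> that lies below the level u.\<close>

lemma window_spectrum:
  fixes p :: "'k \<Rightarrow> real" and v :: "'k \<Rightarrow> 'a \<Rightarrow> complex"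
  assumes v: "onb K I v" and fin: "finite I" "finite K" and p: "\<And>k. k \<in> K \<Longrightarrow> 0 \<le> p k" "(\<Sum>k\<in>K. p k) = 1"
    and T: "T \<subseteq> K" "\<And>k. k \<in> T \<Longrightarrow> p k \<le> pmax" and W: "W \<subseteq> I" and u: "0 < u"
    and \<epsilon>2: "(\<Sum>k\<in>K - T. p k) \<le> \<epsilon>2" and \<epsilon>1: "(\<Sum>k\<in>K. p k * (\<Sum>a\<in>I - W. (cmod (v k a))\<^sup>2)) \<le> \<epsilon>1"
    and pmax: "0 \<le> pmax"
  obtains y and \<beta> :: "nat \<Rightarrow> real" where "onb {..<card W} W y"
    "\<And>j. j < card W \<Longrightarrow> 0 \<le> \<beta> j" "\<And>j. j < card W \<Longrightarrow> \<beta> j \<le> pmax"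
    "(\<Sum>j<card W. \<beta> j) \<le> 1" "1 - \<epsilon>1 - \<epsilon>2 \<le> (\<Sum>j<card W. \<beta> j)"
    "(\<Sum>j<card W. min (\<beta> j) u) \<le> real (card T) * u"
    "\<And>X. contr I X \<Longrightarrow> cmod ((\<Sum>k\<in>K. of_real (p k) * bil I X (v k) (v k)) -
       (\<Sum>j<card W. of_real (\<beta> j) * bil I X (wcut W (y j)) (wcut W (y j)))) \<le> \<epsilon>2 + 2 * sqrt \<epsilon>1"
proof -
  have finW: "finite W" using W fin finite_subset by blast
  have finT: "finite T" using T fin finite_subset by blast
  have pT: "0 \<le> p k" if "k \<in> T" for k using p T that by auto
  define B where "B = (\<lambda>a b. \<Sum>k\<in>T. of_real (p k) * v k a * cnj (v k b))"
  obtain y ev where y0: "onb {..<card W} W y" and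
    ev: "\<And>k a b. k < Suc 0 \<Longrightarrow> a \<in> W \<Longrightarrow> b \<in> W \<Longrightarrow>
       B a b = (\<Sum>i<card W. of_real (ev k i :: real) * y i a * cnj (y i b))"
    by (rule simultaneous_diagonalization[of W "Suc 0" "\<lambda>_. B"])
      (use finW in \<open>auto simp: herm_on_def B_def mult_ac\<close>)
  define \<beta> where "\<beta> = ev 0"
  have By: "B a b = (\<Sum>i<card W. of_real (\<beta> i) * y i a * cnj (y i b))" if "a \<in> W" "b \<in> W" for a b
    using ev[of 0, OF _ that] by (simp add: \<beta>_def)
  define \<gamma> where "\<gamma> = (\<lambda>t j. of_real (sqrt (p t)) * ip W (v t) (y j))"
  have bilB: "bil W B (y j) (y l) = (\<Sum>k\<in>T. of_real (p k) * (cnj (ip W (v k) (y j)) * ip W (v k) (y l)))" for j l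
    by (rule bil_ensemble) (simp add: B_def)
  have diag: "(\<Sum>t\<in>T. cnj (\<gamma> t j) * \<gamma> t l) = of_real (\<beta> j) * of_bool (j = l)"
    if "j \<in> {..<card W}" "l \<in> {..<card W}" for j l
  proof -
    have "(\<Sum>t\<in>T. cnj (\<gamma> t j) * \<gamma> t l) = bil W B (y j) (y l)"
      unfolding bilB
    proof (intro sum.cong refl)
      fix t assume "t \<in> T"
      have "complex_of_real (sqrt (p t)) * complex_of_real (sqrt (p t)) = of_real (p t)"
        using pT[OF \<open>t \<in> T\<close>] by (simp flip: of_real_mult)
      then show "cnj (\<gamma> t j) * \<gamma> t l = of_real (p t) * (cnj (ip W (v t) (y j)) * ip W (v t) (y l))"
        unfolding \<gamma>_def by (simp add: mult_ac)
    qed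
    also have "\<dots> = of_real (\<beta> j) * ip W (y j) (y l)"
      by (rule onb_eigenvalue[OF y0 _ that(1)]) (use By in auto)
    also have "\<dots> = of_real (\<beta> j) * of_bool (j = l)" using y0 that by (simp add: onb_def)
    finally show ?thesis .
  qed
  have \<beta>_eq: "\<beta> j = (\<Sum>k\<in>T. p k * (cmod (ip W (v k) (y j)))\<^sup>2)" if "j < card W" for j
  proof -
    have "complex_of_real (\<beta> j) = bil W B (y j) (y j)"
      using onb_eigenvalue[OF y0 _ _ By, of j j] y0 that by (simp add: onb_def)
    also have "\<dots> = of_real (\<Sum>k\<in>T. p k * (cmod (ip W (v k) (y j)))\<^sup>2)"
      unfolding bilB of_real_sum of_real_mult complex_norm_square by (simp add: mult_ac)
    finally show ?thesis using of_real_eq_iff by blast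
  qed
  have \<beta>0: "0 \<le> \<beta> j" if "j < card W" for j
    unfolding \<beta>_eq[OF that] using pT by (intro sum_nonneg) auto
  have \<beta>p: "\<beta> j \<le> pmax" if j: "j < card W" for j
  proof -
    \<comment> \<open>A unit vector on \<open>W\<close> extended by zero is a unit vector on
      \<open>I\<close>, and the expectation in it of an operator bounded by \<open>pmax\<close> is
      at most \<open>pmax\<close>.\<close>
    have "\<beta> j \<le> (\<Sum>k\<in>T. pmax * (cmod (ip I (v k) (wcut W (y j))))\<^sup>2)"
      unfolding \<beta>_eq[OF j] ip_cut[OF fin(1) W] using T by (intro sum_mono mult_right_mono) auto
    also have "\<dots> \<le> (\<Sum>k\<in>K. pmax * (cmod (ip I (v k) (wcut W (y j))))\<^sup>2)"
      using T fin pmax by (intro sum_mono2) auto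
    also have "\<dots> = pmax * (nrm I (wcut W (y j)))\<^sup>2"
      unfolding sum_distrib_left[symmetric] onb_parseval_nrm[OF v fin(1)] ..
    also have "\<dots> = pmax" using onb_nrm[OF y0, of j] j by (simp add: nrm_cut[OF fin(1) W])
    finally show ?thesis .
  qed
  have trB: "(\<Sum>j<card W. \<beta> j) = (\<Sum>k\<in>T. p k * (\<Sum>a\<in>W. (cmod (v k a))\<^sup>2))"
  proof -
    have "complex_of_real (\<Sum>j<card W. \<beta> j) = (\<Sum>j<card W. of_real (\<beta> j) * ip W (y j) (y j))"
      using y0 by (simp add: onb_def)
    also have "\<dots> = (\<Sum>a\<in>W. \<Sum>j<card W. of_real (\<beta> j) * y j a * cnj (y j a))"
      unfolding ip_def sum_distrib_left by (subst sum.swap) (simp add: mult_ac)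
    also have "\<dots> = (\<Sum>a\<in>W. B a a)" using By by simp
    also have "\<dots> = (\<Sum>k\<in>T. of_real (p k) * (\<Sum>a\<in>W. v k a * cnj (v k a)))"
      unfolding B_def sum_distrib_left by (subst sum.swap) (simp add: mult_ac)
    also have "\<dots> = complex_of_real (\<Sum>k\<in>T. p k * (\<Sum>a\<in>W. (cmod (v k a))\<^sup>2))"
      unfolding of_real_sum of_real_mult complex_norm_square ..
    finally show ?thesis using of_real_eq_iff by blast
  qed
  have split: "(\<Sum>a\<in>W. (cmod (v k a))\<^sup>2) = 1 - (\<Sum>a\<in>I - W. (cmod (v k a))\<^sup>2)" if "k \<in> K" for k
  proof -
    have "(nrm I (v k))\<^sup>2 = 1" using onb_nrm[OF v that] by simp
    then show ?thesis unfolding nrm_sq using sum.subset_diff[OF W fin(1), of "\<lambda>a. (cmod (v k a))\<^sup>2"] by simp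
  qed
  have pK: "(\<Sum>k\<in>T. p k) = 1 - (\<Sum>k\<in>K - T. p k)"
    using sum.subset_diff[OF T(1) fin(2), of p] p(2) by simp
  have out0: "0 \<le> (\<Sum>a\<in>I - W. (cmod (v k a))\<^sup>2)" for k by (intro sum_nonneg) auto
  have \<epsilon>1T: "(\<Sum>k\<in>T. p k * (\<Sum>a\<in>I - W. (cmod (v k a))\<^sup>2)) \<le> \<epsilon>1"
    using T fin p(1) out0 by (intro order_trans[OF sum_mono2 \<epsilon>1]) auto
  have trB': "(\<Sum>j<card W. \<beta> j) = (\<Sum>k\<in>T. p k) - (\<Sum>k\<in>T. p k * (\<Sum>a\<in>I - W. (cmod (v k a))\<^sup>2))"
    unfolding trB sum_subtractf[symmetric]
  proof (intro sum.cong refl)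
    fix k assume "k \<in> T"
    then have "k \<in> K" using T(1) by blast
    show "p k * (\<Sum>a\<in>W. (cmod (v k a))\<^sup>2) = p k - p k * (\<Sum>a\<in>I - W. (cmod (v k a))\<^sup>2)"
      unfolding split[OF \<open>k \<in> K\<close>] by (simp add: right_diff_distrib)
  qed
  have up: "(\<Sum>j<card W. \<beta> j) \<le> 1"
  proof -
    have "0 \<le> (\<Sum>k\<in>T. p k * (\<Sum>a\<in>I - W. (cmod (v k a))\<^sup>2))" "0 \<le> (\<Sum>k\<in>K - T. p k)"
      using pT out0 p(1) by (auto intro!: sum_nonneg)
    then show ?thesis using trB' pK by linarith
  qed
  have low: "1 - \<epsilon>1 - \<epsilon>2 \<le> (\<Sum>j<card W. \<beta> j)" using trB' pK \<epsilon>2 \<epsilon>1T by linarith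
  have trunc: "(\<Sum>j<card W. min (\<beta> j) u) \<le> real (card T) * u"
    by (rule truncated_eigenvalue_sum[OF finT _ u _ diag]) (use \<beta>0 in auto)
  have approx: "cmod ((\<Sum>k\<in>K. of_real (p k) * bil I X (v k) (v k)) -
       (\<Sum>j<card W. of_real (\<beta> j) * bil I X (wcut W (y j)) (wcut W (y j)))) \<le> \<epsilon>2 + 2 * sqrt \<epsilon>1"
    if X: "contr I X" for X
  proof -
    have cutsum: "(\<Sum>i\<in>S. w i * wcut W (z i) a * cnj (wcut W (z i) b)) = (if a \<in> W \<and> b \<in> W then \<Sum>i\<in>S. w i * z i a * cnj (z i b) else 0)"
      for S :: "'s set" and w z a b
      by (auto simp: wcut_def)
    \<comment> \<open>Two ensembles with the same matrix have the same expectations, so the new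
      eigenvectors may be exchanged for the projected old ones, which can be compared with
      \<open>v k\<close> one by one.\<close>
    have "trp I X (\<lambda>a b. \<Sum>j<card W. of_real (\<beta> j) * wcut W (y j) a * cnj (wcut W (y j) b))
        = trp I X (\<lambda>a b. \<Sum>k\<in>T. of_real (p k) * wcut W (v k) a * cnj (wcut W (v k) b))"
      by (rule trp_cong) (use By in \<open>auto simp: cutsum B_def\<close>)
    then have "(\<Sum>j<card W. of_real (\<beta> j) * bil I X (wcut W (y j)) (wcut W (y j)))
        = (\<Sum>k\<in>T. of_real (p k) * bil I X (wcut W (v k)) (wcut W (v k)))"
      by (simp only: trp_ensemble)
    moreover have "(\<Sum>k\<in>K. of_real (p k) * bil I X (v k) (v k)) = (\<Sum>k\<in>K - T. of_real (p k) * bil I X (v k) (v k))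
        + (\<Sum>k\<in>T. of_real (p k) * bil I X (v k) (v k))"
      by (rule sum.subset_diff[OF T(1) fin(2)])
    ultimately have "(\<Sum>k\<in>K. of_real (p k) * bil I X (v k) (v k)) -
         (\<Sum>j<card W. of_real (\<beta> j) * bil I X (wcut W (y j)) (wcut W (y j)))
        = (\<Sum>k\<in>K - T. of_real (p k) * bil I X (v k) (v k))
         + (\<Sum>k\<in>T. of_real (p k) * (bil I X (v k) (v k) - bil I X (wcut W (v k)) (wcut W (v k))))"
      by (simp add: sum_subtractf algebra_simps)
    also have "cmod \<dots> \<le> (\<Sum>k\<in>K - T. p k) + 2 * sqrt \<epsilon>1"
    proof (intro order_trans[OF norm_triangle_ineq] add_mono)
      show "cmod (\<Sum>k\<in>K - T. of_real (p k) * bil I X (v k) (v k)) \<le> (\<Sum>k\<in>K - T. p k)"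
      proof (intro order_trans[OF norm_sum] sum_mono)
        fix k assume k: "k \<in> K - T"
        have "cmod (bil I X (v k) (v k)) \<le> 1" using bil_bound_contr[OF X, of "v k"] onb_nrm[OF v, of k] k by simp
        then show "cmod (of_real (p k) * bil I X (v k) (v k)) \<le> p k"
          using p(1)[of k] k by (simp add: norm_mult mult_left_le)
      qed
      let ?D = "\<lambda>k. nrm I (\<lambda>a. v k a - wcut W (v k) a)"
      have "cmod (\<Sum>k\<in>T. of_real (p k) * (bil I X (v k) (v k) - bil I X (wcut W (v k)) (wcut W (v k))))
          \<le> (\<Sum>k\<in>T. p k * (?D k * 2))"
      proof (intro order_trans[OF norm_sum] sum_mono)
        fix k assume k: "k \<in> T"
        have n1: "nrm I (v k) = 1" using onb_nrm[OF v] k T by auto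
        have "cmod (bil I X (v k) (v k) - bil I X (wcut W (v k)) (wcut W (v k))) \<le> ?D k * (nrm I (v k) + nrm I (wcut W (v k)))"
          by (rule contr_diff[OF X])
        also have "\<dots> \<le> ?D k * 2" using nrm_cut_le[OF fin(1) W, of "v k"] n1 by (intro mult_left_mono) auto
        finally show "cmod (of_real (p k) * (bil I X (v k) (v k) - bil I X (wcut W (v k)) (wcut W (v k)))) \<le> p k * (?D k * 2)"
          using pT[OF k] by (simp add: norm_mult mult_left_mono)
      qed
      also have "\<dots> = 2 * (\<Sum>k\<in>T. \<bar>sqrt (p k)\<bar> * \<bar>sqrt (p k) * ?D k\<bar>)"
        unfolding sum_distrib_left
      proof (intro sum.cong refl)
        fix k assume "k \<in> T"
        then have "\<bar>sqrt (p k)\<bar> * \<bar>sqrt (p k) * ?D k\<bar> = p k * ?D k"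
          using pT by (simp add: abs_mult flip: mult.assoc)
        then show "p k * (?D k * 2) = 2 * (\<bar>sqrt (p k)\<bar> * \<bar>sqrt (p k) * ?D k\<bar>)" by simp
      qed
      \<comment> \<open>Cauchy-Schwarz turns the mean distance into the root of the mean squared
        distance, which is the weight outside the window: a gentle measurement estimate.\<close>
      also have "\<dots> \<le> 2 * (L2_set (\<lambda>k. sqrt (p k)) T * L2_set (\<lambda>k. sqrt (p k) * ?D k) T)"
        by (intro mult_left_mono L2_set_mult_ineq) auto
      also have "\<dots> \<le> 2 * (1 * sqrt \<epsilon>1)"
      proof (intro mult_left_mono mult_mono)
        have "(\<Sum>k\<in>T. (sqrt (p k))\<^sup>2) = (\<Sum>k\<in>T. p k)" using pT by (intro sum.cong refl) simp
        also have "\<dots> \<le> 1" unfolding p(2)[symmetric] using T fin p(1) by (intro sum_mono2) auto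
        finally show "L2_set (\<lambda>k. sqrt (p k)) T \<le> 1" by (simp add: L2_set_def)
        have "(\<Sum>k\<in>T. (sqrt (p k) * ?D k)\<^sup>2) = (\<Sum>k\<in>T. p k * (\<Sum>a\<in>I - W. (cmod (v k a))\<^sup>2))"
          using pT by (intro sum.cong refl) (simp add: power_mult_distrib nrm_minus_cut_sq[OF fin(1) W])
        then show "L2_set (\<lambda>k. sqrt (p k) * ?D k) T \<le> sqrt \<epsilon>1" using \<epsilon>1T by (simp add: L2_set_def)
      qed auto
      finally show "cmod (\<Sum>k\<in>T. of_real (p k) * (bil I X (v k) (v k) - bil I X (wcut W (v k)) (wcut W (v k)))) \<le> 2 * sqrt \<epsilon>1"
        by simp
    qed
    finally show ?thesis using \<epsilon>2 by linarith
  qed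
  show thesis by (rule that[OF y0 \<beta>0 \<beta>p up low trunc approx])
qed

subsection \<open>Pulling back along isometries\<close>

text \<open>The operator with columns \<open>\<tau> a\<close>, an isometry when these are
  orthonormal.\<close>

definition lift :: "'a set \<Rightarrow> ('a \<Rightarrow> 'e \<Rightarrow> complex) \<Rightarrow> ('a \<Rightarrow> complex) \<Rightarrow> 'e \<Rightarrow> complex" where
  "lift I \<tau> f = (\<lambda>e. \<Sum>a\<in>I. f a * \<tau> a e)"

lemma bil_sum_left: "bil E X (\<lambda>e. \<Sum>a\<in>I. f a * u a e) v = (\<Sum>a\<in>I. cnj (f a) * bil E X (u a) v)"
  unfolding bil_def by (simp add: ip_sum_left ip_scale_left)

lemma bil_sum_right: "bil E X w (\<lambda>e. \<Sum>a\<in>I. f a * u a e) = (\<Sum>a\<in>I. f a * bil E X w (u a))"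
proof -
  have "bil E X w (\<lambda>e. \<Sum>a\<in>I. f a * u a e) = (\<Sum>c\<in>E. \<Sum>b\<in>E. \<Sum>a\<in>I. f a * (cnj (w c) * X c b * u a b))"
    unfolding bil_explicit by (simp add: sum_distrib_left mult_ac)
  also have "\<dots> = (\<Sum>c\<in>E. \<Sum>a\<in>I. \<Sum>b\<in>E. f a * (cnj (w c) * X c b * u a b))"
    by (intro sum.cong refl sum.swap)
  also have "\<dots> = (\<Sum>a\<in>I. \<Sum>c\<in>E. \<Sum>b\<in>E. f a * (cnj (w c) * X c b * u a b))"
    by (rule sum.swap)
  finally show ?thesis by (simp only: bil_explicit sum_distrib_left)
qed

lemma bil_lift: "bil E X (lift I \<tau> f) (lift I \<tau> g) = bil I (\<lambda>a b. bil E X (\<tau> a) (\<tau> b)) f g"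
proof -
  have "bil E X (lift I \<tau> f) (lift I \<tau> g) = (\<Sum>a\<in>I. cnj (f a) * (\<Sum>b\<in>I. g b * bil E X (\<tau> a) (\<tau> b)))"
    unfolding lift_def bil_sum_left bil_sum_right ..
  then show ?thesis by (simp add: bil_explicit sum_distrib_left mult_ac)
qed

lemma nrm_lift:
  assumes fin: "finite I" and \<tau>: "\<And>a b. a \<in> I \<Longrightarrow> b \<in> I \<Longrightarrow> ip E (\<tau> a) (\<tau> b) = of_bool (a = b)"
  shows "nrm E (lift I \<tau> f) = nrm I f"
proof -
  have "ip E (lift I \<tau> f) (lift I \<tau> f) = (\<Sum>a\<in>I. \<Sum>b\<in>I. cnj (f a) * (f b * ip E (\<tau> a) (\<tau> b)))"
    unfolding lift_def by (simp add: ip_sum_left ip_sum_right ip_scale_left ip_scale_right sum_distrib_left)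
  also have "\<dots> = (\<Sum>a\<in>I. \<Sum>b\<in>I. if a = b then cnj (f a) * f b else 0)"
    using \<tau> by (intro sum.cong refl) auto
  also have "\<dots> = ip I f f" using fin by (simp add: ip_def)
  finally have "complex_of_real ((nrm E (lift I \<tau> f))\<^sup>2) = of_real ((nrm I f)\<^sup>2)"
    by (simp only: ip_self)
  then have "(nrm E (lift I \<tau> f))\<^sup>2 = (nrm I f)\<^sup>2" using of_real_eq_iff by blast
  then show ?thesis by (rule power2_eq_imp_eq) auto
qed

text \<open>Compression of a contraction by an isometry. Estimates on the large space thereby reduce
  to those assumed for all contractions on the small one.\<close>

lemma contr_lift:
  assumes fin: "finite I" and \<tau>: "\<And>a b. a \<in> I \<Longrightarrow> b \<in> I \<Longrightarrow> ip E (\<tau> a) (\<tau> b) = of_bool (a = b)"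
    and X: "contr E X"
  shows "contr I (\<lambda>a b. bil E X (\<tau> a) (\<tau> b))"
  unfolding contr_def bil_lift[symmetric]
  using X unfolding contr_def by (metis nrm_lift[OF fin \<tau>])

subsection \<open>A finite reference frame\<close>

text \<open>A basis index is a triple \<open>(i, j, s)\<close>: system, flattening ancilla, reference frame with charge
  label \<open>s\<close>; the total charge is the label \<open>c i + s\<close>. In a sector of total charge \<open>x\<close> that
  contains a partner \<open>x - c i\<close> for every \<open>i\<close> in the window, \<open>V\<close> acts; elsewhere the identity acts.\<close>

locale frame =
  fixes I W :: "'i set" and J :: "'j set" and F :: "'g::ab_group_add set" and c :: "'i \<Rightarrow> 'g"
    and V :: "'i \<times> 'j \<Rightarrow> 'i \<times> 'j \<Rightarrow> complex"
  assumes finI: "finite I" and W: "W \<subseteq> I" and finJ: "finite J" and finF: "finite F" and F: "F \<noteq> {}"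
    and V: "\<And>b b'. b \<in> W \<times> J \<Longrightarrow> b' \<in> W \<times> J \<Longrightarrow> (\<Sum>a\<in>W \<times> J. cnj (V a b) * V a b') = of_bool (b = b')"
begin

definition "E = I \<times> (J \<times> F)"

definition lab :: "'i \<times> ('j \<times> 'g) \<Rightarrow> 'g" where
  "lab a = c (fst a) + snd (snd a)"

definition full :: "'g set" where
  "full = {x. \<forall>i\<in>W. x - c i \<in> F}"

definition act :: "'i \<times> ('j \<times> 'g) \<Rightarrow> bool" where
  "act a \<longleftrightarrow> fst a \<in> W \<and> lab a \<in> full"

definition sys :: "'i \<times> ('j \<times> 'g) \<Rightarrow> 'i \<times> 'j" where
  "sys a = (fst a, fst (snd a))"

definition U :: "'i \<times> ('j \<times> 'g) \<Rightarrow> 'i \<times> ('j \<times> 'g) \<Rightarrow> complex" where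
  "U a b = (if act b then (if act a \<and> lab a = lab b then V (sys a) (sys b) else 0) else of_bool (a = b))"

lemma finW: "finite W" using finI W finite_subset by blast

lemma finE: "finite E" using finI finJ finF by (simp add: E_def)

lemma U_lab: "U a b \<noteq> 0 \<Longrightarrow> lab a = lab b"
  by (auto simp: U_def split: if_splits)

text \<open>Within one total charge the frame label is determined by the system index, so an active
  sector is a copy of \<open>W \<times> J\<close>.\<close>

lemma sum_act:
  assumes x: "x \<in> full"
  shows "(\<Sum>a\<in>E. if act a \<and> lab a = x then g a else 0) = (\<Sum>b\<in>W \<times> J. g (fst b, snd b, x - c (fst b)))"
proof -
  have "(\<Sum>a\<in>E. if act a \<and> lab a = x then g a else 0) = sum g {a\<in>E. act a \<and> lab a = x}"
    by (rule sum.inter_filter[symmetric, OF finE])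
  also have "\<dots> = (\<Sum>b\<in>W \<times> J. g (fst b, snd b, x - c (fst b)))"
    by (rule sum.reindex_bij_witness[where i = "\<lambda>b. (fst b, snd b, x - c (fst b))" and j = sys])
      (use x W in \<open>auto simp: E_def act_def lab_def sys_def full_def\<close>)
  finally show ?thesis .
qed

lemma act_sys: "b \<in> E \<Longrightarrow> act b \<Longrightarrow> sys b \<in> W \<times> J"
  by (auto simp: E_def act_def sys_def)

lemma U_columns:
  assumes b: "b \<in> E" "b' \<in> E"
  shows "ip E (\<lambda>a. U a b) (\<lambda>a. U a b') = of_bool (b = b')"
proof -
  consider (both) "act b" "act b'" | (left) "act b" "\<not> act b'" | (right) "\<not> act b" "act b'" | (none) "\<not> act b" "\<not> act b'"
    by blast
  then show ?thesis
  proof cases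
    case both
    show ?thesis
    proof (cases "lab b = lab b'")
      case True
      have "ip E (\<lambda>a. U a b) (\<lambda>a. U a b')
          = (\<Sum>a\<in>E. if act a \<and> lab a = lab b' then cnj (V (sys a) (sys b)) * V (sys a) (sys b') else 0)"
        unfolding ip_def by (intro sum.cong refl) (use both True in \<open>simp add: U_def\<close>)
      also have "\<dots> = (\<Sum>a\<in>W \<times> J. cnj (V a (sys b)) * V a (sys b'))"
        using both by (subst sum_act) (auto simp: act_def sys_def)
      also have "\<dots> = of_bool (sys b = sys b')" by (rule V) (use b both act_sys in auto)
      also have "sys b = sys b' \<longleftrightarrow> b = b'" using True by (auto simp: sys_def lab_def prod_eq_iff)
      finally show ?thesis .
    next
      case False
      then have "ip E (\<lambda>a. U a b) (\<lambda>a. U a b') = 0"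
        unfolding ip_def by (intro sum.neutral) (use both in \<open>auto simp: U_def\<close>)
      then show ?thesis using False by auto
    qed
  next
    case left
    have "ip E (\<lambda>a. U a b) (\<lambda>a. U a b') = (\<Sum>a\<in>E. 0)"
      unfolding ip_def by (intro sum.cong refl) (use left in \<open>auto simp: U_def\<close>)
    then show ?thesis using left by auto
  next
    case right
    have "ip E (\<lambda>a. U a b) (\<lambda>a. U a b') = (\<Sum>a\<in>E. 0)"
      unfolding ip_def by (intro sum.cong refl) (use right in \<open>auto simp: U_def\<close>)
    then show ?thesis using right by auto
  next
    case none
    have "ip E (\<lambda>a. U a b) (\<lambda>a. U a b') = (\<Sum>a\<in>E. if a = b then of_bool (b = b') else 0)"
      unfolding ip_def by (intro sum.cong refl) (use none in \<open>auto simp: U_def\<close>)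
    then show ?thesis using b finE by simp
  qed
qed

abbreviation nF :: complex where "nF \<equiv> of_real (sqrt (real (card F)))"

lemma card_F_pos: "0 < card F"
  using finF F by (simp add: card_gt_0_iff)

lemma nF_sq: "nF * nF = of_nat (card F)"
proof -
  have "nF * nF = complex_of_real (sqrt (real (card F)) * sqrt (real (card F)))" by (rule of_real_mult[symmetric])
  also have "sqrt (real (card F)) * sqrt (real (card F)) = real (card F)" by simp
  finally show ?thesis by simp
qed

text \<open>The vector f tensored with the uniform superposition of all frame labels.\<close>

definition emb :: "('i \<times> 'j \<Rightarrow> complex) \<Rightarrow> 'i \<times> ('j \<times> 'g) \<Rightarrow> complex" where
  "emb f a = f (sys a) / nF"

lemma U_emb:
  assumes a: "a \<in> E"
  shows "ap E U (emb f) a = (if act a then emb (ap (W \<times> J) V f) a else emb f a)"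
proof (cases "act a")
  case True
  have "ap E U (emb f) a = (\<Sum>b\<in>E. if act b \<and> lab b = lab a then V (sys a) (sys b) * emb f b else 0)"
    using a unfolding ap_def by (simp, intro sum.cong refl) (use True in \<open>auto simp: U_def\<close>)
  also have "\<dots> = (\<Sum>b\<in>W \<times> J. V (sys a) b * (f b / nF))"
    using True by (subst sum_act) (auto simp: act_def sys_def emb_def)
  also have "\<dots> = emb (ap (W \<times> J) V f) a"
    using act_sys[OF a True] by (simp add: emb_def ap_def sum_divide_distrib)
  finally show ?thesis using True by simp
next
  case False
  have "ap E U (emb f) a = (\<Sum>b\<in>E. if b = a then emb f b else 0)"
    using a unfolding ap_def by (simp, intro sum.cong refl) (use False in \<open>auto simp: U_def\<close>)
  then show ?thesis using a finE False by simp
qed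

lemma sum_E: "(\<Sum>a\<in>E. g a) = (\<Sum>i\<in>I. \<Sum>j\<in>J. \<Sum>s\<in>F. g (i, j, s))"
  unfolding E_def by (simp add: sum.cartesian_product)

text \<open>The shift of the label that conserves the charge is invisible in a uniform
  superposition, except at labels whose sector is incomplete; for each \<open>i\<close> in the
  window these are at most a fraction \<theta>.\<close>

lemma U_emb_close:
  assumes f: "\<And>b. b \<notin> W \<times> J \<Longrightarrow> f b = 0"
    and \<theta>: "0 \<le> \<theta>" "\<And>i. i \<in> W \<Longrightarrow> real (card {s\<in>F. c i + s \<notin> full}) \<le> \<theta> * real (card F)"
  shows "nrm E (\<lambda>a. ap E U (emb f) a - emb (ap (W \<times> J) V f) a)
    \<le> sqrt \<theta> * nrm (W \<times> J) (\<lambda>b. f b - ap (W \<times> J) V f b)"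
proof -
  let ?g = "\<lambda>b. f b - ap (W \<times> J) V f b"
  let ?n = "real (card F)"
  have n: "0 < ?n" using card_F_pos by simp
  have "(nrm E (\<lambda>a. ap E U (emb f) a - emb (ap (W \<times> J) V f) a))\<^sup>2
      = (\<Sum>a\<in>E. (if act a then 0 else (cmod (?g (sys a)))\<^sup>2 / ?n))"
    unfolding nrm_sq
  proof (intro sum.cong refl)
    fix a assume "a \<in> E"
    then show "(cmod (ap E U (emb f) a - emb (ap (W \<times> J) V f) a))\<^sup>2 = (if act a then 0 else (cmod (?g (sys a)))\<^sup>2 / ?n)"
      by (simp add: U_emb emb_def norm_divide power_divide flip: diff_divide_distrib)
  qed
  also have "\<dots> = (\<Sum>i\<in>I. \<Sum>j\<in>J. \<Sum>s\<in>F. if act (i, j, s) then 0 else (cmod (?g (i, j)))\<^sup>2 / ?n)"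
    unfolding sum_E sys_def by (simp only: fst_conv snd_conv)
  \<comment> \<open>Outside the window both f and its image under V vanish, so no error arises
    there.\<close>
  also have "\<dots> = (\<Sum>i\<in>W. \<Sum>j\<in>J. \<Sum>s\<in>F. if act (i, j, s) then 0 else (cmod (?g (i, j)))\<^sup>2 / ?n)"
    by (rule sum.mono_neutral_right[OF finI W]) (use f in \<open>auto simp: ap_def intro!: sum.neutral\<close>)
  also have "\<dots> = (\<Sum>i\<in>W. \<Sum>j\<in>J. real (card {s\<in>F. c i + s \<notin> full}) * ((cmod (?g (i, j)))\<^sup>2 / ?n))"
  proof (intro sum.cong refl)
    fix i j assume "i \<in> W"
    have "(\<Sum>s\<in>F. if act (i, j, s) then 0 else (cmod (?g (i, j)))\<^sup>2 / ?n)
        = (\<Sum>s\<in>F. if c i + s \<notin> full then (cmod (?g (i, j)))\<^sup>2 / ?n else 0)"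
      using \<open>i \<in> W\<close> by (intro sum.cong refl) (auto simp: act_def lab_def)
    also have "\<dots> = (\<Sum>s\<in>{s\<in>F. c i + s \<notin> full}. (cmod (?g (i, j)))\<^sup>2 / ?n)"
      by (rule sum.inter_filter[symmetric, OF finF])
    finally show "(\<Sum>s\<in>F. if act (i, j, s) then 0 else (cmod (?g (i, j)))\<^sup>2 / ?n)
        = real (card {s\<in>F. c i + s \<notin> full}) * ((cmod (?g (i, j)))\<^sup>2 / ?n)" by simp
  qed
  also have "\<dots> \<le> (\<Sum>i\<in>W. \<Sum>j\<in>J. (\<theta> * ?n) * ((cmod (?g (i, j)))\<^sup>2 / ?n))"
    using \<theta>(2) by (intro sum_mono mult_right_mono) auto
  also have "\<dots> = \<theta> * (nrm (W \<times> J) ?g)\<^sup>2"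
    using n by (simp add: nrm_sq sum.cartesian_product sum_distrib_left case_prod_unfold)
  also have "\<dots> = (sqrt \<theta> * nrm (W \<times> J) ?g)\<^sup>2" using \<theta>(1) by (simp add: power_mult_distrib)
  finally show ?thesis by (rule power2_le_imp_le) (use \<theta>(1) in auto)
qed

text \<open>System vector f, embezzling level l, uniform frame: the product vectors that make up a
  state tensored with the ancilla state.\<close>

definition probe :: "('i \<Rightarrow> complex) \<Rightarrow> 'j \<Rightarrow> 'i \<times> ('j \<times> 'g) \<Rightarrow> complex" where
  "probe f l = emb (\<lambda>b. f (fst b) * of_bool (snd b = l))"

lemma probe_lift:
  assumes "a \<in> E"
  shows "probe f l a = lift I (\<lambda>i. probe (\<lambda>i'. of_bool (i' = i)) l) f a"
proof -
  have "lift I (\<lambda>i. probe (\<lambda>i'. of_bool (i' = i)) l) f a = (\<Sum>i\<in>I. if i = fst a then f i * of_bool (fst (snd a) = l) / nF else 0)"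
    unfolding lift_def probe_def emb_def sys_def by (intro sum.cong refl) auto
  also have "\<dots> = probe f l a" using assms finI by (auto simp: E_def probe_def emb_def sys_def)
  finally show ?thesis by simp
qed

lemma ip_probe:
  assumes "l \<in> J" "i \<in> I" "i' \<in> I"
  shows "ip E (probe (\<lambda>k. of_bool (k = i)) l) (probe (\<lambda>k. of_bool (k = i')) l) = of_bool (i = i')"
proof -
  have "ip E (probe (\<lambda>k. of_bool (k = i)) l) (probe (\<lambda>k. of_bool (k = i')) l)
      = (\<Sum>k\<in>I. if k = i then \<Sum>j\<in>J. if j = l then \<Sum>s\<in>F. of_bool (k = i') / (nF * nF) else 0 else 0)"
    unfolding ip_def sum_E by (intro sum.cong refl) (auto simp: probe_def emb_def sys_def intro!: sum.cong sum.neutral)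
  also have "\<dots> = of_bool (i = i')"
  proof (cases "i = i'")
    case True
    then show ?thesis using assms finI finJ card_F_pos by (simp only: nF_sq) simp
  next
    case False
    then show ?thesis by (intro trans[OF sum.neutral]) (auto intro!: sum.neutral)
  qed
  finally show ?thesis .
qed

lemma nrm_probe: "l \<in> J \<Longrightarrow> nrm E (probe f l) = nrm I f"
  using nrm_lift[OF finI ip_probe, of l f] nrm_cong[of E "probe f l", OF probe_lift] by metis

lemma bil_probe:
  "bil E X (probe f l) (probe f l) = bil I (\<lambda>i i'. bil E X (probe (\<lambda>k. of_bool (k = i)) l) (probe (\<lambda>k. of_bool (k = i')) l)) f f"
  unfolding bil_lift[symmetric] by (rule bil_cong) (rule probe_lift; assumption)+

text \<open>For each level l the map from f to \<open>probe f l\<close> is an isometry, so X pulls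
  back to a contraction on the system; the errors are then averaged over l with the weights
  \<open>a\<close>.\<close>

lemma ensemble_probe_close:
  fixes a :: "'j \<Rightarrow> real"
  assumes a: "\<And>l. l \<in> J \<Longrightarrow> 0 \<le> a l" "(\<Sum>l\<in>J. a l) = 1"
    and close: "\<And>X. contr I X \<Longrightarrow> cmod ((\<Sum>k\<in>K. of_real (p k) * bil I X (v k) (v k)) -
       (\<Sum>k\<in>K'. of_real (\<beta> k) * bil I X (y k) (y k))) \<le> \<epsilon>"
    and X: "contr E X"
  shows "cmod ((\<Sum>x\<in>K \<times> J. of_real (p (fst x) * a (snd x)) * bil E X (probe (v (fst x)) (snd x)) (probe (v (fst x)) (snd x)))
    - (\<Sum>x\<in>K' \<times> J. of_real (\<beta> (fst x) * a (snd x)) * bil E X (probe (y (fst x)) (snd x)) (probe (y (fst x)) (snd x)))) \<le> \<epsilon>"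
proof -
  define Y where "Y = (\<lambda>l i i'. bil E X (probe (\<lambda>k. of_bool (k = i)) l) (probe (\<lambda>k. of_bool (k = i')) l))"
  have eq: "(\<Sum>x\<in>K \<times> J. of_real (p (fst x) * a (snd x)) * bil E X (probe (v (fst x)) (snd x)) (probe (v (fst x)) (snd x)))
      = (\<Sum>l\<in>J. of_real (a l) * (\<Sum>k\<in>K. of_real (p k) * bil I (Y l) (v k) (v k)))" for K and p :: "'k \<Rightarrow> real" and v
  proof -
    have "(\<Sum>x\<in>K \<times> J. of_real (p (fst x) * a (snd x)) * bil E X (probe (v (fst x)) (snd x)) (probe (v (fst x)) (snd x)))
        = (\<Sum>k\<in>K. \<Sum>l\<in>J. of_real (a l) * (of_real (p k) * bil I (Y l) (v k) (v k)))"
      unfolding Y_def bil_probe[symmetric] by (simp add: sum.cartesian_product case_prod_unfold mult_ac)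
    then show ?thesis by (subst (asm) sum.swap) (simp add: sum_distrib_left)
  qed
  have cY: "contr I (Y l)" if "l \<in> J" for l
    unfolding Y_def by (rule contr_lift[OF finI ip_probe[OF that] X])
  have "cmod ((\<Sum>l\<in>J. of_real (a l) * (\<Sum>k\<in>K. of_real (p k) * bil I (Y l) (v k) (v k)))
      - (\<Sum>l\<in>J. of_real (a l) * (\<Sum>k\<in>K'. of_real (\<beta> k) * bil I (Y l) (y k) (y k))))
      \<le> (\<Sum>l\<in>J. a l * \<epsilon>)"
    unfolding sum_subtractf[symmetric] right_diff_distrib[symmetric]
  proof (intro order_trans[OF norm_sum] sum_mono)
    fix l assume l: "l \<in> J"
    show "cmod (of_real (a l) * ((\<Sum>k\<in>K. of_real (p k) * bil I (Y l) (v k) (v k)) - (\<Sum>k\<in>K'. of_real (\<beta> k) * bil I (Y l) (y k) (y k)))) \<le> a l * \<epsilon>"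
      using close[OF cY[OF l]] a(1)[OF l] by (simp add: norm_mult mult_left_mono)
  qed
  also have "\<dots> = \<epsilon>" using a(2) by (simp flip: sum_distrib_right)
  finally show ?thesis unfolding eq .
qed

lemma ap_U_lift: "a \<in> E \<Longrightarrow> ap E U f a = lift E (\<lambda>b a. U a b) f a"
  by (simp add: ap_def lift_def mult.commute)

lemma bil_U:
  "bil E X (ap E U f) (ap E U f) = bil E (\<lambda>b b'. bil E X (\<lambda>a. U a b) (\<lambda>a. U a b')) f f"
  unfolding bil_lift[symmetric] by (rule bil_cong) (rule ap_U_lift; assumption)+

lemma nrm_U: "nrm E (ap E U f) = nrm E f"
  using nrm_lift[OF finE U_columns, of f] nrm_cong[of E "ap E U f", OF ap_U_lift] by metis

end

section \<open>Product bases and the unitary between two of them\<close>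

lemma ip_lift:
  assumes fin: "finite I" and \<tau>: "\<And>a b. a \<in> I \<Longrightarrow> b \<in> I \<Longrightarrow> ip E (\<tau> a) (\<tau> b) = of_bool (a = b)"
  shows "ip E (lift I \<tau> f) (lift I \<tau> g) = ip I f g"
proof -
  have "ip E (lift I \<tau> f) (lift I \<tau> g) = (\<Sum>a\<in>I. \<Sum>b\<in>I. cnj (f a) * (g b * ip E (\<tau> a) (\<tau> b)))"
    unfolding lift_def by (simp add: ip_sum_left ip_sum_right ip_scale_left ip_scale_right sum_distrib_left)
  also have "\<dots> = (\<Sum>a\<in>I. \<Sum>b\<in>I. if a = b then cnj (f a) * g b else 0)"
    using \<tau> by (intro sum.cong refl) auto
  also have "\<dots> = ip I f g" using fin by (simp add: ip_def)
  finally show ?thesis .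
qed

lemma onb_times:
  assumes y: "onb K W y" and finJ: "finite J"
  shows "onb (K \<times> J) (W \<times> J) (\<lambda>x b. y (fst x) (fst b) * of_bool (snd b = snd x))"
  unfolding onb_def
proof (intro conjI ballI)
  fix x x' assume x: "x \<in> K \<times> J" "x' \<in> K \<times> J"
  have "ip (W \<times> J) (\<lambda>b. y (fst x) (fst b) * of_bool (snd b = snd x)) (\<lambda>b. y (fst x') (fst b) * of_bool (snd b = snd x'))
      = (\<Sum>i\<in>W. \<Sum>j\<in>J. cnj (y (fst x) i) * y (fst x') i * (if j = snd x then of_bool (snd x = snd x') else 0))"
    unfolding ip_def sum.cartesian_product by (intro sum.cong refl) auto
  also have "\<dots> = ip W (y (fst x)) (y (fst x')) * of_bool (snd x = snd x')"
    using x finJ unfolding sum_distrib_left[symmetric] by (simp add: ip_def mem_Times_iff flip: sum_distrib_right)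
  also have "\<dots> = of_bool (x = x')" using y x by (auto simp: onb_def prod_eq_iff mem_Times_iff)
  finally show "ip (W \<times> J) (\<lambda>b. y (fst x) (fst b) * of_bool (snd b = snd x)) (\<lambda>b. y (fst x') (fst b) * of_bool (snd b = snd x'))
      = of_bool (x = x')" .
next
  fix a b assume ab: "a \<in> W \<times> J" "b \<in> W \<times> J"
  have "(\<Sum>x\<in>K \<times> J. y (fst x) (fst a) * of_bool (snd a = snd x) * cnj (y (fst x) (fst b) * of_bool (snd b = snd x)))
      = (\<Sum>k\<in>K. \<Sum>j\<in>J. y k (fst a) * cnj (y k (fst b)) * (if j = snd a then of_bool (snd a = snd b) else 0))"
    unfolding sum.cartesian_product by (intro sum.cong refl) auto
  also have "\<dots> = (\<Sum>k\<in>K. y k (fst a) * cnj (y k (fst b))) * of_bool (snd a = snd b)"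
    using ab finJ unfolding sum_distrib_left[symmetric] by (simp add: mem_Times_iff flip: sum_distrib_right)
  also have "\<dots> = of_bool (a = b)" using y ab by (auto simp: onb_def prod_eq_iff mem_Times_iff)
  finally show "(\<Sum>x\<in>K \<times> J. y (fst x) (fst a) * of_bool (snd a = snd x) * cnj (y (fst x) (fst b) * of_bool (snd b = snd x)))
      = of_bool (a = b)" .
qed

text \<open>The operator that sends \<open>Y x\<close> to \<open>Z (\<pi> x)\<close>.\<close>

definition transition :: "'i set \<Rightarrow> ('i \<Rightarrow> 'a \<Rightarrow> complex) \<Rightarrow> ('i \<Rightarrow> 'a \<Rightarrow> complex) \<Rightarrow> ('i \<Rightarrow> 'i) \<Rightarrow> 'a \<Rightarrow> 'a \<Rightarrow> complex" where
  "transition I Y Z \<pi> a b = (\<Sum>x\<in>I. cnj (Y x b) * Z (\<pi> x) a)"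

lemma transition_unitary:
  assumes Y: "onb I A Y" and Z: "onb I A Z" and \<pi>: "bij_betw \<pi> I I" and fin: "finite I"
    and b: "b \<in> A" "b' \<in> A"
  shows "(\<Sum>a\<in>A. cnj (transition I Y Z \<pi> a b) * transition I Y Z \<pi> a b') = of_bool (b = b')"
proof -
  have \<tau>: "ip A (Z (\<pi> x)) (Z (\<pi> x')) = of_bool (x = x')" if "x \<in> I" "x' \<in> I" for x x'
  proof -
    have "\<pi> x \<in> I" "\<pi> x' \<in> I" using \<pi> that by (auto simp: bij_betw_def)
    then have "ip A (Z (\<pi> x)) (Z (\<pi> x')) = of_bool (\<pi> x = \<pi> x')" using Z by (simp add: onb_def)
    then show ?thesis using inj_on_eq_iff[OF bij_betw_imp_inj_on[OF \<pi>] that] by simp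
  qed
  have "(\<Sum>a\<in>A. cnj (transition I Y Z \<pi> a b) * transition I Y Z \<pi> a b')
      = ip A (lift I (\<lambda>x. Z (\<pi> x)) (\<lambda>x. cnj (Y x b))) (lift I (\<lambda>x. Z (\<pi> x)) (\<lambda>x. cnj (Y x b')))"
    by (simp add: ip_def lift_def transition_def)
  also have "\<dots> = ip I (\<lambda>x. cnj (Y x b)) (\<lambda>x. cnj (Y x b'))" by (rule ip_lift[OF fin \<tau>])
  also have "\<dots> = of_bool (b = b')" using Y b by (simp add: ip_def onb_def)
  finally show ?thesis .
qed

lemma transition_ap:
  assumes Y: "onb I A Y" and fin: "finite I" and x: "x \<in> I" and a: "a \<in> A"
  shows "ap A (transition I Y Z \<pi>) (Y x) a = Z (\<pi> x) a"
proof -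
  have "ap A (transition I Y Z \<pi>) (Y x) a = (\<Sum>b\<in>A. \<Sum>x'\<in>I. Z (\<pi> x') a * (cnj (Y x' b) * Y x b))"
    using a by (simp add: ap_def transition_def sum_distrib_left sum_distrib_right mult_ac)
  also have "\<dots> = (\<Sum>x'\<in>I. Z (\<pi> x') a * ip A (Y x') (Y x))"
    by (subst sum.swap) (simp add: ip_def sum_distrib_left)
  also have "\<dots> = (\<Sum>x'\<in>I. if x' = x then Z (\<pi> x') a else 0)"
    using Y x by (intro sum.cong refl) (auto simp: onb_def)
  finally show ?thesis using x fin by simp
qed

context frame
begin

lemma probe_wcut: "probe (wcut W f) l = emb (\<lambda>b. wcut (W \<times> J) (\<lambda>b. f (fst b) * of_bool (snd b = l)) b)" if "l \<in> J"
  using that by (auto simp: probe_def emb_def wcut_def sys_def fun_eq_iff)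

text \<open>The expectations S1 to S5 interpolate: from the first state to its windowed form
  (\<epsilon>), from the action of U to that of V (4 sqrt \<theta>, from unit vectors at distance at
  most 2 sqrt \<theta>), between the matched spectra (\<epsilon>'), and from the windowed form of
  the second state to that state (\<epsilon>).\<close>

lemma conversion_bound:
  fixes a :: "'j \<Rightarrow> real" and \<beta> \<beta>' :: "nat \<Rightarrow> real"
  defines "KJ \<equiv> {..<card W} \<times> J"
  assumes a: "\<And>l. l \<in> J \<Longrightarrow> 0 \<le> a l" "(\<Sum>l\<in>J. a l) = 1"
    and y: "onb {..<card W} W y" and z: "onb {..<card W} W z"
    and \<beta>: "\<And>k. k < card W \<Longrightarrow> 0 \<le> \<beta> k" "(\<Sum>k<card W. \<beta> k) \<le> 1"
    and \<pi>: "bij_betw \<pi> KJ KJ"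
    and Veq: "V = transition KJ (\<lambda>x b. y (fst x) (fst b) * of_bool (snd b = snd x)) (\<lambda>x b. z (fst x) (fst b) * of_bool (snd b = snd x)) \<pi>"
    and \<theta>: "0 \<le> \<theta>" "\<And>i. i \<in> W \<Longrightarrow> real (card {s\<in>F. c i + s \<notin> full}) \<le> \<theta> * real (card F)"
    and \<rho>: "\<And>X. contr I X \<Longrightarrow> cmod ((\<Sum>k\<in>K. of_real (p k) * bil I X (v k) (v k)) -
       (\<Sum>k<card W. of_real (\<beta> k) * bil I X (wcut W (y k)) (wcut W (y k)))) \<le> \<epsilon>"
    and \<sigma>: "\<And>X. contr I X \<Longrightarrow> cmod ((\<Sum>k\<in>K'. of_real (r k) * bil I X (v' k) (v' k)) -
       (\<Sum>k<card W. of_real (\<beta>' k) * bil I X (wcut W (z k)) (wcut W (z k)))) \<le> \<epsilon>"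
    and flat: "(\<Sum>x\<in>KJ. \<bar>\<beta> (fst x) * a (snd x) - \<beta>' (fst (\<pi> x)) * a (snd (\<pi> x))\<bar>) \<le> \<epsilon>'"
    and X: "contr E X"
  shows "cmod ((\<Sum>x\<in>K \<times> J. of_real (p (fst x) * a (snd x)) * bil E X (ap E U (probe (v (fst x)) (snd x))) (ap E U (probe (v (fst x)) (snd x))))
    - (\<Sum>x\<in>K' \<times> J. of_real (r (fst x) * a (snd x)) * bil E X (probe (v' (fst x)) (snd x)) (probe (v' (fst x)) (snd x))))
    \<le> 2 * \<epsilon> + 4 * sqrt \<theta> + \<epsilon>'"
proof -
  let ?Y = "\<lambda>x b. y (fst x) (fst b) * of_bool (snd b = snd x)"
  let ?Z = "\<lambda>x b. z (fst x) (fst b) * of_bool (snd b = snd x)"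
  define QU where "QU = (\<lambda>f. bil E X (ap E U f) (ap E U f))"
  define Q where "Q = (\<lambda>f. bil E X f f)"
  define py where "py = (\<lambda>x. probe (wcut W (y (fst x))) (snd x))"
  define pz where "pz = (\<lambda>x. probe (wcut W (z (fst x))) (snd x))"
  define S1 where "S1 = (\<Sum>x\<in>K \<times> J. of_real (p (fst x) * a (snd x)) * QU (probe (v (fst x)) (snd x)))"
  define S2 where "S2 = (\<Sum>x\<in>KJ. of_real (\<beta> (fst x) * a (snd x)) * QU (py x))"
  define S3 where "S3 = (\<Sum>x\<in>KJ. of_real (\<beta> (fst x) * a (snd x)) * Q (pz (\<pi> x)))"
  define S4 where "S4 = (\<Sum>x\<in>KJ. of_real (\<beta>' (fst x) * a (snd x)) * Q (pz x))"
  define S5 where "S5 = (\<Sum>x\<in>K' \<times> J. of_real (r (fst x) * a (snd x)) * Q (probe (v' (fst x)) (snd x)))"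
  have finKJ: "finite KJ" using finJ by (simp add: KJ_def)
  \<comment> \<open>U is absorbed into the test operator, so the window estimate for the first state
    applies although U has already acted.\<close>
  have XU: "contr E (\<lambda>b b'. bil E X (\<lambda>a. U a b) (\<lambda>a. U a b'))"
    by (rule contr_lift[OF finE U_columns X])
  have 12: "cmod (S1 - S2) \<le> \<epsilon>"
    unfolding S1_def S2_def QU_def bil_U py_def KJ_def by (rule ensemble_probe_close[OF a \<rho> XU])
  have 45: "cmod (S5 - S4) \<le> \<epsilon>"
    unfolding S5_def S4_def Q_def pz_def KJ_def by (rule ensemble_probe_close[OF a \<sigma> X])
  have oY: "onb KJ (W \<times> J) ?Y" and oZ: "onb KJ (W \<times> J) ?Z"
    unfolding KJ_def by (rule onb_times[OF y finJ], rule onb_times[OF z finJ])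
  have \<pi>in: "\<pi> x \<in> KJ" if "x \<in> KJ" for x using \<pi> that by (auto simp: bij_betw_def)
  have w0: "0 \<le> \<beta> (fst x) * a (snd x)" if "x \<in> KJ" for x
    using that \<beta>(1) a(1) by (auto simp: KJ_def)
  have npz: "nrm E (pz x) = 1" if "x \<in> KJ" for x
    unfolding pz_def using that onb_nrm[OF z, of "fst x"] by (auto simp: KJ_def nrm_probe nrm_cut[OF finI W])
  have npy: "nrm E (py x) = 1" if "x \<in> KJ" for x
    unfolding py_def using that onb_nrm[OF y, of "fst x"] by (auto simp: KJ_def nrm_probe nrm_cut[OF finI W])
  have close: "cmod (QU (py x) - Q (pz (\<pi> x))) \<le> 4 * sqrt \<theta>" if x: "x \<in> KJ" for x
  proof -
    define f where "f = wcut (W \<times> J) (?Y x)"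
    have pyx: "py x = emb f" unfolding py_def f_def by (rule probe_wcut) (use x in \<open>auto simp: KJ_def\<close>)
    have Vf: "ap (W \<times> J) V f b = wcut (W \<times> J) (?Z (\<pi> x)) b" for b
    proof (cases "b \<in> W \<times> J")
      case True
      have "ap (W \<times> J) V f b = ap (W \<times> J) V (?Y x) b"
        unfolding ap_def f_def wcut_def by (simp cong: sum.cong)
      also have "\<dots> = ?Z (\<pi> x) b" unfolding Veq by (rule transition_ap[OF oY finKJ x True])
      finally show ?thesis using True by (simp add: wcut_def)
    qed (simp add: ap_def wcut_def)
    have pzx: "pz (\<pi> x) = emb (ap (W \<times> J) V f)"
      unfolding pz_def Vf using \<pi>in[OF x] by (subst probe_wcut) (auto simp: KJ_def)
    have "nrm (W \<times> J) (\<lambda>b. f b - ap (W \<times> J) V f b) \<le> nrm (W \<times> J) f + nrm (W \<times> J) (ap (W \<times> J) V f)"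
      by (rule nrm_diff_le)
    also have "nrm (W \<times> J) f = nrm (W \<times> J) (?Y x)" by (rule nrm_cong) (simp add: f_def wcut_def)
    also have "\<dots> = 1" by (rule onb_nrm[OF oY x])
    also have "nrm (W \<times> J) (ap (W \<times> J) V f) = nrm (W \<times> J) (?Z (\<pi> x))"
      by (rule nrm_cong) (simp add: Vf wcut_def)
    also have "\<dots> = 1" by (rule onb_nrm[OF oZ \<pi>in[OF x]])
    finally have n2: "nrm (W \<times> J) (\<lambda>b. f b - ap (W \<times> J) V f b) \<le> 2" by simp
    have "nrm E (\<lambda>e. ap E U (py x) e - pz (\<pi> x) e) \<le> sqrt \<theta> * nrm (W \<times> J) (\<lambda>b. f b - ap (W \<times> J) V f b)"
      unfolding pyx pzx by (rule U_emb_close) (use \<theta> in \<open>auto simp: f_def wcut_def\<close>)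
    also have "\<dots> \<le> sqrt \<theta> * 2" using n2 \<theta>(1) by (intro mult_left_mono) auto
    finally have d: "nrm E (\<lambda>e. ap E U (py x) e - pz (\<pi> x) e) \<le> sqrt \<theta> * 2" .
    have "cmod (QU (py x) - Q (pz (\<pi> x))) \<le> nrm E (\<lambda>e. ap E U (py x) e - pz (\<pi> x) e) * (nrm E (ap E U (py x)) + nrm E (pz (\<pi> x)))"
      unfolding QU_def Q_def by (rule contr_diff[OF X])
    also have "\<dots> = nrm E (\<lambda>e. ap E U (py x) e - pz (\<pi> x) e) * 2"
      by (simp add: nrm_U npy[OF x] npz[OF \<pi>in[OF x]])
    finally show ?thesis using d by simp
  qed
  have "cmod (S2 - S3) \<le> (\<Sum>x\<in>KJ. \<beta> (fst x) * a (snd x) * (4 * sqrt \<theta>))"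
    unfolding S2_def S3_def sum_subtractf[symmetric] right_diff_distrib[symmetric]
  proof (intro order_trans[OF norm_sum] sum_mono)
    fix x assume x: "x \<in> KJ"
    show "cmod (of_real (\<beta> (fst x) * a (snd x)) * (QU (py x) - Q (pz (\<pi> x)))) \<le> \<beta> (fst x) * a (snd x) * (4 * sqrt \<theta>)"
      unfolding norm_mult norm_of_real using mult_left_mono[OF close[OF x] w0[OF x]] w0[OF x] by simp
  qed
  also have "\<dots> = (\<Sum>k<card W. \<beta> k) * (\<Sum>l\<in>J. a l) * (4 * sqrt \<theta>)"
    unfolding sum_distrib_right[symmetric] by (simp only: KJ_def sum_product sum.cartesian_product case_prod_unfold)
  also have "\<dots> \<le> 1 * (4 * sqrt \<theta>)" using \<beta>(2) a(2) \<theta>(1) by (intro mult_right_mono) auto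
  finally have 23: "cmod (S2 - S3) \<le> 4 * sqrt \<theta>" by simp
  \<comment> \<open>Reindexing by \<pi> makes both sums run over the same vectors, so that only the
    weights differ.\<close>
  have "S4 = (\<Sum>x\<in>KJ. of_real (\<beta>' (fst (\<pi> x)) * a (snd (\<pi> x))) * Q (pz (\<pi> x)))"
    unfolding S4_def by (rule sum.reindex_bij_betw[OF \<pi>, symmetric])
  then have "S3 - S4 = (\<Sum>x\<in>KJ. of_real (\<beta> (fst x) * a (snd x) - \<beta>' (fst (\<pi> x)) * a (snd (\<pi> x))) * Q (pz (\<pi> x)))"
    unfolding S3_def by (simp add: sum_subtractf left_diff_distrib)
  also have "cmod \<dots> \<le> (\<Sum>x\<in>KJ. \<bar>\<beta> (fst x) * a (snd x) - \<beta>' (fst (\<pi> x)) * a (snd (\<pi> x))\<bar>)"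
  proof (intro order_trans[OF norm_sum] sum_mono)
    fix x assume x: "x \<in> KJ"
    have "cmod (Q (pz (\<pi> x))) \<le> 1"
      using bil_bound_contr[OF X, of "pz (\<pi> x)"] npz[OF \<pi>in[OF x]] by (simp add: Q_def)
    then show "cmod (of_real (\<beta> (fst x) * a (snd x) - \<beta>' (fst (\<pi> x)) * a (snd (\<pi> x))) * Q (pz (\<pi> x)))
        \<le> \<bar>\<beta> (fst x) * a (snd x) - \<beta>' (fst (\<pi> x)) * a (snd (\<pi> x))\<bar>"
      unfolding norm_mult norm_of_real by (intro mult_left_le) auto
  qed
  finally have 34: "cmod (S3 - S4) \<le> \<epsilon>'" using flat by linarith
  have "S1 - S5 = (S1 - S2) + (S2 - S3) + (S3 - S4) - (S5 - S4)" by simp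
  also have "cmod \<dots> \<le> cmod (S1 - S2) + cmod (S2 - S3) + cmod (S3 - S4) + cmod (S5 - S4)"
    by (intro order_trans[OF norm_triangle_ineq4] add_mono order_trans[OF norm_triangle_ineq] norm_triangle_ineq order.refl)
  finally have "cmod (S1 - S5) \<le> 2 * \<epsilon> + 4 * sqrt \<theta> + \<epsilon>'" using 12 23 34 45 by linarith
  then show ?thesis by (simp only: S1_def S5_def QU_def Q_def)
qed

end

subsection \<open>Realization by matrices\<close>

lemma nrm_reindex: "bij_betw g A B \<Longrightarrow> nrm A (\<lambda>a. v (g a)) = nrm B v"
  by (simp add: nrm_def L2_set_def sum.reindex_bij_betw[of g A B "\<lambda>b. (cmod (v b))\<^sup>2"])

lemma bil_reindex:
  assumes "bij_betw g A B"
  shows "bil A (\<lambda>a a'. X (g a) (g a')) (\<lambda>a. w (g a)) (\<lambda>a. v (g a)) = bil B X w v"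
  unfolding bil_explicit
  by (subst sum.reindex_bij_betw[OF assms, of "\<lambda>b. \<Sum>b'\<in>A. cnj (w b) * X b (g b') * v (g b')"])
    (simp add: sum.reindex_bij_betw[OF assms, of "\<lambda>b'. cnj (w _) * X _ b' * v b'"])

lemma contr_reindex:
  assumes g: "bij_betw g A B" and X: "contr A X"
  shows "contr B (\<lambda>b b'. X (the_inv_into A g b) (the_inv_into A g b'))"
  unfolding contr_def
proof (intro allI)
  fix w v
  let ?X = "\<lambda>b b'. X (the_inv_into A g b) (the_inv_into A g b')"
  have "bil A X (\<lambda>a. w (g a)) (\<lambda>a. v (g a)) = bil A (\<lambda>a a'. ?X (g a) (g a')) (\<lambda>a. w (g a)) (\<lambda>a. v (g a))"
    using g by (simp add: bil_explicit bij_betw_def the_inv_into_f_f)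
  also have "\<dots> = bil B ?X w v" by (rule bil_reindex[OF g])
  finally have "bil B ?X w v = bil A X (\<lambda>a. w (g a)) (\<lambda>a. v (g a))" by simp
  then show "cmod (bil B ?X w v) \<le> nrm B w * nrm B v"
    using X unfolding contr_def by (metis nrm_reindex[OF g])
qed

text \<open>Positivity and trace are read off an ensemble whose vectors need not be
  orthogonal.\<close>

lemma density_ensemble:
  assumes M: "M \<in> carrier_mat n n" and w: "\<And>i. i \<in> I \<Longrightarrow> 0 \<le> w i"
    and e: "\<And>a b. a < n \<Longrightarrow> b < n \<Longrightarrow> M $$ (a,b) = (\<Sum>i\<in>I. of_real (w i) * v i a * cnj (v i b))"
    and tr: "(\<Sum>i\<in>I. w i * (nrm {..<n} (v i))\<^sup>2) = 1"
  shows "density_mat n M"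
proof -
  have "herm_on {..<n} (ent M)" using e by (auto simp: herm_on_def mult_ac)
  then have h: "hermitian M" using hermitian_herm_on[OF M] by simp
  have "0 \<le> Re (bil {..<n} (ent M) u u)" for u
  proof -
    have "bil {..<n} (ent M) u u = (\<Sum>i\<in>I. of_real (w i) * (cnj (ip {..<n} (v i) u) * ip {..<n} (v i) u))"
      by (rule bil_ensemble) (use e in auto)
    also have "\<dots> = (\<Sum>i\<in>I. of_real (w i) * of_real ((cmod (ip {..<n} (v i) u))\<^sup>2))"
      by (intro sum.cong refl arg_cong2[where f = times]) (metis complex_norm_square mult.commute)
    also have "\<dots> = of_real (\<Sum>i\<in>I. w i * (cmod (ip {..<n} (v i) u))\<^sup>2)" by simp
    finally show ?thesis using w by (simp add: sum_nonneg)
  qed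
  then have pos: "positive_mat M" using h by (simp add: positive_mat_bil[OF M])
  have "mtrace M = (\<Sum>a<n. \<Sum>i\<in>I. of_real (w i) * (cnj (v i a) * v i a))"
    using M e by (simp add: mtrace_def mult_ac)
  also have "\<dots> = (\<Sum>i\<in>I. of_real (w i) * ip {..<n} (v i) (v i))"
    by (subst sum.swap) (simp add: ip_def sum_distrib_left)
  also have "\<dots> = of_real (\<Sum>i\<in>I. w i * (nrm {..<n} (v i))\<^sup>2)" by (simp add: ip_self)
  finally show ?thesis using M pos tr by (simp add: density_mat_def)
qed

locale nat_frame = frame "{..<m}" W J F c V
  for m :: nat and W and J :: "'j set" and F :: "(nat \<Rightarrow> real) set" and c V +
  fixes a :: "'j \<Rightarrow> real"
  assumes a: "l \<in> J \<Longrightarrow> 0 \<le> a l" and a_sum: "(\<Sum>l\<in>J. a l) = 1"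
begin

definition "D = card (J \<times> F)"

text \<open>An arbitrary enumeration of the ancilla basis; only the splitting by \<open>div\<close>
  and \<open>mod\<close> in \<open>g\<close> has to agree with the layout of
  \<open>kron\<close>.\<close>

definition h :: "nat \<Rightarrow> 'j \<times> (nat \<Rightarrow> real)" where
  "h = (SOME f. bij_betw f {..<D} (J \<times> F))"

definition "g x = (x div D, h (x mod D))"

definition "Umat = mat (m * D) (m * D) (\<lambda>(x, x'). U (g x) (g x'))"

text \<open>Mixed with weights \<open>a\<close> over the embezzling levels and pure on the frame:
  the entries do not depend on the charge labels because the superposition is uniform.\<close>

definition "frame_state = mat D D (\<lambda>(x, x'). of_bool (fst (h x) = fst (h x')) * complex_of_real (a (fst (h x)) / real (card F)))"

definition "frame_charge k = mat D D (\<lambda>(x, x'). if x = x' then complex_of_real (snd (h x) k) else 0)"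

lemma h: "bij_betw h {..<D} (J \<times> F)"
proof -
  have "finite (J \<times> F)" using finJ finF by simp
  then have "\<exists>f. bij_betw f {..<D} (J \<times> F)"
    unfolding D_def using ex_bij_betw_nat_finite by (auto simp: atLeast0LessThan)
  then show ?thesis unfolding h_def by (rule someI_ex)
qed

lemma g: "bij_betw g {..<m * D} E"
  unfolding bij_betw_def
proof
  show "inj_on g {..<m * D}"
  proof (rule inj_onI)
    fix x x' assume x: "x \<in> {..<m * D}" "x' \<in> {..<m * D}" "g x = g x'"
    then have "x div D = x' div D" "h (x mod D) = h (x' mod D)" by (auto simp: g_def)
    moreover have "x mod D < D" "x' mod D < D" using x index_mod by auto
    ultimately have "x div D = x' div D \<and> x mod D = x' mod D"
      using h by (auto simp: bij_betw_def inj_on_def)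
    then show "x = x'" by (simp only: div_mod_eq_iff)
  qed
  show "g ` {..<m * D} = E"
  proof
    show "g ` {..<m * D} \<subseteq> E"
    proof
      fix e assume "e \<in> g ` {..<m * D}"
      then obtain x where x: "x < m * D" "e = (x div D, h (x mod D))" by (auto simp: g_def)
      then have "h (x mod D) \<in> J \<times> F" using h index_mod[OF x(1)] by (auto simp: bij_betw_def)
      then show "e \<in> E" using x index_div[OF x(1)] by (auto simp: E_def)
    qed
    show "E \<subseteq> g ` {..<m * D}"
    proof
      fix e assume e: "e \<in> E"
      obtain i f where ie: "e = (i, f)" by (cases e)
      have "f \<in> h ` {..<D}" using h e by (auto simp: E_def bij_betw_def ie)
      then obtain t where t: "t < D" "h t = f" by auto
      have "i < m" using e by (auto simp: E_def ie)
      then have "i * D + t < m * D" "g (i * D + t) = e" using t index_less by (auto simp: g_def ie)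
      then show "e \<in> g ` {..<m * D}" by force
    qed
  qed
qed

lemma Umat_carrier: "Umat \<in> carrier_mat (m * D) (m * D)" by (simp add: Umat_def)

lemma Umat_unitary: "unitary_mat (m * D) Umat"
proof -
  have "adj Umat * Umat = 1\<^sub>m (m * D)"
  proof (rule eq_matI)
    fix x x' assume "x < dim_row (1\<^sub>m (m * D))" "x' < dim_col (1\<^sub>m (m * D))"
    then have x: "x < m * D" "x' < m * D" by auto
    have "(adj Umat * Umat) $$ (x,x') = (\<Sum>e<m * D. adj Umat $$ (x,e) * Umat $$ (e,x'))"
      by (rule mult_index_sum[OF adj_carrier[OF Umat_carrier] Umat_carrier x])
    also have "\<dots> = (\<Sum>e<m * D. cnj (U (g e) (g x)) * U (g e) (g x'))"
      using x by (intro sum.cong refl) (simp add: adj_def Umat_def)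
    also have "\<dots> = ip E (\<lambda>e. U e (g x)) (\<lambda>e. U e (g x'))"
      unfolding ip_def by (rule sum.reindex_bij_betw[OF g])
    also have "\<dots> = of_bool (g x = g x')"
      by (rule U_columns) (use g x in \<open>auto simp: bij_betw_def\<close>)
    also have "g x = g x' \<longleftrightarrow> x = x'" using g x by (auto simp: bij_betw_def inj_on_def)
    finally show "(adj Umat * Umat) $$ (x,x') = 1\<^sub>m (m * D) $$ (x,x')" using x by simp
  qed (auto simp: Umat_def)
  then show ?thesis by (simp add: unitary_mat_def Umat_carrier)
qed

lemma frame_charge_hermitian: "frame_charge k \<in> carrier_mat D D \<and> hermitian (frame_charge k)"
proof -
  have "herm_on {..<D} (ent (frame_charge k))" by (auto simp: herm_on_def frame_charge_def)
  moreover have "frame_charge k \<in> carrier_mat D D" by (simp add: frame_charge_def)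
  ultimately show ?thesis using hermitian_herm_on by blast
qed

text \<open>In the chosen basis the total charge is diagonal with entries \<open>lab\<close>, and U
  connects only equal labels.\<close>

lemma total_charge_commutes:
  assumes C: "C = mat m m (\<lambda>(i,j). if i = j then complex_of_real (c i k) else 0)"
  shows "Umat * (kron C (1\<^sub>m D) + kron (1\<^sub>m m) (frame_charge k)) = (kron C (1\<^sub>m D) + kron (1\<^sub>m m) (frame_charge k)) * Umat"
proof -
  let ?T = "kron C (1\<^sub>m D) + kron (1\<^sub>m m) (frame_charge k)"
  have Cc: "C \<in> carrier_mat m m" by (simp add: C)
  have Lc: "frame_charge k \<in> carrier_mat D D" by (simp add: frame_charge_def)
  have Tc: "?T \<in> carrier_mat (m * D) (m * D)" using Cc Lc by simp
  have T: "?T $$ (x,x') = (if x = x' then complex_of_real (lab (g x) k) else 0)" if x: "x < m * D" "x' < m * D" for x x'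
  proof -
    have "?T $$ (x,x') = C $$ (x div D, x' div D) * 1\<^sub>m D $$ (x mod D, x' mod D)
        + 1\<^sub>m m $$ (x div D, x' div D) * frame_charge k $$ (x mod D, x' mod D)"
      using x Cc Lc kron_index[OF Cc one_carrier_mat x] kron_index[OF one_carrier_mat Lc x] by simp
    also have "\<dots> = (if x div D = x' div D \<and> x mod D = x' mod D then complex_of_real (c (x div D) k + snd (h (x mod D)) k) else 0)"
      using index_div[OF x(1)] index_div[OF x(2)] index_mod[OF x(1)] index_mod[OF x(2)]
      by (simp add: C frame_charge_def)
    finally show ?thesis unfolding div_mod_eq_iff by (simp add: lab_def g_def)
  qed
  show ?thesis
  proof (rule eq_matI)
    fix x x' assume "x < dim_row (?T * Umat)" "x' < dim_col (?T * Umat)"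
    then have x: "x < m * D" "x' < m * D" using Tc Umat_carrier Cc Lc by auto
    have "(Umat * ?T) $$ (x,x') = (\<Sum>e<m * D. if e = x' then U (g x) (g e) * complex_of_real (lab (g x') k) else 0)"
      unfolding mult_index_sum[OF Umat_carrier Tc x]
      by (intro sum.cong refl) (use T x in \<open>auto simp: Umat_def simp del: index_add_mat\<close>)
    also have "\<dots> = U (g x) (g x') * complex_of_real (lab (g x') k)" using x by simp
    also have "\<dots> = complex_of_real (lab (g x) k) * U (g x) (g x')"
      using U_lab[of "g x" "g x'"] by (cases "U (g x) (g x') = 0") auto
    also have "\<dots> = (\<Sum>e<m * D. if e = x then complex_of_real (lab (g x) k) * U (g e) (g x') else 0)" using x by simp
    also have "\<dots> = (?T * Umat) $$ (x,x')"
      unfolding mult_index_sum[OF Tc Umat_carrier x]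
      by (intro sum.cong refl) (use T x in \<open>auto simp: Umat_def simp del: index_add_mat\<close>)
    finally show "(Umat * ?T) $$ (x,x') = (?T * Umat) $$ (x,x')" .
  qed (use Tc Umat_carrier Cc Lc in auto)
qed

lemma frame_state_carrier: "frame_state \<in> carrier_mat D D" by (simp add: frame_state_def)

lemma frame_state_entry:
  assumes x: "x < D" "x' < D"
  shows "frame_state $$ (x,x') = (\<Sum>l\<in>J. of_real (a l) * (of_bool (fst (h x) = l) / nF) * cnj (of_bool (fst (h x') = l) / nF))"
proof -
  have "h x \<in> J \<times> F" using h x by (auto simp: bij_betw_def)
  then have J: "fst (h x) \<in> J" by auto
  have "(\<Sum>l\<in>J. of_real (a l) * (of_bool (fst (h x) = l) / nF) * cnj (of_bool (fst (h x') = l) / nF))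
      = (\<Sum>l\<in>J. if l = fst (h x) then of_bool (fst (h x) = fst (h x')) * of_real (a l) / (nF * nF) else 0)"
    by (intro sum.cong refl) auto
  also have "\<dots> = of_bool (fst (h x) = fst (h x')) * of_real (a (fst (h x))) / (nF * nF)"
    using J finJ by simp
  also have "\<dots> = frame_state $$ (x,x')" unfolding nF_sq using x by (simp add: frame_state_def)
  finally show ?thesis by simp
qed

lemma frame_state_density: "density_mat D frame_state"
proof (rule density_ensemble[where I = J and w = a and v = "\<lambda>l x. of_bool (fst (h x) = l) / nF"])
  show "(\<Sum>l\<in>J. a l * (nrm {..<D} (\<lambda>x. of_bool (fst (h x) = l) / nF))\<^sup>2) = 1"
  proof -
    have "(nrm {..<D} (\<lambda>x. of_bool (fst (h x) = l) / nF))\<^sup>2 = 1" if l: "l \<in> J" for l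
    proof -
      have "(nrm {..<D} (\<lambda>x. of_bool (fst (h x) = l) / nF))\<^sup>2 = (nrm (J \<times> F) (\<lambda>e. of_bool (fst e = l) / nF))\<^sup>2"
        by (simp only: nrm_reindex[OF h, of "\<lambda>e. of_bool (fst e = l) / nF"])
      also have "\<dots> = (\<Sum>e\<in>J \<times> F. case e of (j, s) \<Rightarrow> if j = l then 1 / real (card F) else 0)"
        unfolding nrm_sq by (intro sum.cong refl) (auto simp: norm_divide power_divide)
      also have "\<dots> = (\<Sum>j\<in>J. \<Sum>s\<in>F. if j = l then 1 / real (card F) else 0)"
        by (rule sum.cartesian_product[symmetric])
      also have "\<dots> = (\<Sum>j\<in>J. if j = l then 1 else 0)"
        using card_F_pos by (intro sum.cong refl) auto
      finally show ?thesis using l finJ by simp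
    qed
    then show ?thesis using a_sum by simp
  qed
qed (use frame_state_carrier a frame_state_entry in auto)

lemma kron_frame_entry:
  assumes R: "diagonalizes m R v p" and x: "x < m * D" "x' < m * D"
  shows "kron R frame_state $$ (x,x') =
    (\<Sum>k\<in>{..<m} \<times> J. of_real (p (fst k) * a (snd k)) * probe (v (fst k)) (snd k) (g x) * cnj (probe (v (fst k)) (snd k) (g x')))"
proof -
  have Rc: "R \<in> carrier_mat m m" using R by (simp add: diagonalizes_def)
  have "kron R frame_state $$ (x,x') = R $$ (x div D, x' div D) * frame_state $$ (x mod D, x' mod D)"
    by (rule kron_index[OF Rc frame_state_carrier x])
  also have "\<dots> = (\<Sum>k<m. of_real (p k) * v k (x div D) * cnj (v k (x' div D))) *
      (\<Sum>l\<in>J. of_real (a l) * (of_bool (fst (h (x mod D)) = l) / nF) * cnj (of_bool (fst (h (x' mod D)) = l) / nF))"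
    using R index_div[OF x(1)] index_div[OF x(2)] frame_state_entry[OF index_mod[OF x(1)] index_mod[OF x(2)]]
    by (simp add: diagonalizes_def)
  also have "\<dots> = (\<Sum>k\<in>{..<m} \<times> J. of_real (p (fst k) * a (snd k)) * probe (v (fst k)) (snd k) (g x) * cnj (probe (v (fst k)) (snd k) (g x')))"
    unfolding sum_product sum.cartesian_product case_prod_unfold
    by (intro sum.cong refl) (simp add: probe_def emb_def sys_def g_def mult_ac)
  finally show ?thesis .
qed

text \<open>Duality reduces the trace norm to test operators, which the enumeration \<open>g\<close>
  carries to \<open>E\<close>; there both sides are ensembles of probe vectors.\<close>

lemma realization:
  assumes R: "diagonalizes m R v p" and S: "diagonalizes m S v' r"
    and bound: "\<And>X. contr E X \<Longrightarrow> cmod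
      ((\<Sum>x\<in>{..<m} \<times> J. of_real (p (fst x) * a (snd x)) * bil E X (ap E U (probe (v (fst x)) (snd x))) (ap E U (probe (v (fst x)) (snd x))))
    - (\<Sum>x\<in>{..<m} \<times> J. of_real (r (fst x) * a (snd x)) * bil E X (probe (v' (fst x)) (snd x)) (probe (v' (fst x)) (snd x)))) \<le> \<epsilon>"
  shows "trace_norm (Umat * kron R frame_state * adj Umat - kron S frame_state) \<le> \<epsilon>"
proof (rule trace_norm_upper)
  let ?A = "kron R frame_state" and ?B = "kron S frame_state" and ?M = "m * D"
  obtain u e where e: "diagonalizes D frame_state u e"
    using density_diagonalizes[OF frame_state_density] by blast
  note dA = diagonalizes_kron[OF R e] and dB = diagonalizes_kron[OF S e]
  have A: "?A \<in> carrier_mat ?M ?M" "hermitian ?A" and B: "?B \<in> carrier_mat ?M ?M" "hermitian ?B"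
    using diagonalizes_hermitian[OF dA] diagonalizes_hermitian[OF dB] dA[unfolded diagonalizes_def] dB[unfolded diagonalizes_def]
    by blast+
  have UA: "Umat * ?A * adj Umat \<in> carrier_mat ?M ?M" using A Umat_carrier by auto
  show "Umat * ?A * adj Umat - ?B \<in> carrier_mat ?M ?M" by (rule minus_carrier_mat[OF B(1)])
  show "hermitian (Umat * ?A * adj Umat - ?B)"
    by (rule hermitian_minus[OF UA B(1) hermitian_conj[OF A Umat_carrier] B(2)])
  fix X assume X: "contr {..<?M} X"
  define X' where "X' = (\<lambda>b b'. X (the_inv_into {..<?M} g b) (the_inv_into {..<?M} g b'))"
  have X': "contr E X'" unfolding X'_def by (rule contr_reindex[OF g X])
  have bX: "bil {..<?M} X (\<lambda>x. f (g x)) (\<lambda>x. f (g x)) = bil E X' f f" for f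
  proof -
    have "bil {..<?M} X (\<lambda>x. f (g x)) (\<lambda>x. f (g x)) = bil {..<?M} (\<lambda>x x'. X' (g x) (g x')) (\<lambda>x. f (g x)) (\<lambda>x. f (g x))"
      unfolding X'_def using g by (simp add: bil_explicit bij_betw_def the_inv_into_f_f)
    then show ?thesis by (simp only: bil_reindex[OF g])
  qed
  have apU: "ap {..<?M} (ent Umat) (\<lambda>x. f (g x)) x = ap E U f (g x)" if "x < ?M" for f x
  proof -
    have "ap {..<?M} (ent Umat) (\<lambda>x. f (g x)) x = (\<Sum>x'<?M. U (g x) (g x') * f (g x'))"
      using that by (simp add: ap_def Umat_def)
    also have "\<dots> = (\<Sum>e\<in>E. U (g x) e * f e)" by (rule sum.reindex_bij_betw[OF g])
    also have "\<dots> = ap E U f (g x)" using that g by (auto simp: ap_def bij_betw_def)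
    finally show ?thesis .
  qed
  have "trp {..<?M} X (ent (Umat * ?A * adj Umat - ?B)) = trp {..<?M} X (ent (Umat * ?A * adj Umat)) - trp {..<?M} X (ent ?B)"
    unfolding trp_diff[symmetric] by (rule trp_cong, rule index_minus_mat(1)) (simp_all only: carrier_matD[OF B(1)] lessThan_iff)
  also have "trp {..<?M} X (ent (Umat * ?A * adj Umat))
      = trp {..<?M} X (\<lambda>x x'. \<Sum>k\<in>{..<m} \<times> J. of_real (p (fst k) * a (snd k)) *
          ap E U (probe (v (fst k)) (snd k)) (g x) * cnj (ap E U (probe (v (fst k)) (snd k)) (g x')))"
  proof (rule trp_cong)
    fix x x' assume "x \<in> {..<?M}" "x' \<in> {..<?M}"
    then have x: "x < ?M" "x' < ?M" by auto
    show "ent (Umat * ?A * adj Umat) x x' = (\<Sum>k\<in>{..<m} \<times> J. of_real (p (fst k) * a (snd k)) *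
          ap E U (probe (v (fst k)) (snd k)) (g x) * cnj (ap E U (probe (v (fst k)) (snd k)) (g x')))"
      unfolding apU[OF x(1), symmetric] apU[OF x(2), symmetric]
      by (rule conj_ensemble[OF Umat_carrier A(1) x]) (rule kron_frame_entry[OF R])
  qed
  also have "\<dots> = (\<Sum>x\<in>{..<m} \<times> J. of_real (p (fst x) * a (snd x)) * bil E X' (ap E U (probe (v (fst x)) (snd x))) (ap E U (probe (v (fst x)) (snd x))))"
    unfolding trp_ensemble bX ..
  also have "trp {..<?M} X (ent ?B) = trp {..<?M} X (\<lambda>x x'. \<Sum>k\<in>{..<m} \<times> J. of_real (r (fst k) * a (snd k)) *
          probe (v' (fst k)) (snd k) (g x) * cnj (probe (v' (fst k)) (snd k) (g x')))"
    by (rule trp_cong) (use kron_frame_entry[OF S] in auto)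
  also have "\<dots> = (\<Sum>x\<in>{..<m} \<times> J. of_real (r (fst x) * a (snd x)) * bil E X' (probe (v' (fst x)) (snd x)) (probe (v' (fst x)) (snd x)))"
    unfolding trp_ensemble bX ..
  finally show "cmod (trp {..<?M} X (ent (Umat * ?A * adj Umat - ?B))) \<le> \<epsilon>" using bound[OF X'] by simp
qed

end

subsection \<open>Finitely many copies\<close>

text \<open>Collects what a conversion needs to know about one state: eigenvalues \<beta> on the
  window in units of a cell size \<open>u\<close>, at most \<open>M\<close> cells each, mass at
  least 1 - \<epsilon>' after rounding down to whole cells, and expectations reproduced up to
  \<epsilon>.\<close>

definition windowed :: "nat \<Rightarrow> nat set \<Rightarrow> complex mat \<Rightarrow> real \<Rightarrow> nat \<Rightarrow> real \<Rightarrow> real \<Rightarrow> bool" where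
  "windowed m W R u M \<epsilon> \<epsilon>' \<longleftrightarrow> (\<exists>v p y \<beta>. diagonalizes m R v p \<and> onb {..<card W} W y \<and>
     (\<forall>j<card W. 0 \<le> \<beta> j \<and> nat \<lfloor>\<beta> j / u\<rfloor> \<le> M) \<and> (\<Sum>j<card W. \<beta> j) \<le> 1 \<and>
     1 - \<epsilon>' \<le> u * (\<Sum>j<card W. real (nat \<lfloor>\<beta> j / u\<rfloor>)) \<and>
     (\<forall>X. contr {..<m} X \<longrightarrow> cmod ((\<Sum>k<m. of_real (p k) * bil {..<m} X (v k) (v k)) -
       (\<Sum>j<card W. of_real (\<beta> j) * bil {..<m} X (wcut W (y j)) (wcut W (y j)))) \<le> \<epsilon>))"

lemma windowed_mono:
  "windowed m W R u M \<epsilon> \<epsilon>' \<Longrightarrow> \<epsilon> \<le> \<eta> \<Longrightarrow> \<epsilon>' \<le> \<eta>' \<Longrightarrow> windowed m W R u M \<eta> \<eta>'"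
  unfolding windowed_def by (smt (verit))

text \<open>Consists of vectors of the charge eigenbasis, not of eigenvectors of a state. It depends
  on a state only through the means \<mu>, so states with equal charges share it.\<close>

definition charge_window :: "nat \<Rightarrow> nat \<Rightarrow> (nat \<Rightarrow> nat \<Rightarrow> real) \<Rightarrow> (nat \<Rightarrow> real) \<Rightarrow> real \<Rightarrow> nat \<Rightarrow> nat set" where
  "charge_window d q lam \<mu> \<delta> n = {i\<in>{..<d ^ n}. \<forall>k<q. \<bar>tsum d (lam k) n i - real n * \<mu> k\<bar> \<le> \<delta>}"

lemma sum_UN_le:
  fixes f :: "'a \<Rightarrow> real"
  assumes "finite K" "\<And>k. k \<in> K \<Longrightarrow> finite (A k)" "\<And>k x. k \<in> K \<Longrightarrow> x \<in> A k \<Longrightarrow> 0 \<le> f x"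
  shows "sum f (\<Union>k\<in>K. A k) \<le> (\<Sum>k\<in>K. sum f (A k))"
  using assms
proof (induction K rule: finite_induct)
  case (insert k K)
  have "sum f (A k \<union> (\<Union>k\<in>K. A k)) = sum f (A k) + sum f (\<Union>k\<in>K. A k) - sum f (A k \<inter> (\<Union>k\<in>K. A k))"
    by (rule sum_Un) (use insert in auto)
  moreover have "0 \<le> sum f (A k \<inter> (\<Union>k\<in>K. A k))" using insert.prems by (intro sum_nonneg) auto
  moreover have "sum f (\<Union>k\<in>K. A k) \<le> (\<Sum>k\<in>K. sum f (A k))"
    using insert.prems by (intro insert.IH) auto
  ultimately show ?case using insert.hyps by simp
qed simp

text \<open>The distribution over the charge basis is again a product law, that of the diagonal
  entries, although the state need not be diagonal; Chebyshev's inequality therefore applies to the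
  charges too.\<close>

lemma tpow_diag_entry:
  assumes \<rho>: "\<rho> \<in> carrier_mat d d" and w: "\<And>t. t < d \<Longrightarrow> \<rho> $$ (t,t) = of_real (w t)"
  shows "a < d ^ n \<Longrightarrow> tpow \<rho> n $$ (a,a) = of_real (tprod d w n a)"
proof (induction n arbitrary: a)
  case (Suc n)
  then have a: "a < d ^ n * d" by (simp add: mult.commute)
  show ?case
    using kron_index[OF tpow_carrier[OF \<rho>] \<rho> a a] Suc.IH[OF index_div[OF a]] w[OF index_mod[OF a]] by simp
qed simp

text \<open>The typical eigenvalues lie between exp (- n s - \<delta>) and exp (- n s + \<delta>),
  and the cell size is u = exp (- n s - 2 \<delta>). So an eigenvalue on the window has at most exp
  (3 \<delta>) cells, and rounding down loses at most the number of typical strings times u, that is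
  exp (n s + \<delta>) u = exp (- \<delta>).\<close>

lemma state_windowed:
  assumes \<rho>: "density_mat d \<rho>"
    and \<mu>: "\<And>k. k < q \<Longrightarrow> (\<Sum>t<d. Re (\<rho> $$ (t,t)) * lam k t) = \<mu> k"
  shows "\<exists>V\<ge>0. \<forall>n \<delta>. 0 < \<delta> \<longrightarrow> windowed (d ^ n) (charge_window d q lam \<mu> \<delta> n) (tpow \<rho> n)
    (exp (- (real n * vn_entropy \<rho>) - 2 * \<delta>)) (nat \<lceil>exp (3 * \<delta>)\<rceil>)
    (real n * V / \<delta>\<^sup>2 + 2 * sqrt (real q * real n * V / \<delta>\<^sup>2)) ((real q + 1) * real n * V / \<delta>\<^sup>2 + exp (- \<delta>))"
proof -
  define s where "s = vn_entropy \<rho>"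
  obtain y p where y: "diagonalizes d \<rho> y p" and sp: "spectrum d p s"
    using density_spectrum[OF \<rho>] by (auto simp: s_def)
  interpret spectrum d p s by (rule sp)
  have \<rho>c: "\<rho> \<in> carrier_mat d d" using \<rho> by (simp add: density_mat_def)
  define w where "w = (\<lambda>t. Re (\<rho> $$ (t,t)))"
  have entry: "\<rho> $$ (t,t) = of_real (\<Sum>i<d. p i * (cmod (y i t))\<^sup>2)" if "t < d" for t
  proof -
    have "\<rho> $$ (t,t) = (\<Sum>i<d. of_real (p i) * (y i t * cnj (y i t)))"
      using y that by (simp add: diagonalizes_def mult.assoc)
    also have "\<dots> = of_real (\<Sum>i<d. p i * (cmod (y i t))\<^sup>2)"
      unfolding of_real_sum of_real_mult complex_norm_square ..
    finally show ?thesis .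
  qed
  have w: "\<rho> $$ (t,t) = of_real (w t)" "0 \<le> w t" if "t < d" for t
  proof -
    have "w t = (\<Sum>i<d. p i * (cmod (y i t))\<^sup>2)"
      using entry[OF that] by (simp only: w_def Re_complex_of_real)
    then show "\<rho> $$ (t,t) = of_real (w t)" "0 \<le> w t"
      using entry[OF that] p_nonneg by (simp_all only:) (auto intro!: sum_nonneg)
  qed
  have wsum: "(\<Sum>t<d. w t) = 1"
  proof -
    have "mtrace \<rho> = of_real (\<Sum>t<d. w t)" using \<rho>c w(1) by (simp add: mtrace_def)
    then show ?thesis using \<rho> by (metis density_mat_def of_real_eq_1_iff)
  qed
  define Vk where "Vk = (\<lambda>k. \<Sum>t<d. w t * (lam k t - \<mu> k)\<^sup>2)"
  \<comment> \<open>One constant that dominates every variance, chosen before n and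
    \<delta>.\<close>
  define V where "V = logvar d p s + (\<Sum>k<q. Vk k)"
  have Vk0: "0 \<le> Vk k" for k unfolding Vk_def using w(2) by (intro sum_nonneg) auto
  have lv0: "0 \<le> logvar d p s" unfolding logvar_def using p_nonneg by (intro sum_nonneg) auto
  have V0: "0 \<le> V" using lv0 Vk0 by (simp add: V_def sum_nonneg)
  have lvV: "logvar d p s \<le> V" using Vk0 by (simp add: V_def sum_nonneg)
  have VkV: "Vk k \<le> V" if "k < q" for k
    using member_le_sum[of k "{..<q}" Vk] Vk0 lv0 that by (simp add: V_def)
  have "windowed (d ^ n) (charge_window d q lam \<mu> \<delta> n) (tpow \<rho> n)
    (exp (- (real n * s) - 2 * \<delta>)) (nat \<lceil>exp (3 * \<delta>)\<rceil>)
    (real n * V / \<delta>\<^sup>2 + 2 * sqrt (real q * real n * V / \<delta>\<^sup>2)) ((real q + 1) * real n * V / \<delta>\<^sup>2 + exp (- \<delta>))"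
    if \<delta>: "0 < \<delta>" for n \<delta>
  proof -
    let ?I = "{..<d ^ n}" and ?W = "charge_window d q lam \<mu> \<delta> n" and ?T = "typical d p s \<delta> n"
    define P where "P = tprod d p n"
    define u where "u = exp (- (real n * s) - 2 * \<delta>)"
    define v where "v = tvec d y n"
    have dv: "diagonalizes (d ^ n) (tpow \<rho> n) v P" unfolding v_def P_def by (rule diagonalizes_tpow[OF y])
    have v: "onb ?I ?I v" using dv by (simp add: diagonalizes_def)
    have W: "?W \<subseteq> ?I" by (auto simp: charge_window_def)
    have P0: "0 \<le> P k" if "k \<in> ?I" for k
      unfolding P_def by (rule tprod_nonneg) (use p_nonneg that in auto)
    have wn0: "0 \<le> tprod d w n a" if "a \<in> ?I" for a
      by (rule tprod_nonneg) (use w(2) that in auto)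
    have \<epsilon>2: "(\<Sum>k\<in>?I - ?T. P k) \<le> real n * V / \<delta>\<^sup>2"
    proof -
      have "(\<Sum>k\<in>?I - ?T. P k) \<le> real n * logvar d p s / \<delta>\<^sup>2" unfolding P_def by (rule atypical_mass[OF \<delta>])
      also have "\<dots> \<le> real n * V / \<delta>\<^sup>2" using lvV by (intro divide_right_mono mult_left_mono) auto
      finally show ?thesis .
    qed
    have \<epsilon>1: "(\<Sum>k\<in>?I. P k * (\<Sum>a\<in>?I - ?W. (cmod (v k a))\<^sup>2)) \<le> real q * real n * V / \<delta>\<^sup>2"
    proof -
      have "(\<Sum>k\<in>?I. P k * (\<Sum>a\<in>?I - ?W. (cmod (v k a))\<^sup>2)) = (\<Sum>a\<in>?I - ?W. \<Sum>k\<in>?I. P k * (cmod (v k a))\<^sup>2)"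
        unfolding sum_distrib_left by (rule sum.swap)
      also have "\<dots> = (\<Sum>a\<in>?I - ?W. tprod d w n a)"
      proof (intro sum.cong refl)
        fix a assume "a \<in> ?I - ?W"
        then have a: "a < d ^ n" by auto
        have "complex_of_real (\<Sum>k\<in>?I. P k * (cmod (v k a))\<^sup>2) = (\<Sum>k\<in>?I. of_real (P k) * (v k a * cnj (v k a)))"
          unfolding of_real_sum of_real_mult complex_norm_square ..
        also have "\<dots> = tpow \<rho> n $$ (a,a)" using dv a by (simp add: diagonalizes_def mult.assoc)
        also have "\<dots> = of_real (tprod d w n a)" by (rule tpow_diag_entry[OF \<rho>c w(1) a])
        finally show "(\<Sum>k\<in>?I. P k * (cmod (v k a))\<^sup>2) = tprod d w n a" using of_real_eq_iff by blast
      qed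
      \<comment> \<open>Leaving the window means violating the bound for some charge; the union
        bound over the charges produces the factor q.\<close>
      also have "\<dots> \<le> (\<Sum>a\<in>(\<Union>k\<in>{..<q}. {a\<in>?I. \<delta> < \<bar>tsum d (lam k) n a - real n * \<mu> k\<bar>}). tprod d w n a)"
        using wn0 by (intro sum_mono2) (auto simp: charge_window_def not_le)
      also have "\<dots> \<le> (\<Sum>k<q. \<Sum>a\<in>{a\<in>?I. \<delta> < \<bar>tsum d (lam k) n a - real n * \<mu> k\<bar>}. tprod d w n a)"
        using wn0 by (intro sum_UN_le) auto
      also have "\<dots> \<le> (\<Sum>k<q. real n * V / \<delta>\<^sup>2)"
      proof (intro sum_mono)
        fix k assume k: "k \<in> {..<q}"
        have "(\<Sum>a\<in>{a\<in>?I. \<delta> < \<bar>tsum d (lam k) n a - real n * \<mu> k\<bar>}. tprod d w n a) \<le> real n * Vk k / \<delta>\<^sup>2"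
          unfolding Vk_def by (rule tprod_chebyshev) (use w wsum \<mu> \<delta> k in \<open>auto simp: w_def\<close>)
        also have "\<dots> \<le> real n * V / \<delta>\<^sup>2" using VkV k by (intro divide_right_mono mult_left_mono) auto
        finally show "(\<Sum>a\<in>{a\<in>?I. \<delta> < \<bar>tsum d (lam k) n a - real n * \<mu> k\<bar>}. tprod d w n a) \<le> real n * V / \<delta>\<^sup>2" .
      qed
      finally show ?thesis by simp
    qed
    obtain z and \<beta> :: "nat \<Rightarrow> real" where z: "onb {..<card ?W} ?W z"
      and \<beta>: "\<And>j. j < card ?W \<Longrightarrow> 0 \<le> \<beta> j" "\<And>j. j < card ?W \<Longrightarrow> \<beta> j \<le> exp (- (real n * s) + \<delta>)"
        "(\<Sum>j<card ?W. \<beta> j) \<le> 1" "1 - real q * real n * V / \<delta>\<^sup>2 - real n * V / \<delta>\<^sup>2 \<le> (\<Sum>j<card ?W. \<beta> j)"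
        "(\<Sum>j<card ?W. min (\<beta> j) u) \<le> real (card ?T) * u"
      and X: "\<And>X. contr ?I X \<Longrightarrow> cmod ((\<Sum>k\<in>?I. of_real (P k) * bil ?I X (v k) (v k)) -
        (\<Sum>j<card ?W. of_real (\<beta> j) * bil ?I X (wcut ?W (z j)) (wcut ?W (z j)))) \<le> real n * V / \<delta>\<^sup>2 + 2 * sqrt (real q * real n * V / \<delta>\<^sup>2)"
    proof (rule window_spectrum[OF v finite_lessThan finite_lessThan P0 _ typical_subset _ W _ \<epsilon>2 \<epsilon>1])
      show "(\<Sum>k\<in>?I. P k) = 1" unfolding P_def by (rule tprod_sum[OF p_sum])
      show "\<And>k. k \<in> ?T \<Longrightarrow> P k \<le> exp (- (real n * s) + \<delta>)" unfolding P_def by (rule typical_bounds(2))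
      show "0 < u" by (simp add: u_def)
    qed auto
    have u: "0 < u" by (simp add: u_def)
    have fl: "nat \<lfloor>\<beta> j / u\<rfloor> \<le> nat \<lceil>exp (3 * \<delta>)\<rceil>" if "j < card ?W" for j
    proof -
      have "\<beta> j / u \<le> exp (- (real n * s) + \<delta>) / u" using \<beta>(2)[OF that] u by (intro divide_right_mono) auto
      also have "\<dots> = exp (3 * \<delta>)" by (simp add: u_def flip: exp_diff)
      finally have "\<lfloor>\<beta> j / u\<rfloor> \<le> \<lceil>exp (3 * \<delta>)\<rceil>" by (meson floor_mono floor_le_ceiling order_trans)
      then show ?thesis by (rule nat_mono)
    qed
    have cnt: "1 - ((real q + 1) * real n * V / \<delta>\<^sup>2 + exp (- \<delta>)) \<le> u * (\<Sum>j<card ?W. real (nat \<lfloor>\<beta> j / u\<rfloor>))"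
    proof -
      have "real (card ?T) * u \<le> exp (real n * s + \<delta>) * u" using typical_card[of \<delta> n] u by (intro mult_right_mono) auto
      also have "\<dots> = exp (- \<delta>)" by (simp add: u_def flip: exp_add)
      finally have 1: "(\<Sum>j<card ?W. min (\<beta> j) u) \<le> exp (- \<delta>)" using \<beta>(5) by linarith
      \<comment> \<open>Rounding down to whole cells loses at most u and at most the whole
        eigenvalue, hence at most min (\<beta> j) u.\<close>
      have "(\<Sum>j<card ?W. \<beta> j - min (\<beta> j) u) \<le> (\<Sum>j<card ?W. u * real (nat \<lfloor>\<beta> j / u\<rfloor>))"
      proof (intro sum_mono)
        fix j assume "j \<in> {..<card ?W}"
        then have b0: "0 \<le> \<beta> j" using \<beta>(1) by auto
        have "\<beta> j / u - 1 \<le> real_of_int \<lfloor>\<beta> j / u\<rfloor>" by linarith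
        also have "\<dots> = real (nat \<lfloor>\<beta> j / u\<rfloor>)" using b0 u by simp
        finally have "\<beta> j - u \<le> u * real (nat \<lfloor>\<beta> j / u\<rfloor>)" using u by (simp add: field_simps)
        moreover have "0 \<le> u * real (nat \<lfloor>\<beta> j / u\<rfloor>)" using u by simp
        ultimately show "\<beta> j - min (\<beta> j) u \<le> u * real (nat \<lfloor>\<beta> j / u\<rfloor>)" by (simp add: min_def)
      qed
      moreover have "(real q + 1) * real n * V / \<delta>\<^sup>2 = real q * real n * V / \<delta>\<^sup>2 + real n * V / \<delta>\<^sup>2"
        by (simp add: algebra_simps add_divide_distrib)
      ultimately show ?thesis using 1 \<beta>(4) by (simp add: sum_subtractf sum_distrib_left)
    qed
    show ?thesis
      unfolding windowed_def u_def[symmetric] using dv z \<beta>(1,3) fl cnt X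
      by (intro exI[of _ v] exI[of _ P] exI[of _ z] exI[of _ \<beta>]) auto
  qed
  then show ?thesis using V0 by (intro exI[of _ V]) (simp add: s_def)
qed

section \<open>Assembling the conversion for a fixed number of copies\<close>

lemma copy_charge_diag:
  assumes L: "L = mat d d (\<lambda>(i,j). if i = j then complex_of_real (l i) else 0)"
  shows "copy_charge d L n = mat (d ^ n) (d ^ n) (\<lambda>(i,j). if i = j then complex_of_real (tsum d l n i) else 0)"
proof (induction n)
  case 0
  show ?case by (rule eq_matI) (auto simp: L copy_charge_0)
next
  case (Suc n)
  have Lc: "L \<in> carrier_mat d d" by (simp add: L)
  have Cc: "copy_charge d L n \<in> carrier_mat (d ^ n) (d ^ n)" by (rule copy_charge_entry(1)[OF Lc])
  show ?case
  proof (rule eq_matI)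
    fix x x' assume "x < dim_row (mat (d ^ Suc n) (d ^ Suc n) (\<lambda>(i,j). if i = j then complex_of_real (tsum d l (Suc n) i) else 0))"
      "x' < dim_col (mat (d ^ Suc n) (d ^ Suc n) (\<lambda>(i,j). if i = j then complex_of_real (tsum d l (Suc n) i) else 0))"
    then have x: "x < d ^ n * d" "x' < d ^ n * d" by (auto simp: mult.commute)
    have "copy_charge d L (Suc n) $$ (x,x') = kron (copy_charge d L n) (1\<^sub>m d) $$ (x,x') + kron (1\<^sub>m (d ^ n)) L $$ (x,x')"
      unfolding copy_charge_Suc[OF Lc] by (rule index_add_mat(1)) (use x Lc in auto)
    also have "\<dots> = (if x div d = x' div d \<and> x mod d = x' mod d then complex_of_real (tsum d l n (x div d) + l (x mod d)) else 0)"
      unfolding kron_index[OF Cc one_carrier_mat x] kron_index[OF one_carrier_mat Lc x]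
      using index_div[OF x(1)] index_div[OF x(2)] index_mod[OF x(1)] index_mod[OF x(2)]
      by (simp add: Suc) (simp add: L)
    also have "\<dots> = (if x = x' then complex_of_real (tsum d l (Suc n) x) else 0)"
      unfolding div_mod_eq_iff by simp
    finally show "copy_charge d L (Suc n) $$ (x,x') = mat (d ^ Suc n) (d ^ Suc n) (\<lambda>(i,j). if i = j then complex_of_real (tsum d l (Suc n) i) else 0) $$ (x,x')"
      using x by (simp add: mult.commute)
  qed (use copy_charge_entry(1)[OF Lc, of "Suc n"] in auto)
qed

text \<open>The case of diagonal charges. Both states share the window and the cell size, so their
  flattened spectra can be matched by one permutation \<pi>, and V maps one product eigenbasis on
  the window to the other along \<pi>.\<close>

lemma conversion_exists:
  fixes d :: nat and lam :: "nat \<Rightarrow> nat \<Rightarrow> real"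
  defines "L \<equiv> \<lambda>k. mat d d (\<lambda>(i,j). if i = j then complex_of_real (lam k i) else 0)"
  assumes d: "0 < d" and \<delta>: "0 < \<delta>" and R: "0 < R" and M: "0 < M" and J: "0 < J" and u: "0 < u"
    and \<rho>: "windowed (d ^ n) (charge_window d q lam \<mu> \<delta> n) \<rho>n u M \<epsilon> \<epsilon>'"
    and \<sigma>: "windowed (d ^ n) (charge_window d q lam \<mu> \<delta> n) \<sigma>n u M \<epsilon> \<epsilon>'"
  shows "\<exists>D L' \<omega> U. density_mat D \<omega> \<and> real D \<le> real M * real J * (2 * real R * real n + 1) ^ d \<and>
    (\<forall>k<q. L' k \<in> carrier_mat D D \<and> hermitian (L' k) \<and> \<bar>op_norm (L' k)\<bar> \<le> 2 * real R * \<delta>) \<and>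
    unitary_mat (d ^ n * D) U \<and>
    (\<forall>k<q. U * (kron (copy_charge d (L k) n) (1\<^sub>m D) + kron (1\<^sub>m (d ^ n)) (L' k))
        = (kron (copy_charge d (L k) n) (1\<^sub>m D) + kron (1\<^sub>m (d ^ n)) (L' k)) * U) \<and>
    trace_norm (U * kron \<rho>n \<omega> * adj U - kron \<sigma>n \<omega>)
      \<le> 2 * \<epsilon> + 4 * sqrt (real d * ln (2 * real R * real n + 1) / real R) + (2 - 2 * (1 - \<epsilon>') * (harmon J / harmon (M * J)))"
proof -
  define W where "W = charge_window d q lam \<mu> \<delta> n"
  let ?I = "{..<d ^ n}"
  have W: "W \<subseteq> ?I" by (auto simp: W_def charge_window_def)
  have finW: "finite W" using W finite_subset by blast
  obtain v p y \<beta> where \<rho>0: "diagonalizes (d ^ n) \<rho>n v p \<and> onb {..<card W} W y \<and>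
     (\<forall>j<card W. 0 \<le> \<beta> j \<and> nat \<lfloor>\<beta> j / u\<rfloor> \<le> M) \<and> (\<Sum>j<card W. \<beta> j) \<le> 1 \<and>
     1 - \<epsilon>' \<le> u * (\<Sum>j<card W. real (nat \<lfloor>\<beta> j / u\<rfloor>)) \<and>
     (\<forall>X. contr ?I X \<longrightarrow> cmod ((\<Sum>k\<in>?I. of_real (p k) * bil ?I X (v k) (v k)) -
       (\<Sum>j<card W. of_real (\<beta> j) * bil ?I X (wcut W (y j)) (wcut W (y j)))) \<le> \<epsilon>)"
    using \<rho> unfolding windowed_def W_def[symmetric] by (elim exE)
  have \<rho>v: "diagonalizes (d ^ n) \<rho>n v p" and y: "onb {..<card W} W y" using \<rho>0 by simp_all
  have \<beta>: "\<And>j. j < card W \<Longrightarrow> 0 \<le> \<beta> j" "\<And>j. j < card W \<Longrightarrow> nat \<lfloor>\<beta> j / u\<rfloor> \<le> M"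
      "(\<Sum>j<card W. \<beta> j) \<le> 1" "1 - \<epsilon>' \<le> u * (\<Sum>j<card W. real (nat \<lfloor>\<beta> j / u\<rfloor>))"
    using \<rho>0 by blast+
  have \<rho>X: "cmod ((\<Sum>k\<in>?I. of_real (p k) * bil ?I X (v k) (v k)) -
       (\<Sum>j<card W. of_real (\<beta> j) * bil ?I X (wcut W (y j)) (wcut W (y j)))) \<le> \<epsilon>" if "contr ?I X" for X
    using \<rho>0 that by blast
  obtain v' r z \<beta>' where \<sigma>0: "diagonalizes (d ^ n) \<sigma>n v' r \<and> onb {..<card W} W z \<and>
     (\<forall>j<card W. 0 \<le> \<beta>' j \<and> nat \<lfloor>\<beta>' j / u\<rfloor> \<le> M) \<and> (\<Sum>j<card W. \<beta>' j) \<le> 1 \<and>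
     1 - \<epsilon>' \<le> u * (\<Sum>j<card W. real (nat \<lfloor>\<beta>' j / u\<rfloor>)) \<and>
     (\<forall>X. contr ?I X \<longrightarrow> cmod ((\<Sum>k\<in>?I. of_real (r k) * bil ?I X (v' k) (v' k)) -
       (\<Sum>j<card W. of_real (\<beta>' j) * bil ?I X (wcut W (z j)) (wcut W (z j)))) \<le> \<epsilon>)"
    using \<sigma> unfolding windowed_def W_def[symmetric] by (elim exE)
  have \<sigma>v: "diagonalizes (d ^ n) \<sigma>n v' r" and z: "onb {..<card W} W z" using \<sigma>0 by simp_all
  have \<beta>': "\<And>j. j < card W \<Longrightarrow> 0 \<le> \<beta>' j" "\<And>j. j < card W \<Longrightarrow> nat \<lfloor>\<beta>' j / u\<rfloor> \<le> M"
      "(\<Sum>j<card W. \<beta>' j) \<le> 1" "1 - \<epsilon>' \<le> u * (\<Sum>j<card W. real (nat \<lfloor>\<beta>' j / u\<rfloor>))"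
    using \<sigma>0 by blast+
  have \<sigma>X: "cmod ((\<Sum>k\<in>?I. of_real (r k) * bil ?I X (v' k) (v' k)) -
       (\<Sum>j<card W. of_real (\<beta>' j) * bil ?I X (wcut W (z j)) (wcut W (z j)))) \<le> \<epsilon>" if "contr ?I X" for X
    using \<sigma>0 that by blast
  define N where "N = M * J"
  have N: "0 < N" using M J by (simp add: N_def)
  have hN: "0 < harmon N" by (rule harmon_pos[OF N])
  let ?J = "{..<N}"
  define a where "a = (\<lambda>l. 1 / ((real l + 1) * harmon N))"
  have a0: "0 \<le> a l" for l using hN by (simp add: a_def)
  have asum: "(\<Sum>l\<in>?J. a l) = 1"
  proof -
    have "(\<Sum>l\<in>?J. a l) = (\<Sum>l<N. 1 / (real l + 1)) / harmon N"
      unfolding sum_divide_distrib by (simp add: a_def)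
    then show ?thesis using hN by (simp add: harmon_def)
  qed
  let ?KJ = "{..<card W} \<times> ?J"
  obtain \<pi> where \<pi>: "bij_betw \<pi> ?KJ ?KJ"
    and flat: "(\<Sum>x\<in>?KJ. \<bar>\<beta> (fst x) / ((real (snd x) + 1) * harmon N) - \<beta>' (fst (\<pi> x)) / ((real (snd (\<pi> x)) + 1) * harmon N)\<bar>)
      \<le> 2 - 2 * (1 - \<epsilon>') * (harmon J / harmon N)"
    unfolding N_def
    by (rule flatten[of "{..<card W}" u M J \<beta> \<epsilon>' \<beta>']) (use u M J \<beta> \<beta>' in auto)
  define c where "c = (\<lambda>i k. tsum d (lam k) n i)"
  \<comment> \<open>0 is inserted so that the iterated sumsets are nested, even for an empty
    window.\<close>
  define \<Delta> where "\<Delta> = insert 0 ((\<lambda>(i, j). c i - c j) ` (W \<times> W))"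
  have fin\<Delta>: "finite \<Delta>" and 0: "0 \<in> \<Delta>" using finW by (auto simp: \<Delta>_def)
  obtain r0 where r0: "r0 < R"
    "1 - ln (real (card (sumset \<Delta> R))) / real R \<le> real (card (sumset \<Delta> r0)) / real (card (sumset \<Delta> (Suc r0)))"
    by (rule slow_growth[OF fin\<Delta> 0 R])
  \<comment> \<open>The frame uses the larger of two neighbouring sumsets of almost equal size: a
    label in the smaller one still finds all its partners in \<open>F\<close>.\<close>
  define F where "F = sumset \<Delta> (Suc r0)"
  have finF: "finite F" unfolding F_def by (rule finite_sumset[OF fin\<Delta>])
  have neF: "F \<noteq> {}" using zero_in_sumset[OF 0] unfolding F_def by blast
  have card\<Delta>: "real (card (sumset \<Delta> t)) \<le> (2 * real t * real n + 1) ^ d" for t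
  proof (rule card_sumset_charges[where lam = lam])
    fix x assume "x \<in> \<Delta>"
    then consider "x = 0" | i j where "i \<in> W" "j \<in> W" "x = c i - c j" by (auto simp: \<Delta>_def)
    then show "\<exists>z :: nat \<Rightarrow> int. (\<forall>t. \<bar>z t\<bar> \<le> int n) \<and> x = (\<lambda>k. \<Sum>t<d. of_int (z t) * lam k t)"
    proof cases
      case 1
      then show ?thesis by (intro exI[of _ "\<lambda>_. 0"]) (auto simp: fun_eq_iff)
    next
      case 2
      obtain z :: "nat \<Rightarrow> int" where z: "\<forall>t. 0 \<le> z t \<and> z t \<le> int n" "\<forall>f. tsum d f n i = (\<Sum>t<d. of_int (z t) * f t)"
        using tsum_digit_counts[of i d n] 2 W by blast
      obtain z' :: "nat \<Rightarrow> int" where z': "\<forall>t. 0 \<le> z' t \<and> z' t \<le> int n" "\<forall>f. tsum d f n j = (\<Sum>t<d. of_int (z' t) * f t)"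
        using tsum_digit_counts[of j d n] 2 W by blast
      have "\<bar>z t - z' t\<bar> \<le> int n" for t using z(1)[rule_format, of t] z'(1)[rule_format, of t] by linarith
      moreover have "x = (\<lambda>k. \<Sum>t<d. of_int (z t - z' t) * lam k t)"
        using z(2) z'(2) by (simp add: 2 c_def fun_eq_iff left_diff_distrib sum_subtractf)
      ultimately show ?thesis by (intro exI[of _ "\<lambda>t. z t - z' t"]) auto
    qed
  qed
  \<comment> \<open>Here the window pays off: its charges lie within \<delta> of a common mean, so
    differences are at most 2 \<delta> and the frame charges at most 2 R \<delta>. Over the whole
    spectrum the differences could be of order n.\<close>
  have bound\<Delta>: "\<bar>x k\<bar> \<le> 2 * \<delta>" if x: "x \<in> \<Delta>" and k: "k < q" for x k
  proof -
    consider "x = 0" | i j where "i \<in> W" "j \<in> W" "x = c i - c j" using x by (auto simp: \<Delta>_def)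
    then show ?thesis
    proof cases
      case 2
      then have "\<bar>c i k - real n * \<mu> k\<bar> \<le> \<delta>" "\<bar>c j k - real n * \<mu> k\<bar> \<le> \<delta>"
        using k by (auto simp: W_def charge_window_def c_def)
      then show ?thesis by (simp add: 2)
    qed (use \<delta> in auto)
  qed
  let ?Y = "\<lambda>x b. y (fst x) (fst b) * of_bool (snd b = snd x)"
  let ?Z = "\<lambda>x b. z (fst x) (fst b) * of_bool (snd b = snd x)"
  define V where "V = transition ?KJ ?Y ?Z \<pi>"
  interpret nat_frame "d ^ n" W ?J F c V a
  proof unfold_locales
    fix b b' assume "b \<in> W \<times> ?J" "b' \<in> W \<times> ?J"
    then show "(\<Sum>a\<in>W \<times> ?J. cnj (V a b) * V a b') = of_bool (b = b')"
      unfolding V_def by (intro transition_unitary onb_times[OF y] onb_times[OF z] \<pi>) auto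
  qed (use W finF neF a0 asum in auto)
  define \<theta> where "\<theta> = real d * ln (2 * real R * real n + 1) / real R"
  have \<theta>0: "0 \<le> \<theta>" by (simp add: \<theta>_def)
  have \<theta>: "real (card {s\<in>F. c i + s \<notin> full}) \<le> \<theta> * real (card F)" if i: "i \<in> W" for i
  proof -
    \<comment> \<open>Only labels added in the last sumset step can belong to an incomplete
      sector.\<close>
    have sub: "{s\<in>F. c i + s \<notin> full} \<subseteq> F - sumset \<Delta> r0"
    proof safe
      fix s assume s: "s \<in> sumset \<Delta> r0" "c i + s \<notin> full"
      have "c i + s - c j \<in> F" if j: "j \<in> W" for j
      proof -
        have "c i - c j \<in> \<Delta>" using i j by (auto simp: \<Delta>_def)
        then have "s + (c i - c j) \<in> F" using s(1) unfolding F_def by force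
        then show ?thesis by (simp add: algebra_simps)
      qed
      then show False using s(2) by (simp add: full_def)
    qed
    have sF: "sumset \<Delta> r0 \<subseteq> F" unfolding F_def by (rule sumset_mono[OF 0])
    have "card {s\<in>F. c i + s \<notin> full} \<le> card F - card (sumset \<Delta> r0)"
      using card_mono[OF _ sub] card_Diff_subset[OF finite_sumset[OF fin\<Delta>] sF] finF by simp
    then have "real (card {s\<in>F. c i + s \<notin> full}) \<le> real (card F) - real (card (sumset \<Delta> r0))"
      using card_mono[OF finF sF] by linarith
    also have "\<dots> \<le> \<theta> * real (card F)"
    proof -
      have cR: "0 < card (sumset \<Delta> R)"
        using zero_in_sumset[OF 0] finite_sumset[OF fin\<Delta>] card_gt_0_iff by blast
      have "ln (real (card (sumset \<Delta> R))) \<le> ln ((2 * real R * real n + 1) ^ d)"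
        using cR card\<Delta>[of R] by (intro ln_mono) auto
      also have "\<dots> = real d * ln (2 * real R * real n + 1)" by (rule ln_realpow)
      finally have "ln (real (card (sumset \<Delta> R))) / real R \<le> \<theta>"
        unfolding \<theta>_def by (intro divide_right_mono) auto
      then have "1 - \<theta> \<le> real (card (sumset \<Delta> r0)) / real (card F)" using r0(2) by (simp add: F_def)
      then have "(1 - \<theta>) * real (card F) \<le> real (card (sumset \<Delta> r0))"
        using card_F_pos by (simp add: field_simps)
      then show ?thesis by (simp add: algebra_simps)
    qed
    finally show ?thesis .
  qed
  have tn: "trace_norm (Umat * kron \<rho>n frame_state * adj Umat - kron \<sigma>n frame_state)
      \<le> 2 * \<epsilon> + 4 * sqrt \<theta> + (2 - 2 * (1 - \<epsilon>') * (harmon J / harmon N))"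
  proof (rule realization[OF \<rho>v \<sigma>v])
    fix X :: "nat \<times> nat \<times> (nat \<Rightarrow> real) \<Rightarrow> nat \<times> nat \<times> (nat \<Rightarrow> real) \<Rightarrow> complex"
    assume X: "contr E X"
    have flat': "(\<Sum>x\<in>?KJ. \<bar>\<beta> (fst x) * a (snd x) - \<beta>' (fst (\<pi> x)) * a (snd (\<pi> x))\<bar>) \<le> 2 - 2 * (1 - \<epsilon>') * (harmon J / harmon N)"
      using flat by (simp add: a_def)
    show "cmod ((\<Sum>x\<in>?I \<times> ?J. of_real (p (fst x) * a (snd x)) * bil E X (ap E U (probe (v (fst x)) (snd x))) (ap E U (probe (v (fst x)) (snd x))))
      - (\<Sum>x\<in>?I \<times> ?J. of_real (r (fst x) * a (snd x)) * bil E X (probe (v' (fst x)) (snd x)) (probe (v' (fst x)) (snd x))))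
      \<le> 2 * \<epsilon> + 4 * sqrt \<theta> + (2 - 2 * (1 - \<epsilon>') * (harmon J / harmon N))"
      by (rule conversion_bound[OF _ asum y z \<beta>(1,3) \<pi> V_def \<theta>0 \<theta> \<rho>X \<sigma>X flat' X]) (use a0 in auto)
  qed
  have Dle: "real D \<le> real M * real J * (2 * real R * real n + 1) ^ d"
  proof -
    have "real D = real N * real (card F)" by (simp add: D_def card_cartesian_product)
    also have "\<dots> \<le> real N * (2 * real R * real n + 1) ^ d"
    proof (rule mult_left_mono)
      have "real (card F) \<le> (2 * real (Suc r0) * real n + 1) ^ d" unfolding F_def by (rule card\<Delta>)
      also have "\<dots> \<le> (2 * real R * real n + 1) ^ d"
        using r0(1) by (intro power_mono add_right_mono mult_right_mono) auto
      finally show "real (card F) \<le> (2 * real R * real n + 1) ^ d" .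
    qed simp
    finally show ?thesis by (simp add: N_def)
  qed
  have op: "\<bar>op_norm (frame_charge k)\<bar> \<le> 2 * real R * \<delta>" if k: "k < q" for k
    unfolding frame_charge_def
  proof (rule op_norm_diag)
    show "0 < D" using density_dim_pos[OF frame_state_density] .
    fix x assume "x < D"
    then have "h x \<in> ?J \<times> F" using h by (auto simp: bij_betw_def)
    then have "snd (h x) \<in> sumset \<Delta> (Suc r0)" by (auto simp: F_def)
    then have "\<bar>snd (h x) k\<bar> \<le> real (Suc r0) * (2 * \<delta>)"
      by (rule sumset_bound[rotated]) (use bound\<Delta> k in auto)
    also have "\<dots> \<le> real R * (2 * \<delta>)" using r0(1) \<delta> by (intro mult_right_mono) auto
    finally show "\<bar>snd (h x) k\<bar> \<le> 2 * real R * \<delta>" by simp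
  qed
  have comm: "Umat * (kron (copy_charge d (L k) n) (1\<^sub>m D) + kron (1\<^sub>m (d ^ n)) (frame_charge k))
        = (kron (copy_charge d (L k) n) (1\<^sub>m D) + kron (1\<^sub>m (d ^ n)) (frame_charge k)) * Umat" for k
    by (rule total_charge_commutes, unfold c_def, rule copy_charge_diag) (simp add: L_def)
  show ?thesis
    using frame_state_density Dle frame_charge_hermitian op Umat_unitary comm tn
    by (intro exI[of _ D] exI[of _ frame_charge] exI[of _ frame_state] exI[of _ Umat]) (auto simp: \<theta>_def N_def)
qed

subsection \<open>Change of basis\<close>

definition uconj :: "complex mat \<Rightarrow> complex mat \<Rightarrow> complex mat" where
  "uconj Q A = Q * A * adj Q"

lemma uconj_carrier: "unitary_mat m Q \<Longrightarrow> A \<in> carrier_mat m m \<Longrightarrow> uconj Q A \<in> carrier_mat m m"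
  unfolding uconj_def unitary_mat_def by (metis adj_carrier mult_carrier_mat)

lemma uconj_mult:
  assumes Q: "unitary_mat m Q" and A: "A \<in> carrier_mat m m" and B: "B \<in> carrier_mat m m"
  shows "uconj Q A * uconj Q B = uconj Q (A * B)"
proof -
  have c: "Q \<in> carrier_mat m m" "adj Q \<in> carrier_mat m m" using Q by (auto simp: unitary_mat_def)
  have "uconj Q A * uconj Q B = Q * (A * ((adj Q * Q) * (B * adj Q)))"
    unfolding uconj_def using A B c by (simp add: assoc_mult_mat[of _ m m _ m _ m])
  also have "\<dots> = uconj Q (A * B)"
    unfolding uconj_def using Q A B c by (simp add: unitary_mat_def assoc_mult_mat[of _ m m _ m _ m])
  finally show ?thesis .
qed

lemma uconj_adj:
  assumes Q: "unitary_mat m Q" and A: "A \<in> carrier_mat m m"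
  shows "adj (uconj Q A) = uconj Q (adj A)"
proof -
  have c: "Q \<in> carrier_mat m m" "adj Q \<in> carrier_mat m m" "adj A \<in> carrier_mat m m" "Q * A \<in> carrier_mat m m"
    using Q A by (auto simp: unitary_mat_def)
  show ?thesis
    unfolding uconj_def adj_mult[OF c(4,2)] adj_mult[OF c(1) A] using c by (simp add: assoc_mult_mat[of _ m m _ m _ m])
qed

lemma uconj_add:
  assumes Q: "unitary_mat m Q" and A: "A \<in> carrier_mat m m" and B: "B \<in> carrier_mat m m"
  shows "uconj Q (A + B) = uconj Q A + uconj Q B"
proof -
  have c: "Q \<in> carrier_mat m m" "adj Q \<in> carrier_mat m m" "Q * A \<in> carrier_mat m m" "Q * B \<in> carrier_mat m m"
    using Q A B by (auto simp: unitary_mat_def)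
  show ?thesis unfolding uconj_def mult_add_distrib_mat[OF c(1) A B] by (rule add_mult_distrib_mat[OF c(3,4,2)])
qed

lemma uconj_minus:
  assumes Q: "unitary_mat m Q" and A: "A \<in> carrier_mat m m" and B: "B \<in> carrier_mat m m"
  shows "uconj Q (A - B) = uconj Q A - uconj Q B"
proof -
  have c: "Q \<in> carrier_mat m m" "adj Q \<in> carrier_mat m m" "Q * A \<in> carrier_mat m m" "Q * B \<in> carrier_mat m m"
    using Q A B by (auto simp: unitary_mat_def)
  show ?thesis unfolding uconj_def mult_minus_distrib_mat[OF c(1) A B] by (rule minus_mult_distrib_mat[OF c(3,4,2)])
qed

lemma uconj_unitary: "unitary_mat m Q \<Longrightarrow> unitary_mat m U \<Longrightarrow> unitary_mat m (uconj Q U)"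
  unfolding uconj_def by (intro unitary_mult unitary_adj)

lemma uconj_one: "unitary_mat m Q \<Longrightarrow> uconj Q (1\<^sub>m m) = 1\<^sub>m m"
  using unitary_right[of m Q] by (simp add: uconj_def unitary_mat_def right_mult_one_mat[of Q m m])

lemma uconj_inverse:
  assumes Q: "unitary_mat m Q" and A: "A \<in> carrier_mat m m"
  shows "uconj Q (uconj (adj Q) A) = A"
proof -
  have c: "Q \<in> carrier_mat m m" "adj Q \<in> carrier_mat m m" using Q by (auto simp: unitary_mat_def)
  have AQ: "A * Q \<in> carrier_mat m m" using A c by simp
  have "uconj Q (uconj (adj Q) A) = Q * (adj Q * (A * Q)) * adj Q"
    unfolding uconj_def adj_adj assoc_mult_mat[OF c(2) A c(1)] ..
  also have "Q * (adj Q * (A * Q)) = (Q * adj Q) * (A * Q)"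
    by (rule assoc_mult_mat[OF c AQ, symmetric])
  also have "\<dots> = A * Q" unfolding unitary_right[OF Q] by (rule left_mult_one_mat[OF AQ])
  also have "A * Q * adj Q = A * (Q * adj Q)" by (rule assoc_mult_mat[OF A c])
  finally show ?thesis using A unitary_right[OF Q] by simp
qed

lemma kron_uconj:
  assumes P: "unitary_mat m P" and Q: "unitary_mat n Q" and A: "A \<in> carrier_mat m m" and B: "B \<in> carrier_mat n n"
  shows "kron (uconj P A) (uconj Q B) = uconj (kron P Q) (kron A B)"
proof -
  have c: "P \<in> carrier_mat m m" "adj P \<in> carrier_mat m m" "P * A \<in> carrier_mat m m"
    "Q \<in> carrier_mat n n" "adj Q \<in> carrier_mat n n" "Q * B \<in> carrier_mat n n"
    using P Q A B by (auto simp: unitary_mat_def)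
  show ?thesis
    unfolding uconj_def adj_kron kron_mult[OF c(1,4) A B] kron_mult[OF c(3,6,2,5)] ..
qed

lemma tpow_uconj:
  assumes P: "unitary_mat d P" and A: "A \<in> carrier_mat d d"
  shows "tpow (uconj P A) n = uconj (tpow P n) (tpow A n)"
proof -
  have c: "P \<in> carrier_mat d d" "adj P \<in> carrier_mat d d" "P * A \<in> carrier_mat d d"
    using P A by (auto simp: unitary_mat_def)
  show ?thesis unfolding uconj_def tpow_mult[OF c(3,2)] tpow_mult[OF c(1) A] tpow_adj ..
qed

lemma copy_charge_uconj:
  assumes P: "unitary_mat d P" and A: "A \<in> carrier_mat d d"
  shows "copy_charge d (uconj P A) n = uconj (tpow P n) (copy_charge d A n)"
proof (induction n)
  case 0
  show ?case
    unfolding copy_charge_0[OF A] copy_charge_0[OF uconj_carrier[OF P A]] unfolding uconj_def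
    by (rule eq_matI) (auto simp: scalar_prod_def)
next
  case (Suc n)
  let ?C = "copy_charge d A n"
  have C: "?C \<in> carrier_mat (d ^ n) (d ^ n)" by (rule copy_charge_entry(1)[OF A])
  have Pn: "unitary_mat (d ^ n) (tpow P n)" by (rule tpow_unitary[OF P])
  have PP: "unitary_mat (d ^ n * d) (kron (tpow P n) P)" by (rule unitary_kron[OF Pn P])
  have "copy_charge d (uconj P A) (Suc n) = kron (uconj (tpow P n) ?C) (uconj P (1\<^sub>m d)) + kron (uconj (tpow P n) (1\<^sub>m (d ^ n))) (uconj P A)"
    unfolding copy_charge_Suc[OF uconj_carrier[OF P A]] Suc uconj_one[OF P] uconj_one[OF Pn] ..
  also have "\<dots> = uconj (kron (tpow P n) P) (kron ?C (1\<^sub>m d) + kron (1\<^sub>m (d ^ n)) A)"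
    unfolding kron_uconj[OF Pn P C one_carrier_mat] kron_uconj[OF Pn P one_carrier_mat A]
    using C A by (intro uconj_add[OF PP, symmetric]) auto
  finally show ?case by (simp add: copy_charge_Suc[OF A])
qed

lemma trace_norm_uconj:
  assumes Q: "unitary_mat m Q" and M: "M \<in> carrier_mat m m" "hermitian M"
  shows "trace_norm (uconj Q M) = trace_norm M"
proof -
  obtain y e where d: "diagonalizes m M y e" using hermitian_diagonalizes[OF M] .
  show ?thesis
    using trace_norm_diagonalizes[OF d] trace_norm_diagonalizes[OF diagonalizes_conj[OF Q d]] by (simp add: uconj_def)
qed

lemma trace_norm_nonneg:
  assumes "M \<in> carrier_mat m m" "hermitian M"
  shows "0 \<le> trace_norm M"
proof -
  obtain y e where d: "diagonalizes m M y e" using hermitian_diagonalizes[OF assms] .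
  show ?thesis unfolding trace_norm_diagonalizes[OF d] by (simp add: sum_nonneg)
qed

lemma density_uconj:
  assumes Q: "unitary_mat m Q" and \<rho>: "density_mat m \<rho>"
  shows "density_mat m (uconj Q \<rho>)" "vn_entropy (uconj Q \<rho>) = vn_entropy \<rho>"
proof -
  obtain y p where p: "diagonalizes m \<rho> y p" "\<And>i. i < m \<Longrightarrow> 0 \<le> p i" "(\<Sum>i<m. p i) = 1"
    using density_diagonalizes[OF \<rho>] by blast
  have d: "diagonalizes m (uconj Q \<rho>) (\<lambda>i. ap {..<m} (ent Q) (y i)) p"
    unfolding uconj_def by (rule diagonalizes_conj[OF Q p(1)])
  show "density_mat m (uconj Q \<rho>)" by (rule diagonalizes_density[OF d p(2,3)])
  show "vn_entropy (uconj Q \<rho>) = vn_entropy \<rho>"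
    using vn_entropy_diagonalizes[OF d p(2)] vn_entropy_diagonalizes[OF p(1,2)] by simp
qed

text \<open>\<open>P\<close> has the joint eigenvectors as columns. The last conclusion puts the
  charge expectations into the form that \<open>state_windowed\<close> takes as premise.\<close>

lemma commuting_charges_diagonal:
  fixes q :: nat
  assumes L: "\<forall>k<q. L k \<in> carrier_mat d d \<and> hermitian (L k)" and comm: "\<forall>k<q. \<forall>l<q. L k * L l = L l * L k"
  obtains P lam where "unitary_mat d P"
    "\<forall>k<q. L k = uconj P (mat d d (\<lambda>(i,j). if i = j then complex_of_real (lam k i) else 0))"
    "\<forall>k<q. \<forall>\<rho>. density_mat d \<rho> \<longrightarrow> (\<Sum>t<d. Re (uconj (adj P) \<rho> $$ (t,t)) * lam k t) = Re (mtrace (L k * \<rho>))"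
proof -
  obtain y lam where "onb {..<card {..<d}} {..<d} y" and
    ev: "\<And>k a b. k < q \<Longrightarrow> a \<in> {..<d} \<Longrightarrow> b \<in> {..<d} \<Longrightarrow>
       ent (L k) a b = (\<Sum>i<card {..<d}. of_real (lam k i :: real) * y i a * cnj (y i b))"
  proof (rule simultaneous_diagonalization[of "{..<d}" q "\<lambda>k. ent (L k)"])
    show "herm_on {..<d} (ent (L k))" if "k < q" for k using L hermitian_herm_on that by blast
    fix k l a b assume *: "k < q" "l < q" "a \<in> {..<d}" "b \<in> {..<d}"
    then have c: "L k \<in> carrier_mat d d" "L l \<in> carrier_mat d d" using L by auto
    show "(\<Sum>c<d. L k $$ (a,c) * L l $$ (c,b)) = (\<Sum>c<d. L l $$ (a,c) * L k $$ (c,b))"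
      using mult_index_sum[OF c, of a b] mult_index_sum[OF c(2,1), of a b] comm * by simp
  qed auto
  then have y: "onb {..<d} {..<d} y" by simp
  have dL: "diagonalizes d (L k) y (lam k)" if "k < q" for k
    using y ev[OF that] L that by (simp add: diagonalizes_def)
  define P where "P = mat d d (\<lambda>(a,i). y i a)"
  have Pc: "P \<in> carrier_mat d d" by (simp add: P_def)
  have P: "unitary_mat d P"
  proof -
    have "adj P * P = 1\<^sub>m d"
    proof (rule eq_matI)
      fix i j assume "i < dim_row (1\<^sub>m d)" "j < dim_col (1\<^sub>m d)"
      then have ij: "i < d" "j < d" by auto
      have "(adj P * P) $$ (i,j) = ip {..<d} (y i) (y j)"
        unfolding mult_index_sum[OF adj_carrier[OF Pc] Pc ij] ip_def
        using ij by (intro sum.cong refl) (simp add: adj_def P_def)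
      then show "(adj P * P) $$ (i,j) = 1\<^sub>m d $$ (i,j)" using y ij by (simp add: onb_def)
    qed (auto simp: P_def)
    then show ?thesis using Pc by (simp add: unitary_mat_def)
  qed
  have 1: "L k = uconj P (mat d d (\<lambda>(i,j). if i = j then complex_of_real (lam k i) else 0))" (is "_ = uconj P ?D") if k: "k < q" for k
  proof (rule eq_matI)
    have D: "?D \<in> carrier_mat d d" by simp
    have cc: "uconj P ?D \<in> carrier_mat d d" by (rule uconj_carrier[OF P D])
    fix a b assume "a < dim_row (uconj P ?D)" "b < dim_col (uconj P ?D)"
    then have ab: "a < d" "b < d" using cc by auto
    have "uconj P ?D $$ (a,b) = (\<Sum>i<d. \<Sum>j<d. P $$ (a,i) * ?D $$ (i,j) * cnj (P $$ (b,j)))"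
      unfolding uconj_def by (rule conj_entry[OF Pc D ab])
    also have "\<dots> = (\<Sum>i<d. \<Sum>j<d. if i = j then of_real (lam k i) * y i a * cnj (y i b) else 0)"
      using ab by (intro sum.cong refl) (auto simp: P_def)
    also have "\<dots> = L k $$ (a,b)" using dL[OF k] ab by (simp add: diagonalizes_def)
    finally show "L k $$ (a,b) = uconj P ?D $$ (a,b)" by simp
  qed (use L k uconj_carrier[OF P, of ?D] in auto)
  have 2: "(\<Sum>t<d. Re (uconj (adj P) \<rho> $$ (t,t)) * lam k t) = Re (mtrace (L k * \<rho>))"
    if k: "k < q" and \<rho>: "density_mat d \<rho>" for k \<rho>
  proof -
    have \<rho>c: "\<rho> \<in> carrier_mat d d" using \<rho> by (simp add: density_mat_def)
    have Lc: "L k \<in> carrier_mat d d" using L k by blast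
    have e: "uconj (adj P) \<rho> $$ (t,t) = bil {..<d} (ent \<rho>) (y t) (y t)" if t: "t < d" for t
      unfolding uconj_def conj_entry[OF adj_carrier[OF Pc] \<rho>c t t] bil_explicit
      using t by (intro sum.cong refl) (simp add: adj_def P_def)
    have "mtrace (L k * \<rho>) = mtrace (\<rho> * L k)" by (rule mtrace_comm[OF Lc \<rho>c])
    also have "\<dots> = (\<Sum>t<d. of_real (lam k t) * bil {..<d} (ent \<rho>) (y t) (y t))"
      unfolding mtrace_mult_trp[OF \<rho>c Lc] by (rule trp_diagonalizes[OF dL[OF k]])
    finally show ?thesis using e by (simp add: mult.commute)
  qed
  show thesis by (rule that[OF P, of lam]) (use 1 2 in blast)+
qed

text \<open>\<open>Q\<close> acts trivially on the ancilla, so the ancilla charge is unchanged and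
  the commutation relation is conjugated as a whole.\<close>

lemma conversion_change_basis:
  assumes P: "unitary_mat d P" and A: "A \<in> carrier_mat d d" and L': "L' \<in> carrier_mat D D"
    and U: "unitary_mat (d ^ n * D) U"
    and comm: "U * (kron (copy_charge d A n) (1\<^sub>m D) + kron (1\<^sub>m (d ^ n)) L') = (kron (copy_charge d A n) (1\<^sub>m D) + kron (1\<^sub>m (d ^ n)) L') * U"
  defines "Q \<equiv> kron (tpow P n) (1\<^sub>m D)"
  shows "uconj Q U * (kron (copy_charge d (uconj P A) n) (1\<^sub>m D) + kron (1\<^sub>m (d ^ n)) L') =
    (kron (copy_charge d (uconj P A) n) (1\<^sub>m D) + kron (1\<^sub>m (d ^ n)) L') * uconj Q U"
proof -
  let ?T = "kron (copy_charge d A n) (1\<^sub>m D) + kron (1\<^sub>m (d ^ n)) L'"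
  have Pn: "unitary_mat (d ^ n) (tpow P n)" by (rule tpow_unitary[OF P])
  have Q: "unitary_mat (d ^ n * D) Q" unfolding Q_def by (rule unitary_kron[OF Pn unitary_one])
  have C: "copy_charge d A n \<in> carrier_mat (d ^ n) (d ^ n)" by (rule copy_charge_entry(1)[OF A])
  have cL: "uconj (1\<^sub>m D) L' = L'" using L' by (simp add: uconj_def)
  have "kron (copy_charge d (uconj P A) n) (1\<^sub>m D) + kron (1\<^sub>m (d ^ n)) L'
      = kron (uconj (tpow P n) (copy_charge d A n)) (uconj (1\<^sub>m D) (1\<^sub>m D)) + kron (uconj (tpow P n) (1\<^sub>m (d ^ n))) (uconj (1\<^sub>m D) L')"
    unfolding copy_charge_uconj[OF P A] uconj_one[OF Pn] uconj_one[OF unitary_one] cL ..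
  also have "\<dots> = uconj Q ?T"
    unfolding kron_uconj[OF Pn unitary_one C one_carrier_mat] kron_uconj[OF Pn unitary_one one_carrier_mat L'] Q_def[symmetric]
    using C L' by (intro uconj_add[OF Q, symmetric]) auto
  finally have T: "kron (copy_charge d (uconj P A) n) (1\<^sub>m D) + kron (1\<^sub>m (d ^ n)) L' = uconj Q ?T" .
  have Tc: "?T \<in> carrier_mat (d ^ n * D) (d ^ n * D)" using C L' by simp
  have Uc: "U \<in> carrier_mat (d ^ n * D) (d ^ n * D)" using U by (simp add: unitary_mat_def)
  show ?thesis unfolding T uconj_mult[OF Q Uc Tc] uconj_mult[OF Q Tc Uc] comm ..
qed

lemma trace_distance_change_basis:
  assumes P: "unitary_mat d P" and \<rho>: "density_mat d \<rho>" and \<sigma>: "density_mat d \<sigma>" and \<omega>: "density_mat D \<omega>"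
    and U: "unitary_mat (d ^ n * D) U"
  defines "Q \<equiv> kron (tpow P n) (1\<^sub>m D)"
  shows "trace_norm (uconj Q U * kron (tpow (uconj P \<rho>) n) \<omega> * adj (uconj Q U) - kron (tpow (uconj P \<sigma>) n) \<omega>)
    = trace_norm (U * kron (tpow \<rho> n) \<omega> * adj U - kron (tpow \<sigma> n) \<omega>)"
    and "0 \<le> trace_norm (U * kron (tpow \<rho> n) \<omega> * adj U - kron (tpow \<sigma> n) \<omega>)"
proof -
  let ?m = "d ^ n * D"
  have Pn: "unitary_mat (d ^ n) (tpow P n)" by (rule tpow_unitary[OF P])
  have Q: "unitary_mat ?m Q" unfolding Q_def by (rule unitary_kron[OF Pn unitary_one])
  have \<omega>c: "\<omega> \<in> carrier_mat D D" using \<omega> by (simp add: density_mat_def)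
  have k: "kron (tpow (uconj P \<tau>) n) \<omega> = uconj Q (kron (tpow \<tau> n) \<omega>)" if "density_mat d \<tau>" for \<tau>
  proof -
    have \<tau>c: "\<tau> \<in> carrier_mat d d" using that by (simp add: density_mat_def)
    have "uconj (1\<^sub>m D) \<omega> = \<omega>" using \<omega>c by (simp add: uconj_def)
    then show ?thesis
      unfolding tpow_uconj[OF P \<tau>c] Q_def using kron_uconj[OF Pn unitary_one tpow_carrier[OF \<tau>c] \<omega>c] by simp
  qed
  let ?A = "kron (tpow \<rho> n) \<omega>" and ?B = "kron (tpow \<sigma> n) \<omega>"
  have A: "?A \<in> carrier_mat ?m ?m" "hermitian ?A" and B: "?B \<in> carrier_mat ?m ?m" "hermitian ?B"
    using density_hermitian[OF density_kron[OF density_tpow[OF \<rho>] \<omega>]] density_hermitian[OF density_kron[OF density_tpow[OF \<sigma>] \<omega>]]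
    by auto
  have Uc: "U \<in> carrier_mat ?m ?m" "adj U \<in> carrier_mat ?m ?m" using U by (auto simp: unitary_mat_def)
  have UA: "U * ?A \<in> carrier_mat ?m ?m" "U * ?A * adj U \<in> carrier_mat ?m ?m" using Uc A(1) by (meson mult_carrier_mat)+
  have M: "U * ?A * adj U - ?B \<in> carrier_mat ?m ?m" "hermitian (U * ?A * adj U - ?B)"
    using minus_carrier_mat[OF B(1)] hermitian_minus[OF UA(2) B(1) hermitian_conj[OF A Uc(1)] B(2)] by auto
  have "uconj Q U * kron (tpow (uconj P \<rho>) n) \<omega> * adj (uconj Q U) - kron (tpow (uconj P \<sigma>) n) \<omega> = uconj Q (U * ?A * adj U - ?B)"
    unfolding k[OF \<rho>] k[OF \<sigma>] uconj_adj[OF Q Uc(1)] uconj_mult[OF Q Uc(1) A(1)] uconj_mult[OF Q UA(1) Uc(2)] uconj_minus[OF Q UA(2) B(1)] ..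
  then show "trace_norm (uconj Q U * kron (tpow (uconj P \<rho>) n) \<omega> * adj (uconj Q U) - kron (tpow (uconj P \<sigma>) n) \<omega>)
    = trace_norm (U * ?A * adj U - ?B)"
    using trace_norm_uconj[OF Q M] by simp
  show "0 \<le> trace_norm (U * ?A * adj U - ?B)" by (rule trace_norm_nonneg[OF M])
qed

subsection \<open>Asymptotics\<close>

text \<open>Comparison of sum and integral: 1 / (l + 1) \<le> ln (l + 1) - ln l.\<close>

lemma harmon_add_le: "0 < J \<Longrightarrow> harmon (J + k) \<le> harmon J + (ln (real (J + k)) - ln (real J))"
proof (induction k)
  case (Suc k)
  let ?l = "real (J + k)"
  have l: "0 < ?l" using Suc.prems by simp
  have "ln (?l / (?l + 1)) \<le> ?l / (?l + 1) - 1" using l by (intro ln_le_minus_one) simp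
  also have "\<dots> = - (1 / (?l + 1))" using l by (simp add: field_simps)
  finally have "1 / (?l + 1) \<le> ln (?l + 1) - ln ?l" using l by (simp add: ln_div)
  then show ?case using Suc by (simp add: harmon_def add_ac)
qed simp

lemma harmon_ge_ln: "ln (real n + 1) \<le> harmon n"
proof (induction n)
  case (Suc n)
  have "ln (1 + 1 / (real n + 1)) \<le> 1 / (real n + 1)" by (rule ln_add_one_self_le_self) simp
  moreover have "ln (real n + 2) = ln (real n + 1) + ln (1 + 1 / (real n + 1))"
  proof -
    have "real n + 2 = (real n + 1) * (1 + 1 / (real n + 1))" by (simp add: field_simps)
    then show ?thesis by (simp only:) (rule ln_mult_pos, auto simp: add_pos_pos)
  qed
  ultimately show ?case using Suc by (simp add: harmon_def add_ac)
qed (simp add: harmon_def)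

text \<open>The harmonic sums up to M J and up to J differ by at most ln M, while the larger one is
  at least ln J; flattening is cheap once ln M is small against ln J.\<close>

lemma harmon_ratio:
  assumes J: "0 < J" and M: "0 < M" and x: "0 < x" "x \<le> ln (real J)"
  shows "1 - ln (real M) / x \<le> harmon J / harmon (M * J)" "harmon J / harmon (M * J) \<le> 1"
proof -
  have hJ: "0 < harmon J" by (rule harmon_pos[OF J])
  have hMJ: "0 < harmon (M * J)" using J M by (intro harmon_pos) simp
  have lM: "0 \<le> ln (real M)" using M by (intro ln_ge_zero) simp
  have "ln (real J) \<le> ln (real J + 1)" using J by (intro ln_mono) auto
  then have xh: "x \<le> harmon J" using x(2) harmon_ge_ln[of J] by linarith
  have MJ: "M * J = J + (M - 1) * J" using M by (cases M) auto
  have "harmon (M * J) \<le> harmon J + (ln (real (M * J)) - ln (real J))"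
    using harmon_add_le[OF J, of "(M - 1) * J"] MJ by simp
  also have "ln (real (M * J)) = ln (real M) + ln (real J)" using J M by (simp add: ln_mult_pos)
  finally have le: "harmon (M * J) \<le> harmon J + ln (real M)" by simp
  have mono: "harmon J \<le> harmon (M * J)"
    unfolding harmon_def using M J by (intro sum_mono2) auto
  then show "harmon J / harmon (M * J) \<le> 1" using hMJ by simp
  have "harmon (M * J) - harmon J \<le> ln (real M)" using le by simp
  then have "(harmon (M * J) - harmon J) / harmon (M * J) \<le> ln (real M) / x"
    using x(1) xh mono lM hMJ hJ by (intro frac_le) auto
  moreover have "(harmon (M * J) - harmon J) / harmon (M * J) = 1 - harmon J / harmon (M * J)"
    using hMJ by (simp add: diff_divide_distrib)
  ultimately show "1 - ln (real M) / x \<le> harmon J / harmon (M * J)" by linarith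
qed

section \<open>Choice of scales and the limit in the sufficiency direction\<close>

lemma nat_ceiling_bounds:
  assumes "1 \<le> (x::real)"
  shows "x \<le> real (nat \<lceil>x\<rceil>)" "real (nat \<lceil>x\<rceil>) \<le> 2 * x" "0 < nat \<lceil>x\<rceil>"
proof -
  have "real (nat \<lceil>x\<rceil>) = real_of_int \<lceil>x\<rceil>" using assms by (intro of_nat_nat) linarith
  then show "x \<le> real (nat \<lceil>x\<rceil>)" "real (nat \<lceil>x\<rceil>) \<le> 2 * x" using assms by linarith+
  then show "0 < nat \<lceil>x\<rceil>" using assms by (cases "nat \<lceil>x\<rceil>") auto
qed

theorem sufficiency:
  fixes d q :: nat and L :: "nat \<Rightarrow> complex mat" and \<rho> \<sigma> :: "complex mat"
  assumes L: "\<forall>k<q. L k \<in> carrier_mat d d \<and> hermitian (L k)"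
    and comm: "\<forall>k<q. \<forall>l<q. L k * L l = L l * L k"
    and \<rho>: "density_mat d \<rho>" and \<sigma>: "density_mat d \<sigma>"
    and S: "vn_entropy \<rho> = vn_entropy \<sigma>" and tr: "\<forall>k<q. mtrace (L k * \<rho>) = mtrace (L k * \<sigma>)"
  shows "\<exists>(D :: nat \<Rightarrow> nat) (L' :: nat \<Rightarrow> nat \<Rightarrow> complex mat) (\<omega> :: nat \<Rightarrow> complex mat)
        (\<omega>' :: nat \<Rightarrow> complex mat) (U :: nat \<Rightarrow> complex mat).
       (\<lambda>n. ln (real (D n))) \<in> o[at_top](\<lambda>n. real n)
     \<and> (\<forall>n. \<forall>k<q. L' n k \<in> carrier_mat (D n) (D n) \<and> hermitian (L' n k))
     \<and> (\<forall>k<q. (\<lambda>n. op_norm (L' n k)) \<in> o[at_top](\<lambda>n. real n))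
     \<and> (\<forall>n. density_mat (D n) (\<omega> n) \<and> density_mat (D n) (\<omega>' n))
     \<and> (\<forall>n. unitary_mat (d ^ n * D n) (U n))
     \<and> (\<forall>n. \<forall>k<q.
          U n * (kron (copy_charge d (L k) n) (1\<^sub>m (D n)) + kron (1\<^sub>m (d ^ n)) (L' n k))
          = (kron (copy_charge d (L k) n) (1\<^sub>m (D n)) + kron (1\<^sub>m (d ^ n)) (L' n k)) * U n)
     \<and> (\<lambda>n. trace_norm (U n * kron (tpow \<rho> n) (\<omega>' n) * adj (U n) - kron (tpow \<sigma> n) (\<omega> n)))
          \<longlonglongrightarrow> 0"
proof -
  have d: "0 < d" by (rule density_dim_pos[OF \<rho>])
  obtain P lam where P: "unitary_mat d P"
    and Ld': "\<forall>k<q. L k = uconj P (mat d d (\<lambda>(i,j). if i = j then complex_of_real (lam k i) else 0))"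
    and ex': "\<forall>k<q. \<forall>\<rho>. density_mat d \<rho> \<longrightarrow> (\<Sum>t<d. Re (uconj (adj P) \<rho> $$ (t,t)) * lam k t) = Re (mtrace (L k * \<rho>))"
    by (rule commuting_charges_diagonal[OF L comm])
  note Ld = Ld'[rule_format] and ex = ex'[rule_format]
  have P': "unitary_mat d (adj P)" by (rule unitary_adj[OF P])
  define \<rho>1 where "\<rho>1 = uconj (adj P) \<rho>"
  define \<sigma>1 where "\<sigma>1 = uconj (adj P) \<sigma>"
  have \<rho>1: "density_mat d \<rho>1" "vn_entropy \<rho>1 = vn_entropy \<rho>" unfolding \<rho>1_def by (rule density_uconj[OF P' \<rho>])+
  \<comment> \<open>Equality of the entropies enters here; it gives both states the same cell
    size.\<close>
  have \<sigma>1: "density_mat d \<sigma>1" "vn_entropy \<sigma>1 = vn_entropy \<rho>" unfolding \<sigma>1_def S by (rule density_uconj[OF P' \<sigma>])+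
  have undo: "uconj P \<rho>1 = \<rho>" "uconj P \<sigma>1 = \<sigma>"
    unfolding \<rho>1_def \<sigma>1_def using uconj_inverse[OF P] density_hermitian \<rho> \<sigma> by auto
  define s where "s = vn_entropy \<rho>"
  define \<mu> where "\<mu> = (\<lambda>k. Re (mtrace (L k * \<rho>)))"
  define Ad where "Ad = (\<lambda>k. mat d d (\<lambda>(i,j). if i = j then complex_of_real (lam k i) else 0))"
  have Adc: "Ad k \<in> carrier_mat d d" for k by (simp add: Ad_def)
  \<comment> \<open>With \<delta> about n^(2/3), n / \<delta>^2 tends to 0 in Chebyshev's bounds. R,
    about n^(1/6), dominates ln n, while R \<delta>, about n^(5/6), is o(n). ln M is about 3
    n^(2/3), small against ln J, about n^(5/6), which is itself o(n). The shift to n + 1 keeps the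
    rounded quantities at least 1 at n = 0 too.\<close>
  define \<delta> where "\<delta> = (\<lambda>n. (real n + 1) powr (2/3))"
  define M where "M = (\<lambda>n. nat \<lceil>exp (3 * \<delta> n)\<rceil>)"
  define R where "R = (\<lambda>n. nat \<lceil>(real n + 1) powr (1/6)\<rceil>)"
  define J where "J = (\<lambda>n. nat \<lceil>exp ((real n + 1) powr (5/6))\<rceil>)"
  have \<delta>: "0 < \<delta> n" for n by (simp add: \<delta>_def)
  have ge1: "1 \<le> exp (3 * \<delta> n)" "1 \<le> (real n + 1) powr (1/6)" "1 \<le> exp ((real n + 1) powr (5/6))" for n
    using less_imp_le[OF \<delta>] by (auto simp: ge_one_powr_ge_zero)
  have Mb: "exp (3 * \<delta> n) \<le> real (M n)" "real (M n) \<le> 2 * exp (3 * \<delta> n)" "0 < M n" for n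
    unfolding M_def by (rule nat_ceiling_bounds[OF ge1(1)])+
  have Rb: "(real n + 1) powr (1/6) \<le> real (R n)" "real (R n) \<le> 2 * (real n + 1) powr (1/6)" "0 < R n" for n
    unfolding R_def by (rule nat_ceiling_bounds[OF ge1(2)])+
  have Jb: "exp ((real n + 1) powr (5/6)) \<le> real (J n)" "real (J n) \<le> 2 * exp ((real n + 1) powr (5/6))" "0 < J n" for n
    unfolding J_def by (rule nat_ceiling_bounds[OF ge1(3)])+
  obtain V1 where V1: "0 \<le> V1" "\<And>n \<delta>. 0 < \<delta> \<Longrightarrow> windowed (d ^ n) (charge_window d q lam \<mu> \<delta> n) (tpow \<rho>1 n)
    (exp (- (real n * s) - 2 * \<delta>)) (nat \<lceil>exp (3 * \<delta>)\<rceil>)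
    (real n * V1 / \<delta>\<^sup>2 + 2 * sqrt (real q * real n * V1 / \<delta>\<^sup>2)) ((real q + 1) * real n * V1 / \<delta>\<^sup>2 + exp (- \<delta>))"
    using state_windowed[OF \<rho>1(1), of q lam \<mu>] ex[OF _ \<rho>] unfolding \<rho>1(2) s_def[symmetric] \<rho>1_def[symmetric] \<mu>_def by blast
  obtain V2 where V2: "0 \<le> V2" "\<And>n \<delta>. 0 < \<delta> \<Longrightarrow> windowed (d ^ n) (charge_window d q lam \<mu> \<delta> n) (tpow \<sigma>1 n)
    (exp (- (real n * s) - 2 * \<delta>)) (nat \<lceil>exp (3 * \<delta>)\<rceil>)
    (real n * V2 / \<delta>\<^sup>2 + 2 * sqrt (real q * real n * V2 / \<delta>\<^sup>2)) ((real q + 1) * real n * V2 / \<delta>\<^sup>2 + exp (- \<delta>))"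
  proof -
    \<comment> \<open>Equality of the charge expectations enters here: the second state gets a
      window around the same means \<mu>.\<close>
    have "(\<Sum>t<d. Re (\<sigma>1 $$ (t,t)) * lam k t) = \<mu> k" if "k < q" for k
      using ex[OF that \<sigma>] tr that by (simp add: \<mu>_def \<sigma>1_def)
    then show ?thesis
      using state_windowed[OF \<sigma>1(1), of q lam \<mu>] that unfolding \<sigma>1(2) s_def[symmetric] by blast
  qed
  \<comment> \<open>The error terms increase with the variance constant, so the larger constant
    serves both states.\<close>
  define V where "V = max V1 V2"
  have V: "0 \<le> V" "V1 \<le> V" "V2 \<le> V" using V1(1) by (auto simp: V_def)
  define \<epsilon> where "\<epsilon> = (\<lambda>n. real n * V / (\<delta> n)\<^sup>2 + 2 * sqrt (real q * real n * V / (\<delta> n)\<^sup>2))"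
  define \<epsilon>' where "\<epsilon>' = (\<lambda>n. (real q + 1) * real n * V / (\<delta> n)\<^sup>2 + exp (- \<delta> n))"
  have mono: "real n * v / (\<delta> n)\<^sup>2 + 2 * sqrt (real q * real n * v / (\<delta> n)\<^sup>2) \<le> \<epsilon> n"
    "(real q + 1) * real n * v / (\<delta> n)\<^sup>2 + exp (- \<delta> n) \<le> \<epsilon>' n" if "v \<le> V" for v n
    unfolding \<epsilon>_def \<epsilon>'_def using that
    by (auto intro!: add_mono divide_right_mono mult_left_mono real_sqrt_le_mono)
  define w\<rho> where "w\<rho> = (\<lambda>n \<tau>. windowed (d ^ n) (charge_window d q lam \<mu> (\<delta> n) n) (tpow \<tau> n)
    (exp (- (real n * s) - 2 * \<delta> n)) (M n) (\<epsilon> n) (\<epsilon>' n))"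
  have win: "w\<rho> n \<rho>1" "w\<rho> n \<sigma>1" for n
    unfolding w\<rho>_def M_def
    by (rule windowed_mono[OF V1(2)[OF \<delta>] mono[OF V(2)]], rule windowed_mono[OF V2(2)[OF \<delta>] mono[OF V(3)]])
  define B where "B = (\<lambda>n. 2 * \<epsilon> n + 4 * sqrt (real d * ln (2 * real (R n) * real n + 1) / real (R n))
     + (2 - 2 * (1 - \<epsilon>' n) * (harmon (J n) / harmon (M n * J n))))"
  define good where "good = (\<lambda>n D L' \<omega> U. density_mat D \<omega> \<and> real D \<le> real (M n) * real (J n) * (2 * real (R n) * real n + 1) ^ d \<and>
    (\<forall>k<q. L' k \<in> carrier_mat D D \<and> hermitian (L' k) \<and> \<bar>op_norm (L' k)\<bar> \<le> 2 * real (R n) * \<delta> n) \<and>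
    unitary_mat (d ^ n * D) U \<and>
    (\<forall>k<q. U * (kron (copy_charge d (Ad k) n) (1\<^sub>m D) + kron (1\<^sub>m (d ^ n)) (L' k))
        = (kron (copy_charge d (Ad k) n) (1\<^sub>m D) + kron (1\<^sub>m (d ^ n)) (L' k)) * U) \<and>
    trace_norm (U * kron (tpow \<rho>1 n) \<omega> * adj U - kron (tpow \<sigma>1 n) \<omega>) \<le> B n)"
  have "\<forall>n. \<exists>D L' \<omega> U. good n D L' \<omega> U"
  proof
    fix n
    show "\<exists>D L' \<omega> U. good n D L' \<omega> U"
      unfolding good_def B_def Ad_def
      by (rule conversion_exists[OF d \<delta> Rb(3) Mb(3) Jb(3) exp_gt_zero win[unfolded w\<rho>_def]])
  qed
  then obtain D L' \<omega> U0 where good: "\<And>n. good n (D n) (L' n) (\<omega> n) (U0 n)" by metis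
  define Q where "Q = (\<lambda>n. kron (tpow P n) (1\<^sub>m (D n)))"
  define U where "U = (\<lambda>n. uconj (Q n) (U0 n))"
  have dens: "density_mat (D n) (\<omega> n)" and Dle: "real (D n) \<le> real (M n) * real (J n) * (2 * real (R n) * real n + 1) ^ d"
    and U0: "unitary_mat (d ^ n * D n) (U0 n)"
    and tn: "trace_norm (U0 n * kron (tpow \<rho>1 n) (\<omega> n) * adj (U0 n) - kron (tpow \<sigma>1 n) (\<omega> n)) \<le> B n" for n
    using good[of n] by (auto simp: good_def)
  have L': "L' n k \<in> carrier_mat (D n) (D n)" "hermitian (L' n k)" "\<bar>op_norm (L' n k)\<bar> \<le> 2 * real (R n) * \<delta> n"
    "U0 n * (kron (copy_charge d (Ad k) n) (1\<^sub>m (D n)) + kron (1\<^sub>m (d ^ n)) (L' n k))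
        = (kron (copy_charge d (Ad k) n) (1\<^sub>m (D n)) + kron (1\<^sub>m (d ^ n)) (L' n k)) * U0 n" if "k < q" for n k
    using good[of n] that by (auto simp: good_def)
  have Qu: "unitary_mat (d ^ n * D n) (Q n)" for n
    unfolding Q_def by (rule unitary_kron[OF tpow_unitary[OF P] unitary_one])
  have Uu: "unitary_mat (d ^ n * D n) (U n)" for n unfolding U_def by (rule uconj_unitary[OF Qu U0])
  have Ucomm: "U n * (kron (copy_charge d (L k) n) (1\<^sub>m (D n)) + kron (1\<^sub>m (d ^ n)) (L' n k))
          = (kron (copy_charge d (L k) n) (1\<^sub>m (D n)) + kron (1\<^sub>m (d ^ n)) (L' n k)) * U n" if k: "k < q" for n k
  proof -
    have "L k = uconj P (Ad k)" using Ld[OF k] by (simp only: Ad_def)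
    then show ?thesis
      unfolding U_def Q_def by (simp only:) (rule conversion_change_basis[OF P Adc L'(1)[OF k] U0 L'(4)[OF k]])
  qed
  have tnU: "trace_norm (U n * kron (tpow \<rho> n) (\<omega> n) * adj (U n) - kron (tpow \<sigma> n) (\<omega> n))
      = trace_norm (U0 n * kron (tpow \<rho>1 n) (\<omega> n) * adj (U0 n) - kron (tpow \<sigma>1 n) (\<omega> n))" for n
    unfolding U_def Q_def using trace_distance_change_basis(1)[OF P \<rho>1(1) \<sigma>1(1) dens U0]
    by (simp only: undo)
  have tn0: "0 \<le> trace_norm (U0 n * kron (tpow \<rho>1 n) (\<omega> n) * adj (U0 n) - kron (tpow \<sigma>1 n) (\<omega> n))" for n
    by (rule trace_distance_change_basis(2)[OF P \<rho>1(1) \<sigma>1(1) dens U0])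
  have lnM: "ln (real (M n)) \<le> ln 2 + 3 * \<delta> n" for n
  proof -
    have "ln (real (M n)) \<le> ln (2 * exp (3 * \<delta> n))" using Mb[of n] by (intro ln_mono) auto
    then show ?thesis by (simp add: ln_mult_pos)
  qed
  have lnJ: "ln (real (J n)) \<le> ln 2 + (real n + 1) powr (5/6)" for n
  proof -
    have "ln (real (J n)) \<le> ln (2 * exp ((real n + 1) powr (5/6)))" using Jb[of n] by (intro ln_mono) auto
    then show ?thesis by (simp add: ln_mult_pos)
  qed
  have lnJ': "(real n + 1) powr (5/6) \<le> ln (real (J n))" for n
    using ln_mono[OF Jb(1)[of n] exp_gt_zero] by simp
  have Rpos: "0 < real (R n)" for n using Rb(3) by simp
  have lnR: "ln (2 * real (R n) * real n + 1) \<le> ln (4 * (real n + 1) powr (1/6) * real n + 1)" for n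
  proof (intro ln_mono add_right_mono)
    show "2 * real (R n) * real n \<le> 4 * (real n + 1) powr (1/6) * real n"
      using Rb(2)[of n] by (intro mult_right_mono) auto
  qed (simp_all add: add_nonneg_pos)
  have lnR0: "0 \<le> ln (2 * real (R n) * real n + 1)" for n by (intro ln_ge_zero) simp
  have oD: "(\<lambda>n. ln (real (D n))) \<in> o[at_top](\<lambda>n. real n)"
  proof -
    \<comment> \<open>The three summands come from the cells per eigenvalue, the embezzling levels
      and the frame; the second, of order n^(5/6), dominates.\<close>
    define g where "g = (\<lambda>n. (ln 2 + 3 * (real n + 1) powr (2/3)) + (ln 2 + (real n + 1) powr (5/6))
      + real d * ln (4 * (real n + 1) powr (1/6) * real n + 1))"
    have "\<bar>ln (real (D n))\<bar> \<le> 1 * \<bar>g n\<bar>" for n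
    proof -
      have D1: "1 \<le> real (D n)" using density_dim_pos[OF dens[of n]] by simp
      have pos: "0 < (2 * real (R n) * real n + 1) ^ d" by (intro zero_less_power) (simp add: add_nonneg_pos)
      have "ln (real (D n)) \<le> ln (real (M n) * real (J n) * (2 * real (R n) * real n + 1) ^ d)"
        using D1 Dle[of n] by (intro ln_mono) auto
      also have "\<dots> = ln (real (M n)) + ln (real (J n)) + real d * ln (2 * real (R n) * real n + 1)"
        using Mb(3)[of n] Jb(3)[of n] pos by (simp add: ln_mult_pos ln_realpow)
      also have "\<dots> \<le> g n"
        unfolding g_def using lnM[of n] lnJ[of n] lnR[of n]
        by (intro add_mono mult_left_mono) (auto simp: \<delta>_def)
      finally show ?thesis using D1 by simp
    qed
    then have "(\<lambda>n. ln (real (D n))) \<in> O(g)" by (intro landau_o.bigI[of 1]) (auto simp: eventually_at_top_linorder)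
    moreover have "g \<in> o(\<lambda>n. real n)"
      unfolding g_def
    proof (intro sum_in_smallo)
      have "(\<lambda>n. ln (4 * (real n + 1) powr (1/6) * real n + 1)) \<in> o(\<lambda>n. real n)" by real_asymp
      then show "(\<lambda>n. real d * ln (4 * (real n + 1) powr (1/6) * real n + 1)) \<in> o(\<lambda>n. real n)"
        using d by simp
    qed real_asymp+
    ultimately show ?thesis by (rule landau_o.big_small_trans)
  qed
  have oL: "(\<lambda>n. op_norm (L' n k)) \<in> o[at_top](\<lambda>n. real n)" if k: "k < q" for k
  proof -
    define g where "g = (\<lambda>n. 4 * (real n + 1) powr (1/6) * (real n + 1) powr (2/3))"
    have "\<bar>op_norm (L' n k)\<bar> \<le> 1 * \<bar>g n\<bar>" for n
    proof -
      have "\<bar>op_norm (L' n k)\<bar> \<le> 2 * real (R n) * \<delta> n" by (rule L'(3)[OF k])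
      also have "\<dots> \<le> g n" unfolding g_def \<delta>_def using Rb(2)[of n] by (intro mult_right_mono) auto
      finally show ?thesis by simp
    qed
    then have "(\<lambda>n. op_norm (L' n k)) \<in> O(g)" by (intro landau_o.bigI[of 1]) (auto simp: eventually_at_top_linorder)
    moreover have "g \<in> o(\<lambda>n. real n)" unfolding g_def by real_asymp
    ultimately show ?thesis by (rule landau_o.big_small_trans)
  qed
  have n\<delta>: "(\<lambda>n. real n / (\<delta> n)\<^sup>2) \<longlonglongrightarrow> 0" unfolding \<delta>_def by real_asymp
  have \<epsilon>0: "\<epsilon> \<longlonglongrightarrow> 0"
  proof -
    have "(\<lambda>n. V * (real n / (\<delta> n)\<^sup>2) + 2 * sqrt (real q * V * (real n / (\<delta> n)\<^sup>2))) \<longlonglongrightarrow> V * 0 + 2 * sqrt (real q * V * 0)"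
      by (intro tendsto_intros n\<delta>)
    then show ?thesis by (simp add: \<epsilon>_def mult_ac)
  qed
  have \<epsilon>'0: "\<epsilon>' \<longlonglongrightarrow> 0"
  proof -
    have "(\<lambda>n. exp (- \<delta> n)) \<longlonglongrightarrow> 0" unfolding \<delta>_def by real_asymp
    then have "(\<lambda>n. (real q + 1) * V * (real n / (\<delta> n)\<^sup>2) + exp (- \<delta> n)) \<longlonglongrightarrow> (real q + 1) * V * 0 + 0"
      by (intro tendsto_intros n\<delta>)
    then show ?thesis by (simp add: \<epsilon>'_def mult_ac)
  qed
  have \<theta>0: "(\<lambda>n. ln (2 * real (R n) * real n + 1) / real (R n)) \<longlonglongrightarrow> 0"
  proof (rule tendsto_sandwich[where f = "\<lambda>_. 0" and h = "\<lambda>n. ln (4 * (real n + 1) powr (1/6) * real n + 1) / (real n + 1) powr (1/6)"])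
    show "\<forall>\<^sub>F n in sequentially. 0 \<le> ln (2 * real (R n) * real n + 1) / real (R n)"
      using lnR0 by simp
    show "\<forall>\<^sub>F n in sequentially. ln (2 * real (R n) * real n + 1) / real (R n) \<le> ln (4 * (real n + 1) powr (1/6) * real n + 1) / (real n + 1) powr (1/6)"
    proof (intro always_eventually allI frac_le)
      show "0 \<le> ln (4 * (real n + 1) powr (1/6) * real n + 1)" for n using lnR0[of n] lnR[of n] by linarith
    qed (use lnR Rb(1) in auto)
    show "(\<lambda>n. ln (4 * (real n + 1) powr (1/6) * real n + 1) / (real n + 1) powr (1/6)) \<longlonglongrightarrow> 0" by real_asymp
  qed simp
  have h1: "(\<lambda>n. harmon (J n) / harmon (M n * J n)) \<longlonglongrightarrow> 1"
  proof (rule tendsto_sandwich[where f = "\<lambda>n. 1 - (ln 2 + 3 * (real n + 1) powr (2/3)) / (real n + 1) powr (5/6)" and h = "\<lambda>_. 1"])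
    have x: "0 < (real n + 1) powr (5/6)" for n by simp
    show "\<forall>\<^sub>F n in sequentially. 1 - (ln 2 + 3 * (real n + 1) powr (2/3)) / (real n + 1) powr (5/6) \<le> harmon (J n) / harmon (M n * J n)"
    proof (intro always_eventually allI)
      fix n
      have "ln (real (M n)) / (real n + 1) powr (5/6) \<le> (ln 2 + 3 * (real n + 1) powr (2/3)) / (real n + 1) powr (5/6)"
        using lnM[of n] by (intro divide_right_mono) (auto simp: \<delta>_def)
      then show "1 - (ln 2 + 3 * (real n + 1) powr (2/3)) / (real n + 1) powr (5/6) \<le> harmon (J n) / harmon (M n * J n)"
        using harmon_ratio(1)[OF Jb(3)[of n] Mb(3)[of n] x lnJ'] by linarith
    qed
    show "\<forall>\<^sub>F n in sequentially. harmon (J n) / harmon (M n * J n) \<le> 1"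
      using harmon_ratio(2)[OF Jb(3) Mb(3) x lnJ'] by simp
    show "(\<lambda>n. 1 - (ln 2 + 3 * (real n + 1) powr (2/3)) / (real n + 1) powr (5/6)) \<longlonglongrightarrow> 1" by real_asymp
  qed simp
  have B0: "B \<longlonglongrightarrow> 0"
  proof -
    have "(\<lambda>n. 2 * \<epsilon> n + 4 * sqrt (real d * (ln (2 * real (R n) * real n + 1) / real (R n)))
        + (2 - 2 * (1 - \<epsilon>' n) * (harmon (J n) / harmon (M n * J n)))) \<longlonglongrightarrow> 2 * 0 + 4 * sqrt (real d * 0) + (2 - 2 * (1 - 0) * 1)"
      by (intro tendsto_intros \<epsilon>0 \<epsilon>'0 \<theta>0 h1)
    then show ?thesis by (simp add: B_def)
  qed
  have lim: "(\<lambda>n. trace_norm (U n * kron (tpow \<rho> n) (\<omega> n) * adj (U n) - kron (tpow \<sigma> n) (\<omega> n))) \<longlonglongrightarrow> 0"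
    unfolding tnU
    by (rule tendsto_sandwich[OF _ _ tendsto_const B0]) (use tn0 tn in \<open>auto intro: always_eventually\<close>)
  \<comment> \<open>The same state is supplied for \<omega> and \<omega>': the ancilla acts as an
    approximate catalyst.\<close>
  show ?thesis
    by (rule exI[of _ D], rule exI[of _ L'], rule exI[of _ \<omega>], rule exI[of _ \<omega>], rule exI[of _ U])
      (use oD L' oL dens Uu Ucomm lim in auto)
qed

theorem theorem1:
  fixes d q :: nat and L :: "nat \<Rightarrow> complex mat" and \<rho> \<sigma> :: "complex mat"
  assumes "q \<ge> 1"
    and "\<forall>k<q. L k \<in> carrier_mat d d \<and> hermitian (L k)"
    and "\<forall>k<q. \<forall>l<q. L k * L l = L l * L k"
    and "density_mat d \<rho>" and "density_mat d \<sigma>"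
  shows "(vn_entropy \<rho> = vn_entropy \<sigma> \<and> (\<forall>k<q. mtrace (L k * \<rho>) = mtrace (L k * \<sigma>)))
    \<longleftrightarrow>
    (\<exists>(D :: nat \<Rightarrow> nat) (L' :: nat \<Rightarrow> nat \<Rightarrow> complex mat) (\<omega> :: nat \<Rightarrow> complex mat)
        (\<omega>' :: nat \<Rightarrow> complex mat) (U :: nat \<Rightarrow> complex mat).
       (\<lambda>n. ln (real (D n))) \<in> o[at_top](\<lambda>n. real n)
     \<and> (\<forall>n. \<forall>k<q. L' n k \<in> carrier_mat (D n) (D n) \<and> hermitian (L' n k))
     \<and> (\<forall>k<q. (\<lambda>n. op_norm (L' n k)) \<in> o[at_top](\<lambda>n. real n))
     \<and> (\<forall>n. density_mat (D n) (\<omega> n) \<and> density_mat (D n) (\<omega>' n))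
     \<and> (\<forall>n. unitary_mat (d ^ n * D n) (U n))
     \<and> (\<forall>n. \<forall>k<q.
          U n * (kron (copy_charge d (L k) n) (1\<^sub>m (D n)) + kron (1\<^sub>m (d ^ n)) (L' n k))
          = (kron (copy_charge d (L k) n) (1\<^sub>m (D n)) + kron (1\<^sub>m (d ^ n)) (L' n k)) * U n)
     \<and> (\<lambda>n. trace_norm (U n * kron (tpow \<rho> n) (\<omega>' n) * adj (U n) - kron (tpow \<sigma> n) (\<omega> n)))
          \<longlonglongrightarrow> 0)"
  (is "?eq \<longleftrightarrow> ?conv")
proof
  assume ?eq
  then show ?conv using sufficiency[OF assms(2-5)] by blast
next
  assume ?conv
  then show ?eq by (elim exE conjE) (rule necessity[OF assms(2,4,5)])
qed

end
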